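(* Let $U,V$ be real Banach spaces and let $\mathfrak{F}\in\mathcal{C}^{\omega}(\mathbb{R}\times U,V)$ be analytic with: (F1) $\mathfrak{F}(\lambda,0)=0$ for all $\lambda\in\mathbb{R}$; (F2) $\mathfrak{L}(\lambda):=D_u\mathfrak{F}(\lambda,0)\in\Phi_0(U,V)$ for all $\lambda\in\mathbb{R}$; (F3) $0\in\Sigma(\mathfrak{L})$ is an isolated eigenvalue with $N[\mathfrak{L}(0)]=\mathrm{span}[\varphi_0]$, $\varphi_0\in U\setminus\{0\}$. Then, in a sufficiently small neighbourhood of $(0,0)\in\mathbb{R}\times U$, the set $\mathfrak{F}^{-1}(0)$ consists of finitely many branches of analytic curves. Precisely, it has $$\mathcal{N}_{(0,0)}=[V(\lambda_-,z_+)-V(\lambda_+,z_+)]+[V(\lambda_-,z_-)-V(\lambda_+,z_-)]+2$$ distinct half branches of analytic curve (emanating from $(0,0)$, the two half branches of the trivial curve $(\lambda,0)$ included), regardless of the values of $z_\pm\in\mathscr{U}_z^\pm$. In particular, if $\chi$ is an odd integer, then $\mathcal{N}_{(0,0)}\geq3$ and $(0,0)$ is a bifurcation point of $\mathfrak{F}(\lambda,u)=0$ from $(\lambda,0)$.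
   Context: $\Phi_0(U,V)$: bounded linear Fredholm operators of index zero; $\Sigma(\mathfrak{L})=\{\lambda:\mathfrak{L}(\lambda)\notin GL(U,V)\}$. $(0,0)$ is a bifurcation point if there are $(\lambda_n,u_n)\in\mathfrak{F}^{-1}(0)$, $u_n\neq0$, with $(\lambda_n,u_n)\to(0,0)$. A half branch is an arc given by an injective real analytic curve tending to $(0,0)$ at one end. Reduction: choose $\varphi_0^*\in U^*$ with $\langle\varphi_0,\varphi_0^*\rangle=1$, the projection $P(u)=\langle u,\varphi_0^*\rangle\varphi_0$, a continuous projection $Q$ of $V$ onto $R[\mathfrak{L}(0)]$, $Y=N[P]$, and a linear isomorphism $S:N[Q]\to\mathbb{R}$. By the implicit function theorem there is an analytic $\mathcal{Y}$, defined near $(0,0)$ in $\mathbb{R}\times N[\mathfrak{L}(0)]$ with values in $Y$, $\mathcal{Y}(0,0)=0$, solving $Q\mathfrak{F}(\lambda,x+\mathcal{Y}(\lambda,x))=0$. Put $\mathfrak{G}(\lambda,z):=S(I_V-Q)\mathfrak{F}(\lambda,z\varphi_0+\mathcal{Y}(\lambda,z\varphi_0))$; near $(0,0)$ the zeros of $\mathfrak{F}$ and of $\mathfrak{G}$ are in bijection via $(\lambda,z)\mapsto(\lambda,z\varphi_0+\mathcal{Y}(\lambda,z\varphi_0))$. One has $\mathfrak{G}(\lambda,z)=zg(\lambda,z)$, $g$ analytic, and $\chi:=\mathrm{ord}_{\lambda=0}g(\lambda,0)\in[1,\infty)$ (which coincides with the generalized algebraic multiplicity $\chi[\mathfrak{L},0]$).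 By the Weierstrass preparation theorem, on a neighbourhood $\mathscr{U}=\mathscr{U}_\lambda\times\mathscr{U}_z$ of $(0,0)$ in $\mathbb{R}^2$ ($\mathscr{U}_z=(\alpha,\omega)$ with $\alpha<0<\omega$), $g=c\cdot p$ with $c$ analytic, $c(0,0)\neq0$, and $p(\lambda,z)=\lambda^\chi+c_{\chi-1}(z)\lambda^{\chi-1}+\cdots+c_0(z)$, $c_j$ analytic, $c_j(0)=0$ (the Weierstrass polynomial). Put $\mathscr{U}_z^-=(\alpha,0)$, $\mathscr{U}_z^+=(0,\omega)$. Sturm data: $\mathscr{U}$ is taken sufficiently small and $\lambda_-<0<\lambda_+$ in $\mathscr{U}_\lambda$ are such that $(\{\lambda_\pm\}\times\mathscr{U}_z)\cap\mathfrak{G}^{-1}(0)=\{(\lambda_\pm,0)\}$ and $p(\lambda_\pm,z)\neq0$ for all $z\in\mathscr{U}_z$; the number of distinct real roots of $p(\cdot,z)$ in $(\lambda_-,\lambda_+)$ is constant for $z\in\mathscr{U}_z^+$ and constant for $z\in\mathscr{U}_z^-$. For fixed $z\in\mathscr{U}_z^\pm$ consider the Sturm chain in $\lambda$: $p_0=p$, $p_1=\partial_\lambda p$, $p_i=-\mathrm{rem}_\lambda(p_{i-2},p_{i-1})$ for $i\geq2$ (remainder of Euclidean division of polynomials in $\lambda$ with $z$ fixed, until it vanishes). $V(\xi,z)$ denotes the number of sign changes of $(p_0(\xi,z),p_1(\xi,z),\dots,p_\chi(\xi,z))$, zeros being disregarded. *)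

theory Defs
  imports
    "HOL-Analysis.Analysis"
    "HOL-Computational_Algebra.Polynomial"
    "HOL-Library.Disjoint_Sets"
begin

section \<open>Analytic maps between normed spaces\<close>

text \<open>
  An \<open>n\<close>-linear map takes its arguments as a sequence of which only the first \<open>n\<close> entries
  matter; \<open>K\<close> bounds its norm.
\<close>

definition bounded_multilinear ::
  "nat \<Rightarrow> ((nat \<Rightarrow> 'a::real_normed_vector) \<Rightarrow> 'b::real_normed_vector) \<Rightarrow> real \<Rightarrow> bool" where
  "bounded_multilinear n M K \<longleftrightarrow>
     0 \<le> K \<and>
     (\<forall>x y. (\<forall>i<n. x i = y i) \<longrightarrow> M x = M y) \<and>
     (\<forall>x. \<forall>i<n. linear (\<lambda>v. M (x(i := v)))) \<and>
     (\<forall>x. norm (M x) \<le> K * (\<Prod>i<n. norm (x i)))"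

text \<open>
  Symmetry of the coefficients is not demanded: symmetrising \<open>M n\<close> changes neither its values on
  the diagonal nor the bound.
\<close>

definition real_analytic_at ::
  "('a::real_normed_vector \<Rightarrow> 'b::real_normed_vector) \<Rightarrow> 'a \<Rightarrow> bool" where
  "real_analytic_at f a \<longleftrightarrow>
     (\<exists>M K r. r > 0 \<and> (\<forall>n. bounded_multilinear n (M n) (K n)) \<and>
        summable (\<lambda>n. K n * r ^ n) \<and>
        (\<forall>h. norm h < r \<longrightarrow> (\<lambda>n. M n (\<lambda>_. h)) sums f (a + h)))"

definition real_analytic_on ::
  "'a set \<Rightarrow> ('a::real_normed_vector \<Rightarrow> 'b::real_normed_vector) \<Rightarrow> bool" where
  "real_analytic_on S f \<longleftrightarrow> (\<forall>a\<in>S. real_analytic_at f a)"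

definition has_order_at :: "(real \<Rightarrow> real) \<Rightarrow> real \<Rightarrow> nat \<Rightarrow> bool" where
  "has_order_at f a n \<longleftrightarrow> (\<forall>k<n. (deriv ^^ k) f a = 0) \<and> (deriv ^^ n) f a \<noteq> 0"


section \<open>Fredholm operators and eigenvalues\<close>

abbreviation zero_set :: "('a \<Rightarrow> 'b::zero) \<Rightarrow> 'a set" where
  "zero_set T \<equiv> {x. T x = 0}"

text \<open>
  \<open>B\<close> is a basis of the kernel and \<open>C\<close> a basis of an algebraic complement of the range, so that
  \<open>card B\<close> is the dimension of the kernel and \<open>card C\<close> the codimension of the range.
\<close>

definition fredholm_index_zero :: "('u::real_normed_vector \<Rightarrow> 'v::real_normed_vector) set" where
  "fredholm_index_zero =
     {T. bounded_linear T \<and> closed (range T) \<and>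
         (\<exists>B C. finite B \<and> independent B \<and> span B = zero_set T \<and>
                finite C \<and> independent C \<and> span C \<inter> range T = {0} \<and>
                {x + y |x y. x \<in> span C \<and> y \<in> range T} = UNIV \<and>
                card B = card C)}"

definition GL :: "('u::real_normed_vector \<Rightarrow> 'v::real_normed_vector) set" where
  "GL = {T. bounded_linear T \<and>
            (\<exists>R. bounded_linear R \<and> (\<forall>u. R (T u) = u) \<and> (\<forall>v. T (R v) = v))}"

definition eigenvalues :: "(real \<Rightarrow> 'u::real_normed_vector \<Rightarrow> 'v::real_normed_vector) \<Rightarrow> real set" where
  "eigenvalues L = {l. L l \<notin> GL}"

definition linearization ::
  "(real \<times> 'u::real_normed_vector \<Rightarrow> 'v::real_normed_vector) \<Rightarrow> real \<Rightarrow> 'u \<Rightarrow> 'v" where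
  "linearization F l = frechet_derivative (\<lambda>u. F (l, u)) (at 0)"

definition bifurcation_point ::
  "(real \<times> 'u::real_normed_vector \<Rightarrow> 'v::real_normed_vector) \<Rightarrow> bool" where
  "bifurcation_point F \<longleftrightarrow>
     (\<exists>l u. (\<forall>n. F (l n, u n) = 0 \<and> u n \<noteq> 0) \<and> (\<lambda>n::nat. (l n, u n)) \<longlonglongrightarrow> (0, 0))"


section \<open>Half branches\<close>

definition half_branch :: "'a::real_normed_vector \<Rightarrow> 'a set \<Rightarrow> bool" where
  "half_branch a H \<longleftrightarrow>
     (\<exists>\<gamma>. real_analytic_on {0<..<1} \<gamma> \<and> inj_on \<gamma> {0<..<1::real} \<and>
          (\<gamma> \<longlongrightarrow> a) (at_right 0) \<and> H = \<gamma> ` {0<..<1})"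

definition half_branch_decomposition ::
  "'a::real_normed_vector \<Rightarrow> 'a set \<Rightarrow> 'a set set \<Rightarrow> bool" where
  "half_branch_decomposition a Z \<H> \<longleftrightarrow>
     finite \<H> \<and> disjoint \<H> \<and> (\<forall>H\<in>\<H>. half_branch a H) \<and> \<Union>\<H> = Z - {a}"


section \<open>Sturm chains\<close>

text \<open>
  The case distinction stops the chain once it vanishes; without it \<open>q mod 0 = q\<close> would
  restart it.
\<close>

fun sturm_chain :: "real poly \<Rightarrow> nat \<Rightarrow> real poly" where
  "sturm_chain q 0 = q"
| "sturm_chain q (Suc 0) = pderiv q"
| "sturm_chain q (Suc (Suc i)) =
     (if sturm_chain q (Suc i) = 0 then 0
      else - (sturm_chain q i mod sturm_chain q (Suc i)))"

definition sign_changes :: "real list \<Rightarrow> nat" where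
  "sign_changes xs =
     (let ys = filter (\<lambda>x. x \<noteq> 0) xs
      in card {i. Suc i < length ys \<and> ys ! i * ys ! Suc i < 0})"


section \<open>Lyapunov--Schmidt reduction, Weierstrass polynomial and Sturm data\<close>

text \<open>
  The neighbourhood of the origin in the \<open>(\<lambda>, z)\<close>-plane is \<open>lam_nbhd D \<times> {alpha D<..<omega D}\<close>.
  Only the values of \<open>S_iso D\<close> on the kernel of \<open>Q_proj D\<close>, and those of \<open>Y_map D\<close> at points
  \<open>(\<lambda>, z \<phi>\<^sub>0)\<close>, are relevant.
\<close>

record ('u, 'v) reduction =
  phi_star :: "'u \<Rightarrow> real"
  Q_proj :: "'v \<Rightarrow> 'v"
  S_iso :: "'v \<Rightarrow> real"
  Y_map :: "real \<times> 'u \<Rightarrow> 'u"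
  lam_nbhd :: "real set"
  alpha :: real
  omega :: real
  g_fun :: "real \<times> real \<Rightarrow> real"
  chi :: nat
  c_unit :: "real \<times> real \<Rightarrow> real"
  c_coeff :: "nat \<Rightarrow> real \<Rightarrow> real"
  lam_minus :: real
  lam_plus :: real

definition nbhd :: "('u, 'v) reduction \<Rightarrow> (real \<times> real) set" where
  "nbhd D = lam_nbhd D \<times> {alpha D<..<omega D}"

definition P_proj :: "'u \<Rightarrow> ('u::real_vector, 'v) reduction \<Rightarrow> 'u \<Rightarrow> 'u" where
  "P_proj \<phi>\<^sub>0 D u = phi_star D u *\<^sub>R \<phi>\<^sub>0"

definition lift :: "'u \<Rightarrow> ('u::real_vector, 'v) reduction \<Rightarrow> real \<times> real \<Rightarrow> real \<times> 'u" where
  "lift \<phi>\<^sub>0 D = (\<lambda>(l, z). (l, z *\<^sub>R \<phi>\<^sub>0 + Y_map D (l, z *\<^sub>R \<phi>\<^sub>0)))"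

definition G_fun ::
  "(real \<times> 'u \<Rightarrow> 'v) \<Rightarrow> 'u \<Rightarrow> ('u::real_vector, 'v::real_vector) reduction \<Rightarrow> real \<times> real \<Rightarrow> real"
  where
  "G_fun F \<phi>\<^sub>0 D w = S_iso D (F (lift \<phi>\<^sub>0 D w) - Q_proj D (F (lift \<phi>\<^sub>0 D w)))"

text \<open>The Weierstrass polynomial \<open>p(\<cdot>, z)\<close> as a polynomial in \<open>\<lambda>\<close>.\<close>

definition p_poly :: "('u, 'v) reduction \<Rightarrow> real \<Rightarrow> real poly" where
  "p_poly D z = monom 1 (chi D) + (\<Sum>j<chi D. monom (c_coeff D j z) j)"

definition V_count :: "('u, 'v) reduction \<Rightarrow> real \<Rightarrow> real \<Rightarrow> nat" where
  "V_count D \<xi> z =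
     sign_changes (map (\<lambda>i. poly (sturm_chain (p_poly D z) i) \<xi>) [0..<Suc (chi D)])"

text \<open>
  Analyticity of \<open>Y_map D\<close> on a part of \<open>\<real> \<times> N[L(0)]\<close> is expressed in the linear coordinate
  \<open>z\<close> of the line \<open>N[L(0)]\<close> spanned by \<open>\<phi>\<^sub>0\<close>.
\<close>

definition lyapunov_schmidt ::
  "(real \<times> 'u \<Rightarrow> 'v) \<Rightarrow> 'u \<Rightarrow>
     ('u::real_normed_vector, 'v::real_normed_vector) reduction \<Rightarrow> bool" where
  "lyapunov_schmidt F \<phi>\<^sub>0 D \<longleftrightarrow>
     bounded_linear (phi_star D) \<and> phi_star D \<phi>\<^sub>0 = 1 \<and>
     bounded_linear (Q_proj D) \<and> (\<forall>v. Q_proj D (Q_proj D v) = Q_proj D v) \<and>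
     range (Q_proj D) = range (linearization F 0) \<and>
     (\<forall>x\<in>zero_set (Q_proj D). \<forall>y\<in>zero_set (Q_proj D). S_iso D (x + y) = S_iso D x + S_iso D y) \<and>
     (\<forall>r. \<forall>x\<in>zero_set (Q_proj D). S_iso D (r *\<^sub>R x) = r * S_iso D x) \<and>
     bij_betw (S_iso D) (zero_set (Q_proj D)) UNIV \<and>
     open (lam_nbhd D) \<and> 0 \<in> lam_nbhd D \<and> alpha D < 0 \<and> 0 < omega D \<and>
     real_analytic_on (nbhd D) (\<lambda>(l, z). Y_map D (l, z *\<^sub>R \<phi>\<^sub>0)) \<and>
     Y_map D (0, 0) = 0 \<and>
     (\<forall>(l, z)\<in>nbhd D. Y_map D (l, z *\<^sub>R \<phi>\<^sub>0) \<in> zero_set (P_proj \<phi>\<^sub>0 D)) \<and>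
     (\<forall>w\<in>nbhd D. Q_proj D (F (lift \<phi>\<^sub>0 D w)) = 0)"

definition weierstrass ::
  "(real \<times> 'u \<Rightarrow> 'v) \<Rightarrow> 'u \<Rightarrow>
     ('u::real_normed_vector, 'v::real_normed_vector) reduction \<Rightarrow> bool" where
  "weierstrass F \<phi>\<^sub>0 D \<longleftrightarrow>
     real_analytic_on (nbhd D) (g_fun D) \<and>
     (\<forall>(l, z)\<in>nbhd D. G_fun F \<phi>\<^sub>0 D (l, z) = z * g_fun D (l, z)) \<and>
     has_order_at (\<lambda>l. g_fun D (l, 0)) 0 (chi D) \<and> 1 \<le> chi D \<and>
     real_analytic_on (nbhd D) (c_unit D) \<and> c_unit D (0, 0) \<noteq> 0 \<and>
     (\<forall>j<chi D. real_analytic_on {alpha D<..<omega D} (c_coeff D j) \<and> c_coeff D j 0 = 0) \<and>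
     (\<forall>(l, z)\<in>nbhd D. g_fun D (l, z) = c_unit D (l, z) * poly (p_poly D z) l)"

definition real_root_count :: "('u, 'v) reduction \<Rightarrow> real \<Rightarrow> nat" where
  "real_root_count D z = card {l \<in> {lam_minus D<..<lam_plus D}. poly (p_poly D z) l = 0}"

definition sturm_data ::
  "(real \<times> 'u \<Rightarrow> 'v) \<Rightarrow> 'u \<Rightarrow>
     ('u::real_normed_vector, 'v::real_normed_vector) reduction \<Rightarrow> bool" where
  "sturm_data F \<phi>\<^sub>0 D \<longleftrightarrow>
     lam_minus D < 0 \<and> 0 < lam_plus D \<and>
     (\<forall>l\<in>{lam_minus D, lam_plus D}.
        l \<in> lam_nbhd D \<and>
        ({l} \<times> {alpha D<..<omega D}) \<inter> zero_set (G_fun F \<phi>\<^sub>0 D) = {(l, 0)} \<and>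
        (\<forall>z\<in>{alpha D<..<omega D}. poly (p_poly D z) l \<noteq> 0)) \<and>
     real_root_count D constant_on {0<..<omega D} \<and>
     real_root_count D constant_on {alpha D<..<0}"

definition reduction_data ::
  "(real \<times> 'u \<Rightarrow> 'v) \<Rightarrow> 'u \<Rightarrow>
     ('u::real_normed_vector, 'v::real_normed_vector) reduction \<Rightarrow> bool" where
  "reduction_data F \<phi>\<^sub>0 D \<longleftrightarrow>
     lyapunov_schmidt F \<phi>\<^sub>0 D \<and> weierstrass F \<phi>\<^sub>0 D \<and> sturm_data F \<phi>\<^sub>0 D"

end

theory Submission
  imports Defs
begin

text \<open>
  The implicit function theorem is obtained from the contraction principle in a Banach space of
  absolutely summable double power series, so that the analyticity of the solution is automatic.
  The same fixed point argument gives the Lyapunov--Schmidt map, the Weierstrass preparation of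
  the reduced equation and the analytic continuation of simple roots.  Quotients of analytic germs
  at \<open>0\<^sup>+\<close> form a field whose elements have an eventual sign; the squarefree part of the Weierstrass
  polynomial can therefore be computed over this field by the Euclidean algorithm, and its real
  roots are simple and analytic on each side of \<open>z = 0\<close>.  Besides the trivial line, the
  zeros near the origin are the lifts of these finitely many root branches, which Sturm's theorem
  counts.  When the degree is odd, the Weierstrass polynomial changes sign between
  \<open>\<lambda>\<^sub>-\<close> and \<open>\<lambda>\<^sub>+\<close>, so there is at least one such branch on each side.
\<close>

section \<open>Absolutely summable double power series\<close>

typedef (overloaded) ('v::real_normed_vector) ell1 =
  "{a :: nat \<times> nat \<Rightarrow> 'v. (\<lambda>k. norm (a k)) summable_on UNIV}"
  morphisms coef Ell
  by (rule exI[of _ "\<lambda>_. 0"]) simp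

setup_lifting type_definition_ell1

lemma coef_summable [simp]: "(\<lambda>k. norm (coef a k)) summable_on UNIV"
  using coef[of a] by simp

lemma summable_on_norm_boundI:
  fixes b :: "'i \<Rightarrow> 'v::real_normed_vector"
  assumes "\<And>S. finite S \<Longrightarrow> (\<Sum>k\<in>S. norm (b k)) \<le> C"
  shows "(\<lambda>k. norm (b k)) summable_on UNIV" "infsum (\<lambda>k. norm (b k)) UNIV \<le> C"
proof -
  show *: "(\<lambda>k. norm (b k)) summable_on UNIV"
    using assms by (intro nonneg_bdd_above_summable_on) (auto simp: bdd_above_def)
  show "infsum (\<lambda>k. norm (b k)) UNIV \<le> C"
    by (rule infsum_le_finite_sums[OF *]) (use assms in auto)
qed

instantiation ell1 :: (real_normed_vector) real_normed_vector
begin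

lift_definition zero_ell1 :: "'a ell1" is "\<lambda>_. 0"
  by simp

lift_definition plus_ell1 :: "'a ell1 \<Rightarrow> 'a ell1 \<Rightarrow> 'a ell1" is "\<lambda>a b k. a k + b k"
  by (erule (1) Infinite_Sum.abs_summable_on_comparison_test'[OF summable_on_add])
     (rule norm_triangle_ineq)

lift_definition minus_ell1 :: "'a ell1 \<Rightarrow> 'a ell1 \<Rightarrow> 'a ell1" is "\<lambda>a b k. a k - b k"
  by (erule (1) Infinite_Sum.abs_summable_on_comparison_test'[OF summable_on_add])
     (rule norm_triangle_ineq4)

lift_definition uminus_ell1 :: "'a ell1 \<Rightarrow> 'a ell1" is "\<lambda>a k. - a k"
  by simp

lift_definition scaleR_ell1 :: "real \<Rightarrow> 'a ell1 \<Rightarrow> 'a ell1" is "\<lambda>r a k. r *\<^sub>R a k"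
  by (simp add: summable_on_cmult_right)

definition norm_ell1 :: "'a ell1 \<Rightarrow> real" where
  "norm_ell1 a = infsum (\<lambda>k. norm (coef a k)) UNIV"

definition "dist_ell1 (a::'a ell1) b = norm (a - b)"
definition "sgn_ell1 (a::'a ell1) = inverse (norm a) *\<^sub>R a"
definition "(uniformity :: ('a ell1 \<times> 'a ell1) filter) =
  (INF e\<in>{0<..}. principal {(x, y). dist x y < e})"
definition "open (S :: 'a ell1 set) =
  (\<forall>x\<in>S. \<forall>\<^sub>F (x', y) in uniformity. x' = x \<longrightarrow> y \<in> S)"

instance
proof
  fix a b c :: "'a ell1" and r s :: real
  show "a + b + c = a + (b + c)" by transfer (simp add: add.assoc)
  show "a + b = b + a" by transfer (simp add: add.commute)
  show "0 + a = a" by transfer simp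
  show "- a + a = 0" by transfer simp
  show "a - b = a + - b" by transfer simp
  show "r *\<^sub>R (a + b) = r *\<^sub>R a + r *\<^sub>R b" by transfer (simp add: scaleR_add_right)
  show "(r + s) *\<^sub>R a = r *\<^sub>R a + s *\<^sub>R a" by transfer (simp add: scaleR_add_left)
  show "r *\<^sub>R s *\<^sub>R a = (r * s) *\<^sub>R a" by transfer simp
  show "1 *\<^sub>R a = a" by transfer simp
  show "dist a b = norm (a - b)" by (simp add: dist_ell1_def)
  show "sgn a = inverse (norm a) *\<^sub>R a" by (simp add: sgn_ell1_def)
  show "(uniformity :: ('a ell1 \<times> 'a ell1) filter) =
      (INF e\<in>{0<..}. principal {(x, y). dist x y < e})"
    by (simp add: uniformity_ell1_def)
  show "open (S :: 'a ell1 set) = (\<forall>x\<in>S. \<forall>\<^sub>F (x', y) in uniformity. x' = x \<longrightarrow> y \<in> S)" for S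
    by (simp add: open_ell1_def)
  show "(norm a = 0) = (a = 0)"
  proof
    assume "norm a = 0"
    hence "norm (coef a k) = 0" for k
      by (intro nonneg_infsum_le_0D[of "\<lambda>k. norm (coef a k)" UNIV]) (auto simp: norm_ell1_def)
    thus "a = 0" by transfer auto
  qed (simp add: norm_ell1_def zero_ell1.rep_eq)
  have "norm (a + b) \<le> infsum (\<lambda>k. norm (coef a k) + norm (coef b k)) UNIV"
    unfolding norm_ell1_def
    by (intro infsum_mono summable_on_add) (auto simp: plus_ell1.rep_eq norm_triangle_ineq
          coef_summable[of "a + b", unfolded plus_ell1.rep_eq])
  also have "\<dots> = norm a + norm b"
    unfolding norm_ell1_def by (intro infsum_add) auto
  finally show "norm (a + b) \<le> norm a + norm b" .
  show "norm (r *\<^sub>R a) = \<bar>r\<bar> * norm a"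
    by (simp add: norm_ell1_def scaleR_ell1.rep_eq infsum_cmult_right)
qed

end

lemma norm_ell1_boundI:
  assumes "\<And>S. finite S \<Longrightarrow> (\<Sum>k\<in>S. norm (coef a k)) \<le> C"
  shows "norm a \<le> C"
  unfolding norm_ell1_def by (rule summable_on_norm_boundI[OF assms])

lemma sum_norm_coef_le: "finite S \<Longrightarrow> (\<Sum>k\<in>S. norm (coef a k)) \<le> norm a"
  unfolding norm_ell1_def by (rule finite_sum_le_infsum) auto

lemma norm_coef_le: "norm (coef a k) \<le> norm a"
  using sum_norm_coef_le[of "{k}" a] by simp

lemma coef_sum: "coef (sum f S) k = (\<Sum>i\<in>S. coef (f i) k)"
  by (induction S rule: infinite_finite_induct) (auto simp: zero_ell1.rep_eq plus_ell1.rep_eq)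

lemma ell1_eqI: "(\<And>k. coef a k = coef b k) \<Longrightarrow> a = b"
  by (metis coef_inject ext)

lemmas coef_simps [simp] = zero_ell1.rep_eq plus_ell1.rep_eq minus_ell1.rep_eq uminus_ell1.rep_eq
  scaleR_ell1.rep_eq coef_sum

lemma coef_EllI:
  assumes "\<And>S. finite S \<Longrightarrow> (\<Sum>k\<in>S. norm (b k)) \<le> C"
  shows "coef (Ell b) = b" "norm (Ell b) \<le> C"
proof -
  show *: "coef (Ell b) = b"
    using summable_on_norm_boundI[OF assms] by (intro Ell_inverse) auto
  show "norm (Ell b) \<le> C"
    by (rule norm_ell1_boundI) (simp add: * assms)
qed

lemma bounded_linear_coef: "bounded_linear (\<lambda>a. coef a k)"
  by (rule bounded_linear_intro[of _ 1]) (auto simp: norm_coef_le)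

instance ell1 :: (banach) banach
proof
  fix X :: "nat \<Rightarrow> 'a ell1"
  assume X: "Cauchy X"
  have "convergent (\<lambda>n. coef (X n) k)" for k
    by (rule Cauchy_convergent, rule bounded_linear.Cauchy[OF bounded_linear_coef X])
  then obtain L where L: "\<And>k. (\<lambda>n. coef (X n) k) \<longlonglongrightarrow> L k"
    unfolding convergent_def by metis
  have key: "\<exists>N. \<forall>n\<ge>N. \<forall>S. finite S \<longrightarrow> (\<Sum>k\<in>S. norm (coef (X n) k - L k)) \<le> e"
    if "e > 0" for e
  proof -
    obtain N where N: "\<And>m n. m \<ge> N \<Longrightarrow> n \<ge> N \<Longrightarrow> norm (X m - X n) < e"
      using CauchyD[OF X \<open>e > 0\<close>] by blast
    have "(\<Sum>k\<in>S. norm (coef (X n) k - L k)) \<le> e" if "finite S" "n \<ge> N" for n S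
    proof (rule tendsto_upperbound)
      show "(\<lambda>m. \<Sum>k\<in>S. norm (coef (X n) k - coef (X m) k)) \<longlonglongrightarrow>
          (\<Sum>k\<in>S. norm (coef (X n) k - L k))"
        by (intro tendsto_intros L)
      show "\<forall>\<^sub>F m in sequentially. (\<Sum>k\<in>S. norm (coef (X n) k - coef (X m) k)) \<le> e"
        using eventually_ge_at_top[of N]
      proof eventually_elim
        case (elim m)
        show ?case
          using sum_norm_coef_le[OF \<open>finite S\<close>, of "X n - X m"] N[OF \<open>n \<ge> N\<close> elim] by simp
      qed
    qed simp
    thus ?thesis by blast
  qed
  from key[of 1] obtain N where
    N: "\<And>S. finite S \<Longrightarrow> (\<Sum>k\<in>S. norm (coef (X N) k - L k)) \<le> 1" by fastforce
  have "(\<Sum>k\<in>S. norm (L k)) \<le> norm (X N) + 1" if "finite S" for S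
  proof -
    have "(\<Sum>k\<in>S. norm (L k)) \<le> (\<Sum>k\<in>S. norm (coef (X N) k) + norm (coef (X N) k - L k))"
      by (intro sum_mono) (metis norm_triangle_sub norm_minus_commute)
    also have "\<dots> \<le> norm (X N) + 1"
      unfolding sum.distrib by (intro add_mono N sum_norm_coef_le that)
    finally show ?thesis .
  qed
  hence cL: "coef (Ell L) = L" by (rule coef_EllI)
  have "X \<longlonglongrightarrow> Ell L"
  proof (rule LIMSEQ_I)
    fix r :: real assume "r > 0"
    with key[of "r/2"] obtain N where
      N: "\<And>n S. n \<ge> N \<Longrightarrow> finite S \<Longrightarrow> (\<Sum>k\<in>S. norm (coef (X n) k - L k)) \<le> r / 2" by auto
    have "norm (X n - Ell L) \<le> r / 2" if "n \<ge> N" for n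
      by (rule norm_ell1_boundI) (use N[OF that] in \<open>simp only: coef_simps cL\<close>)
    thus "\<exists>no. \<forall>n\<ge>no. norm (X n - Ell L) < r"
      using \<open>r > 0\<close> by (intro exI[of _ N]) force
  qed
  thus "convergent X" by (auto simp: convergent_def)
qed

lift_definition single :: "nat \<times> nat \<Rightarrow> 'v::real_normed_vector \<Rightarrow> 'v ell1" is
  "\<lambda>j v k. if k = j then v else 0"
  by (rule finite_nonzero_values_imp_summable_on) (rule finite_subset[of _ "{j}" for j], auto)

lemma norm_single [simp]: "norm (single j v) = norm v"
proof -
  have "infsum (\<lambda>k. norm (if k = j then v else 0)) UNIV = infsum (\<lambda>k. norm v) {j}"
    by (rule infsum_cong_neutral) auto
  thus ?thesis by (simp add: norm_ell1_def single.rep_eq)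
qed

lemma has_sum_single: "((\<lambda>k. single k (coef a k)) has_sum a) UNIV"
proof -
  have eq: "norm ((\<Sum>k\<in>S. single k (coef a k)) - a) = norm a - (\<Sum>k\<in>S. norm (coef a k))"
    if "finite S" for S
  proof -
    have "(\<Sum>i\<in>S. if k = i then coef a i else 0) - coef a k = (if k \<in> S then 0 else - coef a k)" for k
      using that by simp
    hence "norm ((\<Sum>k\<in>S. single k (coef a k)) - a) = infsum (\<lambda>k. norm (coef a k)) (UNIV - S)"
      unfolding norm_ell1_def by (intro infsum_cong_neutral) (auto simp: single.rep_eq)
    also have "\<dots> = infsum (\<lambda>k. norm (coef a k)) UNIV - infsum (\<lambda>k. norm (coef a k)) S"
      by (rule infsum_Diff) (use that in auto)
    finally show ?thesis using that by (simp add: norm_ell1_def)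
  qed
  have "((\<lambda>S. \<Sum>k\<in>S. norm (coef a k)) \<longlongrightarrow> norm a) (finite_subsets_at_top UNIV)"
    using has_sum_infsum[OF coef_summable[of a]] by (simp add: has_sum_def norm_ell1_def)
  hence "((\<lambda>S. norm a - (\<Sum>k\<in>S. norm (coef a k))) \<longlongrightarrow> 0) (finite_subsets_at_top UNIV)"
    by (auto intro!: tendsto_eq_intros)
  hence "((\<lambda>S. norm ((\<Sum>k\<in>S. single k (coef a k)) - a)) \<longlongrightarrow> 0) (finite_subsets_at_top UNIV)"
    by (rule Lim_transform_eventually)
       (auto intro!: eventually_finite_subsets_at_top_weakI simp: eq)
  thus ?thesis
    unfolding has_sum_def by (rule LIM_zero_cancel[OF tendsto_norm_zero_cancel])
qed

lemma bounded_linear_ell1_eqI: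
  assumes "bounded_linear f" "bounded_linear g" "\<And>j v. f (single j v) = g (single j v)"
  shows "f a = g a"
  using has_sum_bounded_linear[OF assms(1) has_sum_single[of a]]
    has_sum_bounded_linear[OF assms(2) has_sum_single[of a]]
  by (simp add: assms(3)) (rule has_sum_unique)

definition monom2 :: "real \<times> real \<Rightarrow> nat \<times> nat \<Rightarrow> real" where
  "monom2 w k = fst w ^ fst k * snd w ^ snd k"

lemma monom2_add: "monom2 w (j + k) = monom2 w j * monom2 w k"
  by (simp add: monom2_def power_add)

lemma monom2_0 [simp]: "monom2 w 0 = 1"
  by (simp add: monom2_def)

definition unit_square :: "(real \<times> real) set" where
  "unit_square = {w. \<bar>fst w\<bar> \<le> 1 \<and> \<bar>snd w\<bar> \<le> 1}"

lemma abs_monom2_le: "w \<in> unit_square \<Longrightarrow> \<bar>monom2 w k\<bar> \<le> 1"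
  unfolding monom2_def unit_square_def abs_mult
  by (intro mult_le_one) (auto simp: power_abs power_le_one)

definition ev :: "real \<times> real \<Rightarrow> 'v::banach ell1 \<Rightarrow> 'v" where
  "ev w a = infsum (\<lambda>k. monom2 w k *\<^sub>R coef a k) UNIV"

lemma ev_abs_summable:
  assumes "w \<in> unit_square"
  shows "(\<lambda>k. norm (monom2 w k *\<^sub>R coef a k)) summable_on UNIV"
  by (rule Infinite_Sum.abs_summable_on_comparison_test'[OF coef_summable[of a]])
     (unfold norm_scaleR real_norm_def, intro mult_left_le_one_le abs_monom2_le assms, auto)

lemma ev_has_sum:
  assumes "w \<in> unit_square"
  shows "((\<lambda>k. monom2 w k *\<^sub>R coef a k) has_sum ev w a) UNIV"
  unfolding ev_def by (rule has_sum_infsum[OF abs_summable_summable[OF ev_abs_summable[OF assms]]])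

lemma norm_ev_le:
  assumes "w \<in> unit_square"
  shows "norm (ev w a) \<le> norm a"
  unfolding norm_ell1_def
  by (rule norm_infsum_le[OF ev_has_sum[OF assms] has_sum_infsum[OF coef_summable]])
     (unfold norm_scaleR real_norm_def, intro mult_left_le_one_le abs_monom2_le assms, auto)

lemma bounded_linear_ev:
  assumes "w \<in> unit_square"
  shows "bounded_linear (ev w)"
proof (rule bounded_linear_intro[of _ 1])
  note hs = ev_has_sum[OF assms]
  show "ev w (a + b) = ev w a + ev w b" for a b :: "'a ell1"
    using has_sum_unique[OF hs[of "a + b"]] has_sum_add[OF hs[of a] hs[of b]]
    by (simp add: scaleR_add_right)
  show "ev w (r *\<^sub>R a) = r *\<^sub>R ev w a" for r and a :: "'a ell1"
    using has_sum_unique[OF hs[of "r *\<^sub>R a"]]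
      has_sum_bounded_linear[OF bounded_linear_scaleR_right[of r] hs[of a]]
    by (simp add: mult.commute)
  show "norm (ev w a) \<le> norm a * 1" for a :: "'a ell1"
    using norm_ev_le[OF assms] by simp
qed

lemma ev_single [simp]: "ev w (single j v) = monom2 w j *\<^sub>R v"
proof -
  have "infsum (\<lambda>k. monom2 w k *\<^sub>R coef (single j v) k) UNIV
      = infsum (\<lambda>k. monom2 w j *\<^sub>R v) {j}"
    by (rule infsum_cong_neutral) (auto simp: single.rep_eq)
  thus ?thesis by (simp add: ev_def)
qed

definition emap :: "('u \<Rightarrow> 'v) \<Rightarrow> 'u::real_normed_vector ell1 \<Rightarrow> 'v::real_normed_vector ell1" where
  "emap T a = Ell (\<lambda>k. T (coef a k))"

lemma emap_bound:
  assumes "\<And>x. norm (T x) \<le> K * norm x" "K \<ge> 0"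
  shows "coef (emap T a) = (\<lambda>k. T (coef a k))" "norm (emap T a) \<le> K * norm a"
proof -
  have *: "(\<Sum>k\<in>S. norm (T (coef a k))) \<le> K * norm a" if "finite S" for S
  proof -
    have "(\<Sum>k\<in>S. norm (T (coef a k))) \<le> (\<Sum>k\<in>S. K * norm (coef a k))"
      by (intro sum_mono assms)
    also have "\<dots> = K * (\<Sum>k\<in>S. norm (coef a k))" by (simp add: sum_distrib_left)
    also have "\<dots> \<le> K * norm a" by (intro mult_left_mono sum_norm_coef_le that assms)
    finally show ?thesis .
  qed
  show "coef (emap T a) = (\<lambda>k. T (coef a k))" "norm (emap T a) \<le> K * norm a"
    unfolding emap_def by (rule coef_EllI[OF *], assumption)+
qed

lemma bounded_linear_emap:
  assumes "bounded_linear T"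
  shows "bounded_linear (emap T)" "coef (emap T a) k = T (coef a k)"
proof -
  interpret bounded_linear T by fact
  obtain K where K: "\<And>x. norm (T x) \<le> K * norm x" "K \<ge> 0"
    using nonneg_bounded by (auto simp: mult.commute)
  show c: "coef (emap T a) k = T (coef a k)" for a k
    using emap_bound(1)[OF K] by simp
  show "bounded_linear (emap T)"
    by (rule bounded_linear_intro[of _ K])
       (auto intro!: ell1_eqI simp: c add scaleR mult.commute[of _ K] emap_bound(2)[OF K])
qed

lemma emap_single:
  assumes "bounded_linear T"
  shows "emap T (single j v) = single j (T v)"
  by (rule ell1_eqI) (simp add: bounded_linear_emap[OF assms] single.rep_eq
      linear_0[OF bounded_linear.linear[OF assms]])

lemma ev_emap:
  assumes "bounded_linear T" "w \<in> unit_square"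
  shows "ev w (emap T a) = T (ev w a)"
  by (rule bounded_linear_ell1_eqI[of "\<lambda>a. ev w (emap T a)" "\<lambda>a. T (ev w a)"])
     (simp_all add: bounded_linear_compose[OF bounded_linear_ev[OF assms(2)] bounded_linear_emap(1)[OF assms(1)]]
       bounded_linear_compose[OF assms(1) bounded_linear_ev[OF assms(2)]]
       emap_single[OF assms(1)] linear_scale[OF bounded_linear.linear[OF assms(1)]])

text \<open>Reindexing along an injection realises multiplication by a monomial.\<close>

definition eshift :: "nat \<times> nat \<Rightarrow> 'v::real_normed_vector ell1 \<Rightarrow> 'v ell1" where
  "eshift j a = Ell (\<lambda>k. if k \<in> range ((+) j) then coef a (k - j) else 0)"

lemma eshift_bound:
  shows "coef (eshift j a) = (\<lambda>k. if k \<in> range ((+) j) then coef a (k - j) else 0)"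
    and "norm (eshift j a) \<le> norm a"
proof -
  have *: "(\<Sum>k\<in>S. norm (if k \<in> range ((+) j) then coef a (k - j) else 0)) \<le> norm a" if "finite S" for S
  proof -
    have "(\<Sum>k\<in>S. norm (if k \<in> range ((+) j) then coef a (k - j) else 0))
        = (\<Sum>k\<in>S \<inter> range ((+) j). norm (coef a (k - j)))"
      by (rule sum.mono_neutral_cong_right) (use that in auto)
    also have "\<dots> = (\<Sum>k\<in>(\<lambda>k. k - j) ` (S \<inter> range ((+) j)). norm (coef a k))"
      by (subst sum.reindex) (auto simp: inj_on_def prod_eq_iff)
    also have "\<dots> \<le> norm a" by (rule sum_norm_coef_le) (use that in auto)
    finally show ?thesis .
  qed
  show "coef (eshift j a) = (\<lambda>k. if k \<in> range ((+) j) then coef a (k - j) else 0)"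
    "norm (eshift j a) \<le> norm a"
    unfolding eshift_def by (rule coef_EllI[OF *], assumption)+
qed

lemma coef_eshift_add [simp]: "coef (eshift j a) (j + k) = coef a k"
  by (simp add: eshift_bound prod_eq_iff)

lemma bounded_linear_eshift: "bounded_linear (eshift j)"
proof (rule bounded_linear_intro[of _ 1])
  show "norm (eshift j a) \<le> norm a * 1" for a :: "'a ell1"
    using eshift_bound(2)[of j a] by simp
qed (rule ell1_eqI, simp add: eshift_bound)+

lemma eshift_single: "eshift j (single k v) = single (j + k) v"
proof (rule ell1_eqI)
  fix i
  show "coef (eshift j (single k v)) i = coef (single (j + k) v) i"
  proof (cases "i \<in> range ((+) j)")
    case True
    then obtain l where "i = j + l" by blast
    thus ?thesis by (simp add: single.rep_eq)
  next
    case False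
    thus ?thesis by (auto simp: single.rep_eq eshift_bound)
  qed
qed

lemma ev_eshift:
  assumes "w \<in> unit_square"
  shows "ev w (eshift j a) = monom2 w j *\<^sub>R ev w a"
  by (rule bounded_linear_ell1_eqI[of "\<lambda>a. ev w (eshift j a)" "\<lambda>a. monom2 w j *\<^sub>R ev w a"])
     (simp_all add: bounded_linear_compose[OF bounded_linear_ev[OF assms] bounded_linear_eshift]
       bounded_linear_compose[OF bounded_linear_scaleR_right bounded_linear_ev[OF assms]]
       eshift_single monom2_add)

section \<open>Power series with multilinear coefficients\<close>

lemma bounded_multilinearD:
  assumes "bounded_multilinear n M K"
  shows "0 \<le> K" "(\<And>i. i < n \<Longrightarrow> x i = y i) \<Longrightarrow> M x = M y"
    "i < n \<Longrightarrow> linear (\<lambda>v. M (x(i := v)))" "norm (M x) \<le> K * (\<Prod>i<n. norm (x i))"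
  using assms unfolding bounded_multilinear_def by auto

lemma bounded_multilinear_bounded_linear:
  assumes "bounded_multilinear n M K" "i < n"
  shows "bounded_linear (\<lambda>v. M (x(i := v)))"
proof -
  have "norm (M (x(i := v))) \<le> norm v * (K * (\<Prod>j\<in>{..<n} - {i}. norm (x j)))" for v
  proof -
    have "(\<Prod>j<n. norm ((x(i := v)) j)) = norm v * (\<Prod>j\<in>{..<n} - {i}. norm (x j))"
      using assms(2) by (subst prod.remove[of _ i]) (auto intro!: prod.cong)
    thus ?thesis using bounded_multilinearD(4)[OF assms(1), of "x(i := v)"]
      by (simp add: ac_simps)
  qed
  thus ?thesis
    using bounded_multilinearD(3)[OF assms(1,2), of x]
    by (auto simp: bounded_linear_def bounded_linear_axioms_def)
qed

lemma bounded_multilinear_eq_0: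
  assumes "bounded_multilinear n M K" "i < n" "x i = 0"
  shows "M x = 0"
proof -
  have "(\<Prod>i<n. norm (x i)) = 0" by (rule prod_zero) (use assms in auto)
  thus ?thesis using bounded_multilinearD(4)[OF assms(1), of x] by (simp only: mult_zero_right norm_le_zero_iff)
qed

lemma bounded_multilinear_diag_diff:
  assumes M: "bounded_multilinear n M K" and hk: "norm h \<le> R" "norm k \<le> R"
  shows "norm (M (\<lambda>_. h) - M (\<lambda>_. k)) \<le> real n * K * R ^ (n - 1) * norm (h - k)"
proof -
  define z where "z j = (\<lambda>i::nat. if i < j then h else k)" for j :: nat
  have R: "R \<ge> 0" using hk(1) norm_ge_zero order_trans by blast
  have step: "norm (M (z (Suc j)) - M (z j)) \<le> K * R ^ (n - 1) * norm (h - k)" if j: "j < n" for j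
  proof -
    have eq: "z (Suc j) = (z j)(j := h)" "z j = (z j)(j := k)"
      by (auto simp: z_def fun_eq_iff less_Suc_eq)
    have "M (z (Suc j)) - M (z j) = M ((z j)(j := h)) - M ((z j)(j := k))"
      using eq by metis
    also have "\<dots> = M ((z j)(j := h - k))"
      using linear_diff[OF bounded_multilinearD(3)[OF M j, of "z j"]] by simp
    also have "norm \<dots> \<le> K * (\<Prod>i<n. norm (((z j)(j := h - k)) i))"
      by (rule bounded_multilinearD(4)[OF M])
    also have "(\<Prod>i<n. norm (((z j)(j := h - k)) i)) =
        norm (h - k) * (\<Prod>i\<in>{..<n} - {j}. norm (z j i))"
      using j by (subst prod.remove[of _ j]) (auto intro!: prod.cong)
    also have "K * \<dots> \<le> K * (norm (h - k) * (\<Prod>i\<in>{..<n} - {j}. R))"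
      using hk by (intro mult_left_mono prod_mono bounded_multilinearD(1)[OF M]) (auto simp: z_def)
    also have "\<dots> = K * R ^ (n - 1) * norm (h - k)"
      using j by simp
    finally show ?thesis .
  qed
  have "M (\<lambda>_. h) = M (z n)" "M (\<lambda>_. k) = M (z 0)"
    by (auto intro!: bounded_multilinearD(2)[OF M] simp: z_def)
  hence "M (\<lambda>_. h) - M (\<lambda>_. k) = (\<Sum>j<n. M (z (Suc j)) - M (z j))"
    using sum_lessThan_telescope[of "\<lambda>j. M (z j)" n] by simp
  also have "norm \<dots> \<le> (\<Sum>j<n. K * R ^ (n - 1) * norm (h - k))"
    by (intro sum_norm_le step) auto
  finally show ?thesis by simp
qed

definition power_coeffs ::
  "(nat \<Rightarrow> (nat \<Rightarrow> 'a::real_normed_vector) \<Rightarrow> 'b::real_normed_vector) \<Rightarrow> (nat \<Rightarrow> real) \<Rightarrow> real \<Rightarrow> bool" where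
  "power_coeffs M K r \<longleftrightarrow> r > 0 \<and> (\<forall>n. bounded_multilinear n (M n) (K n)) \<and> summable (\<lambda>n. K n * r ^ n)"

lemma real_analytic_at_iff:
  "real_analytic_at f a \<longleftrightarrow>
    (\<exists>M K r. power_coeffs M K r \<and> (\<forall>h. norm h < r \<longrightarrow> (\<lambda>n. M n (\<lambda>_. h)) sums f (a + h)))"
  unfolding real_analytic_at_def power_coeffs_def by (simp add: conj_assoc)

lemma power_coeffs_mono:
  assumes "power_coeffs M K r" "0 < s" "s \<le> r"
  shows "power_coeffs M K s"
proof -
  have K: "K n \<ge> 0" for n using assms(1) by (auto simp: power_coeffs_def bounded_multilinear_def)
  show ?thesis
    using assms K unfolding power_coeffs_def
    by (auto intro!: summable_comparison_test'[of "\<lambda>n. K n * r ^ n" 0] mult_mono power_mono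
        simp: abs_mult)
qed

lemma power_coeffs_strict:
  fixes M :: "nat \<Rightarrow> (nat \<Rightarrow> 'a::real_normed_vector) \<Rightarrow> 'b::banach"
  assumes M: "power_coeffs M K r"
  obtains C where "C \<ge> 0"
    "\<And>h k R s t. \<lbrakk>norm h \<le> R; norm k \<le> R; R \<le> r / 2;
        (\<lambda>n. M n (\<lambda>_. h)) sums s; (\<lambda>n. M n (\<lambda>_. k)) sums t\<rbrakk>
      \<Longrightarrow> norm (s - t - M 1 (\<lambda>_. h - k)) \<le> C * R * norm (h - k)"
proof -
  have r: "r > 0" and bm: "\<And>n. bounded_multilinear n (M n) (K n)"
    and sK: "summable (\<lambda>n. K n * r ^ n)" using M by (auto simp: power_coeffs_def)
  have K0: "K n \<ge> 0" for n by (rule bounded_multilinearD(1)[OF bm])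
  define D where "D n = (if n < 2 then 0 else real n * K n * (r / 2) ^ (n - 2))" for n
  have D0: "D n \<ge> 0" for n using K0 r by (simp add: D_def)
  have sD: "summable D"
  proof (rule summable_comparison_test'[of "\<lambda>n. 4 / r\<^sup>2 * (K n * r ^ n)" 0])
    show "summable (\<lambda>n. 4 / r\<^sup>2 * (K n * r ^ n))" by (intro summable_mult sK)
    fix n :: nat
    show "norm (D n) \<le> 4 / r\<^sup>2 * (K n * r ^ n)"
    proof (cases "n < 2")
      case True thus ?thesis using K0 r by (simp add: D_def)
    next
      case False
      then obtain m where m: "n = m + 2" by (metis add.commute le_Suc_ex not_less)
      have "real n \<le> 2 ^ n" by (metis less_imp_le of_nat_less_two_power)
      hence "real n * K n * (r / 2) ^ m \<le> 2 ^ n * K n * (r / 2) ^ m"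
        using K0 r by (intro mult_right_mono) auto
      also have "\<dots> = 4 / r\<^sup>2 * (K n * r ^ n)"
        using r by (simp add: m power_add power_divide power2_eq_square field_simps)
      finally show ?thesis using K0 r by (simp add: D_def m)
    qed
  qed
  show thesis
  proof (rule that[of "suminf D"])
    show "suminf D \<ge> 0" by (rule suminf_nonneg[OF sD D0])
    fix h k :: 'a and R s t
    assume hk: "norm h \<le> R" "norm k \<le> R" "R \<le> r / 2"
      and s: "(\<lambda>n. M n (\<lambda>_. h)) sums s" and t: "(\<lambda>n. M n (\<lambda>_. k)) sums t"
    have R: "R \<ge> 0" using hk(1) norm_ge_zero order_trans by blast
    define d where "d n = M n (\<lambda>_. h) - M n (\<lambda>_. k) - (if n = 1 then M 1 (\<lambda>_. h - k) else 0)" for n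
    have "(\<lambda>n. if n = 1 then M 1 (\<lambda>_. h - k) else 0) sums M 1 (\<lambda>_. h - k)"
      by (rule sums_single)
    hence d: "d sums (s - t - M 1 (\<lambda>_. h - k))"
      unfolding d_def by (intro sums_diff s t) auto
    have bound: "norm (d n) \<le> D n * R * norm (h - k)" for n
    proof -
      consider "n = 0" | "n = 1" | "n \<ge> 2" by linarith
      thus ?thesis
      proof cases
        case 1
        have "M 0 (\<lambda>_. h) = M 0 (\<lambda>_. k)" by (rule bounded_multilinearD(2)[OF bm]) auto
        thus ?thesis using 1 by (simp add: d_def D_def)
      next
        case 2
        have eq: "M 1 (\<lambda>_. v) = M 1 ((\<lambda>_. 0)(0 := v))" for v
          by (rule bounded_multilinearD(2)[OF bm]) auto
        have "M 1 (\<lambda>_. h - k) = M 1 (\<lambda>_. h) - M 1 (\<lambda>_. k)"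
          unfolding eq by (rule linear_diff[OF bounded_multilinearD(3)[OF bm]]) auto
        thus ?thesis using 2 by (simp add: d_def D_def)
      next
        case 3
        then obtain m where m: "n = Suc (Suc m)" using that[of "n - 2"] by fastforce
        have "norm (d n) \<le> real n * K n * R ^ (n - 1) * norm (h - k)"
          using bounded_multilinear_diag_diff[OF bm hk(1,2), of n] 3 by (simp add: d_def)
        also have "\<dots> = real n * K n * R ^ m * R * norm (h - k)" by (simp add: m)
        also have "\<dots> \<le> real n * K n * (r / 2) ^ m * R * norm (h - k)"
          using hk R K0 by (intro mult_right_mono mult_left_mono power_mono) auto
        finally show ?thesis by (simp add: m D_def)
      qed
    qed
    have "summable (\<lambda>n. D n * R * norm (h - k))" using sD by (intro summable_mult2)
    hence "norm (suminf d) \<le> (\<Sum>n. D n * R * norm (h - k))"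
      by (rule norm_suminf_le[OF bound])
    also have "\<dots> = suminf D * R * norm (h - k)"
      using suminf_mult2[OF sD, of "R * norm (h - k)"] by (simp add: mult.assoc)
    finally show "norm (s - t - M 1 (\<lambda>_. h - k)) \<le> suminf D * R * norm (h - k)"
      using d by (simp add: sums_iff)
  qed
qed

lemma bounded_linear_power_coeff_1:
  assumes "bounded_multilinear 1 M K"
  shows "bounded_linear (\<lambda>v. M (\<lambda>_. v))"
proof -
  have "M (\<lambda>_. v) = M ((\<lambda>_. 0)(0 := v))" for v
    by (rule bounded_multilinearD(2)[OF assms]) auto
  thus ?thesis using bounded_multilinear_bounded_linear[OF assms, of 0 "\<lambda>_. 0"] by simp
qed

lemma has_derivative_quadraticI:
  assumes L: "bounded_linear L" and C: "C \<ge> 0" and d: "d > 0"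
    and est: "\<And>h. norm h \<le> d \<Longrightarrow> norm (f (a + h) - f a - L h) \<le> C * norm h * norm h"
  shows "(f has_derivative L) (at a)"
  unfolding has_derivative_at
proof (intro conjI L tendstoI)
  fix e :: real assume e: "e > 0"
  define d' where "d' = min d (e / (C + 1))"
  have d': "d' > 0" using d e C by (simp add: d'_def)
  have "dist (norm (f (a + h) - f a - L h) / norm h) 0 < e" if h: "h \<noteq> 0" "norm h < d'" for h
  proof -
    have "norm (f (a + h) - f a - L h) \<le> C * norm h * norm h"
      using h by (intro est) (auto simp: d'_def)
    hence "norm (f (a + h) - f a - L h) / norm h \<le> C * norm h"
      using h by (simp add: field_simps)
    also have "\<dots> \<le> C * (e / (C + 1))"
      using h C by (intro mult_left_mono) (auto simp: d'_def)
    also have "\<dots> < e" using e C by (simp add: field_simps)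
    finally show ?thesis by simp
  qed
  thus "\<forall>\<^sub>F h in at 0. dist (norm (f (a + h) - f a - L h) / norm h) 0 < e"
    unfolding eventually_at using d' by (intro exI[of _ d']) auto
qed

lemma real_analytic_at_strict:
  fixes f :: "'a::real_normed_vector \<Rightarrow> 'b::banach"
  assumes "real_analytic_at f a"
  obtains L C \<rho> where "bounded_linear L" "C \<ge> 0" "\<rho> > 0"
    "\<And>h k R. \<lbrakk>norm h \<le> R; norm k \<le> R; R \<le> \<rho>\<rbrakk>
      \<Longrightarrow> norm (f (a + h) - f (a + k) - L (h - k)) \<le> C * R * norm (h - k)"
    "(f has_derivative L) (at a)"
proof -
  obtain M K r where M: "power_coeffs M K r"
    and f: "\<And>h. norm h < r \<Longrightarrow> (\<lambda>n. M n (\<lambda>_. h)) sums f (a + h)"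
    using assms unfolding real_analytic_at_iff by blast
  have r: "r > 0" and bm: "\<And>n. bounded_multilinear n (M n) (K n)"
    using M by (auto simp: power_coeffs_def)
  obtain C where C: "C \<ge> 0" and est:
    "\<And>h k R s t. \<lbrakk>norm h \<le> R; norm k \<le> R; R \<le> r / 2;
        (\<lambda>n. M n (\<lambda>_. h)) sums s; (\<lambda>n. M n (\<lambda>_. k)) sums t\<rbrakk>
      \<Longrightarrow> norm (s - t - M 1 (\<lambda>_. h - k)) \<le> C * R * norm (h - k)"
    using power_coeffs_strict[OF M] by blast
  define L where "L = (\<lambda>v. M 1 (\<lambda>_. v))"
  have L: "bounded_linear L" unfolding L_def by (rule bounded_linear_power_coeff_1[OF bm])
  have strict: "norm (f (a + h) - f (a + k) - L (h - k)) \<le> C * R * norm (h - k)"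
    if "norm h \<le> R" "norm k \<le> R" "R \<le> r / 2" for h k R
    unfolding L_def using that r by (intro est f) auto
  have "(f has_derivative L) (at a)"
  proof (rule has_derivative_quadraticI[OF L C])
    show "norm (f (a + h) - f a - L h) \<le> C * norm h * norm h" if "norm h \<le> r / 2" for h
      using strict[of h "norm h" 0] that by simp
  qed (use r in simp)
  thus ?thesis using that[OF L C, of "r / 2"] strict r by auto
qed

lemma real_analytic_at_imp_isCont:
  fixes f :: "'a::real_normed_vector \<Rightarrow> 'b::banach"
  shows "real_analytic_at f a \<Longrightarrow> isCont f a"
  by (metis real_analytic_at_strict has_derivative_continuous)

section \<open>Multilinear maps on spaces of power series\<close>

definition midx :: "nat \<Rightarrow> nat \<times> nat \<Rightarrow> (nat \<Rightarrow> nat \<times> nat) set" where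
  "midx n k = {f \<in> {..<n} \<rightarrow>\<^sub>E UNIV. (\<Sum>i<n. f i) = k}"

lemma midx_le:
  assumes "f \<in> midx n k" "i < n"
  shows "f i \<in> {..fst k} \<times> {..snd k}"
proof -
  have "fst (f i) \<le> (\<Sum>i<n. fst (f i))" "snd (f i) \<le> (\<Sum>i<n. snd (f i))"
    using assms(2) by (auto intro!: member_le_sum)
  moreover have "k = (\<Sum>i<n. f i)" using assms(1) unfolding midx_def by blast
  ultimately show ?thesis by (simp only: fst_sum snd_sum mem_Times_iff atMost_iff simp_thms)
qed

lemma finite_midx: "finite (midx n k)"
proof (rule finite_subset)
  show "midx n k \<subseteq> {..<n} \<rightarrow>\<^sub>E ({..fst k} \<times> {..snd k})"
  proof
    fix f assume f: "f \<in> midx n k"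
    show "f \<in> {..<n} \<rightarrow>\<^sub>E ({..fst k} \<times> {..snd k})"
      using f midx_le[OF f] unfolding midx_def PiE_iff by blast
  qed
qed (auto intro: finite_PiE)

definition mlift ::
  "nat \<Rightarrow> ((nat \<Rightarrow> 'a::real_normed_vector) \<Rightarrow> 'b::real_normed_vector) \<Rightarrow> (nat \<Rightarrow> 'a ell1) \<Rightarrow> 'b ell1" where
  "mlift n M x = Ell (\<lambda>k. \<Sum>f\<in>midx n k. M (\<lambda>i. coef (x i) (f i)))"

lemma mlift_bound:
  assumes M: "bounded_multilinear n M K"
  shows "coef (mlift n M x) = (\<lambda>k. \<Sum>f\<in>midx n k. M (\<lambda>i. coef (x i) (f i)))"
    and "norm (mlift n M x) \<le> K * (\<Prod>i<n. norm (x i))"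
proof -
  have *: "(\<Sum>k\<in>S. norm (\<Sum>f\<in>midx n k. M (\<lambda>i. coef (x i) (f i)))) \<le> K * (\<Prod>i<n. norm (x i))"
    if S: "finite S" for S
  proof -
    define B where "B = (\<Union>k\<in>S. {..fst k} \<times> {..snd k})"
    have B: "finite B" using S by (auto simp: B_def)
    let ?p = "\<lambda>f. K * (\<Prod>i<n. norm (coef (x i) (f i)))"
    have p0: "?p f \<ge> 0" for f by (intro mult_nonneg_nonneg prod_nonneg bounded_multilinearD(1)[OF M]) auto
    have "(\<Sum>k\<in>S. norm (\<Sum>f\<in>midx n k. M (\<lambda>i. coef (x i) (f i)))) \<le> (\<Sum>k\<in>S. \<Sum>f\<in>midx n k. ?p f)"
      by (intro sum_mono sum_norm_le bounded_multilinearD(4)[OF M])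
    also have "\<dots> = (\<Sum>f\<in>(\<Union>k\<in>S. midx n k). ?p f)"
      by (rule sum.UNION_disjoint[symmetric]) (use S finite_midx in \<open>auto simp: midx_def\<close>)
    also have "\<dots> \<le> (\<Sum>f\<in>{..<n} \<rightarrow>\<^sub>E B. ?p f)"
    proof (intro sum_mono2 p0)
      show "(\<Union>k\<in>S. midx n k) \<subseteq> {..<n} \<rightarrow>\<^sub>E B"
      proof
        fix f assume "f \<in> (\<Union>k\<in>S. midx n k)"
        then obtain k where k: "k \<in> S" "f \<in> midx n k" by blast
        show "f \<in> {..<n} \<rightarrow>\<^sub>E B"
          using k(2) midx_le[OF k(2)] k(1) unfolding midx_def PiE_iff B_def by blast
      qed
    qed (use B in \<open>auto intro: finite_PiE\<close>)
    also have "\<dots> = K * (\<Prod>i<n. \<Sum>k\<in>B. norm (coef (x i) k))"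
      using B by (simp add: sum_distrib_left[symmetric] prod_sum_PiE)
    also have "\<dots> \<le> K * (\<Prod>i<n. norm (x i))"
      by (intro mult_left_mono prod_mono bounded_multilinearD(1)[OF M] conjI sum_norm_coef_le B sum_nonneg) auto
    finally show ?thesis .
  qed
  show "coef (mlift n M x) = (\<lambda>k. \<Sum>f\<in>midx n k. M (\<lambda>i. coef (x i) (f i)))"
    "norm (mlift n M x) \<le> K * (\<Prod>i<n. norm (x i))"
    unfolding mlift_def by (rule coef_EllI[OF *], assumption)+
qed

lemma bounded_multilinear_mlift:
  assumes M: "bounded_multilinear n M K"
  shows "bounded_multilinear n (mlift n M) K"
  unfolding bounded_multilinear_def
proof (intro conjI allI impI bounded_multilinearD(1)[OF M] mlift_bound(2)[OF M])
  fix x y :: "nat \<Rightarrow> 'a ell1" assume xy: "\<forall>i<n. x i = y i"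
  show "mlift n M x = mlift n M y"
    by (rule ell1_eqI, unfold mlift_bound(1)[OF M], rule sum.cong[OF refl],
        rule bounded_multilinearD(2)[OF M]) (use xy in auto)
next
  fix x :: "nat \<Rightarrow> 'a ell1" and i assume i: "i < n"
  have eq: "(\<lambda>j. coef ((x(i := v)) j) (f j)) = (\<lambda>j. coef (x j) (f j))(i := coef v (f i))" for v f
    by auto
  have lin: "linear (\<lambda>v. M ((\<lambda>j. coef (x j) (f j))(i := v)))" for f
    by (rule bounded_multilinearD(3)[OF M i])
  show "linear (\<lambda>v. mlift n M (x(i := v)))"
  proof (rule linearI; rule ell1_eqI)
    fix u v :: "'a ell1" and k
    show "coef (mlift n M (x(i := u + v))) k = coef (mlift n M (x(i := u)) + mlift n M (x(i := v))) k"
      unfolding coef_simps mlift_bound(1)[OF M] eq by (simp add: linear_add[OF lin] sum.distrib)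
  next
    fix r and v :: "'a ell1" and k
    show "coef (mlift n M (x(i := r *\<^sub>R v))) k = coef (r *\<^sub>R mlift n M (x(i := v))) k"
      unfolding coef_simps mlift_bound(1)[OF M] eq by (simp add: linear_scale[OF lin] scaleR_sum_right)
  qed
qed

lemma mlift_single:
  assumes M: "bounded_multilinear n M K" and x: "\<And>i. i < n \<Longrightarrow> x i = single (j i) (v i)"
  shows "mlift n M x = single (\<Sum>i<n. j i) (M v)"
proof (rule ell1_eqI)
  fix k
  have 0: "M (\<lambda>i. coef (x i) (f i)) = 0" if "i < n" "f i \<noteq> j i" for f i
    by (rule bounded_multilinear_eq_0[OF M that(1)]) (use that x in \<open>simp add: single.rep_eq\<close>)
  have 1: "M (\<lambda>i. coef (x i) (restrict j {..<n} i)) = M v"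
    by (rule bounded_multilinearD(2)[OF M]) (simp add: x single.rep_eq)
  have 2: "f = restrict j {..<n}" if "f \<in> midx n k" "\<And>i. i < n \<Longrightarrow> f i = j i" for f
    using that by (auto simp: midx_def PiE_iff extensional_def fun_eq_iff)
  have "(\<Sum>f\<in>midx n k. M (\<lambda>i. coef (x i) (f i))) =
      (\<Sum>f\<in>midx n k \<inter> {restrict j {..<n}}. M v)"
  proof (rule sum.mono_neutral_cong_right)
    show "\<forall>f\<in>midx n k - midx n k \<inter> {restrict j {..<n}}. M (\<lambda>i. coef (x i) (f i)) = 0"
      using 0 2 by blast
  qed (use 1 in \<open>auto simp: finite_midx\<close>)
  also have "\<dots> = (if k = (\<Sum>i<n. j i) then M v else 0)"
    by (auto simp: midx_def)
  finally show "coef (mlift n M x) k = coef (single (\<Sum>i<n. j i) (M v)) k"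
    by (simp add: mlift_bound(1)[OF M] single.rep_eq)
qed

lemma bounded_multilinear_scale_all:
  assumes M: "bounded_multilinear n M K"
  shows "M (\<lambda>i. c i *\<^sub>R v i) = (\<Prod>i<n. c i) *\<^sub>R M v"
proof -
  have "M (\<lambda>i. (if i < m then c i else 1) *\<^sub>R v i) = (\<Prod>i<m. c i) *\<^sub>R M v" if "m \<le> n" for m
    using that
  proof (induction m)
    case (Suc m)
    let ?x = "\<lambda>i. (if i < m then c i else 1) *\<^sub>R v i"
    have "(\<lambda>i. (if i < Suc m then c i else 1) *\<^sub>R v i) = ?x(m := c m *\<^sub>R v m)"
      by (auto simp: fun_eq_iff less_Suc_eq)
    hence "M (\<lambda>i. (if i < Suc m then c i else 1) *\<^sub>R v i) = c m *\<^sub>R M (?x(m := v m))"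
      using linear_scale[OF bounded_multilinearD(3)[OF M, of m ?x]] Suc.prems by simp
    also have "?x(m := v m) = ?x" by auto
    finally show ?case using Suc by (simp add: mult.commute)
  qed simp
  moreover have "M (\<lambda>i. c i *\<^sub>R v i) = M (\<lambda>i. (if i < n then c i else 1) *\<^sub>R v i)"
    by (rule bounded_multilinearD(2)[OF M]) auto
  ultimately show ?thesis by simp
qed

text \<open>Both sides are bounded linear in every slot, so it suffices to compare them on monomials.\<close>

lemma ev_mlift:
  fixes M :: "(nat \<Rightarrow> 'a::banach) \<Rightarrow> 'b::banach"
  assumes M: "bounded_multilinear n M K" and w: "w \<in> unit_square"
  shows "ev w (mlift n M x) = M (\<lambda>i. ev w (x i))"
proof -
  have "ev w (mlift n M x) = M (\<lambda>i. ev w (x i))"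
    if "m \<le> n" "\<forall>i<n. m \<le> i \<longrightarrow> (\<exists>j v. x i = single j v)" for m x
    using that
  proof (induction m arbitrary: x)
    case 0
    hence "\<forall>i. \<exists>p. i < n \<longrightarrow> x i = single (fst p) (snd p)" by auto
    from choice[OF this] obtain p
      where p: "\<forall>i. i < n \<longrightarrow> x i = single (fst (p i)) (snd (p i))" ..
    define j v where "j i = fst (p i)" and "v i = snd (p i)" for i
    have x: "\<And>i. i < n \<Longrightarrow> x i = single (j i) (v i)"
      using p by (simp add: j_def v_def)
    have mon: "monom2 w (\<Sum>i<n. j i) = (\<Prod>i<n. monom2 w (j i))"
      by (induction n) (auto simp: monom2_add)
    have "M (\<lambda>i. ev w (x i)) = M (\<lambda>i. monom2 w (j i) *\<^sub>R v i)"
      by (rule bounded_multilinearD(2)[OF M]) (simp add: x)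
    also have "\<dots> = (\<Prod>i<n. monom2 w (j i)) *\<^sub>R M v"
      by (rule bounded_multilinear_scale_all[OF M])
    finally show ?case using mlift_single[OF M x] by (simp add: mon)
  next
    case (Suc m)
    have m: "m < n" using Suc.prems by simp
    have eq: "(\<lambda>i. ev w ((x(m := a)) i)) = (\<lambda>i. ev w (x i))(m := ev w a)" for a by auto
    have "ev w (mlift n M (x(m := a))) = M ((\<lambda>i. ev w (x i))(m := ev w a))" for a
    proof (rule bounded_linear_ell1_eqI[of "\<lambda>a. ev w (mlift n M (x(m := a)))"
          "\<lambda>a. M ((\<lambda>i. ev w (x i))(m := ev w a))"])
      show "bounded_linear (\<lambda>a. ev w (mlift n M (x(m := a))))"
        by (rule bounded_linear_compose[OF bounded_linear_ev[OF w]
              bounded_multilinear_bounded_linear[OF bounded_multilinear_mlift[OF M] m]])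
      show "bounded_linear (\<lambda>a. M ((\<lambda>i. ev w (x i))(m := ev w a)))"
        by (rule bounded_linear_compose[OF bounded_multilinear_bounded_linear[OF M m] bounded_linear_ev[OF w]])
      show "ev w (mlift n M (x(m := single j v))) = M ((\<lambda>i. ev w (x i))(m := ev w (single j v)))" for j v
        unfolding eq[symmetric]
      proof (rule Suc.IH)
        show "\<forall>i<n. m \<le> i \<longrightarrow> (\<exists>j' v'. (x(m := single j v)) i = single j' v')"
        proof (intro allI impI)
          fix i assume i: "i < n" "m \<le> i"
          show "\<exists>j' v'. (x(m := single j v)) i = single j' v'"
          proof (cases "i = m")
            case True
            thus ?thesis by (intro exI[of _ j] exI[of _ v]) simp
          next
            case False
            with i have "Suc m \<le> i" by simp
            with Suc.prems(2) i False show ?thesis by (simp only: fun_upd_apply if_False)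
          qed
        qed
      qed (use m in simp)
    qed
    from this[of "x m"] show ?case by (simp add: fun_upd_idem)
  qed
  from this[of n x] show ?thesis by simp
qed

lemma power_coeffs_mlift:
  "power_coeffs M K r \<Longrightarrow> power_coeffs (\<lambda>n. mlift n (M n)) K r"
  by (auto simp: power_coeffs_def bounded_multilinear_mlift)

lemma power_coeffs_summable:
  fixes M :: "nat \<Rightarrow> (nat \<Rightarrow> 'a::real_normed_vector) \<Rightarrow> 'b::banach"
  assumes M: "power_coeffs M K r" and h: "norm h \<le> r"
  shows "summable (\<lambda>n. norm (M n (\<lambda>_. h)))"
proof (rule summable_comparison_test'[of "\<lambda>n. K n * r ^ n" 0])
  show "summable (\<lambda>n. K n * r ^ n)" using M by (simp add: power_coeffs_def)
  fix n
  have bm: "bounded_multilinear n (M n) (K n)" using M by (simp add: power_coeffs_def)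
  have "norm (M n (\<lambda>_. h)) \<le> K n * norm h ^ n"
    using bounded_multilinearD(4)[OF bm, of "\<lambda>_. h"] by simp
  also have "\<dots> \<le> K n * r ^ n"
    using h by (intro mult_left_mono power_mono bounded_multilinearD(1)[OF bm]) auto
  finally show "norm (norm (M n (\<lambda>_. h))) \<le> K n * r ^ n" by simp
qed

lemma power_coeffs_mlift_sums:
  fixes M :: "nat \<Rightarrow> (nat \<Rightarrow> 'a::banach) \<Rightarrow> 'b::banach"
  assumes M: "power_coeffs M K r" and u: "norm u \<le> r"
  obtains b where "(\<lambda>n. mlift n (M n) (\<lambda>_. u)) sums b"
    "\<And>w. w \<in> unit_square \<Longrightarrow> (\<lambda>n. M n (\<lambda>_. ev w u)) sums ev w b"
proof -
  obtain b where b: "(\<lambda>n. mlift n (M n) (\<lambda>_. u)) sums b"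
    using summable_norm_cancel[OF power_coeffs_summable[OF power_coeffs_mlift[OF M] u]]
    by (auto simp: summable_def)
  have "(\<lambda>n. M n (\<lambda>_. ev w u)) sums ev w b" if "w \<in> unit_square" for w
  proof -
    have "ev w (mlift n (M n) (\<lambda>_. u)) = M n (\<lambda>_. ev w u)" for n
      using M by (intro ev_mlift[OF _ that]) (auto simp: power_coeffs_def)
    thus ?thesis
      using bounded_linear.sums[OF bounded_linear_ev[OF that] b] by simp
  qed
  with b show ?thesis using that by blast
qed

section \<open>Closure properties of analytic maps\<close>

lemma real_analytic_atI:
  "power_coeffs M K r \<Longrightarrow> (\<And>h. norm h < r \<Longrightarrow> (\<lambda>n. M n (\<lambda>_. h)) sums f (a + h)) \<Longrightarrow> real_analytic_at f a"
  unfolding real_analytic_at_iff by blast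

lemma power_coeffsD:
  assumes "power_coeffs M K r"
  shows "r > 0" "bounded_multilinear n (M n) (K n)" "summable (\<lambda>n. K n * r ^ n)" "K n \<ge> 0"
  using assms bounded_multilinearD(1) unfolding power_coeffs_def by blast+

lemma bounded_multilinear_sum:
  assumes "\<And>i. i \<in> A \<Longrightarrow> bounded_multilinear n (M i) (K i)"
  shows "bounded_multilinear n (\<lambda>x. \<Sum>i\<in>A. M i x) (\<Sum>i\<in>A. K i)"
  unfolding bounded_multilinear_def
proof (intro conjI allI impI)
  show "(\<Sum>i\<in>A. K i) \<ge> 0" by (intro sum_nonneg bounded_multilinearD(1)[OF assms])
  show "(\<Sum>i\<in>A. M i x) = (\<Sum>i\<in>A. M i y)" if "\<forall>i<n. x i = y i" for x y
    by (rule sum.cong[OF refl], rule bounded_multilinearD(2)[OF assms]) (use that in auto)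
  show "linear (\<lambda>v. \<Sum>i\<in>A. M i (x(j := v)))" if "j < n" for x j
    by (rule linear_compose_sum) (use that bounded_multilinearD(3)[OF assms] in blast)
  show "norm (\<Sum>i\<in>A. M i x) \<le> (\<Sum>i\<in>A. K i) * (\<Prod>i<n. norm (x i))" for x
    unfolding sum_distrib_right by (intro sum_norm_le bounded_multilinearD(4)[OF assms])
qed

lemma bounded_multilinear_add:
  assumes "bounded_multilinear n M K" "bounded_multilinear n M' K'"
  shows "bounded_multilinear n (\<lambda>x. M x + M' x) (K + K')"
  using bounded_multilinear_sum[of "{True, False}" n "\<lambda>b. if b then M else M'" "\<lambda>b. if b then K else K'"]
    assms by simp

lemma bounded_multilinear_mult:
  fixes M :: "(nat \<Rightarrow> 'a::real_normed_vector) \<Rightarrow> real"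
  assumes M: "bounded_multilinear i M K" and M': "bounded_multilinear j M' K'"
  shows "bounded_multilinear (i + j) (\<lambda>x. M x * M' (\<lambda>l. x (i + l))) (K * K')"
  unfolding bounded_multilinear_def
proof (intro conjI allI impI)
  show "K * K' \<ge> 0" by (intro mult_nonneg_nonneg bounded_multilinearD(1)[OF M] bounded_multilinearD(1)[OF M'])
  show "M x * M' (\<lambda>l. x (i + l)) = M y * M' (\<lambda>l. y (i + l))" if "\<forall>l<i+j. x l = y l" for x y
    using that by (intro arg_cong2[where f = "(*)"] bounded_multilinearD(2)[OF M] bounded_multilinearD(2)[OF M']) auto
  show "linear (\<lambda>v. M (x(k := v)) * M' (\<lambda>l. (x(k := v)) (i + l)))" if k: "k < i + j" for x k
  proof (cases "k < i")
    case True
    have "(\<lambda>l. (x(k := v)) (i + l)) = (\<lambda>l. x (i + l))" for v using True by auto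
    moreover note lin = bounded_multilinearD(3)[OF M True, of x]
    ultimately show ?thesis
      by (intro linearI) (simp_all only: linear_add[OF lin] linear_scale[OF lin] distrib_right real_scaleR_def mult.assoc)
  next
    case False
    have "(\<lambda>l. (x(k := v)) (i + l)) = (\<lambda>l. x (i + l))(k - i := v)" for v
      using False by (auto simp: fun_eq_iff)
    moreover have "M (x(k := v)) = M x" for v
      by (rule bounded_multilinearD(2)[OF M]) (use False in auto)
    moreover have "k - i < j" using k False by simp
    moreover note lin = bounded_multilinearD(3)[OF M' this, of "\<lambda>l. x (i + l)"]
    ultimately show ?thesis
      by (intro linearI) (simp_all only: linear_add[OF lin] linear_scale[OF lin] distrib_left real_scaleR_def mult.left_commute)
  qed
  fix x
  have "norm (M x * M' (\<lambda>l. x (i + l))) \<le> (K * (\<Prod>l<i. norm (x l))) * (K' * (\<Prod>l<j. norm (x (i + l))))"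
    unfolding norm_mult
    by (intro mult_mono bounded_multilinearD(4)[OF M] bounded_multilinearD(4)[OF M'] norm_ge_zero
        mult_nonneg_nonneg prod_nonneg bounded_multilinearD(1)[OF M])
  also have "(\<Prod>l<j. norm (x (i + l))) = (\<Prod>l\<in>{i..<i+j}. norm (x l))"
    by (rule prod.reindex_bij_witness[of _ "\<lambda>l. l - i" "\<lambda>l. i + l"]) auto
  also have "(K * (\<Prod>l<i. norm (x l))) * (K' * (\<Prod>l\<in>{i..<i+j}. norm (x l))) =
      K * K' * ((\<Prod>l<i. norm (x l)) * (\<Prod>l\<in>{i..<i+j}. norm (x l)))" by simp
  also have "(\<Prod>l<i. norm (x l)) * (\<Prod>l\<in>{i..<i+j}. norm (x l)) = (\<Prod>l<i+j. norm (x l))"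
    by (subst prod.union_disjoint[symmetric]) (auto intro!: prod.cong)
  finally show "norm (M x * M' (\<lambda>l. x (i + l))) \<le> K * K' * (\<Prod>l<i+j. norm (x l))" .
qed

lemma real_analytic_at_affine:
  assumes T: "bounded_linear T" and f: "real_analytic_at f (T a + b)"
  shows "real_analytic_at (\<lambda>x. f (T x + b)) a"
proof -
  obtain M K r where M: "power_coeffs M K r"
    and s: "\<And>h. norm h < r \<Longrightarrow> (\<lambda>n. M n (\<lambda>_. h)) sums f (T a + b + h)"
    using f unfolding real_analytic_at_iff by blast
  note D = power_coeffsD[OF M]
  interpret T: bounded_linear T by fact
  obtain B where B: "B > 0" "\<And>x. norm (T x) \<le> norm x * B" using T.pos_bounded by blast
  show ?thesis
  proof (rule real_analytic_atI[of "\<lambda>n x. M n (\<lambda>i. T (x i))" "\<lambda>n. K n * B ^ n" "r / B"])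
    have "bounded_multilinear n (\<lambda>x. M n (\<lambda>i. T (x i))) (K n * B ^ n)" for n
      unfolding bounded_multilinear_def
    proof (intro conjI allI impI)
      show "K n * B ^ n \<ge> 0" using D(4) B by simp
      show "M n (\<lambda>i. T (x i)) = M n (\<lambda>i. T (y i))" if "\<forall>i<n. x i = y i" for x y
        by (rule bounded_multilinearD(2)[OF D(2)]) (use that in auto)
      show "linear (\<lambda>v. M n (\<lambda>i. T ((x(j := v)) i)))" if "j < n" for x j
      proof -
        have "(\<lambda>i. T ((x(j := v)) i)) = (\<lambda>i. T (x i))(j := T v)" for v by auto
        thus ?thesis
          using linear_compose[OF T.linear bounded_multilinearD(3)[OF D(2) that, of "\<lambda>i. T (x i)"]]
          by (simp add: o_def)
      qed
      fix x
      have "norm (M n (\<lambda>i. T (x i))) \<le> K n * (\<Prod>i<n. norm (T (x i)))"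
        by (rule bounded_multilinearD(4)[OF D(2)])
      also have "\<dots> \<le> K n * (\<Prod>i<n. norm (x i) * B)"
        by (intro mult_left_mono prod_mono D(4)) (use B in auto)
      also have "\<dots> = K n * B ^ n * (\<Prod>i<n. norm (x i))" by (simp add: prod.distrib)
      finally show "norm (M n (\<lambda>i. T (x i))) \<le> K n * B ^ n * (\<Prod>i<n. norm (x i))" .
    qed
    moreover have "K n * B ^ n * (r / B) ^ n = K n * r ^ n" for n
      using B by (simp add: power_divide)
    ultimately show "power_coeffs (\<lambda>n x. M n (\<lambda>i. T (x i))) (\<lambda>n. K n * B ^ n) (r / B)"
      using D B by (simp only: power_coeffs_def) simp
    fix h :: 'a assume h: "norm h < r / B"
    have "norm (T h) < r" using B(2)[of h] h B(1) by (simp add: field_simps)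
    thus "(\<lambda>n. M n (\<lambda>i. T h)) sums f (T (a + h) + b)"
      using s[of "T h"] by (simp add: T.add algebra_simps)
  qed
qed

lemma real_analytic_at_compose_linear:
  "bounded_linear T \<Longrightarrow> real_analytic_at f (T a) \<Longrightarrow> real_analytic_at (\<lambda>x. f (T x)) a"
  using real_analytic_at_affine[of T f a 0] by simp

lemma real_analytic_at_linear_compose:
  assumes T: "bounded_linear T" and f: "real_analytic_at f a"
  shows "real_analytic_at (\<lambda>x. T (f x)) a"
proof -
  obtain M K r where M: "power_coeffs M K r"
    and s: "\<And>h. norm h < r \<Longrightarrow> (\<lambda>n. M n (\<lambda>_. h)) sums f (a + h)"
    using f unfolding real_analytic_at_iff by blast
  note D = power_coeffsD[OF M]
  interpret T: bounded_linear T by fact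
  obtain B where B: "B > 0" "\<And>x. norm (T x) \<le> norm x * B" using T.pos_bounded by blast
  show ?thesis
  proof (rule real_analytic_atI[of "\<lambda>n x. T (M n x)" "\<lambda>n. B * K n" r])
    have "bounded_multilinear n (\<lambda>x. T (M n x)) (B * K n)" for n
      unfolding bounded_multilinear_def
    proof (intro conjI allI impI)
      show "B * K n \<ge> 0" using D(4) B by simp
      show "T (M n x) = T (M n y)" if "\<forall>i<n. x i = y i" for x y
        by (rule arg_cong[where f = T], rule bounded_multilinearD(2)[OF D(2)]) (use that in auto)
      show "linear (\<lambda>v. T (M n (x(j := v))))" if "j < n" for x j
        using linear_compose[OF bounded_multilinearD(3)[OF D(2) that, of x] T.linear] by (simp add: o_def)
      fix x
      have "norm (T (M n x)) \<le> B * norm (M n x)" using B(2) by (simp add: mult.commute)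
      also have "\<dots> \<le> B * (K n * (\<Prod>i<n. norm (x i)))"
        using B(1) by (intro mult_left_mono bounded_multilinearD(4)[OF D(2)]) auto
      finally show "norm (T (M n x)) \<le> B * K n * (\<Prod>i<n. norm (x i))" by (simp add: mult.assoc)
    qed
    moreover have "summable (\<lambda>n. B * K n * r ^ n)"
      using summable_mult[OF D(3), of B] by (simp add: mult.assoc)
    ultimately show "power_coeffs (\<lambda>n x. T (M n x)) (\<lambda>n. B * K n) r"
      using D by (simp add: power_coeffs_def)
    show "(\<lambda>n. T (M n (\<lambda>_. h))) sums T (f (a + h))" if "norm h < r" for h
      by (rule T.sums[OF s[OF that]])
  qed
qed

lemma real_analytic_at_add:
  assumes "real_analytic_at f a" "real_analytic_at g a"
  shows "real_analytic_at (\<lambda>x. f x + g x) a"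
proof -
  obtain M K r where M: "power_coeffs M K r"
    and s: "\<And>h. norm h < r \<Longrightarrow> (\<lambda>n. M n (\<lambda>_. h)) sums f (a + h)"
    using assms(1) unfolding real_analytic_at_iff by blast
  obtain M' K' r' where M': "power_coeffs M' K' r'"
    and s': "\<And>h. norm h < r' \<Longrightarrow> (\<lambda>n. M' n (\<lambda>_. h)) sums g (a + h)"
    using assms(2) unfolding real_analytic_at_iff by blast
  define t where "t = min r r'"
  have t: "t > 0" "t \<le> r" "t \<le> r'" using power_coeffsD(1)[OF M] power_coeffsD(1)[OF M'] by (auto simp: t_def)
  note D = power_coeffsD[OF power_coeffs_mono[OF M t(1,2)]]
    and D' = power_coeffsD[OF power_coeffs_mono[OF M' t(1,3)]]
  show ?thesis
  proof (rule real_analytic_atI[of "\<lambda>n x. M n x + M' n x" "\<lambda>n. K n + K' n" t])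
    show "power_coeffs (\<lambda>n x. M n x + M' n x) (\<lambda>n. K n + K' n) t"
      using t D(2) D'(2) summable_add[OF D(3) D'(3)]
      by (simp add: power_coeffs_def bounded_multilinear_add distrib_right)
    show "(\<lambda>n. M n (\<lambda>_. h) + M' n (\<lambda>_. h)) sums (f (a + h) + g (a + h))" if "norm h < t" for h
      using that t by (intro sums_add s s') auto
  qed
qed

lemma real_analytic_at_const: "real_analytic_at (\<lambda>_. c) a"
proof (rule real_analytic_atI[of "\<lambda>n x. if n = 0 then c else 0" "\<lambda>n. if n = 0 then norm c else 0" 1])
  have "summable (\<lambda>n. if n = 0 then norm c else 0)"
    by (rule summable_finite[of "{0}"]) auto
  thus "power_coeffs (\<lambda>n x. if n = 0 then c else 0) (\<lambda>n. if n = 0 then norm c else 0) 1"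
    by (auto simp: power_coeffs_def bounded_multilinear_def module_hom_zero linear_zero)
  show "(\<lambda>n. if n = 0 then c else 0) sums c" for h using sums_single[of 0 "\<lambda>_. c"] by simp
qed

lemma real_analytic_at_linear:
  assumes "bounded_linear T"
  shows "real_analytic_at T a"
proof -
  interpret T: bounded_linear T by fact
  obtain B where B: "B \<ge> 0" "\<And>x. norm (T x) \<le> norm x * B" using T.nonneg_bounded by blast
  have "real_analytic_at T 0"
  proof (rule real_analytic_atI[of "\<lambda>n x. if n = 1 then T (x 0) else 0" "\<lambda>n. if n = 1 then B else 0" 1])
    have "summable (\<lambda>n. if n = 1 then B else 0)" by (rule summable_finite[of "{1}"]) auto
    thus "power_coeffs (\<lambda>n x. if n = 1 then T (x 0) else 0) (\<lambda>n. if n = 1 then B else 0) 1"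
      using B T.linear by (auto simp: power_coeffs_def bounded_multilinear_def mult.commute linear_zero)
    show "(\<lambda>n. if n = 1 then T h else 0) sums T (0 + h)" for h using sums_single[of 1 "\<lambda>_. T h"] by simp
  qed
  hence "real_analytic_at (\<lambda>x. T (x + - a) + T a) a"
    using real_analytic_at_affine[OF bounded_linear_ident, of T a "- a"]
    by (intro real_analytic_at_add real_analytic_at_const) simp
  thus ?thesis by (simp add: T.diff)
qed

lemma real_analytic_at_bilinear:
  assumes "bounded_bilinear B" "bounded_linear S" "bounded_linear T"
  shows "real_analytic_at (\<lambda>x. B (S x) (T x)) 0"
proof -
  interpret P: bounded_bilinear "\<lambda>x y. B (S x) (T y)"
    using bounded_bilinear.comp[OF assms] .
  obtain K where K: "K \<ge> 0" "\<And>x y. norm (B (S x) (T y)) \<le> norm x * norm y * K"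
    using P.nonneg_bounded by blast
  show ?thesis
  proof (rule real_analytic_atI[of "\<lambda>n x. if n = 2 then B (S (x 0)) (T (x 1)) else 0"
        "\<lambda>n. if n = 2 then K else 0" 1])
    have sm: "summable (\<lambda>n. if n = 2 then K else 0)" by (rule summable_finite[of "{2}"]) auto
    have "linear (\<lambda>v. B (S ((x(i := v)) 0)) (T ((x(i := v)) 1)))" if "i < 2" for x and i :: nat
    proof -
      have "i = 0 \<or> i = 1" using that by auto
      thus ?thesis
        using bounded_linear.linear[OF P.bounded_linear_left] bounded_linear.linear[OF P.bounded_linear_right]
        by auto
    qed
    with sm show "power_coeffs (\<lambda>n x. if n = 2 then B (S (x 0)) (T (x 1)) else 0) (\<lambda>n. if n = 2 then K else 0) 1"
      using K by (auto simp: power_coeffs_def bounded_multilinear_def linear_zero numeral_2_eq_2 ac_simps)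
    show "(\<lambda>n. if n = 2 then B (S h) (T h) else 0) sums B (S (0 + h)) (T (0 + h))" for h
      using sums_single[of 2 "\<lambda>_. B (S h) (T h)"] by simp
  qed
qed

lemma real_analytic_at_mult:
  fixes f g :: "'a::real_normed_vector \<Rightarrow> real"
  assumes "real_analytic_at f a" "real_analytic_at g a"
  shows "real_analytic_at (\<lambda>x. f x * g x) a"
proof -
  obtain M K r where M: "power_coeffs M K r"
    and s: "\<And>h. norm h < r \<Longrightarrow> (\<lambda>n. M n (\<lambda>_. h)) sums f (a + h)"
    using assms(1) unfolding real_analytic_at_iff by blast
  obtain M' K' r' where M': "power_coeffs M' K' r'"
    and s': "\<And>h. norm h < r' \<Longrightarrow> (\<lambda>n. M' n (\<lambda>_. h)) sums g (a + h)"
    using assms(2) unfolding real_analytic_at_iff by blast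
  define t where "t = min r r'"
  have t: "t > 0" "t \<le> r" "t \<le> r'" using power_coeffsD(1)[OF M] power_coeffsD(1)[OF M'] by (auto simp: t_def)
  note P = power_coeffs_mono[OF M t(1,2)] and P' = power_coeffs_mono[OF M' t(1,3)]
  note D = power_coeffsD[OF P] and D' = power_coeffsD[OF P']
  define N where "N = (\<lambda>n x. \<Sum>i\<le>n. M i x * M' (n - i) (\<lambda>l. x (i + l)))"
  define J where "J = (\<lambda>n. \<Sum>i\<le>n. K i * K' (n - i))"
  show ?thesis
  proof (rule real_analytic_atI[of N J t])
    have bm: "bounded_multilinear n (N n) (J n)" for n
      unfolding N_def J_def
    proof (rule bounded_multilinear_sum)
      fix i assume "i \<in> {..n}"
      thus "bounded_multilinear n (\<lambda>x. M i x * M' (n - i) (\<lambda>l. x (i + l))) (K i * K' (n - i))"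
        using bounded_multilinear_mult[OF D(2)[of i] D'(2)[of "n - i"]] by simp
    qed
    have eq: "(\<Sum>i\<le>n. (K i * t ^ i) * (K' (n - i) * t ^ (n - i))) = J n * t ^ n" for n
      unfolding J_def sum_distrib_right
    proof (rule sum.cong[OF refl])
      fix i assume "i \<in> {..n}"
      hence "t ^ n = t ^ i * t ^ (n - i)" by (simp add: power_add[symmetric])
      thus "(K i * t ^ i) * (K' (n - i) * t ^ (n - i)) = K i * K' (n - i) * t ^ n" by simp
    qed
    have "summable (\<lambda>n. J n * t ^ n)"
      using summable_Cauchy_product[of "\<lambda>n. K n * t ^ n" "\<lambda>n. K' n * t ^ n"] D(1,3,4) D'(3,4)
      by (simp add: eq abs_mult)
    thus "power_coeffs N J t" using bm t by (simp add: power_coeffs_def)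
    fix h :: 'a assume h: "norm h < t"
    have "(\<lambda>n. \<Sum>i\<le>n. M i (\<lambda>_. h) * M' (n - i) (\<lambda>_. h)) sums
        ((\<Sum>n. M n (\<lambda>_. h)) * (\<Sum>n. M' n (\<lambda>_. h)))"
      using h by (intro Cauchy_product_sums power_coeffs_summable[OF P] power_coeffs_summable[OF P']) auto
    thus "(\<lambda>n. N n (\<lambda>_. h)) sums (f (a + h) * g (a + h))"
      using s[of h] s'[of h] h t by (simp add: N_def sums_iff)
  qed
qed

lemma real_analytic_at_cong:
  assumes f: "real_analytic_at f a" and eq: "eventually (\<lambda>x. f x = g x) (nhds a)"
  shows "real_analytic_at g a"
proof -
  obtain M K r where M: "power_coeffs M K r"
    and s: "\<And>h. norm h < r \<Longrightarrow> (\<lambda>n. M n (\<lambda>_. h)) sums f (a + h)"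
    using f unfolding real_analytic_at_iff by blast
  obtain d where d: "d > 0" "\<And>x. dist x a < d \<Longrightarrow> f x = g x"
    using eq by (auto simp: eventually_nhds_metric)
  show ?thesis
  proof (rule real_analytic_atI[of M K "min r d"])
    show "power_coeffs M K (min r d)"
      using d power_coeffsD(1)[OF M] by (intro power_coeffs_mono[OF M]) auto
    show "(\<lambda>n. M n (\<lambda>_. h)) sums g (a + h)" if "norm h < min r d" for h
      using s[of h] d(2)[of "a + h"] that by (simp add: dist_norm)
  qed
qed

lemma real_analytic_at_Pair:
  assumes "real_analytic_at f a" "real_analytic_at g a"
  shows "real_analytic_at (\<lambda>x. (f x, g x)) a"
proof -
  have "real_analytic_at (\<lambda>x. (f x, 0) + (0, g x)) a"
    by (intro real_analytic_at_add real_analytic_at_linear_compose[OF _ assms(1)]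
        real_analytic_at_linear_compose[OF _ assms(2)] bounded_linear_Pair bounded_linear_ident bounded_linear_zero)
  thus ?thesis by simp
qed

lemma real_analytic_at_sum:
  assumes "\<And>i. i \<in> A \<Longrightarrow> real_analytic_at (f i) a"
  shows "real_analytic_at (\<lambda>x. \<Sum>i\<in>A. f i x) a"
  using assms
  by (induction A rule: infinite_finite_induct) (auto intro: real_analytic_at_const real_analytic_at_add)

lemma real_analytic_at_power:
  fixes f :: "'a::real_normed_vector \<Rightarrow> real"
  shows "real_analytic_at f a \<Longrightarrow> real_analytic_at (\<lambda>x. f x ^ n) a"
  by (induction n) (auto intro: real_analytic_at_const real_analytic_at_mult)

lemma real_analytic_at_minus: "real_analytic_at f a \<Longrightarrow> real_analytic_at (\<lambda>x. - f x) a"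
  by (rule real_analytic_at_linear_compose[OF bounded_linear_minus[OF bounded_linear_ident]])

lemma real_analytic_at_diff:
  "real_analytic_at f a \<Longrightarrow> real_analytic_at g a \<Longrightarrow> real_analytic_at (\<lambda>x. f x - g x) a"
  using real_analytic_at_add[OF _ real_analytic_at_minus, of f a g] by simp

lemma real_analytic_at_inverse:
  fixes a :: real
  assumes "a \<noteq> 0"
  shows "real_analytic_at inverse a"
proof (rule real_analytic_atI[of "\<lambda>n x. (-1) ^ n * inverse a ^ Suc n * (\<Prod>i<n. x i)"
      "\<lambda>n. inverse \<bar>a\<bar> ^ Suc n" "\<bar>a\<bar> / 2"])
  have "bounded_multilinear n (\<lambda>x. (-1) ^ n * inverse a ^ Suc n * (\<Prod>i<n. x i)) (inverse \<bar>a\<bar> ^ Suc n)" for n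
    unfolding bounded_multilinear_def
  proof (intro conjI allI impI)
    show "linear (\<lambda>v. (-1) ^ n * inverse a ^ Suc n * (\<Prod>l<n. (x(i := v)) l))" if "i < n" for x :: "nat \<Rightarrow> real" and i
    proof -
      have "(\<Prod>l<n. (x(i := v)) l) = v * (\<Prod>l\<in>{..<n} - {i}. x l)" for v
        using that by (subst prod.remove[of _ i]) (auto intro!: prod.cong)
      thus ?thesis by (auto intro!: linearI simp: algebra_simps)
    qed
  qed (auto simp: abs_mult power_abs abs_prod intro!: prod.cong)
  moreover have "summable (\<lambda>n. inverse \<bar>a\<bar> ^ Suc n * (\<bar>a\<bar> / 2) ^ n)"
  proof -
    have "inverse \<bar>a\<bar> ^ Suc n * (\<bar>a\<bar> / 2) ^ n = inverse \<bar>a\<bar> * (1 / 2) ^ n" for n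
      using assms by (simp add: field_simps power_divide)
    thus ?thesis
      using summable_mult[OF summable_geometric[of "1 / 2 :: real"], of "inverse \<bar>a\<bar>"]
      by (simp only:) simp
  qed
  ultimately show "power_coeffs (\<lambda>n x. (-1) ^ n * inverse a ^ Suc n * (\<Prod>i<n. x i)) (\<lambda>n. inverse \<bar>a\<bar> ^ Suc n) (\<bar>a\<bar> / 2)"
    using assms by (simp add: power_coeffs_def)
  fix h :: real assume h: "norm h < \<bar>a\<bar> / 2"
  have "\<bar>h\<bar> < \<bar>a\<bar>" using h assms by simp
  hence h2: "norm (- (h / a)) < 1" using assms by simp
  have h3: "a + h \<noteq> 0" using \<open>\<bar>h\<bar> < \<bar>a\<bar>\<close> by linarith
  have "inverse a * (1 / (1 - - (h / a))) = inverse (a + h)" using assms h3 by (simp add: field_simps)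
  hence "(\<lambda>n. inverse a * (- (h / a)) ^ n) sums inverse (a + h)"
    using sums_mult[OF geometric_sums[OF h2], of "inverse a"] by simp
  moreover have "inverse a * (- (h / a)) ^ n = (-1) ^ n * inverse a ^ Suc n * (\<Prod>i<n. h)" for n
    by (simp add: power_minus[of "h / a"] power_divide field_simps)
  ultimately show "(\<lambda>n. (-1) ^ n * inverse a ^ Suc n * (\<Prod>i<n. h)) sums inverse (a + h)" by simp
qed

section \<open>Analytic maps of two real variables\<close>

lemma real_analytic_at_imp_ev:
  fixes f :: "real \<times> real \<Rightarrow> 'b::banach"
  assumes "real_analytic_at f w0"
  obtains \<rho>0 C where "\<rho>0 > 0" "C \<ge> 0"
    "\<And>\<rho>. 0 < \<rho> \<Longrightarrow> \<rho> \<le> \<rho>0 \<Longrightarrow> \<exists>a. norm (a - single 0 (f w0)) \<le> C * \<rho> \<and>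
      (\<forall>w\<in>unit_square. f (w0 + \<rho> *\<^sub>R w) = ev w a)"
proof -
  obtain M K r where M: "power_coeffs M K r"
    and s: "\<And>h. norm h < r \<Longrightarrow> (\<lambda>n. M n (\<lambda>_. h)) sums f (w0 + h)"
    using assms unfolding real_analytic_at_iff by blast
  note D = power_coeffsD[OF M] and MM = power_coeffs_mlift[OF M]
  obtain C where C: "C \<ge> 0" and est:
    "\<And>h k R s t. \<lbrakk>norm h \<le> R; norm k \<le> R; R \<le> r / 2;
        (\<lambda>n. mlift n (M n) (\<lambda>_. h)) sums s; (\<lambda>n. mlift n (M n) (\<lambda>_. k)) sums t\<rbrakk>
      \<Longrightarrow> norm (s - t - mlift 1 (M 1) (\<lambda>_. h - k)) \<le> C * R * norm (h - k)"
    using power_coeffs_strict[OF MM] by blast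
  have f0: "M 0 (\<lambda>_. 0) = f w0"
  proof -
    have "(\<lambda>n. M n (\<lambda>_. 0)) = (\<lambda>n. if n = 0 then M 0 (\<lambda>_. 0) else 0)"
      using bounded_multilinear_eq_0[OF D(2), of 0 _ "\<lambda>_. 0"] by (auto simp: fun_eq_iff)
    thus ?thesis using s[of 0] D(1) sums_single[of 0 "\<lambda>_. M 0 (\<lambda>_. 0)"] by (simp add: sums_iff)
  qed
  have m0: "(\<lambda>n. mlift n (M n) (\<lambda>_. 0)) sums single 0 (f w0)"
  proof -
    have "mlift 0 (M 0) (\<lambda>_. 0) = single 0 (M 0 (\<lambda>_. 0))"
      using mlift_single[OF D(2)[of 0], of "\<lambda>_. 0" "\<lambda>_. 0" "\<lambda>_. 0"] by simp
    hence "(\<lambda>n. mlift n (M n) (\<lambda>_. 0)) = (\<lambda>n. if n = 0 then single 0 (f w0) else 0)"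
      using bounded_multilinear_eq_0[OF bounded_multilinear_mlift[OF D(2)], of 0 _ "\<lambda>_. 0"]
      by (auto simp: fun_eq_iff f0)
    thus ?thesis using sums_single[of 0 "\<lambda>_. single 0 (f w0)"] by simp
  qed
  show thesis
  proof (rule that[of "r / 4" "C * r + 2 * K 1"])
    fix \<rho> :: real assume \<rho>: "0 < \<rho>" "\<rho> \<le> r / 4"
    define u :: "(real \<times> real) ell1" where "u = \<rho> *\<^sub>R (single (1,0) (1,0) + single (0,1) (0,1))"
    have nu: "norm u \<le> 2 * \<rho>"
    proof -
      have "norm (single (1,0) (1::real,0::real) + single (0,1) (0::real,1::real)) \<le> 2"
        by (rule order_trans[OF norm_triangle_ineq]) simp
      thus ?thesis using \<rho> by (simp add: u_def mult.commute)
    qed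
    have eu: "ev w u = \<rho> *\<^sub>R w" if "w \<in> unit_square" for w
    proof -
      interpret E: bounded_linear "ev w :: (real \<times> real) ell1 \<Rightarrow> _" by (rule bounded_linear_ev[OF that])
      show ?thesis by (simp add: u_def E.scaleR E.add monom2_def prod_eq_iff)
    qed
    obtain b where b: "(\<lambda>n. mlift n (M n) (\<lambda>_. u)) sums b"
      "\<And>w. w \<in> unit_square \<Longrightarrow> (\<lambda>n. M n (\<lambda>_. ev w u)) sums ev w b"
      using power_coeffs_mlift_sums[OF M, of u] nu \<rho> D(1) by auto
    have "f (w0 + \<rho> *\<^sub>R w) = ev w b" if w: "w \<in> unit_square" for w
    proof -
      have "norm (\<rho> *\<^sub>R w) < r"
        using norm_ev_le[OF w, of u] nu \<rho> D(1) eu[OF w] by simp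
      from s[OF this] b(2)[OF w] show ?thesis unfolding eu[OF w] by (rule sums_unique2)
    qed
    moreover have "norm (b - single 0 (f w0)) \<le> (C * r + 2 * K 1) * \<rho>"
    proof -
      have "norm (b - single 0 (f w0) - mlift 1 (M 1) (\<lambda>_. u - 0)) \<le> C * (2 * \<rho>) * norm (u - 0)"
        using nu \<rho> by (intro est[OF _ _ _ b(1) m0]) auto
      also have "\<dots> \<le> C * (2 * \<rho>) * (2 * \<rho>)" using nu C \<rho> by (intro mult_left_mono) auto
      also have "\<dots> \<le> C * r * \<rho>" using mult_left_mono[of "4 * \<rho>" r "C * \<rho>"] \<rho> C by (simp add: algebra_simps)
      finally have 1: "norm (b - single 0 (f w0) - mlift 1 (M 1) (\<lambda>_. u)) \<le> C * r * \<rho>" by simp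
      have "norm (mlift 1 (M 1) (\<lambda>_. u)) \<le> K 1 * norm u"
        using mlift_bound(2)[OF D(2)[of 1], of "\<lambda>_. u"] by simp
      also have "\<dots> \<le> K 1 * (2 * \<rho>)" by (intro mult_left_mono nu D(4))
      finally have 2: "norm (mlift 1 (M 1) (\<lambda>_. u)) \<le> 2 * K 1 * \<rho>" by simp
      have "norm (b - single 0 (f w0)) \<le> norm (b - single 0 (f w0) - mlift 1 (M 1) (\<lambda>_. u)) + norm (mlift 1 (M 1) (\<lambda>_. u))"
        using norm_triangle_ineq[of "b - single 0 (f w0) - mlift 1 (M 1) (\<lambda>_. u)" "mlift 1 (M 1) (\<lambda>_. u)"] by simp
      thus ?thesis using 1 2 by (simp add: distrib_right)
    qed
    ultimately show "\<exists>a. norm (a - single 0 (f w0)) \<le> (C * r + 2 * K 1) * \<rho> \<and>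
      (\<forall>w\<in>unit_square. f (w0 + \<rho> *\<^sub>R w) = ev w a)" by blast
  qed (use D C in auto)
qed

lemma has_sum_diagonal:
  fixes f :: "nat \<times> nat \<Rightarrow> 'b::banach"
  assumes "(f has_sum S) UNIV"
  shows "(\<lambda>n. \<Sum>i\<le>n. f (i, n - i)) sums S"
proof -
  have eq: "((\<lambda>(n, i). f (i, n - i)) has_sum S) (SIGMA n:UNIV. {..n}) = (f has_sum S) UNIV"
    by (rule has_sum_reindex_bij_witness[of _ "\<lambda>(i, j). (i + j, i)" "\<lambda>(n, i). (i, n - i)"]) auto
  have "((\<lambda>n. \<Sum>i\<le>n. f (i, n - i)) has_sum S) UNIV"
  proof (rule has_sum_SigmaD)
    show "((\<lambda>(n, i). f (i, n - i)) has_sum S) (SIGMA n:UNIV. {..n})" unfolding eq by (rule assms)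
    show "((\<lambda>i. case (n, i) of (n, i) \<Rightarrow> f (i, n - i)) has_sum (\<Sum>i\<le>n. f (i, n - i))) {..n}" for n
      unfolding prod.case by (rule has_sum_finite) simp
  qed
  thus ?thesis by (rule has_sum_imp_sums)
qed

lemma ev_imp_real_analytic_at:
  fixes f :: "real \<times> real \<Rightarrow> 'b::banach"
  assumes \<rho>: "\<rho> > 0" and f: "\<And>w. w \<in> unit_square \<Longrightarrow> f (w0 + \<rho> *\<^sub>R w) = ev w a"
  shows "real_analytic_at f w0"
proof -
  define sel where "sel i l = (if l < i then fst else snd :: real \<times> real \<Rightarrow> real)" for i l :: nat
  define M where "M = (\<lambda>n (x::nat \<Rightarrow> real \<times> real). \<Sum>i\<le>n. ((\<Prod>l<n. sel i l (x l)) / \<rho> ^ n) *\<^sub>R coef a (i, n - i))"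
  define K where "K = (\<lambda>n. \<Sum>i\<le>n. norm (coef a (i, n - i)) / \<rho> ^ n)"
  have sel: "linear (sel i l)" "\<bar>sel i l v\<bar> \<le> norm v" for i l v
    using bounded_linear.linear[OF bounded_linear_fst] bounded_linear.linear[OF bounded_linear_snd]
      norm_fst_le[of "fst v" "snd v"] norm_snd_le[of "snd v" "fst v"] by (auto simp: sel_def)
  have bm: "bounded_multilinear n (M n) (K n)" for n
    unfolding M_def K_def
  proof (rule bounded_multilinear_sum)
    fix i
    show "bounded_multilinear n (\<lambda>x. ((\<Prod>l<n. sel i l (x l)) / \<rho> ^ n) *\<^sub>R coef a (i, n - i))
        (norm (coef a (i, n - i)) / \<rho> ^ n)"
      unfolding bounded_multilinear_def
    proof (intro conjI allI impI)
      show "linear (\<lambda>v. ((\<Prod>l<n. sel i l ((x(j := v)) l)) / \<rho> ^ n) *\<^sub>R coef a (i, n - i))" if "j < n" for x j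
      proof -
        have "(\<Prod>l<n. sel i l ((x(j := v)) l)) = sel i j v * (\<Prod>l\<in>{..<n} - {j}. sel i l (x l))" for v
          using that by (subst prod.remove[of _ j]) (auto intro!: prod.cong)
        thus ?thesis
          by (intro linearI) (simp_all only: linear_add[OF sel(1)] linear_scale[OF sel(1)]
              add_divide_distrib scaleR_add_left distrib_right mult.assoc scaleR_scaleR
              real_scaleR_def times_divide_eq_right[symmetric])
      qed
      fix x
      have "(\<Prod>l<n. \<bar>sel i l (x l)\<bar>) \<le> (\<Prod>l<n. norm (x l))"
        by (intro prod_mono) (use sel in auto)
      thus "norm (((\<Prod>l<n. sel i l (x l)) / \<rho> ^ n) *\<^sub>R coef a (i, n - i))
          \<le> norm (coef a (i, n - i)) / \<rho> ^ n * (\<Prod>l<n. norm (x l))"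
        using \<rho> by (auto simp: abs_prod divide_right_mono mult_mono mult.commute[of "norm (coef a (i, n - i))"]
            intro!: divide_right_mono mult_right_mono)
    qed (use \<rho> in auto)
  qed
  have sm: "summable (\<lambda>n. K n * \<rho> ^ n)"
  proof -
    have "K n * \<rho> ^ n = (\<Sum>i\<le>n. norm (coef a (i, n - i)))" for n
      using \<rho> by (simp add: K_def sum_distrib_right)
    thus ?thesis
      using has_sum_diagonal[OF has_sum_infsum[OF coef_summable[of a]]] by (simp add: sums_iff)
  qed
  show ?thesis
  proof (rule real_analytic_atI[of M K \<rho>])
    show "power_coeffs M K \<rho>" using bm sm \<rho> by (simp add: power_coeffs_def)
    fix h :: "real \<times> real" assume h: "norm h < \<rho>"
    define w where "w = (1 / \<rho>) *\<^sub>R h"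
    have hw: "h = \<rho> *\<^sub>R w" using \<rho> by (simp add: w_def)
    have "norm w \<le> 1" using h \<rho> by (simp add: w_def)
    hence w: "w \<in> unit_square"
      using norm_fst_le[of "fst w" "snd w"] norm_snd_le[of "snd w" "fst w"]
      by (simp add: unit_square_def)
    have "M n (\<lambda>_. h) = (\<Sum>i\<le>n. monom2 w (i, n - i) *\<^sub>R coef a (i, n - i))" for n
      unfolding M_def
    proof (rule sum.cong[OF refl])
      fix i assume i: "i \<in> {..n}"
      have "(\<Prod>l<n. sel i l h) = (\<Prod>l<i. fst h) * (\<Prod>l\<in>{i..<n}. snd h)"
      proof -
        have "{..<n} = {..<i} \<union> {i..<n}" using i by auto
        hence "(\<Prod>l<n. sel i l h) = (\<Prod>l\<in>{..<i} \<union> {i..<n}. sel i l h)" by (rule arg_cong)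
        also have "\<dots> = (\<Prod>l<i. sel i l h) * (\<Prod>l\<in>{i..<n}. sel i l h)"
          by (rule prod.union_disjoint) auto
        finally show ?thesis by (simp add: sel_def)
      qed
      also have "\<dots> = monom2 w (i, n - i) * \<rho> ^ n"
        using i by (simp add: hw monom2_def power_mult_distrib power_add[symmetric])
      finally show "((\<Prod>l<n. sel i l h) / \<rho> ^ n) *\<^sub>R coef a (i, n - i) = monom2 w (i, n - i) *\<^sub>R coef a (i, n - i)"
        using \<rho> by simp
    qed
    thus "(\<lambda>n. M n (\<lambda>_. h)) sums f (w0 + h)"
      using has_sum_diagonal[OF ev_has_sum[OF w, of a]] f[OF w] by (simp add: hw)
  qed
qed

text \<open>
  Multiplication by the coordinate \<open>s\<^sub>1 + r s\<close> is the operator \<open>s\<^sub>1 + r \<sigma>\<close>, with \<open>\<sigma>\<close> the shift;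
  its norm is at most one, which gives the expansion at an interior point.
\<close>

lemma ev_reexpand:
  fixes a :: "'b::banach ell1"
  assumes r: "r \<ge> 0" "\<bar>fst w1\<bar> + r \<le> 1" "\<bar>snd w1\<bar> + r \<le> 1"
  obtains b where "\<And>w. w \<in> unit_square \<Longrightarrow> ev (w1 + r *\<^sub>R w) a = ev w b"
proof -
  define A where "A = (\<lambda>(s::real) j (c::'b ell1). s *\<^sub>R c + r *\<^sub>R eshift j c)"
  have nA: "norm (A s j c) \<le> norm c" if "\<bar>s\<bar> + r \<le> 1" for s j c
  proof -
    have "norm (A s j c) \<le> \<bar>s\<bar> * norm c + r * norm (eshift j c)"
      unfolding A_def using r(1) by (intro order_trans[OF norm_triangle_ineq]) simp
    also have "\<dots> \<le> \<bar>s\<bar> * norm c + r * norm c"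
      using r(1) eshift_bound(2)[of j c] by (intro add_left_mono mult_left_mono)
    also have "\<dots> = (\<bar>s\<bar> + r) * norm c" by (simp add: algebra_simps)
    also have "\<dots> \<le> 1 * norm c" using that by (intro mult_right_mono) auto
    finally show ?thesis by simp
  qed
  have eA: "ev w (A s j c) = (s + r * monom2 w j) *\<^sub>R ev w c" if "w \<in> unit_square" for s j c w
  proof -
    interpret E: bounded_linear "ev w :: 'b ell1 \<Rightarrow> _" by (rule bounded_linear_ev[OF that])
    show ?thesis by (simp add: A_def E.add E.scaleR ev_eshift[OF that] scaleR_add_left)
  qed
  have nAp: "norm ((A s j ^^ n) c) \<le> norm c" if "\<bar>s\<bar> + r \<le> 1" for s j n c
    by (induction n) (auto intro: order_trans[OF nA[OF that]])
  have eAp: "ev w ((A s j ^^ n) c) = (s + r * monom2 w j) ^ n *\<^sub>R ev w c" if "w \<in> unit_square" for s j n c w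
    by (induction n) (auto simp: eA[OF that])
  define T where "T k v = (A (fst w1) (1,0) ^^ fst k) ((A (snd w1) (0,1) ^^ snd k) (single 0 v))" for k v
  have nT: "norm (T k v) \<le> norm v" for k v
    unfolding T_def by (rule order_trans[OF nAp[OF r(2)]], rule order_trans[OF nAp[OF r(3)]]) simp
  have eT: "ev w (T k v) = monom2 (w1 + r *\<^sub>R w) k *\<^sub>R v" if "w \<in> unit_square" for w k v
    by (simp add: T_def eAp[OF that] monom2_def)
  define b where "b = infsum (\<lambda>k. T k (coef a k)) UNIV"
  have "(\<lambda>k. norm (T k (coef a k))) summable_on UNIV"
    by (rule Infinite_Sum.abs_summable_on_comparison_test'[OF coef_summable[of a]]) (rule nT)
  hence hb: "((\<lambda>k. T k (coef a k)) has_sum b) UNIV"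
    unfolding b_def by (rule has_sum_infsum[OF abs_summable_summable])
  have "ev (w1 + r *\<^sub>R w) a = ev w b" if w: "w \<in> unit_square" for w
  proof -
    have "\<bar>fst w1 + r * fst w\<bar> \<le> 1" "\<bar>snd w1 + r * snd w\<bar> \<le> 1"
    proof -
      have "r * \<bar>fst w\<bar> \<le> r" "r * \<bar>snd w\<bar> \<le> r"
        using w r(1) by (auto simp: unit_square_def intro: mult_left_le)
      thus "\<bar>fst w1 + r * fst w\<bar> \<le> 1" "\<bar>snd w1 + r * snd w\<bar> \<le> 1"
        using r abs_triangle_ineq[of "fst w1" "r * fst w"] abs_triangle_ineq[of "snd w1" "r * snd w"]
        by (simp_all add: abs_mult)
    qed
    hence w': "w1 + r *\<^sub>R w \<in> unit_square" by (simp add: unit_square_def)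
    show ?thesis
      using has_sum_bounded_linear[OF bounded_linear_ev[OF w] hb] ev_has_sum[OF w', of a]
      by (simp add: eT[OF w]) (metis has_sum_unique)
  qed
  thus ?thesis by (rule that)
qed

lemma ev_imp_real_analytic_on:
  fixes f :: "real \<times> real \<Rightarrow> 'b::banach"
  assumes \<rho>: "\<rho> > 0" and f: "\<And>w. w \<in> unit_square \<Longrightarrow> f (w0 + \<rho> *\<^sub>R w) = ev w a"
  shows "real_analytic_on (ball w0 \<rho>) f"
  unfolding real_analytic_on_def
proof
  fix y assume y: "y \<in> ball w0 \<rho>"
  define w1 where "w1 = (1 / \<rho>) *\<^sub>R (y - w0)"
  have y1: "y = w0 + \<rho> *\<^sub>R w1" using \<rho> by (simp add: w1_def)
  have "norm (y - w0) < \<rho>" using y by (simp add: dist_norm norm_minus_commute)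
  hence n1: "norm w1 < 1" using \<rho> by (simp add: w1_def)
  hence "\<bar>fst w1\<bar> < 1" "\<bar>snd w1\<bar> < 1"
    using norm_fst_le[of "fst w1" "snd w1"] norm_snd_le[of "snd w1" "fst w1"] by simp_all
  define r where "r = 1 - norm w1"
  have r: "r > 0" "\<bar>fst w1\<bar> + r \<le> 1" "\<bar>snd w1\<bar> + r \<le> 1"
    using n1 norm_fst_le[of "fst w1" "snd w1"] norm_snd_le[of "snd w1" "fst w1"] by (auto simp: r_def)
  obtain b where b: "\<And>w. w \<in> unit_square \<Longrightarrow> ev (w1 + r *\<^sub>R w) a = ev w b"
    using ev_reexpand[of r w1 a] r by (metis less_imp_le)
  show "real_analytic_at f y"
  proof (rule ev_imp_real_analytic_at[of "\<rho> * r" f y b])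
    show "\<rho> * r > 0" using \<rho> r by simp
    fix w assume w: "w \<in> unit_square"
    have "\<bar>r * fst w\<bar> \<le> r" "\<bar>r * snd w\<bar> \<le> r"
      using w r(1) by (auto simp: unit_square_def abs_mult intro: mult_left_le)
    hence "w1 + r *\<^sub>R w \<in> unit_square"
      using r abs_triangle_ineq[of "fst w1" "r * fst w"] abs_triangle_ineq[of "snd w1" "r * snd w"]
      by (simp add: unit_square_def)
    from f[OF this] b[OF w] show "f (y + (\<rho> * r) *\<^sub>R w) = ev w b"
      by (simp add: y1 scaleR_add_right add.assoc)
  qed
qed

lemma real_analytic_at_imp_on_ball:
  fixes f :: "real \<times> real \<Rightarrow> 'b::banach"
  assumes "real_analytic_at f w0"
  obtains \<rho> where "\<rho> > 0" "real_analytic_on (ball w0 \<rho>) f"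
proof -
  obtain \<rho> C where \<rho>: "\<rho> > 0" and e: "\<And>s. 0 < s \<Longrightarrow> s \<le> \<rho> \<Longrightarrow>
      \<exists>a. norm (a - single 0 (f w0)) \<le> C * s \<and> (\<forall>w\<in>unit_square. f (w0 + s *\<^sub>R w) = ev w a)"
    using real_analytic_at_imp_ev[OF assms] by metis
  from e[OF \<rho> order.refl] obtain a where "\<forall>w\<in>unit_square. f (w0 + \<rho> *\<^sub>R w) = ev w a" by blast
  thus ?thesis using ev_imp_real_analytic_on[OF \<rho>, of f w0 a] that \<rho> by blast
qed

lemma real_analytic_at_compose:
  fixes u :: "real \<times> real \<Rightarrow> 'a::banach" and f :: "'a \<Rightarrow> 'b::banach"
  assumes f: "real_analytic_at f (u w0)" and u: "real_analytic_at u w0"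
  shows "real_analytic_at (\<lambda>w. f (u w)) w0"
proof -
  obtain M K r where M: "power_coeffs M K r"
    and s: "\<And>h. norm h < r \<Longrightarrow> (\<lambda>n. M n (\<lambda>_. h)) sums f (u w0 + h)"
    using f unfolding real_analytic_at_iff by blast
  note D = power_coeffsD[OF M]
  obtain \<rho>0 C where \<rho>0: "\<rho>0 > 0" "C \<ge> 0" and e: "\<And>s. 0 < s \<Longrightarrow> s \<le> \<rho>0 \<Longrightarrow>
      \<exists>a. norm (a - single 0 (u w0)) \<le> C * s \<and> (\<forall>w\<in>unit_square. u (w0 + s *\<^sub>R w) = ev w a)"
    using real_analytic_at_imp_ev[OF u] by metis
  define \<rho> where "\<rho> = min \<rho>0 (r / (2 * (C + 1)))"
  have \<rho>: "\<rho> > 0" "\<rho> \<le> \<rho>0" using \<rho>0 D(1) by (auto simp: \<rho>_def)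
  have "C * \<rho> < r"
  proof -
    have "C * \<rho> \<le> C * (r / (2 * (C + 1)))" using \<rho>0 by (intro mult_left_mono) (auto simp: \<rho>_def)
    also have "\<dots> < r" using \<rho>0 D(1) by (simp add: field_simps add_strict_increasing)
    finally show ?thesis .
  qed
  from e[OF \<rho>] obtain a where a: "norm (a - single 0 (u w0)) \<le> C * \<rho>"
    "\<And>w. w \<in> unit_square \<Longrightarrow> u (w0 + \<rho> *\<^sub>R w) = ev w a" by blast
  define v where "v = a - single 0 (u w0)"
  have nv: "norm v < r" using a(1) \<open>C * \<rho> < r\<close> by (simp add: v_def)
  obtain b where b: "\<And>w. w \<in> unit_square \<Longrightarrow> (\<lambda>n. M n (\<lambda>_. ev w v)) sums ev w b"
    using power_coeffs_mlift_sums[OF M, of v] nv by (metis less_imp_le)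
  show ?thesis
  proof (rule ev_imp_real_analytic_at[OF \<rho>(1)])
    fix w assume w: "w \<in> unit_square"
    interpret E: bounded_linear "ev w :: 'a ell1 \<Rightarrow> _" by (rule bounded_linear_ev[OF w])
    have ev: "ev w v = ev w a - u w0" by (simp add: v_def E.diff)
    have "(\<lambda>n. M n (\<lambda>_. ev w v)) sums f (u w0 + ev w v)"
      using norm_ev_le[OF w, of v] nv by (intro s) simp
    hence "f (u w0 + ev w v) = ev w b" using b[OF w] by (rule sums_unique2)
    thus "f (u (w0 + \<rho> *\<^sub>R w)) = ev w b" by (simp add: ev a(2)[OF w])
  qed
qed

lemma real_analytic_at_fst_iff:
  fixes f :: "real \<Rightarrow> 'b::real_normed_vector" and s t :: real
  shows "real_analytic_at (\<lambda>w. f (fst w)) (s, t) \<longleftrightarrow> real_analytic_at f s"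
proof
  assume "real_analytic_at (\<lambda>w. f (fst w)) (s, t)"
  moreover have "bounded_linear (\<lambda>x::real. (x, 0::real))"
    by (intro bounded_linear_Pair bounded_linear_ident bounded_linear_zero)
  ultimately have "real_analytic_at (\<lambda>x. f (fst ((x, 0) + (0, t)))) s"
    by (intro real_analytic_at_affine[where f = "\<lambda>w. f (fst w)"]) simp_all
  thus "real_analytic_at f s" by simp
qed (auto intro: real_analytic_at_compose_linear[OF bounded_linear_fst])

lemma real_analytic_at_compose_real:
  fixes u :: "real \<Rightarrow> 'a::banach" and f :: "'a \<Rightarrow> 'b::banach"
  assumes "real_analytic_at f (u s)" "real_analytic_at u s"
  shows "real_analytic_at (\<lambda>x. f (u x)) s"
  using real_analytic_at_compose[of f "\<lambda>w. u (fst w)" "(s, 0)"] assms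
  by (simp add: real_analytic_at_fst_iff real_analytic_at_fst_iff[where f = "\<lambda>x. f (u x)"])

lemma real_analytic_at_imp_near:
  fixes f :: "real \<Rightarrow> 'b::banach"
  assumes "real_analytic_at f s"
  obtains d where "d > 0" "real_analytic_on (ball s d) f"
proof -
  obtain d where d: "d > 0" "real_analytic_on (ball (s, 0::real) d) (\<lambda>w. f (fst w))"
    using real_analytic_at_imp_on_ball[of "\<lambda>w. f (fst w)" "(s, 0)"] assms
    by (auto simp: real_analytic_at_fst_iff)
  have "real_analytic_at f x" if "x \<in> ball s d" for x
  proof -
    have "(x, 0::real) \<in> ball (s, 0) d" using that by (simp add: dist_Pair_Pair)
    thus ?thesis using d(2) real_analytic_at_fst_iff unfolding real_analytic_on_def by blast
  qed
  thus ?thesis using that d(1) by (auto simp: real_analytic_on_def)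
qed

section \<open>Functionals and bounded inverses\<close>

lemma exists_between_sets:
  fixes A B :: "real set"
  assumes "A \<noteq> {}" "B \<noteq> {}" "\<And>x y. x \<in> A \<Longrightarrow> y \<in> B \<Longrightarrow> x \<le> y"
  obtains c where "\<And>x. x \<in> A \<Longrightarrow> x \<le> c" "\<And>y. y \<in> B \<Longrightarrow> c \<le> y"
proof (rule that[of "Sup A"])
  have "bdd_above A" using assms by (meson bdd_above.I ex_in_conv)
  thus "\<And>x. x \<in> A \<Longrightarrow> x \<le> Sup A" by (simp add: cSup_upper)
  show "\<And>y. y \<in> B \<Longrightarrow> Sup A \<le> y" using assms by (intro cSup_least) auto
qed

text \<open>
  The Hahn--Banach theorem for a single vector: a maximal subspace whose distance from \<open>\<phi>\<close> is
  \<open>norm \<phi>\<close> is a complement of the line through \<open>\<phi>\<close>.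
\<close>

lemma exists_functional:
  fixes \<phi> :: "'u::real_normed_vector"
  assumes \<phi>: "\<phi> \<noteq> 0"
  obtains f :: "'u \<Rightarrow> real" where "bounded_linear f" "f \<phi> = 1"
proof -
  define p where "p = norm \<phi>"
  have p: "p > 0" using \<phi> by (simp add: p_def)
  define \<N> where "\<N> = {N :: 'u set. subspace N \<and> (\<forall>n\<in>N. p \<le> norm (\<phi> + n))}"
  have "{0} \<in> \<N>" by (auto simp: \<N>_def p_def subspace_def)
  have chain: "\<Union>C \<in> \<N>" if C: "C \<noteq> {}" "subset.chain \<N> C" for C
  proof -
    have sub: "subspace A" if "A \<in> C" for A using C that by (auto simp: \<N>_def subset.chain_def)
    have lin: "A \<subseteq> B \<or> B \<subseteq> A" if "A \<in> C" "B \<in> C" for A B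
      using C that by (auto simp: subset.chain_def)
    have "subspace (\<Union>C)"
      unfolding subspace_def
    proof (intro conjI ballI allI)
      show "0 \<in> \<Union>C" using C(1) sub subspace_0 by blast
      fix x y assume "x \<in> \<Union>C" "y \<in> \<Union>C"
      then obtain A B where "A \<in> C" "B \<in> C" "x \<in> A" "y \<in> B" by blast
      thus "x + y \<in> \<Union>C" using lin[of A B] sub subspace_add by blast
    next
      fix c x assume "x \<in> \<Union>C"
      thus "c *\<^sub>R x \<in> \<Union>C" using sub subspace_scale by blast
    qed
    thus ?thesis using C by (auto simp: \<N>_def subset.chain_def)
  qed
  obtain M where M: "M \<in> \<N>" and max: "\<And>X. X \<in> \<N> \<Longrightarrow> M \<subseteq> X \<Longrightarrow> X = M"
    using subset_Zorn_nonempty[of \<N>] \<open>{0} \<in> \<N>\<close> chain by blast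
  have sM: "subspace M" and dM: "\<And>n. n \<in> M \<Longrightarrow> p \<le> norm (\<phi> + n)" using M by (auto simp: \<N>_def)
  have bnd: "\<bar>c\<bar> * p \<le> norm (n + c *\<^sub>R \<phi>)" if "n \<in> M" for n c
  proof (cases "c = 0")
    case False
    have "p \<le> norm (\<phi> + (1 / c) *\<^sub>R n)" by (intro dM subspace_scale sM that)
    hence "\<bar>c\<bar> * p \<le> \<bar>c\<bar> * norm (\<phi> + (1 / c) *\<^sub>R n)" by (intro mult_left_mono) auto
    also have "\<dots> = norm (c *\<^sub>R (\<phi> + (1 / c) *\<^sub>R n))" by simp
    also have "c *\<^sub>R (\<phi> + (1 / c) *\<^sub>R n) = n + c *\<^sub>R \<phi>" using False by (simp add: scaleR_add_right)
    finally show ?thesis .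
  qed simp
  have decomp: "\<exists>a. x - a *\<^sub>R \<phi> \<in> M" for x
  proof -
    let ?A = "{- norm (n + c *\<^sub>R \<phi> + x) - c * p |n c. n \<in> M}"
    let ?B = "{norm (n + c *\<^sub>R \<phi> + x) - c * p |n c. n \<in> M}"
    have le: "- norm (n + c *\<^sub>R \<phi> + x) - c * p \<le> norm (m + d *\<^sub>R \<phi> + x) - d * p"
      if "n \<in> M" "m \<in> M" for n m c d
    proof -
      have "(d - c) * p \<le> \<bar>d - c\<bar> * p" using p by (intro mult_right_mono) auto
      also have "\<dots> \<le> norm ((m - n) + (d - c) *\<^sub>R \<phi>)" by (intro bnd subspace_diff sM that)
      also have "(m - n) + (d - c) *\<^sub>R \<phi> = (m + d *\<^sub>R \<phi> + x) - (n + c *\<^sub>R \<phi> + x)"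
        by (simp add: algebra_simps)
      also have "norm \<dots> \<le> norm (m + d *\<^sub>R \<phi> + x) + norm (n + c *\<^sub>R \<phi> + x)" by (rule norm_triangle_ineq4)
      finally show ?thesis by (simp add: algebra_simps)
    qed
    have "0 \<in> M" by (rule subspace_0[OF sM])
    hence ne: "?A \<noteq> {}" "?B \<noteq> {}" by blast+
    obtain \<alpha> where "\<And>y. y \<in> ?A \<Longrightarrow> y \<le> \<alpha>" "\<And>y. y \<in> ?B \<Longrightarrow> \<alpha> \<le> y"
      using exists_between_sets[OF ne] le by blast
    hence \<alpha>: "- norm (n + c *\<^sub>R \<phi> + x) - c * p \<le> \<alpha>" "\<alpha> \<le> norm (n + c *\<^sub>R \<phi> + x) - c * p" if "n \<in> M" for n c
      using that by blast+
    define y where "y = x - (\<alpha> / p) *\<^sub>R \<phi>"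
    define N where "N = {n + t *\<^sub>R y |n t. n \<in> M}"
    have NI: "n + t *\<^sub>R y \<in> N" if "n \<in> M" for n t using that by (auto simp: N_def)
    have "subspace N"
      unfolding subspace_def
    proof (intro conjI ballI allI)
      show "0 \<in> N" using NI[OF \<open>0 \<in> M\<close>, of 0] by simp
    next
      fix u v assume "u \<in> N" "v \<in> N"
      then obtain n t m s where "u = n + t *\<^sub>R y" "v = m + s *\<^sub>R y" "n \<in> M" "m \<in> M" by (auto simp: N_def)
      thus "u + v \<in> N" using NI[OF subspace_add[OF sM, of n m], of "t + s"] by (simp add: algebra_simps)
    next
      fix c u assume "u \<in> N"
      then obtain n t where "u = n + t *\<^sub>R y" "n \<in> M" by (auto simp: N_def)
      thus "c *\<^sub>R u \<in> N" using NI[OF subspace_scale[OF sM, of n c], of "c * t"] by (simp add: algebra_simps)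
    qed
    moreover have "p \<le> norm (\<phi> + u)" if u: "u \<in> N" for u
    proof -
      obtain n t where nt: "u = n + t *\<^sub>R y" "n \<in> M" using u by (auto simp: N_def)
      show ?thesis
      proof (cases "t = 0")
        case True thus ?thesis using nt dM by simp
      next
        case False
        define m c where "m = (1 / t) *\<^sub>R n" and "c = 1 / t - \<alpha> / p"
        have m: "m \<in> M" unfolding m_def by (intro subspace_scale sM nt)
        have "c * p + \<alpha> = p / t" using p False by (simp add: c_def field_simps)
        hence "\<bar>p / t\<bar> \<le> norm (m + c *\<^sub>R \<phi> + x)" using \<alpha>[OF m, of c] by linarith
        hence "p \<le> \<bar>t\<bar> * norm (m + c *\<^sub>R \<phi> + x)" using p False by (simp add: field_simps)
        also have "\<dots> = norm (t *\<^sub>R (m + c *\<^sub>R \<phi> + x))" by simp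
        also have "t *\<^sub>R (m + c *\<^sub>R \<phi> + x) = \<phi> + u"
          using False by (simp add: m_def c_def nt y_def scaleR_add_right scaleR_diff_right scaleR_diff_left algebra_simps)
        finally show ?thesis .
      qed
    qed
    ultimately have "N \<in> \<N>" by (simp add: \<N>_def)
    moreover have "M \<subseteq> N" using NI[of _ 0] by auto
    ultimately have "N = M" by (rule max)
    moreover have "y \<in> N" using NI[OF \<open>0 \<in> M\<close>, of 1] by simp
    ultimately show ?thesis unfolding y_def by blast
  qed
  have uniq: "a = b" if "x - a *\<^sub>R \<phi> \<in> M" "x - b *\<^sub>R \<phi> \<in> M" for x a b
  proof -
    have "\<bar>a - b\<bar> * p \<le> norm ((x - a *\<^sub>R \<phi>) - (x - b *\<^sub>R \<phi>) + (a - b) *\<^sub>R \<phi>)"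
      by (intro bnd subspace_diff sM that)
    also have "(x - a *\<^sub>R \<phi>) - (x - b *\<^sub>R \<phi>) + (a - b) *\<^sub>R \<phi> = 0" by (simp add: algebra_simps)
    finally show ?thesis using p by (simp add: mult_le_0_iff)
  qed
  obtain f where f: "\<And>x. x - f x *\<^sub>R \<phi> \<in> M" using decomp by metis
  have "bounded_linear f"
  proof (rule bounded_linear_intro[of _ "1 / p"])
    show "f (x + y) = f x + f y" for x y
      using uniq[OF f[of "x + y"], of "f x + f y"] subspace_add[OF sM f[of x] f[of y]]
      by (simp add: algebra_simps)
    show "f (c *\<^sub>R x) = c *\<^sub>R f x" for c x
      using uniq[OF f[of "c *\<^sub>R x"], of "c * f x"] subspace_scale[OF sM f[of x], of c]
      by (simp add: algebra_simps)
    show "norm (f x) \<le> norm x * (1 / p)" for x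
      using bnd[OF f[of x], of "f x"] p by (simp add: field_simps)
  qed
  moreover have "f \<phi> = 1"
    using uniq[OF f[of \<phi>], of 1] subspace_0[OF sM] by simp
  ultimately show ?thesis by (rule that)
qed

lemma bounded_inverse:
  fixes T :: "'u::banach \<Rightarrow> 'v::banach"
  assumes T: "bounded_linear T" and inj: "\<And>u. T u = 0 \<Longrightarrow> u = 0" and surj: "surj T"
  obtains C where "C > 0" "\<And>u. norm u \<le> C * norm (T u)"
proof -
  interpret T: bounded_linear T by fact
  define A where "A k = closure (T ` cball 0 (real k))" for k
  have "\<exists>k. interior (A k) \<noteq> {}"
  proof (rule ccontr)
    assume "\<not> ?thesis"
    hence "Met_TC.mtopology interior_of \<Union>(range A) = ({} :: 'v set)"
      by (intro Met_TC.metric_Baire_category_alt) (auto simp: A_def)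
    moreover have "\<Union>(range A) = UNIV"
    proof -
      have "v \<in> \<Union>(range A)" for v
      proof -
        obtain u where "v = T u" using surj by blast
        moreover obtain k :: nat where "norm u \<le> real k" using real_arch_simple by blast
        ultimately have "v \<in> A k" using closure_subset by (fastforce simp: A_def)
        thus ?thesis by blast
      qed
      thus ?thesis by blast
    qed
    ultimately show False by simp
  qed
  then obtain k v0 e where e: "e > 0" "ball v0 e \<subseteq> A k"
    by (metis all_not_in_conv mem_interior)
  define B where "B = 2 * real k + 1"
  have B: "B > 0" by (simp add: B_def)
  have approx: "\<exists>u. norm u \<le> B \<and> norm (v - T u) \<le> e / 4" if v: "norm v < e" for v
  proof -
    have "v0 + v \<in> A k" "v0 \<in> A k" using e v by (auto simp: dist_norm intro!: subsetD[OF e(2)])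
    moreover have "e / 8 > 0" using e(1) by simp
    ultimately obtain y z where yz: "y \<in> T ` cball 0 (real k)" "dist y (v0 + v) < e / 8"
        "z \<in> T ` cball 0 (real k)" "dist z v0 < e / 8"
      unfolding A_def closure_approachable by meson
    then obtain a b where ab: "y = T a" "z = T b" "norm a \<le> real k" "norm b \<le> real k" by auto
    have "v - T (a - b) = (v0 + v - y) - (v0 - z)" by (simp add: ab T.diff)
    also have "norm \<dots> \<le> norm (v0 + v - y) + norm (v0 - z)" by (rule norm_triangle_ineq4)
    also have "\<dots> \<le> e / 4" using yz by (simp add: dist_norm norm_minus_commute)
    finally have "norm (v - T (a - b)) \<le> e / 4" .
    moreover have "norm (a - b) \<le> B" using norm_triangle_ineq4[of a b] ab by (simp add: B_def)
    ultimately show ?thesis by blast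
  qed
  define C where "C = 2 * B / e"
  have C: "C > 0" using B e by (simp add: C_def)
  have half: "\<exists>u. norm u \<le> C * norm v \<and> norm (v - T u) \<le> norm v / 2" for v
  proof (cases "v = 0")
    case False
    define s where "s = e / (2 * norm v)"
    have s: "s > 0" using False e by (simp add: s_def)
    have "norm (s *\<^sub>R v) < e" using False e by (simp add: s_def)
    then obtain u where u: "norm u \<le> B" "norm (s *\<^sub>R v - T u) \<le> e / 4" using approx by blast
    have "v - T ((1 / s) *\<^sub>R u) = (1 / s) *\<^sub>R (s *\<^sub>R v - T u)"
      using s by (simp add: T.scaleR scaleR_diff_right)
    hence "norm (v - T ((1 / s) *\<^sub>R u)) = (1 / s) * norm (s *\<^sub>R v - T u)" using s by simp
    also have "\<dots> \<le> (1 / s) * (e / 4)" using s u by (intro mult_left_mono) auto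
    also have "\<dots> = norm v / 2" using e False by (simp add: s_def field_simps)
    finally have 1: "norm (v - T ((1 / s) *\<^sub>R u)) \<le> norm v / 2" .
    have "norm ((1 / s) *\<^sub>R u) = norm u / s" using s by simp
    also have "\<dots> \<le> B / s" using s u by (intro divide_right_mono) auto
    also have "\<dots> = C * norm v" using e False by (simp add: s_def C_def field_simps)
    finally show ?thesis using 1 by blast
  qed (intro exI[of _ 0], simp)
  then obtain g where g: "\<And>v. norm (g v) \<le> C * norm v" "\<And>v. norm (v - T (g v)) \<le> norm v / 2" by metis
  show thesis
  proof (rule that[of "2 * C"])
    fix u
    define res where "res n = ((\<lambda>v. v - T (g v)) ^^ n) (T u)" for n
    have res: "norm (res n) \<le> norm (T u) * (1 / 2) ^ n" for n
    proof (induction n)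
      case (Suc n)
      have "norm (res (Suc n)) \<le> norm (res n) / 2" using g(2)[of "res n"] by (simp add: res_def)
      with Suc show ?case by simp
    qed (simp add: res_def)
    have gn: "norm (g (res n)) \<le> C * norm (T u) * (1 / 2) ^ n" for n
      using order_trans[OF g(1) mult_left_mono[OF res, of C]] C by (simp add: mult.assoc)
    have sm: "summable (\<lambda>n. C * norm (T u) * (1 / 2) ^ n)" by (intro summable_mult summable_geometric) simp
    have sg: "summable (\<lambda>n. g (res n))" by (rule summable_comparison_test'[OF sm, of 0]) (use gn in auto)
    have part: "(\<Sum>i<n. T (g (res i))) = T u - res n" for n
      by (induction n) (auto simp: res_def)
    have "res \<longlonglongrightarrow> 0"
    proof (rule Lim_null_comparison[OF always_eventually, rule_format])
      show "norm (res n) \<le> norm (T u) * (1 / 2) ^ n" for n by (rule res)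
      show "(\<lambda>n. norm (T u) * (1 / 2) ^ n) \<longlonglongrightarrow> 0"
        by (intro tendsto_mult_right_zero LIMSEQ_power_zero) simp
    qed
    hence "(\<lambda>n. T u - res n) \<longlonglongrightarrow> T u - 0" by (intro tendsto_intros)
    hence "(\<lambda>n. T (g (res n))) sums T u" by (simp add: sums_def part)
    moreover have "(\<lambda>n. T (g (res n))) sums T (\<Sum>n. g (res n))"
      by (rule T.sums[OF summable_sums[OF sg]])
    ultimately have "T (\<Sum>n. g (res n)) = T u" by (rule sums_unique2[symmetric])
    hence "u = (\<Sum>n. g (res n))" using inj[of "u - (\<Sum>n. g (res n))"] by (simp add: T.diff)
    also have "norm \<dots> \<le> (\<Sum>n. C * norm (T u) * (1 / 2) ^ n)"
      by (rule norm_suminf_le[OF gn sm])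
    also have "\<dots> = 2 * C * norm (T u)"
      using suminf_mult[OF summable_geometric[of "1 / 2 :: real"], of "C * norm (T u)"] suminf_geometric[of "1 / 2 :: real"]
      by simp
    finally show "norm u \<le> 2 * C * norm (T u)" .
  qed (use C in simp)
qed

lemma fredholm_simple_kernel:
  assumes T: "T \<in> fredholm_index_zero" and ker: "zero_set T = span {\<phi>}" and \<phi>: "\<phi> \<noteq> 0"
  obtains \<psi> where "\<psi> \<notin> range T" "\<And>v. \<exists>c u. v = c *\<^sub>R \<psi> + T u"
proof -
  obtain B C where BC: "finite B" "independent B" "span B = zero_set T"
    "finite C" "independent C" "span C \<inter> range T = {0}"
    "{x + y |x y. x \<in> span C \<and> y \<in> range T} = UNIV" "card B = card C"
    using T unfolding fredholm_index_zero_def by blast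
  have "dim {\<phi>} = card B" using BC ker by (intro dim_eq_card) auto
  moreover have "dim {\<phi>} = card {\<phi>}" using \<phi> by (intro dim_eq_card refl) simp
  ultimately have "card C = 1" using BC by simp
  then obtain \<psi> where C: "C = {\<psi>}" by (auto simp: card_1_singleton_iff)
  have "\<psi> \<noteq> 0" using BC(5) C by auto
  hence 1: "\<psi> \<notin> range T" using BC(6) C span_base[of \<psi> C] by blast
  have "\<exists>c u. v = c *\<^sub>R \<psi> + T u" for v
  proof -
    have "v \<in> {x + y |x y. x \<in> span C \<and> y \<in> range T}" using BC(7) by blast
    thus ?thesis by (auto simp: C span_singleton)
  qed
  with 1 show ?thesis by (rule that)
qed

lemma bordered_isomorphism:
  fixes T :: "'u::banach \<Rightarrow> 'v::banach"
  assumes T: "bounded_linear T" and ker: "zero_set T = span {\<phi>}"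
    and f: "bounded_linear f" "f \<phi> = 1"
    and \<psi>: "\<psi> \<notin> range T" "\<And>v. \<exists>c u. v = c *\<^sub>R \<psi> + T u"
  obtains R where "bounded_linear R" "\<And>u. R (T u + f u *\<^sub>R \<psi>) = u" "\<And>v. T (R v) + f (R v) *\<^sub>R \<psi> = v"
proof -
  interpret T: bounded_linear T by fact
  interpret f: bounded_linear f by fact
  define J where "J u = T u + f u *\<^sub>R \<psi>" for u
  have J: "bounded_linear J"
    unfolding J_def by (intro bounded_linear_add T bounded_linear_compose[OF bounded_linear_scaleR_left f(1)])
  interpret J: bounded_linear J by fact
  have T\<phi>: "T \<phi> = 0" using ker span_base[of \<phi> "{\<phi>}"] by blast
  have inj: "u = 0" if "J u = 0" for u
  proof -
    have "f u = 0"
    proof (rule ccontr)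
      assume "f u \<noteq> 0"
      moreover have "f u *\<^sub>R \<psi> = T (- u)" using that by (simp add: J_def T.neg add_eq_0_iff)
      ultimately have "\<psi> = T ((1 / f u) *\<^sub>R (- u))" by (metis T.scaleR divide_self_if scaleR_one scaleR_scaleR times_divide_eq_left mult_1)
      thus False using \<psi>(1) by blast
    qed
    moreover from this have "T u = 0" using that by (simp add: J_def)
    hence "u \<in> span {\<phi>}" using ker by blast
    then obtain c where "u = c *\<^sub>R \<phi>" by (auto simp: span_singleton)
    ultimately show ?thesis using f(2) by (simp add: f.scaleR)
  qed
  have surj: "surj J"
  proof -
    have "\<exists>u. v = J u" for v
    proof -
      obtain c u where "v = c *\<^sub>R \<psi> + T u" using \<psi>(2) by blast
      hence "v = J (u + (c - f u) *\<^sub>R \<phi>)"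
        by (simp add: J_def T.add T.scaleR f.add f.scaleR T\<phi> f(2) add.commute)
      thus ?thesis ..
    qed
    thus ?thesis by (auto simp: surj_def)
  qed
  obtain C where C: "C > 0" "\<And>u. norm u \<le> C * norm (J u)" using bounded_inverse[OF J inj surj] by blast
  have "inj J" using inj J.diff by (metis eq_iff_diff_eq_0 injI)
  define R where "R = inv J"
  have RJ: "R (J u) = u" for u using \<open>inj J\<close> by (simp add: R_def)
  have JR: "J (R v) = v" for v using surj by (simp add: R_def surj_f_inv_f)
  have "bounded_linear R"
  proof (rule bounded_linear_intro[of _ C])
    show "R (x + y) = R x + R y" for x y by (metis JR RJ J.add)
    show "R (c *\<^sub>R x) = c *\<^sub>R R x" for c x by (metis JR RJ J.scaleR)
    show "norm (R x) \<le> norm x * C" for x using C(2)[of "R x"] by (simp add: JR mult.commute)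
  qed
  thus ?thesis using that RJ JR by (simp add: J_def)
qed

section \<open>Sturm's theorem\<close>

lemma sign_changes_simps [simp]:
  "sign_changes [] = 0" "sign_changes [x] = 0" "sign_changes (0 # xs) = sign_changes xs"
  "sign_changes (x # 0 # xs) = sign_changes (x # xs)"
  by (auto simp: sign_changes_def)

lemma sign_changes_Cons_Cons:
  assumes "x \<noteq> 0" "y \<noteq> 0"
  shows "sign_changes (x # y # xs) = (if x * y < 0 then 1 else 0) + sign_changes (y # xs)"
proof -
  define zs where "zs = y # filter (\<lambda>x. x \<noteq> 0) xs"
  have z0: "zs ! 0 = y" "length zs \<ge> 1" by (auto simp: zs_def)
  let ?A = "{i. Suc i < length zs \<and> zs ! i * zs ! Suc i < 0}"
  let ?B = "{i. Suc i < length (x # zs) \<and> (x # zs) ! i * (x # zs) ! Suc i < 0}"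
  have fin: "finite ?A" by (rule finite_subset[of _ "{..<length zs}"]) auto
  have "i \<in> ?B \<longleftrightarrow> i \<in> (if x * y < 0 then {0} else {}) \<union> Suc ` ?A" for i
    using z0 by (cases i) auto
  hence "?B = (if x * y < 0 then {0} else {}) \<union> Suc ` ?A" by blast
  hence "card ?B = card (if x * y < 0 then {0::nat} else {}) + card (Suc ` ?A)"
    using fin by (simp only:) (rule card_Un_disjoint, auto)
  also have "card (Suc ` ?A) = card ?A" by (rule card_image) simp
  finally show ?thesis using assms by (simp add: sign_changes_def zs_def Let_def)
qed

lemma sign_changes_scale:
  assumes "c \<noteq> 0"
  shows "sign_changes (map (\<lambda>i. c * f i) is) = sign_changes (map f is)"
proof -
  have *: "filter (\<lambda>x. x \<noteq> 0) (map (\<lambda>i. c * f i) is) = map ((*) c) (filter (\<lambda>x. x \<noteq> 0) (map f is))"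
    using assms by (simp add: filter_map o_def)
  have "(c * x) * (c * y) < 0 \<longleftrightarrow> x * y < 0" for x y :: real
  proof -
    have "(c * x) * (c * y) = c\<^sup>2 * (x * y)" by (simp add: power2_eq_square)
    moreover have "c\<^sup>2 > 0" using assms by simp
    ultimately show ?thesis using mult_less_0_iff[of "c\<^sup>2" "x * y"] by (metis less_asym)
  qed
  thus ?thesis unfolding sign_changes_def Let_def * by (auto intro!: arg_cong[where f = card])
qed

lemma sign_changes_zeros:
  assumes "m \<le> n" "\<And>i. m < i \<Longrightarrow> i \<le> n \<Longrightarrow> f i = 0"
  shows "sign_changes (map f [0..<Suc n]) = sign_changes (map f [0..<Suc m])"
proof -
  have "[0..<Suc n] = [0..<Suc m] @ [Suc m..<Suc n]"
    using upt_add_eq_append[of 0 "Suc m" "n - m"] assms(1) by simp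
  moreover have "filter (\<lambda>x. x \<noteq> 0) (map f [Suc m..<Suc n]) = []"
    using assms(2) by (auto simp: filter_empty_conv)
  ultimately show ?thesis unfolding sign_changes_def by simp
qed

lemma sign_changes_perturb:
  assumes "\<And>i. i \<le> m \<Longrightarrow> X i \<noteq> 0 \<Longrightarrow> sgn (Y i) = sgn (X i)" "X m \<noteq> 0"
    and alt: "\<And>i. Suc (Suc i) \<le> m \<Longrightarrow> X (Suc i) = 0 \<Longrightarrow> X i * X (Suc (Suc i)) < 0"
    and "i \<le> m" "X i \<noteq> 0"
  shows "sign_changes (map X [i..<Suc m]) = sign_changes (map (Y :: nat \<Rightarrow> real) [i..<Suc m])"
  using assms(4,5)
proof (induction "m - i" arbitrary: i rule: less_induct)
  case less
  have sg: "sgn (X j * X k) = sgn (Y j * Y k)" "Y j \<noteq> 0" if "j \<le> m" "k \<le> m" "X j \<noteq> 0" "X k \<noteq> 0" for j k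
    using assms(1)[of j] assms(1)[of k] that by (auto simp: sgn_mult sgn_eq_0_iff)
  have neg: "X j * X k < 0 \<longleftrightarrow> Y j * Y k < 0" if "j \<le> m" "k \<le> m" "X j \<noteq> 0" "X k \<noteq> 0" for j k
    using sg[OF that] by (metis sgn_less)
  show ?case
  proof (cases "i = m")
    case True thus ?thesis by simp
  next
    case False
    hence i: "i < m" using less.prems by simp
    have u: "[i..<Suc m] = i # Suc i # [Suc (Suc i)..<Suc m]" "[Suc i..<Suc m] = Suc i # [Suc (Suc i)..<Suc m]"
      using i by (simp_all add: upt_conv_Cons)
    show ?thesis
    proof (cases "X (Suc i) = 0")
      case X1: False
      have "sign_changes (map X [Suc i..<Suc m]) = sign_changes (map Y [Suc i..<Suc m])"
        using less.hyps[of "Suc i"] i X1 by auto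
      thus ?thesis
        using sign_changes_Cons_Cons[of "X i" "X (Suc i)"] sign_changes_Cons_Cons[of "Y i" "Y (Suc i)"]
          neg[of i "Suc i"] sg(2)[of i "Suc i"] sg(2)[of "Suc i" i] i X1 less.prems
        unfolding u by simp
    next
      case True
      hence i2: "Suc (Suc i) \<le> m" using i assms(2) by (metis Suc_leI le_neq_implies_less)
      have a: "X i * X (Suc (Suc i)) < 0" by (rule alt[OF i2 True])
      hence X2: "X (Suc (Suc i)) \<noteq> 0" by auto
      have IH: "sign_changes (map X [Suc (Suc i)..<Suc m]) = sign_changes (map Y [Suc (Suc i)..<Suc m])"
        using less.hyps[of "Suc (Suc i)"] i i2 X2 by auto
      have u2: "[Suc (Suc i)..<Suc m] = Suc (Suc i) # [Suc (Suc (Suc i))..<Suc m]"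
        using i2 by (simp add: upt_conv_Cons)
      have b: "Y i * Y (Suc (Suc i)) < 0" using neg[of i "Suc (Suc i)"] a i2 less.prems X2 by auto
      hence Y: "Y i \<noteq> 0" "Y (Suc (Suc i)) \<noteq> 0" by auto
      have "sign_changes (map Y [i..<Suc m]) = 1 + sign_changes (map Y [Suc (Suc i)..<Suc m])"
      proof (cases "Y (Suc i) = 0")
        case True
        thus ?thesis using sign_changes_Cons_Cons[of "Y i" "Y (Suc (Suc i))"] Y b unfolding u u2 by simp
      next
        case False
        have "(Y i * Y (Suc i) < 0) \<noteq> (Y (Suc i) * Y (Suc (Suc i)) < 0)"
          using b False by (auto simp: mult_less_0_iff not_less zero_less_mult_iff)
        thus ?thesis
          using sign_changes_Cons_Cons[of "Y i" "Y (Suc i)"] sign_changes_Cons_Cons[of "Y (Suc i)" "Y (Suc (Suc i))"]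
            Y False unfolding u u2 by auto
      qed
      moreover have "sign_changes (map X [i..<Suc m]) = 1 + sign_changes (map X [Suc (Suc i)..<Suc m])"
        using sign_changes_Cons_Cons[of "X i" "X (Suc (Suc i))"] X2 a less.prems True unfolding u u2 by simp
      ultimately show ?thesis using IH by simp
    qed
  qed
qed

lemma eventually_sgn_poly:
  fixes p :: "real poly"
  assumes "poly p x \<noteq> 0"
  shows "\<forall>\<^sub>F y in nhds x. sgn (poly p y) = sgn (poly p x)"
proof -
  have op: "open {y. 0 < poly p y}" "open {y. poly p y < 0}"
    by (intro open_Collect_less continuous_intros)+
  show ?thesis
  proof (cases "poly p x > 0")
    case True
    thus ?thesis using eventually_nhds_in_open[OF op(1), of x] by (auto elim: eventually_mono)
  next
    case False
    hence neg: "poly p x < 0" using assms by simp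
    thus ?thesis using eventually_nhds_in_open[OF op(2), of x] by (auto elim: eventually_mono)
  qed
qed

lemma eventually_sgn_poly_pderiv:
  fixes p :: "real poly"
  assumes "p \<noteq> 0" "poly p x = 0"
  shows "\<forall>\<^sub>F y in nhds x. sgn (poly p y * poly (pderiv p) y) = sgn (y - x)"
proof -
  obtain k where k: "order x p = Suc k" using assms by (metis not0_implies_Suc order_root)
  obtain r where r: "p = [:- x, 1:] ^ Suc k * r" "\<not> [:- x, 1:] dvd r"
    using order_decomp[OF assms(1), of x] k by auto
  have rx: "poly r x \<noteq> 0" using r(2) by (simp add: poly_eq_0_iff_dvd)
  define s where "s = r * (smult (of_nat (Suc k)) r + [:- x, 1:] * pderiv r)"
  have "poly s x = of_nat (Suc k) * (poly r x)\<^sup>2" by (simp add: s_def power2_eq_square)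
  moreover have "\<dots> > 0" using rx by (intro mult_pos_pos) auto
  ultimately have sx: "poly s x > 0" by simp
  have eq: "poly p y * poly (pderiv p) y = (y - x) * ((y - x) ^ k)\<^sup>2 * poly s y" for y
  proof -
    have "pderiv p = [:- x, 1:] ^ Suc k * pderiv r + r * (smult (of_nat (Suc k)) ([:- x, 1:] ^ k) * pderiv [:- x, 1:])"
      unfolding r(1) by (simp only: pderiv_mult pderiv_power_Suc)
    hence "poly (pderiv p) y = (y - x) ^ Suc k * poly (pderiv r) y + poly r y * (of_nat (Suc k) * (y - x) ^ k)"
      by (simp add: pderiv_pCons left_diff_distrib)
    moreover have "poly [:- x, 1:] y = y - x" by simp
    hence "poly p y = (y - x) ^ Suc k * poly r y" by (simp only: r(1) poly_mult poly_power)
    moreover have "(y - x) ^ Suc k = (y - x) * (y - x) ^ k" by simp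
    ultimately show ?thesis
      by (simp only: s_def power2_eq_square poly_mult poly_add poly_smult poly_pCons poly_0)
         (simp add: algebra_simps del: power_Suc)
  qed
  have "\<forall>\<^sub>F y in nhds x. sgn (poly s y) = sgn (poly s x)" using sx by (intro eventually_sgn_poly) simp
  thus ?thesis
  proof eventually_elim
    case (elim y)
    show ?case
    proof (cases "y = x")
      case False
      hence "((y - x) ^ k)\<^sup>2 > 0" by simp
      hence "sgn (((y - x) ^ k)\<^sup>2) = 1" by (rule sgn_pos)
      moreover have "sgn (poly s y) = 1" using elim sx by simp
      ultimately show ?thesis unfolding eq sgn_mult by simp
    qed (simp add: eq)
  qed
qed

locale sturm_setup =
  fixes q :: "real poly" and m :: nat and g :: "nat \<Rightarrow> real poly" and d :: "real poly"
  assumes q0: "q \<noteq> 0"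
    and chain: "\<And>i. sturm_chain q i = d * g i"
    and gm: "g m = 1"
    and rec: "\<And>i. i < m \<Longrightarrow> \<exists>h. g i + g (Suc (Suc i)) = h * g (Suc i)"
begin

lemma g0_nonzero: "g 0 \<noteq> 0"
  using q0 chain[of 0] by auto

lemma no_common_zero:
  assumes "i < m" "poly (g i) x = 0"
  shows "poly (g (Suc i)) x \<noteq> 0"
proof
  assume z: "poly (g (Suc i)) x = 0"
  have "poly (g (i + j)) x = 0 \<and> poly (g (Suc (i + j))) x = 0" if "i + j \<le> m" for j
    using that
  proof (induction j)
    case (Suc j)
    obtain h where "g (i + j) + g (Suc (Suc (i + j))) = h * g (Suc (i + j))" using rec[of "i + j"] Suc.prems by auto
    from arg_cong[OF this, of "\<lambda>p. poly p x"] show ?case using Suc by simp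
  qed (use assms z in simp)
  from this[of "m - i"] assms(1) show False by (simp add: gm)
qed

lemma alternate:
  assumes "Suc (Suc i) \<le> m" "poly (g (Suc i)) x = 0"
  shows "poly (g i) x * poly (g (Suc (Suc i))) x < 0"
proof -
  obtain h where "g i + g (Suc (Suc i)) = h * g (Suc i)" using rec[of i] assms by auto
  from arg_cong[OF this, of "\<lambda>p. poly p x"] have "poly (g i) x = - poly (g (Suc (Suc i))) x"
    using assms by simp
  moreover have "poly (g (Suc (Suc i))) x \<noteq> 0" using no_common_zero[of "Suc i"] assms by simp
  ultimately show ?thesis by (auto simp: mult_less_0_iff zero_less_mult_iff neq_iff)
qed

lemma root_iff: "poly (g 0) x = 0 \<longleftrightarrow> poly q x = 0"
proof
  assume z: "poly q x = 0"
  have q: "q = d * g 0" "pderiv q = d * g 1" using chain[of 0] chain[of 1] by simp_all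
  have pq: "pderiv q \<noteq> 0"
  proof
    assume "pderiv q = 0"
    then obtain c where "q = [:c:]" by (metis pderiv_eq_0_iff degree_0_id degree_eq_zeroE)
    thus False using z q0 by simp
  qed
  have "order x q = Suc (order x (pderiv q))" using pq z q0 by (intro order_pderiv) (auto simp: order_root)
  also have "order x (pderiv q) = order x d + order x (g 1)" using pq q(2) order_mult[of d "g 1" x] by simp
  finally have "order x d < order x q" by simp
  moreover have "order x q = order x d + order x (g 0)" using q0 q(1) order_mult[of d "g 0" x] by simp
  ultimately show "poly (g 0) x = 0" by (metis add_0_right less_irrefl order_root)
qed (use chain[of 0] in simp)

definition W :: "real \<Rightarrow> nat" where "W x = sign_changes (map (\<lambda>i. poly (g i) x) [0..<Suc m])"

lemma W_local:
  "\<forall>\<^sub>F y in nhds x. W y = W x + (if poly (g 0) x = 0 \<and> y < x then 1 else 0)"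
proof -
  have "\<forall>\<^sub>F y in nhds x. \<forall>i\<in>{..m}. poly (g i) x \<noteq> 0 \<longrightarrow> sgn (poly (g i) y) = sgn (poly (g i) x)"
    by (intro eventually_ball_finite) (auto intro!: eventually_sgn_poly intro: eventually_mono)
  note ev = this
  have pert: "sign_changes (map (\<lambda>i. poly (g i) x) [i..<Suc m]) = sign_changes (map (\<lambda>i. poly (g i) y) [i..<Suc m])"
    if "\<forall>i\<in>{..m}. poly (g i) x \<noteq> 0 \<longrightarrow> sgn (poly (g i) y) = sgn (poly (g i) x)" "i \<le> m" "poly (g i) x \<noteq> 0" for i y
    using that by (intro sign_changes_perturb) (auto simp: gm alternate)
  show ?thesis
  proof (cases "poly (g 0) x = 0")
    case False
    show ?thesis using ev by eventually_elim (use False pert[of _ 0] in \<open>simp add: W_def\<close>)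
  next
    case True
    hence "m \<noteq> 0" using gm by (intro notI) simp
    then obtain m' where m': "m = Suc m'" by (cases m) auto
    have g1: "poly (g 1) x \<noteq> 0" using no_common_zero[of 0] True m' by simp
    have "poly q x = 0" using True root_iff by simp
    from eventually_sgn_poly_pderiv[OF q0 this] ev
    show ?thesis
    proof eventually_elim
      case (elim y)
      have u: "[0..<Suc m] = 0 # Suc 0 # [Suc (Suc 0)..<Suc m]" "[Suc 0..<Suc m] = Suc 0 # [Suc (Suc 0)..<Suc m]"
        by (simp_all add: m' upt_conv_Cons del: upt_Suc)
      have Wx: "W x = sign_changes (map (\<lambda>i. poly (g i) x) [Suc 0..<Suc m])"
        unfolding W_def u using True by simp
      also have "\<dots> = sign_changes (map (\<lambda>i. poly (g i) y) [Suc 0..<Suc m])"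
        by (rule pert) (use elim(2) g1 m' in auto)
      finally have Wx: "W x = sign_changes (map (\<lambda>i. poly (g i) y) [Suc 0..<Suc m])" .
      show ?case
      proof (cases "y = x")
        case False
        have "poly q y * poly (pderiv q) y = (poly d y)\<^sup>2 * (poly (g 0) y * poly (g 1) y)"
          using chain[of 0] chain[of 1] by (simp add: power2_eq_square)
        with elim(1) have s: "sgn ((poly d y)\<^sup>2 * (poly (g 0) y * poly (g 1) y)) = sgn (y - x)" by simp
        hence nz: "poly d y \<noteq> 0" using False by (auto simp: sgn_eq_0_iff)
        hence "(poly d y)\<^sup>2 > 0" by simp
        hence "sgn ((poly d y)\<^sup>2) = 1" by (rule sgn_pos)
        hence s': "sgn (poly (g 0) y * poly (g 1) y) = sgn (y - x)" using s by (simp only: sgn_mult mult_1)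
        hence nz: "poly (g 0) y \<noteq> 0" "poly (g 1) y \<noteq> 0" using False by (auto simp: sgn_eq_0_iff)
        have "poly (g 0) y * poly (g (Suc 0)) y < 0 \<longleftrightarrow> y < x"
          using s' by (metis One_nat_def diff_less_0_iff_less sgn_less)
        thus ?thesis
          using sign_changes_Cons_Cons[of "poly (g 0) y" "poly (g (Suc 0)) y"] nz True
          unfolding Wx by (subst W_def) (simp add: u del: upt_Suc)
      qed simp
    qed
  qed
qed

lemma W_count:
  assumes "a < b" "poly q a \<noteq> 0" "poly q b \<noteq> 0"
  shows "W a = W b + card {x \<in> {a<..<b}. poly q x = 0}"
proof -
  define R where "R = {x. poly (g 0) x = 0}"
  have finR: "finite R" unfolding R_def by (rule poly_roots_finite[OF g0_nonzero])
  define N where "N x = W x + card (R \<inter> {a<..x})" for x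
  have loc: "\<forall>\<^sub>F y in nhds x. y \<in> {a..b} \<longrightarrow> N y = N x" if x: "x \<in> {a..b}" for x
  proof -
    have "open (- (R - {x}))" using finR by (intro open_Compl finite_imp_closed) auto
    from openE[OF this, of x] obtain e where "e > 0" "ball x e \<subseteq> - (R - {x})" by blast
    hence e: "e > 0" "\<And>y. dist y x < e \<Longrightarrow> y \<notin> R - {x}" by (auto simp: dist_commute subset_iff)
    have "\<forall>\<^sub>F y in nhds x. dist y x < e" using e(1) by (auto simp: eventually_nhds_metric)
    with W_local[of x] show ?thesis
    proof eventually_elim
      case (elim y)
      have nr: "z \<notin> R" if "z \<noteq> x" "\<bar>z - x\<bar> \<le> \<bar>y - x\<bar>" for z
        using e(2)[of z] that elim(2) by (auto simp: dist_real_def)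
      show ?case
      proof (intro impI)
        assume y: "y \<in> {a..b}"
        show "N y = N x"
        proof (cases "y < x")
          case True
          have "R \<inter> {a<..x} = R \<inter> {a<..y} \<union> (if x \<in> R then {x} else {})"
          proof -
            have "z \<le> y" if "z \<in> R" "z \<le> x" "z \<noteq> x" for z
              using nr[of z] that True by (cases "z \<le> y") auto
            hence "z \<le> y \<or> z = x" if "z \<in> R" "z \<le> x" for z using that by blast
            moreover have "x \<in> {a<..x}" using True y by simp
            ultimately show ?thesis using True by (auto simp: less_imp_le split: if_splits) fastforce+
          qed
          moreover have "card (R \<inter> {a<..y} \<union> (if x \<in> R then {x} else {})) = card (R \<inter> {a<..y}) + (if x \<in> R then 1 else 0)"
            using finR True by (subst card_Un_disjoint) auto
          ultimately show ?thesis using elim(1) True by (auto simp: N_def R_def)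
        next
          case False
          have "R \<inter> {a<..y} = R \<inter> {a<..x}"
          proof -
            have "z \<le> x" if "z \<in> R" "z \<le> y" for z
              using nr[of z] that False by (cases "z \<le> x") auto
            thus ?thesis using False by auto
          qed
          thus ?thesis using elim(1) False by (simp add: N_def)
        qed
      qed
    qed
  qed
  have "N constant_on {a..b}"
  proof (rule locally_constant_imp_constant)
    fix x assume x: "x \<in> {a..b}"
    obtain S where S: "open S" "x \<in> S" "\<And>y. y \<in> S \<Longrightarrow> y \<in> {a..b} \<Longrightarrow> N y = N x"
      using loc[OF x] by (auto simp: eventually_nhds)
    show "\<exists>T. openin (top_of_set {a..b}) T \<and> x \<in> T \<and> (\<forall>y\<in>T. N y = N x)"
    proof (intro exI[of _ "{a..b} \<inter> S"] conjI ballI)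
      show "openin (top_of_set {a..b}) ({a..b} \<inter> S)" by (rule openin_open_Int[OF S(1)])
    qed (use S x in blast)+
  qed simp
  hence "N a = N b" using assms(1) by (auto simp: constant_on_def)
  moreover have "R \<inter> {a<..a} = {}" by auto
  moreover have "R \<inter> {a<..b} = {x \<in> {a<..<b}. poly q x = 0}"
    using assms by (auto simp: R_def root_iff order.order_iff_strict)
  ultimately show ?thesis by (simp add: N_def)
qed

end

theorem sturm:
  fixes q :: "real poly"
  assumes q: "q \<noteq> 0" "degree q \<le> n" and ab: "a < b" "poly q a \<noteq> 0" "poly q b \<noteq> 0"
  shows "sign_changes (map (\<lambda>i. poly (sturm_chain q i) a) [0..<Suc n]) =
    sign_changes (map (\<lambda>i. poly (sturm_chain q i) b) [0..<Suc n]) + card {x \<in> {a<..<b}. poly q x = 0}"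
proof -
  let ?f = "sturm_chain q"
  have step: "?f i = (?f i div ?f (Suc i)) * ?f (Suc i) - ?f (Suc (Suc i))" if "?f (Suc i) \<noteq> 0" for i
    using that by (simp add: div_mult_mod_eq)
  have deg: "degree (?f i) + i \<le> degree q" if "?f i \<noteq> 0" for i
    using that
  proof (induction q i rule: sturm_chain.induct)
    case (2 q)
    hence "degree q > 0" by (metis pderiv_eq_0_iff gr0I sturm_chain.simps(2))
    thus ?case by (simp add: degree_pderiv)
  next
    case (3 q i)
    hence nz: "sturm_chain q (Suc i) \<noteq> 0" "sturm_chain q i mod sturm_chain q (Suc i) \<noteq> 0"
      by (auto split: if_splits)
    hence "degree (sturm_chain q i mod sturm_chain q (Suc i)) < degree (sturm_chain q (Suc i))"
      using degree_mod_less' by blast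
    with 3(1) nz show ?case by simp
  qed simp
  have "?f (Suc (degree q)) = 0" using deg[of "Suc (degree q)"] by auto
  hence ex: "\<exists>i. ?f (Suc i) = 0" by blast
  define m where "m = (LEAST i. ?f (Suc i) = 0)"
  have m: "?f (Suc m) = 0" unfolding m_def by (rule LeastI_ex[OF ex])
  have nz: "?f i \<noteq> 0" if "i \<le> m" for i
    using not_less_Least[of "i - 1" "\<lambda>i. ?f (Suc i) = 0"] that q(1) by (cases i) (auto simp: m_def)
  have zero: "?f (Suc (m + j)) = 0" for j
    by (induction j) (use m in auto)
  have mn: "m \<le> n" using deg[OF nz[OF order.refl]] q(2) by simp
  define d where "d = ?f m"
  have dvd: "d dvd ?f (m - j) \<and> d dvd ?f (Suc (m - j))" for j
  proof (induction j)
    case (Suc j)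
    show ?case
    proof (cases "j < m")
      case True
      hence S: "Suc (m - Suc j) = m - j" by simp
      have "?f (Suc (m - Suc j)) \<noteq> 0" unfolding S by (rule nz) simp
      from step[OF this] have "?f (m - Suc j) = (?f (m - Suc j) div ?f (m - j)) * ?f (m - j) - ?f (Suc (m - j))"
        unfolding S .
      hence "d dvd ?f (m - Suc j)" using Suc.IH by (metis dvd_diff dvd_mult)
      thus ?thesis using Suc.IH by (simp only: S)
    next
      case False
      thus ?thesis using Suc.IH by simp
    qed
  qed (simp add: d_def m)
  have dvd': "d dvd ?f i" for i
  proof (cases "i \<le> m")
    case True
    thus ?thesis using dvd[of "m - i"] by simp
  next
    case False
    thus ?thesis using zero[of "i - Suc m"] by simp
  qed
  define g where "g i = ?f i div d" for i
  have chain: "?f i = d * g i" for i using dvd'[of i] by (simp add: g_def)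
  have d0: "d \<noteq> 0" using nz[of m] by (simp add: d_def)
  interpret sturm_setup q m g d
  proof
    show "q \<noteq> 0" by fact
    show "sturm_chain q i = d * g i" for i by (rule chain)
    show "g m = 1" using d0 by (simp add: g_def d_def)
    fix i assume "i < m"
    hence "?f (Suc i) \<noteq> 0" using nz by simp
    from step[OF this] have "d * (g i + g (Suc (Suc i))) = d * ((?f i div ?f (Suc i)) * g (Suc i))"
      by (simp only: chain[symmetric] distrib_left mult.left_commute[of d])
    thus "\<exists>h. g i + g (Suc (Suc i)) = h * g (Suc i)" using d0 by (metis mult_cancel_left)
  qed
  have V: "sign_changes (map (\<lambda>i. poly (?f i) x) [0..<Suc n]) = W x" if "poly q x \<noteq> 0" for x
  proof -
    have "poly d x \<noteq> 0" using that chain[of 0] by auto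
    moreover have "sign_changes (map (\<lambda>i. poly (?f i) x) [0..<Suc n]) = sign_changes (map (\<lambda>i. poly (?f i) x) [0..<Suc m])"
    proof (rule sign_changes_zeros[OF mn])
      fix i assume "m < i"
      thus "poly (?f i) x = 0" using zero[of "i - Suc m"] by simp
    qed
    ultimately show ?thesis
      using sign_changes_scale[of "poly d x" "\<lambda>i. poly (g i) x" "[0..<Suc m]"] by (simp add: W_def chain del: upt_Suc)
  qed
  show ?thesis using W_count[OF ab] V[OF ab(2)] V[OF ab(3)] by simp
qed

section \<open>An analytic implicit function theorem\<close>

text \<open>
  The fixed point is found in the space of power series, so that its analyticity is automatic.
\<close>

lemma analytic_fixpoint:
  fixes h :: "(real \<times> real) \<times> 'u::banach \<Rightarrow> 'u"
  assumes an: "real_analytic_at h 0" and h0: "h 0 = 0"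
    and T: "((\<lambda>u. h (0, u)) has_derivative T) (at 0)" and half: "\<And>u. norm (T u) \<le> norm u / 2"
  obtains \<rho> u where "\<rho> > 0" "real_analytic_on (ball 0 \<rho>) u" "u 0 = 0"
    "\<And>w. w \<in> ball 0 \<rho> \<Longrightarrow> h (w, u w) = u w"
proof -
  obtain M K r where M: "power_coeffs M K r"
    and s: "\<And>v. norm v < r \<Longrightarrow> (\<lambda>n. M n (\<lambda>_. v)) sums h (0 + v)"
    using an unfolding real_analytic_at_iff by blast
  note D = power_coeffsD[OF M] and MM = power_coeffs_mlift[OF M]
  obtain C1 where C1: "C1 \<ge> 0" and est1:
    "\<And>h k R s t. \<lbrakk>norm h \<le> R; norm k \<le> R; R \<le> r / 2;
        (\<lambda>n. M n (\<lambda>_. h)) sums s; (\<lambda>n. M n (\<lambda>_. k)) sums t\<rbrakk>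
      \<Longrightarrow> norm (s - t - M 1 (\<lambda>_. h - k)) \<le> C1 * R * norm (h - k)"
    using power_coeffs_strict[OF M] by blast
  obtain C2 where C2: "C2 \<ge> 0" and est2:
    "\<And>h k R s t. \<lbrakk>norm h \<le> R; norm k \<le> R; R \<le> r / 2;
        (\<lambda>n. mlift n (M n) (\<lambda>_. h)) sums s; (\<lambda>n. mlift n (M n) (\<lambda>_. k)) sums t\<rbrakk>
      \<Longrightarrow> norm (s - t - mlift 1 (M 1) (\<lambda>_. h - k)) \<le> C2 * R * norm (h - k)"
    using power_coeffs_strict[OF MM] by blast
  define L where "L = (\<lambda>v. M 1 (\<lambda>_. v))"
  have L: "bounded_linear L" unfolding L_def by (rule bounded_linear_power_coeff_1[OF D(2)])
  have bl0: "bounded_linear (\<lambda>u::'u. (0::real \<times> real, u))"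
    by (intro bounded_linear_Pair bounded_linear_zero bounded_linear_ident)
  have n0: "norm (0::real \<times> real, u) = norm u" for u :: 'u by (simp add: norm_Pair)
  have strict1: "norm (h v - h v' - L (v - v')) \<le> C1 * R * norm (v - v')"
    if "norm v \<le> R" "norm v' \<le> R" "R \<le> r / 2" for v v' R
    unfolding L_def using that D(1) s[of v] s[of v'] by (intro est1) auto
  have LT: "L (0, u) = T u" for u
  proof -
    have "((\<lambda>u. h (0, u)) has_derivative (\<lambda>u. L (0, u))) (at 0)"
    proof (rule has_derivative_quadraticI[OF bounded_linear_compose[OF L bl0] C1, of "r / 2"])
      show "norm (h (0, 0 + u) - h (0, 0) - L (0, u)) \<le> C1 * norm u * norm u" if "norm u \<le> r / 2" for u
        using strict1[of "(0, u)" "norm u" "(0, 0)"] that unfolding diff_Pair diff_zero add_0 n0 norm_zero by simp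
    qed (use D(1) in simp)
    from has_derivative_unique[OF this T] show ?thesis by (rule fun_cong)
  qed
  have M0: "M 0 x = 0" for x
  proof -
    have "(\<lambda>n. M n (\<lambda>_. 0)) = (\<lambda>n. if n = 0 then M 0 (\<lambda>_. 0) else 0)"
      using bounded_multilinear_eq_0[OF D(2), of 0 _ "\<lambda>_. 0"] by (auto simp: fun_eq_iff)
    hence "M 0 (\<lambda>_. 0) = h 0" using s[of 0] D(1) sums_single[of 0 "\<lambda>_. M 0 (\<lambda>_. 0)"] by (simp add: sums_iff)
    moreover have "M 0 x = M 0 (\<lambda>_. 0)" by (rule bounded_multilinearD(2)[OF D(2)]) simp
    ultimately show ?thesis using h0 by simp
  qed
  have m0: "(\<lambda>n. mlift n (M n) (\<lambda>_. 0)) sums 0"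
  proof -
    have "mlift n (M n) (\<lambda>_. 0) = 0" for n
    proof (cases n)
      case 0
      thus ?thesis by (intro ell1_eqI) (simp add: mlift_bound(1)[OF D(2)] M0)
    next
      case (Suc k)
      thus ?thesis using bounded_multilinear_eq_0[OF bounded_multilinear_mlift[OF D(2)], of 0 n "\<lambda>_. 0"] by simp
    qed
    thus ?thesis by simp
  qed

  define R where "R = min (r / 8) (1 / (8 * (C1 + C2 + 1)))"
  have R: "R > 0" "2 * R \<le> r / 2" using D(1) C1 C2 by (auto simp: R_def)
  have CR: "C1 * (2 * R) \<le> 1 / 4" "C2 * (2 * R) \<le> 1 / 4"
  proof -
    have "R \<le> 1 / (8 * (C1 + C2 + 1))" by (simp add: R_def)
    hence "R * (8 * (C1 + C2 + 1)) \<le> 1" using C1 C2 by (subst (asm) pos_le_divide_eq) auto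
    moreover have "R * C1 \<ge> 0" "R * C2 \<ge> 0" using R C1 C2 by auto
    ultimately show "C1 * (2 * R) \<le> 1 / 4" "C2 * (2 * R) \<le> 1 / 4" using R by (simp_all add: algebra_simps)
  qed
  define \<rho> where "\<rho> = min (R / 2) (R / (8 * (K 1 + 1)))"
  have K1: "K 1 \<ge> 0" by (rule D(4))
  have \<rho>: "\<rho> > 0" "2 * \<rho> \<le> R" "(K 1 + 1) * (2 * \<rho>) \<le> R / 4"
  proof -
    show "\<rho> > 0" "2 * \<rho> \<le> R" using R K1 by (auto simp: \<rho>_def)
    have "\<rho> \<le> R / (8 * (K 1 + 1))" by (simp add: \<rho>_def)
    hence "\<rho> * (8 * (K 1 + 1)) \<le> R" using K1 by (simp add: pos_le_divide_eq)
    thus "(K 1 + 1) * (2 * \<rho>) \<le> R / 4" by (simp add: algebra_simps)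
  qed
  define x :: "((real \<times> real) \<times> 'u) ell1"
    where "x = \<rho> *\<^sub>R (single (1,0) ((1,0),0) + single (0,1) ((0,1),0))"
  have nx: "norm x \<le> 2 * \<rho>"
  proof -
    have "norm (single (1,0) ((1::real,0::real),0::'u) + single (0,1) ((0,1),0)) \<le> 2"
      by (rule order_trans[OF norm_triangle_ineq]) (simp add: norm_Pair)
    thus ?thesis using \<rho>(1) by (simp add: x_def mult.commute)
  qed
  have ex: "ev w x = (\<rho> *\<^sub>R w, 0)" if "w \<in> unit_square" for w
  proof -
    interpret E: bounded_linear "ev w :: ((real \<times> real) \<times> 'u) ell1 \<Rightarrow> _" by (rule bounded_linear_ev[OF that])
    show ?thesis by (simp add: x_def E.scaleR E.add monom2_def prod_eq_iff)
  qed
  define \<iota> where "\<iota> = emap (\<lambda>u::'u. (0::real \<times> real, u))"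
  have bl\<iota>: "bounded_linear \<iota>" unfolding \<iota>_def by (rule bounded_linear_emap[OF bl0])
  interpret I: bounded_linear \<iota> by (rule bl\<iota>)
  have n\<iota>: "norm (\<iota> a) \<le> norm a" for a
    using emap_bound(2)[of "\<lambda>u::'u. (0::real \<times> real, u)" 1 a] by (simp add: \<iota>_def n0)
  have e\<iota>: "ev w (\<iota> a) = (0, ev w a)" if "w \<in> unit_square" for w a
    unfolding \<iota>_def by (rule ev_emap[OF bl0 that])
  have bm1: "bounded_multilinear 1 (mlift 1 (M 1)) (K 1)" by (rule bounded_multilinear_mlift[OF D(2)])
  have blT: "bounded_linear T" by (rule has_derivative_bounded_linear[OF T])
  have lin1: "mlift 1 (M 1) (\<lambda>_. \<iota> a) = emap T a" for a
  proof (rule bounded_linear_ell1_eqI[of "\<lambda>a. mlift 1 (M 1) (\<lambda>_. \<iota> a)" "emap T"])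
    show "bounded_linear (\<lambda>a. mlift 1 (M 1) (\<lambda>_. \<iota> a))"
      by (rule bounded_linear_compose[OF bounded_linear_power_coeff_1[OF bm1] bl\<iota>])
    show "bounded_linear (emap T)" by (rule bounded_linear_emap[OF blT])
    fix j v
    have "mlift 1 (M 1) (\<lambda>_. single j (0, v)) = single (\<Sum>i<1::nat. j) (M 1 (\<lambda>_. (0, v)))"
      by (rule mlift_single[OF D(2)]) simp
    also have "\<dots> = single j (T v)" using LT[of v] by (simp add: L_def)
    finally show "mlift 1 (M 1) (\<lambda>_. \<iota> (single j v)) = emap T (single j v)"
      by (simp add: \<iota>_def emap_single[OF bl0] emap_single[OF blT])
  qed
  have nT: "norm (emap T a) \<le> norm a / 2" for a
    using emap_bound(2)[of T "1 / 2" a] half by simp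

  define \<Phi> where "\<Phi> a = (\<Sum>n. mlift n (M n) (\<lambda>_. x + \<iota> a))" for a
  have nv: "norm (x + \<iota> a) \<le> 2 * R" if "norm a \<le> R" for a
    using norm_triangle_ineq[of x "\<iota> a"] nx n\<iota>[of a] \<rho>(2) that by linarith
  have \<Phi>: "(\<lambda>n. mlift n (M n) (\<lambda>_. x + \<iota> a)) sums \<Phi> a"
      "\<And>w. w \<in> unit_square \<Longrightarrow> ev w (\<Phi> a) = h (\<rho> *\<^sub>R w, ev w a)" if a: "norm a \<le> R" for a
  proof -
    have "norm (x + \<iota> a) \<le> r" using nv[OF a] R by simp
    then obtain b where b: "(\<lambda>n. mlift n (M n) (\<lambda>_. x + \<iota> a)) sums b"
      "\<And>w. w \<in> unit_square \<Longrightarrow> (\<lambda>n. M n (\<lambda>_. ev w (x + \<iota> a))) sums ev w b"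
      by (rule power_coeffs_mlift_sums[OF M]) (rule that)
    have "b = \<Phi> a" using b(1) by (simp add: \<Phi>_def sums_iff)
    with b show "(\<lambda>n. mlift n (M n) (\<lambda>_. x + \<iota> a)) sums \<Phi> a" by simp
    fix w assume w: "w \<in> unit_square"
    interpret E: bounded_linear "ev w :: ((real \<times> real) \<times> 'u) ell1 \<Rightarrow> _" by (rule bounded_linear_ev[OF w])
    have e: "ev w (x + \<iota> a) = (\<rho> *\<^sub>R w, ev w a)" by (simp add: E.add ex[OF w] e\<iota>[OF w])
    have "norm (ev w (x + \<iota> a)) < r" using norm_ev_le[OF w, of "x + \<iota> a"] nv[OF a] R by linarith
    from s[OF this] b(2)[OF w] show "ev w (\<Phi> a) = h (\<rho> *\<^sub>R w, ev w a)"
      unfolding e \<open>b = \<Phi> a\<close> by (simp add: sums_iff)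
  qed
  have contr: "norm (\<Phi> a - \<Phi> b) \<le> 3 / 4 * norm (a - b)" if ab: "norm a \<le> R" "norm b \<le> R" for a b
  proof -
    have d: "(x + \<iota> a) - (x + \<iota> b) = \<iota> (a - b)" by (simp add: I.diff)
    have "norm (\<Phi> a - \<Phi> b - mlift 1 (M 1) (\<lambda>_. (x + \<iota> a) - (x + \<iota> b)))
        \<le> C2 * (2 * R) * norm ((x + \<iota> a) - (x + \<iota> b))"
      using ab R by (intro est2 \<Phi>(1) nv)
    hence "norm (\<Phi> a - \<Phi> b - emap T (a - b)) \<le> C2 * (2 * R) * norm (\<iota> (a - b))"
      unfolding d lin1 .
    also have "\<dots> \<le> 1 / 4 * norm (a - b)" using CR n\<iota> by (intro mult_mono) auto
    finally show ?thesis
      using norm_triangle_ineq[of "\<Phi> a - \<Phi> b - emap T (a - b)" "emap T (a - b)"] nT[of "a - b"] by simp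
  qed
  have \<Phi>0: "norm (\<Phi> 0) \<le> R / 4"
  proof -
    have x0: "x + \<iota> 0 = x" by (simp add: I.zero)
    have "norm (\<Phi> 0 - 0 - mlift 1 (M 1) (\<lambda>_. x - 0)) \<le> C2 * (2 * R) * norm (x - 0)"
      using R nx \<rho> \<Phi>(1)[of 0] by (intro est2 m0) (auto simp: x0)
    also have "\<dots> \<le> 1 / 4 * (2 * \<rho>)" using CR nx by (intro mult_mono) auto
    finally have 1: "norm (\<Phi> 0 - mlift 1 (M 1) (\<lambda>_. x)) \<le> \<rho> / 2" by simp
    have "norm (mlift 1 (M 1) (\<lambda>_. x)) \<le> K 1 * norm x"
      using mlift_bound(2)[OF D(2)[of 1], of "\<lambda>_. x"] by simp
    also have "\<dots> \<le> K 1 * (2 * \<rho>)" by (intro mult_left_mono nx K1)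
    finally have 2: "norm (mlift 1 (M 1) (\<lambda>_. x)) \<le> K 1 * (2 * \<rho>)" .
    show ?thesis
      using norm_triangle_ineq[of "\<Phi> 0 - mlift 1 (M 1) (\<lambda>_. x)" "mlift 1 (M 1) (\<lambda>_. x)"] 1 2 \<rho>(1,3)
      by (simp add: distrib_right)
  qed
  have "\<exists>!a\<in>cball 0 R. \<Phi> a = a"
  proof (rule Banach_fix[where c = "3 / 4"])
    show "complete (cball (0::'u ell1) R)" by (simp add: complete_eq_closed)
    show "cball (0::'u ell1) R \<noteq> {}" using R by simp
    show "dist (\<Phi> a) (\<Phi> b) \<le> 3 / 4 * dist a b" if "a \<in> cball 0 R" "b \<in> cball 0 R" for a b
      using contr[of a b] that by (simp add: dist_norm)
    show "\<Phi> ` cball 0 R \<subseteq> cball 0 R"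
    proof
      fix y assume "y \<in> \<Phi> ` cball 0 R"
      then obtain a where a: "y = \<Phi> a" "norm a \<le> R" by auto
      have "norm (\<Phi> a) \<le> norm (\<Phi> a - \<Phi> 0) + norm (\<Phi> 0)"
        using norm_triangle_ineq[of "\<Phi> a - \<Phi> 0" "\<Phi> 0"] by simp
      also have "\<dots> \<le> 3 / 4 * R + R / 4" using contr[of a 0] a R \<Phi>0 by (intro add_mono) auto
      finally show "y \<in> cball 0 R" using a by simp
    qed
  qed simp_all
  then obtain a where a: "norm a \<le> R" "\<Phi> a = a" by auto
  define u where "u w = ev ((1 / \<rho>) *\<^sub>R w) a" for w
  have u\<rho>: "u (0 + \<rho> *\<^sub>R w) = ev w a" for w using \<rho>(1) by (simp add: u_def)
  show thesis
  proof (rule that[OF \<rho>(1)])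
    show "real_analytic_on (ball 0 \<rho>) u" by (rule ev_imp_real_analytic_on[OF \<rho>(1) u\<rho>])
    have fixed: "h (\<rho> *\<^sub>R w, ev w a) = ev w a" if "w \<in> unit_square" for w
      using \<Phi>(2)[OF a(1) that] a(2) by simp
    show "h (y, u y) = u y" if "y \<in> ball 0 \<rho>" for y
    proof -
      define w where "w = (1 / \<rho>) *\<^sub>R y"
      have "norm w \<le> 1" using that \<rho>(1) by (simp add: w_def)
      hence "w \<in> unit_square"
        using norm_fst_le[of "fst w" "snd w"] norm_snd_le[of "snd w" "fst w"] by (simp add: unit_square_def)
      moreover have "\<rho> *\<^sub>R w = y" using \<rho>(1) by (simp add: w_def)
      ultimately show ?thesis using fixed[of w] by (simp add: u_def w_def)
    qed
    define e where "e = ev 0 a"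
    have z: "(0::real \<times> real) \<in> unit_square" by (simp add: unit_square_def)
    have ne: "norm e \<le> R" using norm_ev_le[OF z, of a] a by (simp add: e_def)
    have "norm (h (0, e) - h 0 - L ((0, e) - 0)) \<le> C1 * (2 * R) * norm ((0::real \<times> real, e) - 0)"
      using ne R by (intro strict1) (auto simp: n0)
    also have "norm ((0::real \<times> real, e) - 0) = norm e" by (simp only: diff_zero n0)
    also have "C1 * (2 * R) * norm e \<le> 1 / 4 * norm e" by (intro mult_right_mono CR(1)) simp
    finally have "norm (e - T e) \<le> 1 / 4 * norm e"
      using fixed[OF z] LT[of e] h0 by (simp add: e_def)
    moreover have "norm e \<le> norm (e - T e) + norm (T e)"
      using norm_triangle_ineq[of "e - T e" "T e"] by simp
    ultimately have "norm e \<le> 0" using half[of e] by linarith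
    thus "u 0 = 0" by (simp add: u_def e_def)
  qed
qed

section \<open>Germs of quotients of analytic functions\<close>

lemma real_analytic_at_powser:
  fixes f :: "real \<Rightarrow> 'b::real_normed_vector"
  assumes "real_analytic_at f s"
  obtains a r where "r > 0" "\<And>x. \<bar>x\<bar> < r \<Longrightarrow> (\<lambda>n. x ^ n *\<^sub>R a n) sums f (s + x)"
proof -
  obtain M K r where M: "power_coeffs M K r"
    and s: "\<And>h. norm h < r \<Longrightarrow> (\<lambda>n. M n (\<lambda>_. h)) sums f (s + h)"
    using assms unfolding real_analytic_at_iff by blast
  have eq: "M n (\<lambda>_. h) = h ^ n *\<^sub>R M n (\<lambda>_. 1)" for n h
    using bounded_multilinear_scale_all[OF power_coeffsD(2)[OF M], of n "\<lambda>_. h" "\<lambda>_. 1"] by simp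
  show ?thesis
  proof (rule that[of r "\<lambda>n. M n (\<lambda>_. 1)"])
    fix x :: real assume "\<bar>x\<bar> < r"
    hence "(\<lambda>n. M n (\<lambda>_. x)) sums f (s + x)" by (intro s) simp
    moreover have "(\<lambda>n. M n (\<lambda>_. x)) = (\<lambda>n. x ^ n *\<^sub>R M n (\<lambda>_. 1))" by (rule ext) (rule eq)
    ultimately show "(\<lambda>n. x ^ n *\<^sub>R M n (\<lambda>_. 1)) sums f (s + x)" by (rule subst[rotated])
  qed (rule power_coeffsD(1)[OF M])
qed

lemma real_analytic_at_factor:
  fixes f :: "real \<Rightarrow> real"
  assumes "real_analytic_at f 0"
  shows "(\<forall>\<^sub>F z in at 0. f z = 0) \<or> (\<exists>m q c. c \<noteq> 0 \<and> (q \<longlongrightarrow> c) (at 0) \<and> (\<forall>\<^sub>F z in at 0. f z = z ^ m * q z))"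
proof -
  obtain a r where r: "r > 0" and s': "\<And>x. \<bar>x\<bar> < r \<Longrightarrow> (\<lambda>n. x ^ n *\<^sub>R a n) sums f (0 + x)"
    by (rule real_analytic_at_powser[OF assms]) (rule that)
  note s = s'[unfolded add_0]
  have near: "\<forall>\<^sub>F z in at (0::real). \<bar>z\<bar> < r \<and> z \<noteq> 0"
    using r by (auto simp: eventually_at dist_real_def)
  show ?thesis
  proof (cases "\<forall>n. a n = 0")
    case True
    have "f x = 0" if "\<bar>x\<bar> < r" for x using s[OF that] True by (simp add: sums_iff)
    thus ?thesis using near by (auto elim: eventually_mono)
  next
    case False
    define m where "m = (LEAST n. a n \<noteq> 0)"
    have am: "a m \<noteq> 0" unfolding m_def using False by (metis (mono_tags, lifting) LeastI)
    have a0: "a n = 0" if "n < m" for n using not_less_Least[of n "\<lambda>n. a n \<noteq> 0"] that by (auto simp: m_def)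
    define q where "q x = f x / x ^ m" for x
    have sq: "(\<lambda>n. a (n + m) * x ^ n) sums q x" if x: "x \<noteq> 0" "norm x < r" for x
    proof -
      have "(\<lambda>n. x ^ (n + m) *\<^sub>R a (n + m)) sums (f x - (\<Sum>n<m. x ^ n *\<^sub>R a n))"
        using s[of x] x by (subst sums_iff_shift) (simp add: a0)
      hence "(\<lambda>n. x ^ (n + m) * a (n + m)) sums f x" by (simp add: a0)
      from sums_divide[OF this, of "x ^ m"] show ?thesis using x by (simp add: q_def power_add mult.commute)
    qed
    have "(q \<longlongrightarrow> a (0 + m)) (at 0)" by (rule powser_limit_0_strong[OF r sq])
    moreover have "\<forall>\<^sub>F z in at 0. f z = z ^ m * q z" using near by eventually_elim (simp add: q_def)
    ultimately show ?thesis using am by auto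
  qed
qed

lemma real_analytic_at_sgn:
  fixes f :: "real \<Rightarrow> real"
  assumes "real_analytic_at f 0"
  shows "\<exists>s. \<forall>\<^sub>F z in at_right 0. sgn (f z) = s"
proof -
  have le: "at_right (0::real) \<le> at 0" by (simp add: at_le)
  have pos: "\<forall>\<^sub>F z in at_right (0::real). z > 0" by (simp add: eventually_at_right_less)
  from real_analytic_at_factor[OF assms] show ?thesis
  proof
    assume "\<forall>\<^sub>F z in at 0. f z = 0"
    hence "\<forall>\<^sub>F z in at_right 0. f z = 0" by (rule filter_leD[OF le])
    thus ?thesis by (intro exI[of _ 0]) (auto elim: eventually_mono)
  next
    assume "\<exists>m q c. c \<noteq> 0 \<and> (q \<longlongrightarrow> c) (at 0) \<and> (\<forall>\<^sub>F z in at 0. f z = z ^ m * q z)"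
    then obtain m q c where c: "c \<noteq> 0" "(q \<longlongrightarrow> c) (at 0)" "\<forall>\<^sub>F z in at 0. f z = z ^ m * q z" by blast
    have "\<forall>\<^sub>F z in at 0. sgn (q z) = sgn c"
    proof (cases "c > 0")
      case True
      from order_tendstoD(1)[OF c(2) True] show ?thesis by eventually_elim (use True in simp)
    next
      case False
      hence neg: "c < 0" using c(1) by simp
      from order_tendstoD(2)[OF c(2) neg] show ?thesis by eventually_elim (use neg in simp)
    qed
    from filter_leD[OF le this] filter_leD[OF le c(3)] pos
    have "\<forall>\<^sub>F z in at_right 0. sgn (f z) = sgn c"
      by eventually_elim (simp add: sgn_mult)
    thus ?thesis by blast
  qed
qed

definition germ :: "(real \<Rightarrow> real) \<Rightarrow> bool" where
  "germ f \<longleftrightarrow> (\<exists>g h. real_analytic_at g 0 \<and> real_analytic_at h 0 \<and>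
    (\<forall>\<^sub>F z in at_right 0. h z \<noteq> 0 \<and> f z = g z / h z))"

lemma germI: "real_analytic_at g 0 \<Longrightarrow> real_analytic_at h 0 \<Longrightarrow>
    \<forall>\<^sub>F z in at_right 0. h z \<noteq> 0 \<and> f z = g z / h z \<Longrightarrow> germ f"
  unfolding germ_def by blast

lemma germ_analytic: "real_analytic_at f 0 \<Longrightarrow> germ f"
  by (rule germI[of f "\<lambda>_. 1"]) (auto intro: real_analytic_at_const)

lemma germ_const [simp]: "germ (\<lambda>_. c)"
  by (intro germ_analytic real_analytic_at_const)

lemma germ_cong:
  assumes "germ f" "\<forall>\<^sub>F z in at_right 0. f z = f' z"
  shows "germ f'"
proof -
  obtain g h where gh: "real_analytic_at g 0" "real_analytic_at h 0"
    "\<forall>\<^sub>F z in at_right 0. h z \<noteq> 0 \<and> f z = g z / h z" using assms(1) unfolding germ_def by blast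
  from gh(3) assms(2) have "\<forall>\<^sub>F z in at_right 0. h z \<noteq> 0 \<and> f' z = g z / h z" by eventually_elim simp
  with gh show ?thesis by (intro germI)
qed

lemma germ_add: "germ f \<Longrightarrow> germ f' \<Longrightarrow> germ (\<lambda>z. f z + f' z)"
  and germ_mult: "germ f \<Longrightarrow> germ f' \<Longrightarrow> germ (\<lambda>z. f z * f' z)"
proof -
  assume f: "germ f" and f': "germ f'"
  obtain g h where gh: "real_analytic_at g 0" "real_analytic_at h 0"
    "\<forall>\<^sub>F z in at_right 0. h z \<noteq> 0 \<and> f z = g z / h z" using f unfolding germ_def by blast
  obtain g' h' where gh': "real_analytic_at g' 0" "real_analytic_at h' 0"
    "\<forall>\<^sub>F z in at_right 0. h' z \<noteq> 0 \<and> f' z = g' z / h' z" using f' unfolding germ_def by blast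
  have "\<forall>\<^sub>F z in at_right 0. h z * h' z \<noteq> 0 \<and> f z + f' z = (g z * h' z + g' z * h z) / (h z * h' z)"
    using gh(3) gh'(3) by eventually_elim (simp add: add_divide_eq_iff divide_add_eq_iff)
  thus "germ (\<lambda>z. f z + f' z)"
    by (rule germI[rotated 2]) (intro real_analytic_at_add real_analytic_at_mult gh gh')+
  have "\<forall>\<^sub>F z in at_right 0. h z * h' z \<noteq> 0 \<and> f z * f' z = (g z * g' z) / (h z * h' z)"
    using gh(3) gh'(3) by eventually_elim simp
  thus "germ (\<lambda>z. f z * f' z)"
    by (rule germI[rotated 2]) (intro real_analytic_at_add real_analytic_at_mult gh gh')+
qed

lemma germ_sum: "(\<And>i. i \<in> A \<Longrightarrow> germ (f i)) \<Longrightarrow> germ (\<lambda>z. \<Sum>i\<in>A. f i z)"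
  by (induction A rule: infinite_finite_induct) (auto intro: germ_add)

lemma germ_sgn:
  assumes "germ f"
  shows "\<exists>s. \<forall>\<^sub>F z in at_right 0. sgn (f z) = s"
proof -
  obtain g h where gh: "real_analytic_at g 0" "real_analytic_at h 0"
    "\<forall>\<^sub>F z in at_right 0. h z \<noteq> 0 \<and> f z = g z / h z" using assms unfolding germ_def by blast
  obtain s t where "\<forall>\<^sub>F z in at_right 0. sgn (g z) = s" "\<forall>\<^sub>F z in at_right 0. sgn (h z) = t"
    using real_analytic_at_sgn gh by meson
  with gh(3) have "\<forall>\<^sub>F z in at_right 0. sgn (f z) = s / t" by eventually_elim (simp add: sgn_divide)
  thus ?thesis by blast
qed

lemma germ_zero_or_nonzero:
  assumes "germ f"
  shows "(\<forall>\<^sub>F z in at_right 0. f z = 0) \<or> (\<forall>\<^sub>F z in at_right 0. f z \<noteq> 0)"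
proof -
  obtain s where s: "\<forall>\<^sub>F z in at_right 0. sgn (f z) = s" using germ_sgn[OF assms] by blast
  show ?thesis
  proof (cases "s = 0")
    case True
    have "\<forall>\<^sub>F z in at_right 0. f z = 0" using s by eventually_elim (use True in \<open>simp add: sgn_eq_0_iff\<close>)
    thus ?thesis ..
  next
    case False
    have "\<forall>\<^sub>F z in at_right 0. f z \<noteq> 0" using s by eventually_elim (use False in auto)
    thus ?thesis ..
  qed
qed

lemma germ_divide:
  assumes "germ f" "germ f'"
  shows "germ (\<lambda>z. f z / f' z)"
proof -
  from germ_zero_or_nonzero[OF assms(2)] have "germ (\<lambda>z. inverse (f' z))"
  proof
    assume "\<forall>\<^sub>F z in at_right 0. f' z = 0"
    thus ?thesis by (intro germ_cong[OF germ_const[of 0]]) (auto elim: eventually_mono)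
  next
    assume nz: "\<forall>\<^sub>F z in at_right 0. f' z \<noteq> 0"
    obtain g h where gh: "real_analytic_at g 0" "real_analytic_at h 0"
      "\<forall>\<^sub>F z in at_right 0. h z \<noteq> 0 \<and> f' z = g z / h z" using assms(2) unfolding germ_def by blast
    show ?thesis
      by (rule germI[OF gh(2,1)]) (use gh(3) nz in \<open>eventually_elim, auto\<close>)
  qed
  from germ_mult[OF assms(1) this] show ?thesis by (simp add: divide_inverse)
qed

lemma germ_imp_analytic:
  assumes "germ f"
  shows "\<forall>\<^sub>F z in at_right 0. real_analytic_at f z"
proof -
  obtain g h where gh: "real_analytic_at g 0" "real_analytic_at h 0"
    "\<forall>\<^sub>F z in at_right 0. h z \<noteq> 0 \<and> f z = g z / h z" using assms unfolding germ_def by blast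
  obtain d1 where d1: "d1 > 0" "real_analytic_on (ball 0 d1) g" using real_analytic_at_imp_near[OF gh(1)] by blast
  obtain d2 where d2: "d2 > 0" "real_analytic_on (ball 0 d2) h" using real_analytic_at_imp_near[OF gh(2)] by blast
  obtain d3 where d3: "d3 > 0" "\<And>z. 0 < z \<Longrightarrow> z < d3 \<Longrightarrow> h z \<noteq> 0 \<and> f z = g z / h z"
    using gh(3) by (auto simp: eventually_at_right_field)
  define d where "d = min d1 (min d2 d3)"
  have "d > 0" using d1 d2 d3 by (simp add: d_def)
  moreover have "real_analytic_at f z" if z: "0 < z" "z < d" for z
  proof -
    have an: "real_analytic_at g z" "real_analytic_at h z"
      using d1(2) d2(2) z by (auto simp: real_analytic_on_def d_def)
    have hz: "h z \<noteq> 0" using d3 z by (simp add: d_def)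
    have "real_analytic_at (\<lambda>z. g z * inverse (h z)) z"
      by (rule real_analytic_at_mult[OF an(1) real_analytic_at_compose_real[OF real_analytic_at_inverse[OF hz] an(2)]])
    moreover have "\<forall>\<^sub>F y in nhds z. y \<in> {0<..<d}" using z by (intro eventually_nhds_in_open) auto
    hence "\<forall>\<^sub>F y in nhds z. g y * inverse (h y) = f y"
      by eventually_elim (use d3 in \<open>auto simp: d_def divide_inverse\<close>)
    ultimately show ?thesis by (rule real_analytic_at_cong)
  qed
  ultimately show ?thesis by (auto simp: eventually_at_right_field)
qed

definition gpoly :: "(real \<Rightarrow> real poly) \<Rightarrow> bool" where
  "gpoly P \<longleftrightarrow> (\<exists>N. \<forall>\<^sub>F z in at_right 0. degree (P z) \<le> N) \<and> (\<forall>i. germ (\<lambda>z. coeff (P z) i))"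

lemma gpolyI: "\<forall>\<^sub>F z in at_right 0. degree (P z) \<le> N \<Longrightarrow> (\<And>i. germ (\<lambda>z. coeff (P z) i)) \<Longrightarrow> gpoly P"
  unfolding gpoly_def by blast

lemma gpoly_const [simp]: "gpoly (\<lambda>_. p)"
  by (rule gpolyI[of _ "degree p"]) auto

lemma gpoly_cong:
  assumes "gpoly P" "\<forall>\<^sub>F z in at_right 0. P z = Q z"
  shows "gpoly Q"
proof -
  obtain N where N: "\<forall>\<^sub>F z in at_right 0. degree (P z) \<le> N" using assms(1) by (auto simp: gpoly_def)
  show ?thesis
  proof (rule gpolyI)
    show "\<forall>\<^sub>F z in at_right 0. degree (Q z) \<le> N" using N assms(2) by eventually_elim simp
    fix i
    show "germ (\<lambda>z. coeff (Q z) i)"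
    proof (rule germ_cong)
      show "germ (\<lambda>z. coeff (P z) i)" using assms(1) by (auto simp: gpoly_def)
      show "\<forall>\<^sub>F z in at_right 0. coeff (P z) i = coeff (Q z) i" using assms(2) by eventually_elim simp
    qed
  qed
qed

lemma gpoly_add: "gpoly P \<Longrightarrow> gpoly Q \<Longrightarrow> gpoly (\<lambda>z. P z + Q z)"
  and gpoly_mult: "gpoly P \<Longrightarrow> gpoly Q \<Longrightarrow> gpoly (\<lambda>z. P z * Q z)"
proof -
  assume P: "gpoly P" and Q: "gpoly Q"
  obtain N N' where N: "\<forall>\<^sub>F z in at_right 0. degree (P z) \<le> N" "\<forall>\<^sub>F z in at_right 0. degree (Q z) \<le> N'"
    using P Q by (auto simp: gpoly_def)
  show "gpoly (\<lambda>z. P z + Q z)"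
  proof (rule gpolyI[of _ "max N N'"])
    show "\<forall>\<^sub>F z in at_right 0. degree (P z + Q z) \<le> max N N'"
      using N by eventually_elim (rule degree_add_le, auto)
  qed (use P Q in \<open>auto simp: gpoly_def intro: germ_add\<close>)
  show "gpoly (\<lambda>z. P z * Q z)"
  proof (rule gpolyI[of _ "N + N'"])
    show "\<forall>\<^sub>F z in at_right 0. degree (P z * Q z) \<le> N + N'"
      using N by eventually_elim (rule order_trans[OF degree_mult_le], simp)
    show "germ (\<lambda>z. coeff (P z * Q z) i)" for i
      unfolding coeff_mult using P Q by (intro germ_sum germ_mult) (auto simp: gpoly_def)
  qed
qed

lemma gpoly_uminus: "gpoly P \<Longrightarrow> gpoly (\<lambda>z. - P z)"
  using gpoly_mult[of "\<lambda>_. - 1" P] by simp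

lemma gpoly_diff: "gpoly P \<Longrightarrow> gpoly Q \<Longrightarrow> gpoly (\<lambda>z. P z - Q z)"
  using gpoly_add[OF _ gpoly_uminus, of P Q] by simp

lemma gpoly_monom:
  assumes "germ f"
  shows "gpoly (\<lambda>z. monom (f z) n)"
proof (rule gpolyI[of _ n])
  show "\<forall>\<^sub>F z in at_right 0. degree (monom (f z) n) \<le> n" by (simp add: degree_monom_le)
  show "germ (\<lambda>z. coeff (monom (f z) n) i)" for i using assms by (cases "i = n") auto
qed

lemma gpoly_sum: "(\<And>i. i \<in> A \<Longrightarrow> gpoly (P i)) \<Longrightarrow> gpoly (\<lambda>z. \<Sum>i\<in>A. P i z)"
  by (induction A rule: infinite_finite_induct) (auto intro: gpoly_add)

lemma gpoly_pderiv:
  assumes "gpoly P"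
  shows "gpoly (\<lambda>z. pderiv (P z))"
proof -
  obtain N where N: "\<forall>\<^sub>F z in at_right 0. degree (P z) \<le> N" using assms by (auto simp: gpoly_def)
  show ?thesis
  proof (rule gpolyI)
    show "\<forall>\<^sub>F z in at_right 0. degree (pderiv (P z)) \<le> N"
      using N by eventually_elim (simp add: degree_pderiv)
    show "germ (\<lambda>z. coeff (pderiv (P z)) i)" for i
      unfolding coeff_pderiv using assms by (intro germ_mult) (auto simp: gpoly_def)
  qed
qed

lemma gpoly_degree:
  assumes "gpoly P"
  shows "(\<forall>\<^sub>F z in at_right 0. P z = 0) \<or> (\<exists>n. \<forall>\<^sub>F z in at_right 0. P z \<noteq> 0 \<and> degree (P z) = n)"
proof -
  obtain N where N: "\<forall>\<^sub>F z in at_right 0. degree (P z) \<le> N" using assms by (auto simp: gpoly_def)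
  have "\<exists>b. \<forall>\<^sub>F z in at_right 0. (coeff (P z) i = 0) = b" for i
  proof -
    have "germ (\<lambda>z. coeff (P z) i)" using assms by (auto simp: gpoly_def)
    from germ_zero_or_nonzero[OF this] show ?thesis
    proof
      assume "\<forall>\<^sub>F z in at_right 0. coeff (P z) i = 0"
      thus ?thesis by (intro exI[of _ True]) simp
    next
      assume "\<forall>\<^sub>F z in at_right 0. coeff (P z) i \<noteq> 0"
      thus ?thesis by (intro exI[of _ False]) simp
    qed
  qed
  then obtain b where b: "\<And>i. \<forall>\<^sub>F z in at_right 0. (coeff (P z) i = 0) = b i" by metis
  have ev: "\<forall>\<^sub>F z in at_right 0. degree (P z) \<le> N \<and> (\<forall>i\<in>{..N}. (coeff (P z) i = 0) = b i)"
    by (intro eventually_conj N eventually_ball_finite) (auto intro: b)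
  have same: "degree p = degree q \<and> (p = 0) = (q = 0)"
    if "degree p \<le> N" "\<forall>i\<in>{..N}. (coeff p i = 0) = b i" "degree q \<le> N" "\<forall>i\<in>{..N}. (coeff q i = 0) = b i"
    for p q :: "real poly"
  proof -
    have iff: "coeff p i = 0 \<longleftrightarrow> coeff q i = 0" for i
      using that by (cases "i \<le> N") (auto simp: coeff_eq_0)
    have "degree p \<le> degree q" by (rule degree_le) (simp add: iff coeff_eq_0)
    moreover have "degree q \<le> degree p" by (rule degree_le) (simp add: iff[symmetric] coeff_eq_0)
    ultimately show ?thesis using iff by (auto simp: poly_eq_iff)
  qed
  obtain z0 where z0: "degree (P z0) \<le> N" "\<forall>i\<in>{..N}. (coeff (P z0) i = 0) = b i"
    using eventually_happens[OF ev] by auto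
  have ev2: "\<forall>\<^sub>F z in at_right 0. degree (P z) = degree (P z0) \<and> (P z = 0) = (P z0 = 0)"
    using ev by eventually_elim (use same z0 in blast)
  show ?thesis
    by (cases "P z0 = 0") (use ev2 in \<open>auto elim: eventually_mono\<close>)
qed

lemma gpoly_divmod:
  assumes P: "gpoly P" and Q: "gpoly Q" and nz: "\<forall>\<^sub>F z in at_right 0. Q z \<noteq> 0"
  shows "gpoly (\<lambda>z. P z div Q z)" "gpoly (\<lambda>z. P z mod Q z)"
proof -
  obtain m where m: "\<forall>\<^sub>F z in at_right 0. Q z \<noteq> 0 \<and> degree (Q z) = m"
  proof -
    from gpoly_degree[OF Q] show ?thesis
    proof
      assume "\<forall>\<^sub>F z in at_right 0. Q z = 0"
      with nz have "\<forall>\<^sub>F z in at_right (0::real). False" by eventually_elim simp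
      thus ?thesis by (simp add: eventually_False)
    qed (use that in blast)
  qed
  have "\<exists>D R. gpoly D \<and> gpoly R \<and> (\<forall>\<^sub>F z in at_right 0. P z = Q z * D z + R z \<and> (R z = 0 \<or> degree (R z) < m))"
    if "gpoly P" "\<forall>\<^sub>F z in at_right 0. P z = 0 \<or> degree (P z) < n" for P n
    using that
  proof (induction n arbitrary: P)
    case 0
    show ?case
      by (rule exI[of _ "\<lambda>_. 0"], rule exI[of _ P]) (use 0 in \<open>auto elim: eventually_mono\<close>)
  next
    case (Suc n P)
    show ?case
    proof (cases "m \<le> n \<and> \<not> (\<forall>\<^sub>F z in at_right 0. P z = 0 \<or> degree (P z) < n)")
      case False
      hence "(\<forall>\<^sub>F z in at_right 0. P z = 0 \<or> degree (P z) < n) \<or> n < m" by auto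
      thus ?thesis
      proof
        assume "n < m"
        thus ?thesis
          by (intro exI[of _ "\<lambda>_. 0"] exI[of _ P]) (use Suc.prems in \<open>auto elim: eventually_mono\<close>)
      qed (use Suc in blast)
    next
      case True
      have dP: "\<forall>\<^sub>F z in at_right 0. degree (P z) = n"
        using gpoly_degree[OF Suc.prems(1)]
      proof
        assume "\<exists>k. \<forall>\<^sub>F z in at_right 0. P z \<noteq> 0 \<and> degree (P z) = k"
        then obtain k where k: "\<forall>\<^sub>F z in at_right 0. P z \<noteq> 0 \<and> degree (P z) = k" by blast
        with Suc.prems(2) have "\<forall>\<^sub>F z in at_right (0::real). k < Suc n" by eventually_elim auto
        hence "k < Suc n" by (simp add: eventually_const)
        moreover have "\<not> k < n"
        proof
          assume "k < n"
          with k have "\<forall>\<^sub>F z in at_right 0. P z = 0 \<or> degree (P z) < n" by (auto elim!: eventually_mono)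
          thus False using True by blast
        qed
        ultimately have "k = n" by simp
        thus ?thesis using k by (auto elim: eventually_mono)
      next
        assume "\<forall>\<^sub>F z in at_right 0. P z = 0"
        hence "\<forall>\<^sub>F z in at_right 0. P z = 0 \<or> degree (P z) < n" by (auto elim!: eventually_mono)
        thus ?thesis using True by blast
      qed
      define f where "f z = coeff (P z) n / coeff (Q z) m" for z
      have f: "germ f" unfolding f_def using Suc.prems(1) Q by (intro germ_divide) (auto simp: gpoly_def)
      define P' where "P' z = P z - monom (f z) (n - m) * Q z" for z
      have P': "gpoly P'" unfolding P'_def by (intro gpoly_diff gpoly_mult gpoly_monom Suc.prems f Q)
      have "\<forall>\<^sub>F z in at_right 0. P' z = 0 \<or> degree (P' z) < n"
        using dP m
      proof eventually_elim
        case (elim z)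
        have "coeff (Q z) m \<noteq> 0" using elim by (metis leading_coeff_0_iff)
        hence "coeff (P' z) n = 0" using True by (simp add: P'_def f_def coeff_monom_mult)
        moreover have "degree (monom (f z) (n - m) * Q z) \<le> n"
          using degree_mult_le[of "monom (f z) (n - m)" "Q z"] degree_monom_le[of "f z" "n - m"] elim True by linarith
        hence "degree (P' z) \<le> n" unfolding P'_def using elim by (intro degree_diff_le) auto
        ultimately show ?case
          by (metis le_neq_implies_less leading_coeff_0_iff)
      qed
      from Suc.IH[OF P' this] obtain D R where DR: "gpoly D" "gpoly R"
        "\<forall>\<^sub>F z in at_right 0. P' z = Q z * D z + R z \<and> (R z = 0 \<or> degree (R z) < m)" by blast
      have "\<forall>\<^sub>F z in at_right 0. P z = Q z * (D z + monom (f z) (n - m)) + R z \<and> (R z = 0 \<or> degree (R z) < m)"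
        using DR(3) by eventually_elim (auto simp: P'_def algebra_simps)
      moreover have "gpoly (\<lambda>z. D z + monom (f z) (n - m))" by (intro gpoly_add gpoly_monom DR f)
      ultimately show ?thesis using DR(2) by blast
    qed
  qed
  moreover obtain N where "\<forall>\<^sub>F z in at_right 0. degree (P z) \<le> N" using P by (auto simp: gpoly_def)
  hence "\<forall>\<^sub>F z in at_right 0. P z = 0 \<or> degree (P z) < Suc N" by eventually_elim simp
  ultimately obtain D R where DR: "gpoly D" "gpoly R"
    "\<forall>\<^sub>F z in at_right 0. P z = Q z * D z + R z \<and> (R z = 0 \<or> degree (R z) < m)" using P by blast
  have "\<forall>\<^sub>F z in at_right 0. D z = P z div Q z \<and> R z = P z mod Q z"
    using DR(3) m
  proof eventually_elim
    case (elim z)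
    hence "R z mod Q z = R z" "R z div Q z = 0" by (auto simp: mod_poly_less div_poly_less)
    thus ?case using elim by simp
  qed
  hence dm: "\<forall>\<^sub>F z in at_right 0. D z = P z div Q z" "\<forall>\<^sub>F z in at_right 0. R z = P z mod Q z"
    by (auto elim!: eventually_mono)
  show "gpoly (\<lambda>z. P z div Q z)" by (rule gpoly_cong[OF DR(1) dm(1)])
  show "gpoly (\<lambda>z. P z mod Q z)" by (rule gpoly_cong[OF DR(2) dm(2)])
qed

lemma gpoly_bezout:
  assumes "gpoly A" "gpoly B"
  obtains D S T where "gpoly D" "gpoly S" "gpoly T"
    "\<forall>\<^sub>F z in at_right 0. D z = S z * A z + T z * B z \<and> D z dvd A z \<and> D z dvd B z"
proof -
  have "\<exists>D S T. gpoly D \<and> gpoly S \<and> gpoly T \<and>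
      (\<forall>\<^sub>F z in at_right 0. D z = S z * A z + T z * B z \<and> D z dvd A z \<and> D z dvd B z)"
    if "gpoly A" "gpoly B" "\<forall>\<^sub>F z in at_right 0. B z = 0 \<or> degree (B z) < n" for n A B
    using that
  proof (induction n arbitrary: A B)
    case 0
    show ?case
      by (rule exI[of _ A], rule exI[of _ "\<lambda>_. 1"], rule exI[of _ "\<lambda>_. 0"])
         (use 0 in \<open>auto elim: eventually_mono\<close>)
  next
    case (Suc n A B)
    from gpoly_degree[OF Suc.prems(2)] show ?case
    proof
      assume "\<forall>\<^sub>F z in at_right 0. B z = 0"
      thus ?thesis
        by (intro exI[of _ A] exI[of _ "\<lambda>_. 1"] exI[of _ "\<lambda>_. 0"])
           (use Suc.prems in \<open>auto elim: eventually_mono\<close>)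
    next
      assume "\<exists>k. \<forall>\<^sub>F z in at_right 0. B z \<noteq> 0 \<and> degree (B z) = k"
      hence nz: "\<forall>\<^sub>F z in at_right 0. B z \<noteq> 0" by (auto elim: eventually_mono)
      note dm = gpoly_divmod[OF Suc.prems(1,2) nz]
      have "\<forall>\<^sub>F z in at_right 0. A z mod B z = 0 \<or> degree (A z mod B z) < n"
        using nz Suc.prems(3) by eventually_elim (metis degree_mod_less' less_Suc_eq order_less_trans less_antisym)
      from Suc.IH[OF Suc.prems(2) dm(2) this] obtain D S T where DST: "gpoly D" "gpoly S" "gpoly T"
        "\<forall>\<^sub>F z in at_right 0. D z = S z * B z + T z * (A z mod B z) \<and> D z dvd B z \<and> D z dvd (A z mod B z)"
        by blast
      have "\<forall>\<^sub>F z in at_right 0. D z = T z * A z + (S z - T z * (A z div B z)) * B z \<and> D z dvd A z \<and> D z dvd B z"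
        using DST(4)
      proof eventually_elim
        case (elim z)
        have md: "A z mod B z = A z - A z div B z * B z" by (simp add: minus_div_mult_eq_mod)
        have "D z dvd A z" using elim by (metis dvd_mod_imp_dvd)
        moreover have "D z = S z * B z + T z * (A z - A z div B z * B z)" using elim md by simp
        hence "D z = T z * A z + (S z - T z * (A z div B z)) * B z" by (simp add: algebra_simps)
        ultimately show ?case using elim by blast
      qed
      moreover have "gpoly (\<lambda>z. S z - T z * (A z div B z))" by (intro gpoly_diff gpoly_mult DST dm)
      ultimately show ?thesis using DST by blast
    qed
  qed
  moreover obtain N where "\<forall>\<^sub>F z in at_right 0. degree (B z) \<le> N" using assms(2) by (auto simp: gpoly_def)
  hence "\<forall>\<^sub>F z in at_right 0. B z = 0 \<or> degree (B z) < Suc N" by eventually_elim simp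
  ultimately show ?thesis using that assms by blast
qed

lemma gpoly_sturm_chain:
  assumes "gpoly P"
  shows "gpoly (\<lambda>z. sturm_chain (P z) i)"
proof -
  have "gpoly (\<lambda>z. sturm_chain (P z) i) \<and> gpoly (\<lambda>z. sturm_chain (P z) (Suc i))"
  proof (induction i)
    case 0
    show ?case using assms by (simp add: gpoly_pderiv)
  next
    case (Suc i)
    hence g: "gpoly (\<lambda>z. sturm_chain (P z) i)" "gpoly (\<lambda>z. sturm_chain (P z) (Suc i))" by auto
    from gpoly_degree[OF g(2)] have "gpoly (\<lambda>z. sturm_chain (P z) (Suc (Suc i)))"
    proof
      assume z: "\<forall>\<^sub>F z in at_right 0. sturm_chain (P z) (Suc i) = 0"
      show ?thesis by (rule gpoly_cong[OF gpoly_const[of 0]]) (use z in \<open>eventually_elim, simp\<close>)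
    next
      assume "\<exists>n. \<forall>\<^sub>F z in at_right 0. sturm_chain (P z) (Suc i) \<noteq> 0 \<and> degree (sturm_chain (P z) (Suc i)) = n"
      hence nz: "\<forall>\<^sub>F z in at_right 0. sturm_chain (P z) (Suc i) \<noteq> 0" by (auto elim: eventually_mono)
      show ?thesis
        by (rule gpoly_cong[OF gpoly_uminus[OF gpoly_divmod(2)[OF g nz]]]) (use nz in \<open>eventually_elim, simp\<close>)
    qed
    thus ?case using g by blast
  qed
  thus ?thesis ..
qed

lemma poly_altdef_le:
  fixes p :: "real poly"
  assumes "degree p \<le> N"
  shows "poly p x = (\<Sum>i\<le>N. coeff p i * x ^ i)"
  unfolding poly_altdef
  by (rule sum.mono_neutral_left) (use assms in \<open>auto simp: coeff_eq_0\<close>)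

lemma germ_poly:
  assumes "gpoly P"
  shows "germ (\<lambda>z. poly (P z) x)"
proof -
  obtain N where N: "\<forall>\<^sub>F z in at_right 0. degree (P z) \<le> N" using assms by (auto simp: gpoly_def)
  show ?thesis
  proof (rule germ_cong)
    show "germ (\<lambda>z. \<Sum>i\<le>N. coeff (P z) i * x ^ i)"
      using assms by (intro germ_sum germ_mult) (auto simp: gpoly_def)
    show "\<forall>\<^sub>F z in at_right 0. (\<Sum>i\<le>N. coeff (P z) i * x ^ i) = poly (P z) x"
      using N by eventually_elim (simp add: poly_altdef_le)
  qed
qed

lemma sign_changes_sgn: "sign_changes (map sgn xs) = sign_changes xs"
proof -
  have "filter (\<lambda>x. x \<noteq> 0) (map sgn xs) = map sgn (filter (\<lambda>x. x \<noteq> 0) xs)"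
    by (simp add: filter_map o_def sgn_eq_0_iff)
  moreover have "sgn x * sgn y < 0 \<longleftrightarrow> x * y < 0" for x y :: real
    by (metis sgn_less sgn_mult)
  ultimately show ?thesis unfolding sign_changes_def Let_def by (auto intro!: arg_cong[where f = card])
qed

lemma eventually_root_count_constant:
  assumes P: "gpoly P" and n: "\<forall>\<^sub>F z in at_right 0. degree (P z) \<le> n" and ab: "a < b"
    and nz: "\<forall>\<^sub>F z in at_right 0. poly (P z) a \<noteq> 0 \<and> poly (P z) b \<noteq> 0"
  obtains c where "\<forall>\<^sub>F z in at_right 0. card {x \<in> {a<..<b}. poly (P z) x = 0} = c"
proof -
  have "\<exists>s. \<forall>\<^sub>F z in at_right 0. sgn (poly (sturm_chain (P z) i) x) = s" for i x
    by (intro germ_sgn germ_poly gpoly_sturm_chain P)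
  then obtain s where s: "\<And>i x. \<forall>\<^sub>F z in at_right 0. sgn (poly (sturm_chain (P z) i) x) = s i x" by metis
  have V: "\<forall>\<^sub>F z in at_right 0. sign_changes (map (\<lambda>i. poly (sturm_chain (P z) i) x) [0..<Suc n]) =
      sign_changes (map (\<lambda>i. s i x) [0..<Suc n])" for x
  proof -
    have "\<forall>\<^sub>F z in at_right 0. \<forall>i\<in>{0..<Suc n}. sgn (poly (sturm_chain (P z) i) x) = s i x"
      by (intro eventually_ball_finite) (auto intro: s)
    thus ?thesis
    proof eventually_elim
      case (elim z)
      have "map (\<lambda>i. s i x) [0..<Suc n] = map sgn (map (\<lambda>i. poly (sturm_chain (P z) i) x) [0..<Suc n])"
        unfolding map_map o_def by (rule map_cong) (use elim in auto)
      thus ?case by (simp only: sign_changes_sgn)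
    qed
  qed
  show thesis
  proof (rule that)
    show "\<forall>\<^sub>F z in at_right 0. card {x \<in> {a<..<b}. poly (P z) x = 0} =
      sign_changes (map (\<lambda>i. s i a) [0..<Suc n]) - sign_changes (map (\<lambda>i. s i b) [0..<Suc n])"
      using V[of a] V[of b] n nz
    proof eventually_elim
      case (elim z)
      have "P z \<noteq> 0" using elim by auto
      from sturm[OF this elim(3) ab] elim show ?case by simp
    qed
  qed
qed

lemma gpoly_squarefree_part:
  assumes P: "gpoly P" and nc: "\<forall>\<^sub>F z in at_right 0. degree (P z) \<noteq> 0"
  obtains Q where "gpoly Q"
    "\<forall>\<^sub>F z in at_right 0. \<forall>x. (poly (Q z) x = 0 \<longleftrightarrow> poly (P z) x = 0) \<and>
      \<not> (poly (Q z) x = 0 \<and> poly (pderiv (Q z)) x = 0)"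
proof -
  obtain D S T where DST: "gpoly D" "gpoly S" "gpoly T"
    "\<forall>\<^sub>F z in at_right 0. D z = S z * P z + T z * pderiv (P z) \<and> D z dvd P z \<and> D z dvd pderiv (P z)"
    using gpoly_bezout[OF P gpoly_pderiv[OF P]] by blast
  have nz: "\<forall>\<^sub>F z in at_right 0. D z \<noteq> 0" using DST(4) nc by eventually_elim auto
  show thesis
  proof (rule that)
    show "gpoly (\<lambda>z. P z div D z)" by (rule gpoly_divmod[OF P DST(1) nz])
    show "\<forall>\<^sub>F z in at_right 0. \<forall>x. (poly (P z div D z) x = 0 \<longleftrightarrow> poly (P z) x = 0) \<and>
        \<not> (poly (P z div D z) x = 0 \<and> poly (pderiv (P z div D z)) x = 0)"
      using DST(4) nc
    proof eventually_elim
      case (elim z)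
      have pd: "pderiv (P z) \<noteq> 0" using elim(2) by (simp add: pderiv_eq_0_iff)
      have "rsquarefree (P z div D z) \<and> (\<forall>a. poly (P z div D z) a = 0 \<longleftrightarrow> poly (P z) a = 0)"
        by (rule poly_squarefree_decomp[OF pd, of _ "D z" "pderiv (P z) div D z" "S z" "T z"]) (use elim in auto)
      thus ?case by (auto simp: rsquarefree_roots)
    qed
  qed
qed

section \<open>Analytic branches of roots\<close>

lemma simple_root_analytic:
  fixes Q :: "real \<Rightarrow> real poly"
  assumes coef: "\<And>i. i \<le> N \<Longrightarrow> real_analytic_at (\<lambda>z. coeff (Q z) i) z0"
    and deg: "\<forall>\<^sub>F z in nhds z0. degree (Q z) \<le> N"
    and root: "poly (Q z0) x0 = 0" "poly (pderiv (Q z0)) x0 \<noteq> 0"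
  obtains r where "real_analytic_at r z0" "r z0 = x0" "\<forall>\<^sub>F z in nhds z0. poly (Q z) (r z) = 0"
proof -
  define d where "d = poly (pderiv (Q z0)) x0"
  define h where "h v = snd v - (\<Sum>i\<le>N. coeff (Q (z0 + fst (fst v))) i * (x0 + snd v) ^ i) * inverse d"
    for v :: "(real \<times> real) \<times> real"
  have deg0: "degree (Q z0) \<le> N" using eventually_nhds_x_imp_x[OF deg] .
  have bl1: "bounded_linear (\<lambda>v::(real \<times> real) \<times> real. fst (fst v))"
    by (intro bounded_linear_compose[OF bounded_linear_fst] bounded_linear_fst)
  have an: "real_analytic_at h 0"
  proof -
    have c: "real_analytic_at (\<lambda>v::(real \<times> real) \<times> real. coeff (Q (z0 + fst (fst v))) i) 0" if "i \<in> {..N}" for i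
      using real_analytic_at_affine[OF bl1, of "\<lambda>z. coeff (Q z) i" 0 z0] coef[of i] that by (simp add: add.commute)
    have s: "real_analytic_at (\<lambda>v::(real \<times> real) \<times> real. snd v) 0"
      by (rule real_analytic_at_linear[OF bounded_linear_snd])
    show ?thesis
      unfolding h_def
      by (rule real_analytic_at_diff[OF s real_analytic_at_mult[OF real_analytic_at_sum[OF real_analytic_at_mult[OF c
              real_analytic_at_power[OF real_analytic_at_add[OF real_analytic_at_const s]]]] real_analytic_at_const]])
  qed
  have hQ: "h (w, y) = y - poly (Q (z0 + fst w)) (x0 + y) * inverse d" if "degree (Q (z0 + fst w)) \<le> N" for w y
    by (simp add: h_def poly_altdef_le[OF that])
  have h0: "h 0 = 0" using hQ[of 0 0] deg0 root(1) by (simp add: zero_prod_def)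
  have "((\<lambda>y. h (0, y)) has_derivative (\<lambda>_. 0)) (at 0)"
  proof -
    have "((\<lambda>y. y - poly (Q z0) (x0 + y) * inverse d) has_field_derivative 1 - poly (pderiv (Q z0)) (x0 + 0) * inverse d) (at 0)"
      by (auto intro!: derivative_eq_intros DERIV_chain2[OF poly_DERIV])
    moreover have "1 - poly (pderiv (Q z0)) (x0 + 0) * inverse d = 0" using root(2) by (simp add: d_def)
    moreover have "(\<lambda>y. h (0, y)) = (\<lambda>y. y - poly (Q z0) (x0 + y) * inverse d)" using hQ[of 0] deg0 by auto
    ultimately show ?thesis by (simp add: has_field_derivative_def lambda_zero)
  qed
  from analytic_fixpoint[OF an h0 this] obtain \<rho> u where \<rho>: "\<rho> > 0" and u: "real_analytic_on (ball 0 \<rho>) u" "u 0 = 0"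
    "\<And>w. w \<in> ball 0 \<rho> \<Longrightarrow> h (w, u w) = u w" by auto
  define r where "r z = x0 + u ((z, 0) + (- z0, 0))" for z
  show thesis
  proof (rule that[of r])
    have "bounded_linear (\<lambda>z::real. (z, 0::real))" by (intro bounded_linear_Pair bounded_linear_ident bounded_linear_zero)
    moreover have "real_analytic_at u ((z0, 0) + (- z0, 0))"
      using u(1) \<rho> by (simp add: real_analytic_on_def zero_prod_def)
    ultimately have "real_analytic_at (\<lambda>z. u ((z, 0) + (- z0, 0))) z0" by (rule real_analytic_at_affine)
    thus "real_analytic_at r z0" unfolding r_def by (intro real_analytic_at_add real_analytic_at_const)
    show "r z0 = x0" using u(2) by (simp add: r_def zero_prod_def)
    have "\<forall>\<^sub>F z in nhds z0. dist z z0 < \<rho>" using \<rho> by (auto simp: eventually_nhds_metric)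
    with deg show "\<forall>\<^sub>F z in nhds z0. poly (Q z) (r z) = 0"
    proof eventually_elim
      case (elim z)
      have "(z - z0, 0::real) \<in> ball 0 \<rho>" using elim(2) by (simp add: dist_norm norm_Pair norm_minus_commute abs_minus_commute)
      from u(3)[OF this] hQ[of "(z - z0, 0)" "u (z - z0, 0)"] elim(1) have "poly (Q z) (r z) * inverse d = 0"
        by (simp add: r_def)
      thus ?case using root(2) by (simp add: d_def)
    qed
  qed
qed

lemma analytic_root_branches:
  assumes P: "gpoly P" and nc: "\<forall>\<^sub>F z in at_right 0. degree (P z) \<noteq> 0"
    and cnt: "\<forall>\<^sub>F z in at_right 0. card {x. poly (P z) x = 0} = n"
  obtains e l where "e > 0" "\<And>z. 0 < z \<Longrightarrow> z < e \<Longrightarrow> {x. poly (P z) x = 0} = (\<lambda>i. l i z) ` {..<n}"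
    "\<And>z i j. 0 < z \<Longrightarrow> z < e \<Longrightarrow> i < j \<Longrightarrow> j < n \<Longrightarrow> l i z < l j z"
    "\<And>i. i < n \<Longrightarrow> real_analytic_on {0<..<e} (l i)"
proof -
  obtain Q where Q: "gpoly Q" "\<forall>\<^sub>F z in at_right 0. \<forall>x. (poly (Q z) x = 0 \<longleftrightarrow> poly (P z) x = 0) \<and>
      \<not> (poly (Q z) x = 0 \<and> poly (pderiv (Q z)) x = 0)"
    using gpoly_squarefree_part[OF P nc] by blast
  obtain N where N: "\<forall>\<^sub>F z in at_right 0. degree (Q z) \<le> N" using Q(1) by (auto simp: gpoly_def)
  have an: "\<forall>\<^sub>F z in at_right 0. \<forall>i\<in>{..N}. real_analytic_at (\<lambda>z. coeff (Q z) i) z"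
    using Q(1) by (intro eventually_ball_finite) (auto simp: gpoly_def intro: germ_imp_analytic)
  define good where "good z \<longleftrightarrow>
      (\<forall>x. (poly (Q z) x = 0 \<longleftrightarrow> poly (P z) x = 0) \<and> \<not> (poly (Q z) x = 0 \<and> poly (pderiv (Q z)) x = 0)) \<and>
      degree (Q z) \<le> N \<and> (\<forall>i\<in>{..N}. real_analytic_at (\<lambda>z. coeff (Q z) i) z) \<and>
      card {x. poly (P z) x = 0} = n \<and> degree (P z) \<noteq> 0" for z
  from Q(2) N an cnt nc have "\<forall>\<^sub>F z in at_right 0. good z"
    unfolding good_def by eventually_elim blast
  then obtain e where e: "e > 0" and E: "\<And>z. 0 < z \<Longrightarrow> z < e \<Longrightarrow> good z"
    unfolding eventually_at_right_field by blast
  have e1: "poly (Q z) x = 0 \<longleftrightarrow> poly (P z) x = 0" if "0 < z" "z < e" for z x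
    using E[OF that] unfolding good_def by blast
  have e2: "poly (pderiv (Q z)) x \<noteq> 0" if "0 < z" "z < e" "poly (Q z) x = 0" for z x
    using E[OF that(1,2)] that(3) unfolding good_def by blast
  have e3: "degree (Q z) \<le> N" if "0 < z" "z < e" for z
    using E[OF that] unfolding good_def by blast
  have e4: "real_analytic_at (\<lambda>z. coeff (Q z) i) z" if "0 < z" "z < e" "i \<le> N" for z i
    using E[OF that(1,2)] that(3) unfolding good_def by blast
  have e5: "card {x. poly (P z) x = 0} = n" if "0 < z" "z < e" for z
    using E[OF that] unfolding good_def by blast
  have e6: "degree (P z) \<noteq> 0" if "0 < z" "z < e" for z
    using E[OF that] unfolding good_def by blast
  define R where "R z = {x. poly (P z) x = 0}" for z
  have finR: "finite (R z)" if "0 < z" "z < e" for z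
    unfolding R_def using e6[OF that] by (intro poly_roots_finite) auto
  define l where "l i z = sorted_list_of_set (R z) ! i" for i z
  have len: "length (sorted_list_of_set (R z)) = n" if "0 < z" "z < e" for z
    using e5[OF that] by (simp add: R_def)
  have img: "R z = (\<lambda>i. l i z) ` {..<n}" if z: "0 < z" "z < e" for z
  proof -
    have "R z = set (sorted_list_of_set (R z))" using finR[OF z] by simp
    also have "\<dots> = (\<lambda>i. l i z) ` {..<n}" unfolding l_def set_conv_nth len[OF z] by auto
    finally show ?thesis .
  qed
  have lt: "l i z < l j z" if z: "0 < z" "z < e" and ij: "i < j" "j < n" for z i j
    using strict_sorted_list_of_set[of "R z"] ij len[OF z] unfolding l_def
    by (simp add: sorted_wrt_iff_nth_less)
  have "real_analytic_at (l i) z0" if i: "i < n" and z0: "0 < z0" "z0 < e" for i z0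
  proof -
    have near: "\<forall>\<^sub>F z in nhds z0. z \<in> {0<..<e}" using z0 by (intro eventually_nhds_in_open) auto
    have "\<exists>r. real_analytic_at r z0 \<and> r z0 = l j z0 \<and> (\<forall>\<^sub>F z in nhds z0. poly (Q z) (r z) = 0)" if j: "j < n" for j
    proof -
      have "l j z0 \<in> R z0" using img[OF z0] j by blast
      hence root: "poly (Q z0) (l j z0) = 0" using e1[OF z0] by (simp add: R_def)
      have "\<forall>\<^sub>F z in nhds z0. degree (Q z) \<le> N" using near by eventually_elim (use e3 in auto)
      from simple_root_analytic[OF e4[OF z0] this root e2[OF z0 root]] show ?thesis by blast
    qed
    then obtain r where r: "\<And>j. j < n \<Longrightarrow> real_analytic_at (r j) z0" "\<And>j. j < n \<Longrightarrow> r j z0 = l j z0"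
      "\<And>j. j < n \<Longrightarrow> \<forall>\<^sub>F z in nhds z0. poly (Q z) (r j z) = 0" by metis
    have cont: "((\<lambda>z. r j z) \<longlongrightarrow> l j z0) (nhds z0)" if "j < n" for j
    proof -
      have "isCont (r j) z0" by (rule real_analytic_at_imp_isCont[OF r(1)[OF that]])
      from tendsto_at_iff_tendsto_nhds[THEN iffD1, OF isContD[OF this]] r(2)[OF that] show ?thesis by simp
    qed
    have ord: "\<forall>\<^sub>F z in nhds z0. \<forall>p\<in>{(j, k). j < k \<and> k < n}. r (fst p) z < r (snd p) z"
    proof (rule eventually_ball_finite)
      show "finite {(j, k). j < k \<and> k < n}" by (rule finite_subset[of _ "{..<n} \<times> {..<n}"]) auto
      have "\<forall>\<^sub>F z in nhds z0. r j z < r k z" if "j < k" "k < n" for j k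
      proof -
        have "\<forall>\<^sub>F z in nhds z0. 0 < r k z - r j z"
        proof (rule order_tendstoD(1))
          show "((\<lambda>z. r k z - r j z) \<longlongrightarrow> l k z0 - l j z0) (nhds z0)" using that by (intro tendsto_diff cont) auto
          show "0 < l k z0 - l j z0" using lt[OF z0 that] by simp
        qed
        thus ?thesis by eventually_elim simp
      qed
      thus "\<forall>p\<in>{(j, k). j < k \<and> k < n}. \<forall>\<^sub>F z in nhds z0. r (fst p) z < r (snd p) z" by auto
    qed
    have "\<forall>\<^sub>F z in nhds z0. \<forall>j\<in>{..<n}. poly (Q z) (r j z) = 0"
      by (intro eventually_ball_finite) (auto intro: r(3))
    with near ord have "\<forall>\<^sub>F z in nhds z0. r i z = l i z"
    proof eventually_elim
      case (elim z)
      hence z: "0 < z" "z < e" by auto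
      let ?xs = "map (\<lambda>j. r j z) [0..<n]"
      have sorted: "sorted_wrt (<) ?xs" using elim(2) by (auto simp: sorted_wrt_iff_nth_less)
      have "set ?xs \<subseteq> R z" using elim(3) e1[OF z] by (auto simp: R_def)
      moreover have "card (set ?xs) = n" using sorted by (metis distinct_card length_map length_upt minus_nat.diff_0 strict_sorted_iff)
      ultimately have "set ?xs = R z" using finR[OF z] e5[OF z] by (intro card_subset_eq) (auto simp: R_def)
      hence "sorted_list_of_set (R z) = ?xs"
        using sorted by (metis sorted_list_of_set.idem_if_sorted_distinct strict_sorted_iff)
      thus ?case using i by (simp add: l_def)
    qed
    thus ?thesis by (rule real_analytic_at_cong[OF r(1)[OF i]])
  qed
  thus thesis using that[OF e, of l] img lt by (auto simp: real_analytic_on_def R_def)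
qed

section \<open>Lyapunov--Schmidt reduction\<close>

lemma has_derivative_linearization:
  fixes F :: "real \<times> 'u::real_normed_vector \<Rightarrow> 'v::banach"
  assumes "real_analytic_at F (l, 0)"
  shows "((\<lambda>u. F (l, u)) has_derivative linearization F l) (at 0)"
proof -
  have "bounded_linear (\<lambda>u::'u. (0::real, u))" by (intro bounded_linear_Pair bounded_linear_zero bounded_linear_ident)
  from real_analytic_at_affine[OF this, of F 0 "(l, 0)"] assms have "real_analytic_at (\<lambda>u. F (l, u)) 0" by simp
  then obtain L where L: "((\<lambda>u. F (l, u)) has_derivative L) (at 0)" by (rule real_analytic_at_strict)
  thus ?thesis unfolding linearization_def by (metis frechet_derivative_at)
qed

lemma linearization_strict:
  fixes F :: "real \<times> 'u::real_normed_vector \<Rightarrow> 'v::banach"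
  assumes an: "real_analytic_at F (0, 0)"
  obtains C d where "C \<ge> 0" "d > 0"
    "\<And>l u u' R. \<lbrakk>norm (l, u) \<le> R; norm (l, u') \<le> R; R \<le> d\<rbrakk>
      \<Longrightarrow> norm (F (l, u) - F (l, u') - linearization F 0 (u - u')) \<le> C * R * norm (u - u')"
proof -
  obtain L C d where L: "bounded_linear L" "C \<ge> 0" "d > 0" and
    st: "\<And>h k R. \<lbrakk>norm h \<le> R; norm k \<le> R; R \<le> d\<rbrakk>
      \<Longrightarrow> norm (F ((0, 0) + h) - F ((0, 0) + k) - L (h - k)) \<le> C * R * norm (h - k)"
    by (rule real_analytic_at_strict[OF an]) (rule that)
  have bl0: "bounded_linear (\<lambda>u::'u. (0::real, u))" by (intro bounded_linear_Pair bounded_linear_zero bounded_linear_ident)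
  have n0: "norm (0::real, u) = norm u" for u :: 'u by (simp add: norm_Pair)
  have st': "norm (F (l, u) - F (l, u') - L (0, u - u')) \<le> C * R * norm (u - u')"
    if "norm (l, u) \<le> R" "norm (l, u') \<le> R" "R \<le> d" for l u u' R
    using st[OF that] by (simp add: n0)
  have "((\<lambda>u. F (0, u)) has_derivative (\<lambda>u. L (0, u))) (at 0)"
  proof (rule has_derivative_quadraticI[OF bounded_linear_compose[OF L(1) bl0] L(2,3)])
    show "norm (F (0, 0 + h) - F (0, 0) - L (0, h)) \<le> C * norm h * norm h" if "norm h \<le> d" for h
      using st'[of 0 h "norm h" 0] that by (simp add: n0)
  qed
  from has_derivative_unique[OF this has_derivative_linearization[OF an]]
  have "linearization F 0 u = L (0, u)" for u by metis
  with st' L show ?thesis using that by simp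
qed

lemma lyapunov_schmidt_unique:
  fixes F :: "real \<times> 'u::banach \<Rightarrow> 'v::banach"
  assumes an: "real_analytic_at F (0, 0)"
    and f: "bounded_linear f" and R: "bounded_linear R" "\<And>u. R (linearization F 0 u + f u *\<^sub>R \<psi>) = u"
    and Q: "bounded_linear Q" "\<And>u. Q (linearization F 0 u) = linearization F 0 u"
  obtains d where "d > 0" "\<And>l u u'. \<lbrakk>norm (l, u) < d; norm (l, u') < d; f u = f u'; Q (F (l, u)) = Q (F (l, u'))\<rbrakk> \<Longrightarrow> u = u'"
proof -
  let ?L = "linearization F 0"
  interpret f: bounded_linear f by fact
  interpret R: bounded_linear R by fact
  interpret Q: bounded_linear Q by fact
  obtain C d0 where C: "C \<ge> 0" "d0 > 0" and
    st: "\<And>l u u' r. \<lbrakk>norm (l, u) \<le> r; norm (l, u') \<le> r; r \<le> d0\<rbrakk>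
      \<Longrightarrow> norm (F (l, u) - F (l, u') - ?L (u - u')) \<le> C * r * norm (u - u')"
    by (rule linearization_strict[OF an]) (rule that)
  obtain BR where BR: "BR > 0" "\<And>x. norm (R x) \<le> norm x * BR" using R.pos_bounded by blast
  obtain BQ where BQ: "BQ > 0" "\<And>x. norm (Q x) \<le> norm x * BQ" using Q.pos_bounded by blast
  define d where "d = min d0 (1 / (2 * BR * BQ * (C + 1)))"
  have d: "d > 0" "d \<le> d0" using C BR BQ by (auto simp: d_def)
  have "d \<le> 1 / (2 * BR * BQ * (C + 1))" by (simp add: d_def)
  hence "d * (2 * BR * BQ * (C + 1)) \<le> 1" using BR BQ C by (subst (asm) pos_le_divide_eq) auto
  moreover have "C * d * (BQ * BR) \<le> d * (BR * BQ * (C + 1))"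
    using d BR BQ by (simp add: algebra_simps)
  ultimately have small: "C * d * (BQ * BR) \<le> 1 / 2" by simp
  show thesis
  proof (rule that[OF d(1)])
    fix l u u' assume uu: "norm (l, u) < d" "norm (l, u') < d" "f u = f u'" "Q (F (l, u)) = Q (F (l, u'))"
    define v where "v = u - u'"
    have "norm (F (l, u) - F (l, u') - ?L v) \<le> C * d * norm v"
      unfolding v_def using uu d by (intro st) auto
    hence "norm (Q (F (l, u) - F (l, u') - ?L v)) \<le> C * d * norm v * BQ"
      using BQ by (meson order_trans mult_right_mono less_imp_le)
    moreover have "Q (F (l, u) - F (l, u') - ?L v) = - ?L v" using uu by (simp add: Q.diff Q(2))
    ultimately have 1: "norm (?L v) \<le> C * d * norm v * BQ" by simp
    have "R (?L v) = v" using R(2)[of v] uu(3) by (simp add: v_def f.diff)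
    hence "norm v \<le> norm (?L v) * BR" using BR(2)[of "?L v"] by simp
    also have "\<dots> \<le> C * d * norm v * BQ * BR" using 1 BR by (intro mult_right_mono) auto
    also have "\<dots> = C * d * (BQ * BR) * norm v" by simp
    also have "\<dots> \<le> 1 / 2 * norm v" by (intro mult_right_mono small) simp
    finally have "norm v \<le> 0" by simp
    thus "u = u'" by (simp add: v_def)
  qed
qed

lemma lyapunov_schmidt_solution:
  fixes F :: "real \<times> 'u::banach \<Rightarrow> 'v::banach"
  assumes an: "real_analytic_at F (0, 0)" and F1: "\<And>l. F (l, 0) = 0"
    and f: "bounded_linear f" and \<psi>: "\<psi> \<notin> range (linearization F 0)"
    and R: "bounded_linear R" "\<And>u. R (linearization F 0 u + f u *\<^sub>R \<psi>) = u"
      "\<And>v. linearization F 0 (R v) + f (R v) *\<^sub>R \<psi> = v"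
    and Q: "bounded_linear Q" "\<And>u. Q (linearization F 0 u) = linearization F 0 u" "\<And>v. Q v \<in> range (linearization F 0)"
  obtains \<rho> y where "\<rho> > 0" "real_analytic_on (ball 0 \<rho>) y"
    "\<And>w. w \<in> ball 0 \<rho> \<Longrightarrow> f (y w) = snd w" "\<And>w. w \<in> ball 0 \<rho> \<Longrightarrow> Q (F (fst w, y w)) = 0"
    "\<And>l. (l, 0::real) \<in> ball 0 \<rho> \<Longrightarrow> y (l, 0) = 0"
proof -
  let ?L = "linearization F 0"
  interpret f: bounded_linear f by fact
  interpret R: bounded_linear R by fact
  interpret Q: bounded_linear Q by fact
  have der: "((\<lambda>u. F (0, u)) has_derivative ?L) (at 0)" by (rule has_derivative_linearization[OF an])
  have L: "bounded_linear ?L" by (rule has_derivative_bounded_linear[OF der])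
  interpret L: bounded_linear ?L by fact
  define h where "h v = snd v - R (Q (F (fst (fst v), snd v)) + (f (snd v) - snd (fst v)) *\<^sub>R \<psi>)"
    for v :: "(real \<times> real) \<times> 'u"
  have bl: "bounded_linear (\<lambda>v::(real \<times> real) \<times> 'u. (fst (fst v), snd v))"
    by (intro bounded_linear_Pair bounded_linear_snd bounded_linear_compose[OF bounded_linear_fst] bounded_linear_fst)
  have bl2: "bounded_linear (\<lambda>v::(real \<times> real) \<times> 'u. (f (snd v) - snd (fst v)) *\<^sub>R \<psi>)"
    by (intro bounded_linear_compose[OF bounded_linear_scaleR_left] bounded_linear_sub bounded_linear_compose[OF f]
        bounded_linear_snd bounded_linear_compose[OF bounded_linear_snd] bounded_linear_fst)
  have "real_analytic_at (\<lambda>v::(real \<times> real) \<times> 'u. F (fst (fst v), snd v)) 0"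
    by (rule real_analytic_at_compose_linear[OF bl]) (simp add: an)
  hence "real_analytic_at h 0"
    unfolding h_def
    by (rule real_analytic_at_diff[OF real_analytic_at_linear[OF bounded_linear_snd] real_analytic_at_linear_compose[OF R(1)
        real_analytic_at_add[OF real_analytic_at_linear_compose[OF Q(1)] real_analytic_at_linear[OF bl2]]]])
  moreover have "h 0 = 0" by (simp add: h_def F1 Q.zero R.zero f.zero)
  moreover have "((\<lambda>u. h (0, u)) has_derivative (\<lambda>u. u - R (Q (?L u) + (f u - 0) *\<^sub>R \<psi>))) (at 0)"
    unfolding h_def fst_conv snd_conv fst_zero snd_zero
    by (intro has_derivative_diff has_derivative_ident R.has_derivative has_derivative_add Q.has_derivative der
        has_derivative_scaleR_left f.has_derivative has_derivative_const)
  hence "((\<lambda>u. h (0, u)) has_derivative (\<lambda>u. 0)) (at 0)" by (simp add: Q(2) R(2))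
  moreover have "norm ((\<lambda>u. 0::'u) u) \<le> norm u / 2" for u :: 'u by simp
  ultimately obtain \<rho>1 y where \<rho>1: "\<rho>1 > 0" and y: "real_analytic_on (ball 0 \<rho>1) y" "y 0 = 0"
    "\<And>w. w \<in> ball 0 \<rho>1 \<Longrightarrow> h (w, y w) = y w" by (rule analytic_fixpoint) blast+
  have R0: "v = 0" if "R v = 0" for v using R(3)[of v] that by (simp add: L.zero f.zero)
  have fRL: "f (R (?L u)) = 0" for u
  proof (rule ccontr)
    define c where "c = f (R (?L u))"
    assume "f (R (?L u)) \<noteq> 0"
    hence c: "c \<noteq> 0" by (simp add: c_def)
    have "?L (R (?L u)) + c *\<^sub>R \<psi> = ?L u" using R(3)[of "?L u"] by (simp add: c_def)
    hence "c *\<^sub>R \<psi> = ?L (u - R (?L u))" by (simp add: L.diff algebra_simps)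
    hence "(1 / c) *\<^sub>R (c *\<^sub>R \<psi>) = ?L ((1 / c) *\<^sub>R (u - R (?L u)))" by (simp only: L.scaleR)
    hence "\<psi> = ?L ((1 / c) *\<^sub>R (u - R (?L u)))" using c by simp
    thus False using \<psi> by blast
  qed
  have LR: "?L (R (?L u)) = ?L u" for u using R(3)[of "?L u"] fRL[of u] by simp
  have fix1: "f (y w) = snd w" and fix2: "Q (F (fst w, y w)) = 0" if w: "w \<in> ball 0 \<rho>1" for w
  proof -
    let ?v = "Q (F (fst w, y w)) + (f (y w) - snd w) *\<^sub>R \<psi>"
    have "R ?v = 0" using y(3)[OF w] by (simp add: h_def)
    hence v: "?v = 0" by (rule R0)
    obtain x where x: "Q (F (fst w, y w)) = ?L x" using Q(3) by blast
    show 1: "f (y w) = snd w"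
    proof (rule ccontr)
      assume ne: "f (y w) \<noteq> snd w"
      define c where "c = f (y w) - snd w"
      have "c *\<^sub>R \<psi> = ?L (- x)" using v by (simp add: x c_def L.neg add_eq_0_iff)
      hence "(1 / c) *\<^sub>R (c *\<^sub>R \<psi>) = ?L ((1 / c) *\<^sub>R (- x))" by (simp only: L.scaleR)
      moreover have "c \<noteq> 0" using ne by (simp add: c_def)
      ultimately have "\<psi> = ?L ((1 / c) *\<^sub>R (- x))" by simp
      thus False using \<psi> by blast
    qed
    show "Q (F (fst w, y w)) = 0" using v 1 by simp
  qed
  obtain d where d: "d > 0" "\<And>l u u'. \<lbrakk>norm (l, u) < d; norm (l, u') < d; f u = f u'; Q (F (l, u)) = Q (F (l, u'))\<rbrakk> \<Longrightarrow> u = u'"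
    by (rule lyapunov_schmidt_unique[OF an f R(1,2) Q(1,2)]) (rule that)
  have "isCont y 0" using y(1) \<rho>1 by (intro real_analytic_at_imp_isCont) (auto simp: real_analytic_on_def)
  then obtain \<delta> where \<delta>: "\<delta> > 0" "\<And>w. dist w 0 < \<delta> \<Longrightarrow> dist (y w) (y 0) < d / 2"
    unfolding continuous_at_eps_delta using d(1) by (metis half_gt_zero)
  define \<rho> where "\<rho> = min \<rho>1 (min \<delta> (d / 2))"
  have \<rho>: "\<rho> > 0" "\<rho> \<le> \<rho>1" "\<rho> \<le> \<delta>" "\<rho> \<le> d / 2" using \<rho>1 \<delta> d by (auto simp: \<rho>_def)
  have sub: "w \<in> ball 0 \<rho>1" if "w \<in> ball 0 \<rho>" for w :: "real \<times> real" using that \<rho> by auto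
  show thesis
  proof (rule that[OF \<rho>(1)])
    show "real_analytic_on (ball 0 \<rho>) y" using y(1) sub by (auto simp: real_analytic_on_def)
    show "f (y w) = snd w" if "w \<in> ball 0 \<rho>" for w by (rule fix1[OF sub[OF that]])
    show "Q (F (fst w, y w)) = 0" if "w \<in> ball 0 \<rho>" for w by (rule fix2[OF sub[OF that]])
    fix l :: real assume l: "(l, 0::real) \<in> ball 0 \<rho>"
    have nl: "\<bar>l\<bar> < \<rho>" using l by (simp add: norm_Pair)
    have ny: "norm (y (l, 0)) < d / 2" using \<delta>(2)[of "(l, 0)"] l \<rho> y(2) by (simp add: norm_Pair)
    have "norm (l, y (l, 0)) \<le> \<bar>l\<bar> + norm (y (l, 0))" using norm_Pair_le[of l "y (l, 0)"] by simp
    hence "norm (l, y (l, 0)) < d" using nl ny \<rho> by linarith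
    moreover have "norm (l, 0::'u) < d" using nl \<rho> d by (simp add: norm_Pair)
    ultimately show "y (l, 0) = 0"
      by (rule d(2)) (use fix1[OF sub[OF l]] fix2[OF sub[OF l]] in \<open>simp_all add: f.zero F1 Q.zero\<close>)
  qed
qed

section \<open>The Weierstrass preparation theorem\<close>

definition epull :: "(nat \<times> nat \<Rightarrow> nat \<times> nat) \<Rightarrow> 'v::real_normed_vector ell1 \<Rightarrow> 'v ell1" where
  "epull \<sigma> a = Ell (\<lambda>k. coef a (\<sigma> k))"

definition ewt :: "(nat \<times> nat \<Rightarrow> real) \<Rightarrow> 'v::real_normed_vector ell1 \<Rightarrow> 'v ell1" where
  "ewt c a = Ell (\<lambda>k. c k *\<^sub>R coef a k)"

lemma epull_bound:
  assumes "inj \<sigma>"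
  shows "coef (epull \<sigma> a) = (\<lambda>k. coef a (\<sigma> k))" "norm (epull \<sigma> a) \<le> norm a"
proof -
  have *: "(\<Sum>k\<in>S. norm (coef a (\<sigma> k))) \<le> norm a" if "finite S" for S
  proof -
    have "(\<Sum>k\<in>S. norm (coef a (\<sigma> k))) = (\<Sum>k\<in>\<sigma> ` S. norm (coef a k))"
      using inj_on_subset[OF assms] by (subst sum.reindex) auto
    also have "\<dots> \<le> norm a" by (rule sum_norm_coef_le) (use that in auto)
    finally show ?thesis .
  qed
  show "coef (epull \<sigma> a) = (\<lambda>k. coef a (\<sigma> k))" "norm (epull \<sigma> a) \<le> norm a"
    unfolding epull_def by (rule coef_EllI[OF *], assumption)+
qed

lemma bounded_linear_epull: "inj \<sigma> \<Longrightarrow> bounded_linear (epull \<sigma>)"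
  by (rule bounded_linear_intro[of _ 1]) (auto intro!: ell1_eqI simp: epull_bound)

lemma ewt_bound:
  assumes "\<And>k. \<bar>c k\<bar> \<le> 1"
  shows "coef (ewt c a) = (\<lambda>k. c k *\<^sub>R coef a k)" "norm (ewt c a) \<le> norm a"
proof -
  have *: "(\<Sum>k\<in>S. norm (c k *\<^sub>R coef a k)) \<le> norm a" if "finite S" for S
  proof -
    have "(\<Sum>k\<in>S. norm (c k *\<^sub>R coef a k)) \<le> (\<Sum>k\<in>S. norm (coef a k))"
      by (intro sum_mono) (simp add: mult_left_le_one_le assms)
    also have "\<dots> \<le> norm a" by (rule sum_norm_coef_le[OF that])
    finally show ?thesis .
  qed
  show "coef (ewt c a) = (\<lambda>k. c k *\<^sub>R coef a k)" "norm (ewt c a) \<le> norm a"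
    unfolding ewt_def by (rule coef_EllI[OF *], assumption)+
qed

lemma bounded_linear_ewt:
  assumes "\<And>k. \<bar>c k\<bar> \<le> 1"
  shows "bounded_linear (ewt c)"
proof (rule bounded_linear_intro[of _ 1])
  show "norm (ewt c a) \<le> norm a * 1" for a :: "'a ell1" using ewt_bound(2)[of c a] assms by simp
qed (rule ell1_eqI, simp add: ewt_bound[OF assms] algebra_simps)+

lemma ev_split:
  fixes a :: "'v::banach ell1"
  assumes "w \<in> unit_square"
  shows "ev w a = ev w (ewt (\<lambda>k. if k \<in> range ((+) j) then 0 else 1) a) + monom2 w j *\<^sub>R ev w (epull ((+) j) a)"
proof -
  let ?b = "ewt (\<lambda>k. if k \<in> range ((+) j) then 0 else 1) a"
  have inj: "inj ((+) j)" by (simp add: inj_def)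
  have "a = ?b + eshift j (epull ((+) j) a)"
  proof (rule ell1_eqI)
    fix k
    show "coef a k = coef (?b + eshift j (epull ((+) j) a)) k"
      by (auto simp: ewt_bound eshift_bound epull_bound[OF inj])
  qed
  from arg_cong[OF this, of "ev w"] show ?thesis
    by (simp add: linear_add[OF bounded_linear.linear[OF bounded_linear_ev[OF assms]]] ev_eshift[OF assms])
qed

lemma ev_cong:
  assumes "\<And>k. monom2 w k *\<^sub>R coef a k = monom2 w' k *\<^sub>R coef b k"
  shows "ev w a = ev w' b"
  unfolding ev_def by (rule infsum_cong) (rule assms)

lemma ev_restrict_fst: "ev (s, 0) a = ev (s, t) (ewt (\<lambda>k. if snd k = 0 then 1 else 0) a)"
  by (rule ev_cong) (auto simp: ewt_bound monom2_def)

lemma ev_fst_has_sum: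
  fixes a :: "real ell1"
  assumes "\<bar>s\<bar> \<le> 1"
  shows "((\<lambda>m. s ^ m * coef a (m, 0)) has_sum ev (s, 0) a) UNIV"
proof -
  have us: "(s, 0) \<in> unit_square" using assms by (simp add: unit_square_def)
  have "((\<lambda>k. monom2 (s, 0) k *\<^sub>R coef a k) has_sum ev (s, 0) a) (range (\<lambda>m. (m, 0)))"
    by (rule has_sum_cong_neutral[THEN iffD1, OF _ _ _ ev_has_sum[OF us]])
       (auto simp: monom2_def image_iff)
  thus ?thesis
    by (subst (asm) has_sum_reindex) (auto simp: inj_def o_def monom2_def)
qed

lemma range_add_10:
  fixes k :: "nat \<times> nat"
  shows "k \<in> range ((+) (n, 0)) \<longleftrightarrow> n \<le> fst k"
proof
  assume "n \<le> fst k"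
  hence "k = (n, 0) + (fst k - n, snd k)" by (simp add: prod_eq_iff)
  thus "k \<in> range ((+) (n, 0))" by (rule range_eqI)
qed auto

lemma range_add_01:
  fixes k :: "nat \<times> nat"
  shows "k \<in> range ((+) (0, 1)) \<longleftrightarrow> snd k \<noteq> 0"
proof
  assume "snd k \<noteq> 0"
  hence "k = (0, 1) + (fst k, snd k - 1)" by (simp add: prod_eq_iff)
  thus "k \<in> range ((+) (0, 1))" by (rule range_eqI)
qed auto

lemma real_analytic_divide_snd:
  fixes G :: "real \<times> real \<Rightarrow> real"
  assumes an: "real_analytic_at G 0" and z: "d > 0" "\<And>l. \<bar>l\<bar> < d \<Longrightarrow> G (l, 0) = 0"
  obtains g \<rho> where "\<rho> > 0" "real_analytic_on (ball 0 \<rho>) g" "\<And>w. w \<in> ball 0 \<rho> \<Longrightarrow> G w = snd w * g w"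
proof -
  obtain \<rho>0 C where \<rho>0: "\<rho>0 > 0" and e: "\<And>\<rho>. 0 < \<rho> \<Longrightarrow> \<rho> \<le> \<rho>0 \<Longrightarrow>
      \<exists>a. norm (a - single 0 (G 0)) \<le> C * \<rho> \<and> (\<forall>w\<in>unit_square. G (0 + \<rho> *\<^sub>R w) = ev w a)"
    using real_analytic_at_imp_ev[OF an] by metis
  define \<rho> where "\<rho> = min \<rho>0 (d / 2)"
  have \<rho>: "\<rho> > 0" "\<rho> \<le> \<rho>0" "\<rho> < d" using \<rho>0 z by (auto simp: \<rho>_def)
  from e[OF \<rho>(1,2)] obtain a where a: "\<And>w. w \<in> unit_square \<Longrightarrow> G (\<rho> *\<^sub>R w) = ev w a" by auto
  define b where "b = (1 / \<rho>) *\<^sub>R epull ((+) (0, 1)) a"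
  define g where "g w = ev ((1 / \<rho>) *\<^sub>R w) b" for w
  have key: "G (\<rho> *\<^sub>R w) = (\<rho> * snd w) * ev w b" if w: "w \<in> unit_square" for w
  proof -
    obtain s t where st: "w = (s, t)" by (cases w)
    have s0: "(s, 0) \<in> unit_square" using w by (simp add: st unit_square_def)
    have "\<bar>\<rho> * s\<bar> < d"
    proof -
      have "\<bar>\<rho> * s\<bar> \<le> \<rho> * 1" unfolding abs_mult using w \<rho>(1) by (intro mult_mono) (auto simp: st unit_square_def)
      thus ?thesis using \<rho>(3) by simp
    qed
    hence "ev (s, 0) a = 0" using a[OF s0] z(2) by simp
    moreover have "ev w (ewt (\<lambda>k. if k \<in> range ((+) (0, 1)) then 0 else 1) a) = ev (s, 0) a"
      unfolding st ev_restrict_fst[of s a t] by (rule ev_cong) (simp only: ewt_bound range_add_01, simp add: ewt_bound)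
    moreover have "ev w b = (1 / \<rho>) * ev w (epull ((+) (0, 1)) a)"
      unfolding b_def by (simp add: linear_scale[OF bounded_linear.linear[OF bounded_linear_ev[OF w]]])
    ultimately show ?thesis
      using ev_split[OF w, of a "(0, 1)"] a[OF w] \<rho>(1) by (simp add: st monom2_def)
  qed
  show thesis
  proof (rule that[OF \<rho>(1)])
    have "g (0 + \<rho> *\<^sub>R w) = ev w b" for w using \<rho>(1) by (simp add: g_def)
    thus "real_analytic_on (ball 0 \<rho>) g" by (rule ev_imp_real_analytic_on[OF \<rho>(1)])
    fix y :: "real \<times> real" assume y: "y \<in> ball 0 \<rho>"
    define w where "w = (1 / \<rho>) *\<^sub>R y"
    have "norm w \<le> 1" using y \<rho>(1) by (simp add: w_def)
    hence "w \<in> unit_square"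
      using norm_fst_le[of "fst w" "snd w"] norm_snd_le[of "snd w" "fst w"] by (simp add: unit_square_def)
    from key[OF this] show "G y = snd y * g y" using \<rho>(1) by (simp add: w_def g_def)
  qed
qed

lemma higher_deriv_powser:
  fixes a :: "nat \<Rightarrow> real"
  assumes "r > 0" "\<And>x. \<bar>x\<bar> < r \<Longrightarrow> (\<lambda>n. a n * x ^ n) sums f x"
  shows "(deriv ^^ k) f 0 = fact k * a k"
  using assms
proof (induction k arbitrary: f a)
  case 0
  have "(\<lambda>n. a n * 0 ^ n) sums f 0" by (rule "0.prems"(2)) (use "0.prems"(1) in simp)
  thus ?case by simp
next
  case (Suc k)
  have sm: "summable (\<lambda>n. a n * x ^ n)" if "norm x < r" for x
    using Suc.prems(2)[of x] that by (auto simp: sums_iff)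
  have f: "(\<Sum>n. a n * x ^ n) = f x" if "\<bar>x\<bar> < r" for x
    using Suc.prems(2)[OF that] by (simp add: sums_iff)
  have near: "\<forall>\<^sub>F y in nhds x. \<bar>y\<bar> < r" if "\<bar>x\<bar> < r" for x
    using eventually_nhds_in_open[of "{y. \<bar>y\<bar> < r}" x] that
    by (simp add: open_Collect_less continuous_intros)
  have d: "(\<lambda>n. diffs a n * x ^ n) sums deriv f x" if x: "\<bar>x\<bar> < r" for x
  proof -
    have "((\<lambda>x. \<Sum>n. a n * x ^ n) has_field_derivative (\<Sum>n. diffs a n * x ^ n)) (at x)"
      by (rule termdiffs_strong'[OF sm]) (use x in auto)
    hence "(f has_field_derivative (\<Sum>n. diffs a n * x ^ n)) (at x)"
      by (rule DERIV_cong_ev[THEN iffD1, rotated 3]) (use near[OF x] f in \<open>auto elim: eventually_mono\<close>)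
    hence "deriv f x = (\<Sum>n. diffs a n * x ^ n)" by (rule DERIV_imp_deriv)
    moreover have "summable (\<lambda>n. diffs a n * x ^ n)"
      by (rule termdiff_converges[of x r]) (use x sm in auto)
    ultimately show ?thesis by (simp add: sums_iff)
  qed
  have "(deriv ^^ Suc k) f 0 = (deriv ^^ k) (deriv f) 0" by (simp add: funpow_swap1)
  also have "\<dots> = fact k * diffs a k" by (rule Suc.IH[OF Suc.prems(1) d])
  finally show ?case by (simp add: diffs_def algebra_simps)
qed

lemma bounded_bilinear_emul:
  obtains emul :: "real ell1 \<Rightarrow> real ell1 \<Rightarrow> real ell1" where "bounded_bilinear emul"
    "\<And>a b. norm (emul a b) \<le> norm a * norm b"
    "\<And>w a b. w \<in> unit_square \<Longrightarrow> ev w (emul a b) = ev w a * ev w b"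
proof -
  define M where "M = (\<lambda>x::nat \<Rightarrow> real. x 0 * x 1)"
  have two: "{..<2::nat} = {0, 1}" by auto
  have M: "bounded_multilinear 2 M 1"
    unfolding bounded_multilinear_def
  proof (intro conjI allI impI)
    fix x :: "nat \<Rightarrow> real" and i :: nat assume "i < 2"
    hence "i = 0 \<or> i = 1" by auto
    thus "linear (\<lambda>v. M (x(i := v)))" by (auto simp: M_def intro!: linearI simp: algebra_simps)
  qed (auto simp: M_def two abs_mult)
  define emul where "emul a b = mlift 2 M (\<lambda>i. if i = 0 then a else b)" for a b
  note Ml = bounded_multilinear_mlift[OF M]
  have n: "norm (emul a b) \<le> norm a * norm b" for a b
    using mlift_bound(2)[OF M, of "\<lambda>i. if i = 0 then a else b"] by (simp add: emul_def two)
  have l1: "bounded_linear (\<lambda>a. emul a b)" for b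
  proof -
    have eq: "(\<lambda>i::nat. if i = 0 then a else b) = (\<lambda>i. b)(0 := a)" for a by auto
    show ?thesis unfolding emul_def eq by (rule bounded_multilinear_bounded_linear[OF Ml]) simp
  qed
  have l2: "bounded_linear (\<lambda>b. emul a b)" for a
  proof -
    have "mlift 2 M (\<lambda>i. if i = 0 then a else b) = mlift 2 M ((\<lambda>i. a)(1 := b))" for b
      by (rule bounded_multilinearD(2)[OF Ml]) auto
    thus ?thesis unfolding emul_def using bounded_multilinear_bounded_linear[OF Ml, of 1 "\<lambda>i. a"] by simp
  qed
  have "bounded_bilinear emul"
  proof
    fix a a' b b' :: "real ell1" and r :: real
    show "emul (a + a') b = emul a b + emul a' b" by (rule linear_add[OF bounded_linear.linear[OF l1]])
    show "emul a (b + b') = emul a b + emul a b'" by (rule linear_add[OF bounded_linear.linear[OF l2]])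
    show "emul (r *\<^sub>R a) b = r *\<^sub>R emul a b" by (rule linear_scale[OF bounded_linear.linear[OF l1]])
    show "emul a (r *\<^sub>R b) = r *\<^sub>R emul a b" by (rule linear_scale[OF bounded_linear.linear[OF l2]])
    show "\<exists>K. \<forall>a b. norm (emul a b) \<le> norm a * norm b * K" using n by (intro exI[of _ 1]) simp
  qed
  moreover have "ev w (emul a b) = ev w a * ev w b" if "w \<in> unit_square" for w a b
    unfolding emul_def ev_mlift[OF M that] by (simp add: M_def)
  ultimately show ?thesis using that n by blast
qed

lemma real_analytic_at_partial_series:
  fixes A :: "real ell1"
  obtains gh :: "real \<Rightarrow> real ell1" where "real_analytic_at gh 0"
    "gh 0 = ewt (\<lambda>k. if snd k = 0 then 1 else 0) A"
    "\<And>s t. \<bar>s\<bar> \<le> 1 \<Longrightarrow> \<bar>t\<bar> < 1 / 2 \<Longrightarrow> ev (s, 0) (gh t) = ev (s, t) A"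
proof -
  define col where "col n = ewt (\<lambda>k. if snd k = 0 then 1 else 0) (epull ((+) (0, n)) A)" for n
  have inj: "inj ((+) j)" for j :: "nat \<times> nat" by (simp add: inj_def)
  have ncol: "norm (col n) \<le> norm A" for n
    unfolding col_def by (rule order_trans[OF ewt_bound(2)]) (auto simp: epull_bound[OF inj])
  define gh where "gh t = (\<Sum>n. t ^ n *\<^sub>R col n)" for t
  have sm: "summable (\<lambda>n. norm A * (1 / 2) ^ n)" by (intro summable_mult summable_geometric) simp
  have sums: "(\<lambda>n. t ^ n *\<^sub>R col n) sums gh t" if "\<bar>t\<bar> \<le> 1 / 2" for t
  proof -
    have "summable (\<lambda>n. t ^ n *\<^sub>R col n)"
    proof (rule summable_comparison_test'[OF sm, of 0])
      fix n
      have "norm (t ^ n *\<^sub>R col n) \<le> (1 / 2) ^ n * norm A"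
        unfolding norm_scaleR using that
        by (intro mult_mono ncol) (auto simp: power_abs intro: power_mono)
      thus "norm (t ^ n *\<^sub>R col n) \<le> norm A * (1 / 2) ^ n" by (simp add: mult.commute)
    qed
    thus ?thesis by (simp add: gh_def summable_sums)
  qed
  show thesis
  proof (rule that[of gh])
    show "real_analytic_at gh 0"
    proof (rule real_analytic_atI[of "\<lambda>n x. (\<Prod>i<n. x i) *\<^sub>R col n" "\<lambda>n. norm A" "1 / 2"])
      have "bounded_multilinear n (\<lambda>x. (\<Prod>i<n. x i) *\<^sub>R col n) (norm A)" for n
        unfolding bounded_multilinear_def
      proof (intro conjI allI impI)
        show "linear (\<lambda>v. (\<Prod>l<n. (x(i := v)) l) *\<^sub>R col n)" if "i < n" for x :: "nat \<Rightarrow> real" and i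
        proof -
          have "(\<Prod>l<n. (x(i := v)) l) = v * (\<Prod>l\<in>{..<n} - {i}. x l)" for v
            using that by (subst prod.remove[of _ i]) (auto intro!: prod.cong)
          thus ?thesis
            by (intro linearI) (simp_all only: distrib_right scaleR_add_left real_scaleR_def mult.assoc scaleR_scaleR)
        qed
        show "norm ((\<Prod>i<n. x i) *\<^sub>R col n) \<le> norm A * (\<Prod>i<n. norm (x i))" for x :: "nat \<Rightarrow> real"
          unfolding norm_scaleR by (simp add: abs_prod mult.commute[of _ "norm (col n)"] mult_right_mono[OF ncol] prod_nonneg)
      qed (auto intro!: arg_cong[where f = "\<lambda>c. c *\<^sub>R col n"] prod.cong)
      thus "power_coeffs (\<lambda>n x. (\<Prod>i<n. x i) *\<^sub>R col n) (\<lambda>n. norm A) (1 / 2)"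
        using sm by (simp add: power_coeffs_def)
      show "(\<lambda>n. (\<Prod>i<n. h) *\<^sub>R col n) sums gh (0 + h)" if "norm h < 1 / 2" for h
        using sums[of h] that by simp
    qed
    have "(\<lambda>n. 0 ^ n *\<^sub>R col n) = (\<lambda>n. if n = 0 then col 0 else 0)" by (auto simp: fun_eq_iff power_0_left)
    hence "gh 0 = col 0" using sums[of 0] sums_single[of 0 "\<lambda>_. col 0"] by (simp add: sums_iff)
    also have "\<dots> = ewt (\<lambda>k. if snd k = 0 then 1 else 0) A"
      by (rule ell1_eqI) (simp add: col_def ewt_bound epull_bound[OF inj] zero_prod_def[symmetric])
    finally show "gh 0 = ewt (\<lambda>k. if snd k = 0 then 1 else 0) A" .
    fix s t :: real assume st: "\<bar>s\<bar> \<le> 1" "\<bar>t\<bar> < 1 / 2"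
    have us: "(s, 0) \<in> unit_square" "(s, t) \<in> unit_square" using st by (auto simp: unit_square_def)
    have 1: "(\<lambda>n. t ^ n * ev (s, 0) (col n)) sums ev (s, 0) (gh t)"
      using bounded_linear.sums[OF bounded_linear_ev[OF us(1)] sums[of t]] st
      by (simp add: linear_scale[OF bounded_linear.linear[OF bounded_linear_ev[OF us(1)]]])
    have inner: "((\<lambda>m. monom2 (s, t) (m, n) *\<^sub>R coef A (m, n)) has_sum t ^ n * ev (s, 0) (col n)) UNIV" for n
    proof -
      from has_sum_cmult_right[OF ev_fst_has_sum[OF st(1), of "col n"], of "t ^ n"] show ?thesis
        by (simp add: monom2_def col_def ewt_bound epull_bound[OF inj] ac_simps)
    qed
    have "((\<lambda>(n, m). monom2 (s, t) (m, n) *\<^sub>R coef A (m, n)) has_sum ev (s, t) A) (UNIV \<times> UNIV)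
       = ((\<lambda>k. monom2 (s, t) k *\<^sub>R coef A k) has_sum ev (s, t) A) UNIV"
      by (rule has_sum_reindex_bij_witness[of _ prod.swap prod.swap]) auto
    hence "((\<lambda>(n, m). monom2 (s, t) (m, n) *\<^sub>R coef A (m, n)) has_sum ev (s, t) A) (UNIV \<times> UNIV)"
      using ev_has_sum[OF us(2)] by blast
    hence "((\<lambda>n. t ^ n * ev (s, 0) (col n)) has_sum ev (s, t) A) UNIV"
      by (rule has_sum_SigmaD) (unfold prod.case, rule inner)
    from sums_unique2[OF 1 has_sum_imp_sums[OF this]] show "ev (s, 0) (gh t) = ev (s, t) A" .
  qed
qed

lemma real_analytic_at_ev_fst:
  fixes v0 :: "real ell1"
  shows "real_analytic_at (\<lambda>x::real \<times> real ell1. ev (fst x, 0) (snd x)) (0, v0)"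
proof -
  have us: "(s, 0) \<in> unit_square" if "\<bar>s\<bar> \<le> 1" for s :: real using that by (simp add: unit_square_def)
  have 1: "real_analytic_at (\<lambda>x::real \<times> real ell1. ev (fst x, 0) (snd x)) 0"
  proof (rule real_analytic_atI)
    define M where "M n x = (case n of 0 \<Rightarrow> 0 | Suc m \<Rightarrow> (\<Prod>i<m. fst (x i)) * coef (snd (x m)) (m, 0))"
      for n and x :: "nat \<Rightarrow> real \<times> real ell1"
    have bm: "bounded_multilinear n (M n) 1" for n
    proof (cases n)
      case 0 thus ?thesis by (auto simp: M_def bounded_multilinear_def linear_zero)
    next
      case (Suc m)
      have "bounded_multilinear m (\<lambda>x::nat \<Rightarrow> real \<times> real ell1. \<Prod>i<m. fst (x i)) 1"
        unfolding bounded_multilinear_def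
      proof (intro conjI allI impI)
        show "linear (\<lambda>v. \<Prod>l<m. fst ((x(i := v)) l))" if "i < m" for x :: "nat \<Rightarrow> real \<times> real ell1" and i
        proof -
          have "(\<Prod>l<m. fst ((x(i := v)) l)) = fst v * (\<Prod>l\<in>{..<m} - {i}. fst (x l))" for v
            using that by (subst prod.remove[of _ i]) (auto intro!: prod.cong)
          thus ?thesis by (intro linearI) (simp_all add: distrib_right)
        qed
        show "norm (\<Prod>i<m. fst (x i)) \<le> 1 * (\<Prod>i<m. norm (x i))" for x :: "nat \<Rightarrow> real \<times> real ell1"
          unfolding prod_norm[symmetric] mult_1
          by (intro prod_mono conjI norm_ge_zero) (metis norm_fst_le prod.collapse)
      qed (auto intro!: prod.cong)
      moreover have "bounded_multilinear 1 (\<lambda>x::nat \<Rightarrow> real \<times> real ell1. coef (snd (x 0)) (m, 0)) 1"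
        unfolding bounded_multilinear_def
      proof (intro conjI allI impI)
        show "norm (coef (snd (x 0)) (m, 0)) \<le> 1 * (\<Prod>i<1. norm (x i))" for x :: "nat \<Rightarrow> real \<times> real ell1"
          using norm_coef_le[of "snd (x 0)" "(m, 0)"] norm_snd_le[of "snd (x 0)" "fst (x 0)"] by simp
      qed (auto intro!: linearI)
      ultimately show ?thesis
        using bounded_multilinear_mult[of m "\<lambda>x::nat \<Rightarrow> real \<times> real ell1. \<Prod>i<m. fst (x i)" 1 1
            "\<lambda>x::nat \<Rightarrow> real \<times> real ell1. coef (snd (x 0)) (m, 0)" 1] Suc by (simp add: M_def[abs_def])
    qed
    thus "power_coeffs M (\<lambda>_. 1) (1 / 2)"
      by (simp add: power_coeffs_def summable_geometric)
    fix h :: "real \<times> real ell1" assume h: "norm h < 1 / 2"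
    have s: "\<bar>fst h\<bar> \<le> 1" using h norm_fst_le[of "fst h" "snd h"] by simp
    from ev_fst_has_sum[OF s, of "snd h"]
    have "(\<lambda>m. fst h ^ m * coef (snd h) (m, 0)) sums ev (fst h, 0) (snd h)"
      by (intro has_sum_imp_sums) simp
    hence "(\<lambda>m. M (Suc m) (\<lambda>_. h)) sums ev (fst h, 0) (snd h)" by (simp add: M_def)
    thus "(\<lambda>n. M n (\<lambda>_. h)) sums ev (fst (0 + h), 0) (snd (0 + h))"
      by (subst (asm) sums_Suc_iff) (simp add: M_def)
  qed
  have 2: "real_analytic_at (\<lambda>x::real \<times> real ell1. ev (fst x, 0) v0) (0, v0)"
  proof -
    have "real_analytic_at (\<lambda>w::real \<times> real. ev w (ewt (\<lambda>k. if snd k = 0 then 1 else 0) v0)) 0"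
      by (rule ev_imp_real_analytic_at[of 1 _ 0]) auto
    hence "real_analytic_at (\<lambda>x::real \<times> real ell1. ev (fst x, 0) (ewt (\<lambda>k. if snd k = 0 then 1 else 0) v0)) (0, v0)"
      by (intro real_analytic_at_compose_linear[where T = "\<lambda>x::real \<times> real ell1. (fst x, 0::real)"])
         (auto simp: zero_prod_def intro!: bounded_linear_Pair bounded_linear_fst)
    thus ?thesis by (simp add: ev_restrict_fst[of _ v0 0])
  qed
  have "real_analytic_at (\<lambda>x::real \<times> real ell1. ev (fst (x + - (0, v0)), 0) (snd (x + - (0, v0)))) (0, v0)"
    using 1 real_analytic_at_affine[OF bounded_linear_ident, of "\<lambda>x::real \<times> real ell1. ev (fst x, 0) (snd x)" "(0, v0)" "- (0, v0)"]
    by (simp add: zero_prod_def)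
  from real_analytic_at_add[OF 2 this] have
    3: "real_analytic_at (\<lambda>x::real \<times> real ell1. ev (fst x, 0) v0 + ev (fst x, 0) (snd x - v0)) (0, v0)" by simp
  show ?thesis
  proof (rule real_analytic_at_cong[OF 3])
    have "\<forall>\<^sub>F x in nhds (0::real, v0). x \<in> {-1<..<1} \<times> UNIV" by (intro eventually_nhds_in_open open_Times) auto
    thus "\<forall>\<^sub>F x in nhds (0, v0). ev (fst x, 0) v0 + ev (fst x, 0) (snd x - v0) = ev (fst x, 0) (snd x)"
    proof eventually_elim
      case (elim x)
      hence "\<bar>fst x\<bar> \<le> 1" by (auto simp: mem_Times_iff)
      thus ?case by (simp add: linear_diff[OF bounded_linear.linear[OF bounded_linear_ev[OF us]]])
    qed
  qed
qed

lemma weierstrass_preparation: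
  fixes g :: "real \<times> real \<Rightarrow> real"
  assumes an: "real_analytic_at g 0" and ord: "has_order_at (\<lambda>l. g (l, 0)) 0 p"
  obtains \<rho> c d where "\<rho> > 0" "real_analytic_on (ball 0 \<rho>) c" "c 0 \<noteq> 0"
    "\<And>j. j < p \<Longrightarrow> real_analytic_on (ball 0 \<rho>) (d j)" "\<And>j. j < p \<Longrightarrow> d j 0 = 0"
    "\<And>l z. (l, z) \<in> ball 0 \<rho> \<Longrightarrow> g (l, z) = c (l, z) * (l ^ p + (\<Sum>j<p. d j z * l ^ j))"
proof -
  obtain \<rho>0 C where \<rho>0: "\<rho>0 > 0" and ex: "\<And>\<rho>. 0 < \<rho> \<Longrightarrow> \<rho> \<le> \<rho>0 \<Longrightarrow>
      \<exists>a. norm (a - single 0 (g 0)) \<le> C * \<rho> \<and> (\<forall>w\<in>unit_square. g (0 + \<rho> *\<^sub>R w) = ev w a)"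
    using real_analytic_at_imp_ev[OF an] by metis
  from ex[OF \<rho>0 order.refl] obtain a where a: "\<And>w. w \<in> unit_square \<Longrightarrow> g (\<rho>0 *\<^sub>R w) = ev w a" by auto
  define \<alpha> where "\<alpha> = coef a (p, 0)"
  have hd: "(deriv ^^ k) (\<lambda>l. g (l, 0)) 0 = fact k * (coef a (k, 0) / \<rho>0 ^ k)" for k
  proof (rule higher_deriv_powser[OF \<rho>0])
    fix l :: real assume l: "\<bar>l\<bar> < \<rho>0"
    hence s: "\<bar>l / \<rho>0\<bar> \<le> 1" using \<rho>0 by simp
    have "(l / \<rho>0, 0) \<in> unit_square" using s by (simp add: unit_square_def)
    from a[OF this] have "ev (l / \<rho>0, 0) a = g (l, 0)" using \<rho>0 by simp
    moreover have "(\<lambda>n. (l / \<rho>0) ^ n * coef a (n, 0)) sums ev (l / \<rho>0, 0) a"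
      by (rule has_sum_imp_sums[OF ev_fst_has_sum[OF s]])
    ultimately show "(\<lambda>n. coef a (n, 0) / \<rho>0 ^ n * l ^ n) sums g (l, 0)"
      by (simp add: power_divide mult.commute)
  qed
  have a0: "coef a (m, 0) = 0" if "m < p" for m
    using ord that hd[of m] \<rho>0 by (auto simp: has_order_at_def)
  have \<alpha>: "\<alpha> \<noteq> 0" using ord hd[of p] by (auto simp: has_order_at_def \<alpha>_def)
  have na: "norm a \<ge> \<bar>\<alpha>\<bar>" using norm_coef_le[of a "(p, 0)"] by (simp add: \<alpha>_def)
  define \<theta> where "\<theta> = \<bar>\<alpha>\<bar> / (2 * norm a)"
  have na0: "norm a > 0" using na \<alpha> by linarith
  have \<theta>: "\<theta> > 0" "\<theta> \<le> 1" using na \<alpha> na0 by (auto simp: \<theta>_def field_simps)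
  define N where "N = \<theta> ^ p * \<alpha>"
  have N: "N \<noteq> 0" using \<theta> \<alpha> by (simp add: N_def)
  define A where "A = (1 / N) *\<^sub>R ewt (\<lambda>k. \<theta> ^ (fst k + snd k)) a"
  have wb: "\<bar>\<theta> ^ (fst k + snd k)\<bar> \<le> 1" for k :: "nat \<times> nat" using \<theta> by (simp add: power_le_one)
  have evA: "g ((\<rho>0 * \<theta>) *\<^sub>R w) = N * ev w A" if w: "w \<in> unit_square" for w
  proof -
    have "\<bar>\<theta> * fst w\<bar> \<le> 1" "\<bar>\<theta> * snd w\<bar> \<le> 1"
      unfolding abs_mult using w \<theta> by (auto simp: unit_square_def intro!: mult_le_one)
    hence w': "\<theta> *\<^sub>R w \<in> unit_square" by (simp add: unit_square_def)
    have cw: "coef (ewt (\<lambda>k. \<theta> ^ (fst k + snd k)) a) k = \<theta> ^ (fst k + snd k) *\<^sub>R coef a k" for k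
      by (simp only: ewt_bound(1)[OF wb])
    have "ev w (ewt (\<lambda>k. \<theta> ^ (fst k + snd k)) a) = ev (\<theta> *\<^sub>R w) a"
      by (rule ev_cong) (simp only: cw, simp add: monom2_def power_mult_distrib power_add)
    hence "ev w A = (1 / N) * ev (\<theta> *\<^sub>R w) a"
      unfolding A_def by (simp add: linear_scale[OF bounded_linear.linear[OF bounded_linear_ev[OF w]]])
    thus ?thesis using a[OF w'] N by simp
  qed
  have coefA: "coef A k = \<theta> ^ (fst k + snd k) * coef a k / N" for k
    by (simp only: A_def ewt_bound(1)[OF wb] scaleR_ell1.rep_eq) simp
  obtain gh :: "real \<Rightarrow> real ell1" where gh: "real_analytic_at gh 0"
    "gh 0 = ewt (\<lambda>k. if snd k = 0 then 1 else 0) A"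
    "\<And>s t. \<bar>s\<bar> \<le> 1 \<Longrightarrow> \<bar>t\<bar> < 1 / 2 \<Longrightarrow> ev (s, 0) (gh t) = ev (s, t) A"
    by (rule real_analytic_at_partial_series[of A]) (rule that)
  define q :: "real ell1 \<Rightarrow> real ell1" where "q = ewt (\<lambda>k. if p \<le> fst k then 0 else 1)"
  define c :: "real ell1 \<Rightarrow> real ell1" where "c = epull ((+) (p, 0))"
  have inj: "inj ((+) j)" for j :: "nat \<times> nat" by (simp add: inj_def)
  have blq: "bounded_linear q" unfolding q_def by (rule bounded_linear_ewt) simp
  have blc: "bounded_linear c" unfolding c_def by (rule bounded_linear_epull[OF inj])
  have nq: "norm (q x) \<le> norm x" for x unfolding q_def by (rule ewt_bound) simp
  have nc: "norm (c x) \<le> norm x" for x unfolding c_def by (rule epull_bound[OF inj])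
  have split: "ev w x = ev w (q x) + monom2 w (p, 0) * ev w (c x)" if "w \<in> unit_square" for w x
    using ev_split[OF that, of x "(p, 0)"] unfolding range_add_10 q_def c_def by simp
  have evq: "ev (s, 0) (q x) = (\<Sum>j<p. coef x (j, 0) * s ^ j)" if s: "\<bar>s\<bar> \<le> 1" for s x
  proof -
    have cq: "coef (q x) (m, 0) = (if m < p then coef x (m, 0) else 0)" for m
      by (simp add: q_def ewt_bound)
    have "(\<lambda>m. s ^ m * coef (q x) (m, 0)) sums (\<Sum>m<p. s ^ m * coef (q x) (m, 0))"
      by (rule sums_finite) (auto simp: cq)
    from sums_unique2[OF has_sum_imp_sums[OF ev_fst_has_sum[OF s]] this] show ?thesis
      by (simp add: cq mult.commute)
  qed
  define e where "e = c (gh 0) - single 0 1"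
  have ne: "norm e \<le> 1 / 2"
  proof (rule norm_ell1_boundI)
    fix S :: "(nat \<times> nat) set" assume S: "finite S"
    have ce: "norm (coef e k) \<le> \<theta> / \<bar>\<alpha>\<bar> * norm (coef (c a) k)" for k
    proof -
      have 1: "coef e k = (if snd k = 0 then coef A ((p, 0) + k) else 0) - (if k = 0 then 1 else 0)"
        by (simp add: e_def c_def epull_bound[OF inj] gh(2) ewt_bound single.rep_eq)
      consider "k = 0" | "snd k \<noteq> 0" | m where "k = (Suc m, 0)"
        by (cases k) (metis (no_types, opaque_lifting) not0_implies_Suc snd_conv zero_prod_def)
      thus ?thesis
      proof cases
        case 1
        have "coef e k = 0" unfolding \<open>coef e k = _\<close> using \<alpha> \<theta> 1 by (simp add: coefA N_def \<alpha>_def zero_prod_def)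
        thus ?thesis using \<theta> by simp
      next
        case 2
        hence "k \<noteq> 0" by auto
        hence "coef e k = 0" unfolding \<open>coef e k = _\<close> using 2 by simp
        thus ?thesis using \<theta> by simp
      next
        case (3 m)
        have "coef e k = \<theta> ^ Suc m / \<alpha> * coef a (p + Suc m, 0)"
          unfolding \<open>coef e k = _\<close> using 3 \<theta> by (simp add: coefA N_def power_add zero_prod_def)
        hence "norm (coef e k) = \<theta> ^ Suc m / \<bar>\<alpha>\<bar> * norm (coef (c a) k)"
          using 3 \<theta> by (simp add: abs_mult c_def epull_bound[OF inj])
        also have "\<dots> \<le> \<theta> / \<bar>\<alpha>\<bar> * norm (coef (c a) k)"
          using \<theta> by (intro mult_right_mono divide_right_mono) (auto simp: mult_left_le power_le_one)
        finally show ?thesis .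
      qed
    qed
    have "(\<Sum>k\<in>S. norm (coef e k)) \<le> (\<Sum>k\<in>S. \<theta> / \<bar>\<alpha>\<bar> * norm (coef (c a) k))" by (intro sum_mono ce)
    also have "\<dots> = \<theta> / \<bar>\<alpha>\<bar> * (\<Sum>k\<in>S. norm (coef (c a) k))" by (simp add: sum_distrib_left)
    also have "\<dots> \<le> \<theta> / \<bar>\<alpha>\<bar> * norm a"
      using \<theta> order_trans[OF sum_norm_coef_le[OF S] nc] by (intro mult_left_mono) auto
    also have "\<dots> = 1 / 2" using \<alpha> na0 by (simp add: \<theta>_def)
    finally show "(\<Sum>k\<in>S. norm (coef e k)) \<le> 1 / 2" .
  qed
  have q0: "q (gh 0) = 0"
  proof (rule ell1_eqI)
    fix k
    have "coef (q (gh 0)) k = (if p \<le> fst k then 0 else if snd k = 0 then coef A k else 0)"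
      by (simp add: q_def gh(2) ewt_bound)
    also have "\<dots> = 0" using a0[of "fst k"] by (cases k) (auto simp: coefA)
    finally show "coef (q (gh 0)) k = coef 0 k" by simp
  qed
  obtain emul :: "real ell1 \<Rightarrow> real ell1 \<Rightarrow> real ell1" where emul: "bounded_bilinear emul"
    "\<And>a b. norm (emul a b) \<le> norm a * norm b"
    "\<And>w a b. w \<in> unit_square \<Longrightarrow> ev w (emul a b) = ev w a * ev w b"
    by (rule bounded_bilinear_emul) (rule that)
  define h where "h v = (gh (fst (fst v)) - gh 0) + (- emul e (q (snd v)) - emul (c (snd v)) (q (snd v)))"
    for v :: "(real \<times> real) \<times> real ell1"
  define T where "T x = - emul e (q x)" for x
  have blT: "bounded_linear T"
    unfolding T_def by (intro bounded_linear_minus bounded_linear_compose[OF bounded_bilinear.bounded_linear_right[OF emul(1)] blq])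
  have "real_analytic_at h 0"
  proof -
    have bl1: "bounded_linear (\<lambda>v::(real \<times> real) \<times> real ell1. fst (fst v))"
      by (intro bounded_linear_compose[OF bounded_linear_fst] bounded_linear_fst)
    have 1: "real_analytic_at (\<lambda>v::(real \<times> real) \<times> real ell1. gh (fst (fst v))) 0"
      by (rule real_analytic_at_compose_linear[OF bl1]) (simp add: gh(1))
    have 2: "real_analytic_at (\<lambda>v::(real \<times> real) \<times> real ell1. T (snd v)) 0"
      by (rule real_analytic_at_linear[OF bounded_linear_compose[OF blT bounded_linear_snd]])
    have 3: "real_analytic_at (\<lambda>v::(real \<times> real) \<times> real ell1. emul (c (snd v)) (q (snd v))) 0"
      by (rule real_analytic_at_bilinear[OF emul(1) bounded_linear_compose[OF blc bounded_linear_snd]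
            bounded_linear_compose[OF blq bounded_linear_snd]])
    show ?thesis
      unfolding h_def using real_analytic_at_add[OF real_analytic_at_diff[OF 1 real_analytic_at_const]
          real_analytic_at_diff[OF 2 3]] by (simp add: T_def)
  qed
  moreover have em0: "emul a 0 = 0" for a by (rule bounded_bilinear.zero_right[OF emul(1)])
  have q00: "q 0 = 0" "c 0 = 0"
    using linear_0[OF bounded_linear.linear[OF blq]] linear_0[OF bounded_linear.linear[OF blc]] .
  have "h 0 = 0" by (simp add: h_def q00 em0)
  moreover have "((\<lambda>x. h (0, x)) has_derivative T) (at 0)"
  proof (rule has_derivative_quadraticI[OF blT, of 1 1])
    fix x :: "real ell1"
    have "h (0, 0 + x) - h (0, 0) - T x = - emul (c x) (q x)" by (simp add: h_def T_def q00 em0)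
    moreover have "norm (emul (c x) (q x)) \<le> norm x * norm x"
      using emul(2)[of "c x" "q x"] mult_mono[OF nc nq, of x x] by simp
    ultimately show "norm (h (0, 0 + x) - h (0, 0) - T x) \<le> 1 * norm x * norm x" by simp
  qed simp_all
  moreover have "norm (T x) \<le> norm x / 2" for x
  proof -
    have "norm (T x) \<le> norm e * norm (q x)" using emul(2) by (simp add: T_def)
    also have "\<dots> \<le> 1 / 2 * norm x" by (intro mult_mono ne nq) auto
    finally show ?thesis by simp
  qed
  ultimately obtain \<rho>1 X where \<rho>1: "\<rho>1 > 0" and X: "real_analytic_on (ball 0 \<rho>1) X" "X 0 = 0"
    "\<And>w. w \<in> ball 0 \<rho>1 \<Longrightarrow> h (w, X w) = X w" by (rule analytic_fixpoint) blast+
  define y where "y t = X (t, 0)" for t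
  have y0: "y 0 = 0" using X(2) by (simp add: y_def zero_prod_def)
  have yan: "real_analytic_at y 0"
  proof -
    have "bounded_linear (\<lambda>t::real. (t, 0::real))" by (intro bounded_linear_Pair bounded_linear_ident bounded_linear_zero)
    moreover have "real_analytic_at X (0, 0)" using X(1) \<rho>1 by (simp add: real_analytic_on_def zero_prod_def)
    ultimately show ?thesis unfolding y_def by (rule real_analytic_at_compose_linear)
  qed
  define c0 where "c0 w = ev (fst w, 0) (single 0 1 + e + c (y (snd w)))" for w :: "real \<times> real"
  define d0 where "d0 j t = coef (y t) (j, 0)" for j t
  have fac: "ev (s, t) A = c0 (s, t) * (s ^ p + (\<Sum>j<p. d0 j t * s ^ j))"
    if s: "\<bar>s\<bar> \<le> 1" and t: "\<bar>t\<bar> < 1 / 2" "\<bar>t\<bar> < \<rho>1" for s t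
  proof -
    have us: "(s, 0) \<in> unit_square" using s by (simp add: unit_square_def)
    interpret E: bounded_linear "ev (s, 0) :: real ell1 \<Rightarrow> real" by (rule bounded_linear_ev[OF us])
    have "h ((t, 0), y t) = y t" unfolding y_def using t by (intro X(3)) (simp add: norm_Pair)
    hence "gh t = y t + emul e (q (y t)) + emul (c (y t)) (q (y t)) + gh 0"
      by (simp add: h_def algebra_simps)
    hence "ev (s, t) A = ev (s, 0) (y t + emul e (q (y t)) + emul (c (y t)) (q (y t)) + gh 0)"
      using gh(3)[OF s t(1)] by simp
    also have "\<dots> = ev (s, 0) (y t) + ev (s, 0) e * ev (s, 0) (q (y t)) + ev (s, 0) (c (y t)) * ev (s, 0) (q (y t)) + ev (s, 0) (gh 0)"
      by (simp add: E.add emul(3)[OF us])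
    also have "ev (s, 0) (y t) = ev (s, 0) (q (y t)) + s ^ p * ev (s, 0) (c (y t))"
      using split[OF us, of "y t"] by (simp add: monom2_def)
    also have "ev (s, 0) (gh 0) = s ^ p * (1 + ev (s, 0) e)"
      using split[OF us, of "gh 0"] by (simp add: q0 E.zero e_def E.diff monom2_def)
    finally have "ev (s, t) A = (1 + ev (s, 0) e + ev (s, 0) (c (y t))) * (s ^ p + ev (s, 0) (q (y t)))"
      by (simp add: algebra_simps)
    thus ?thesis by (simp add: c0_def E.add evq[OF s] d0_def)
  qed
  have c0an: "real_analytic_at c0 0"
  proof -
    have v: "real_analytic_at (\<lambda>w::real \<times> real. y (snd w)) 0"
      by (rule real_analytic_at_compose_linear[OF bounded_linear_snd]) (simp add: yan)
    have "real_analytic_at (\<lambda>w::real \<times> real. (fst w, single 0 1 + e + c (y (snd w)))) 0"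
      by (rule real_analytic_at_Pair[OF real_analytic_at_linear[OF bounded_linear_fst]
            real_analytic_at_add[OF real_analytic_at_const real_analytic_at_linear_compose[OF blc v]]])
    from real_analytic_at_compose[OF _ this, of "\<lambda>x. ev (fst x, 0) (snd x)"] real_analytic_at_ev_fst[of "single 0 1 + e"]
    show ?thesis by (simp add: c0_def[abs_def] y0 q00)
  qed
  have c00: "c0 0 \<noteq> 0"
  proof -
    have us: "(0::real, 0::real) \<in> unit_square" by (simp add: unit_square_def)
    interpret E: bounded_linear "ev (0, 0) :: real ell1 \<Rightarrow> real" by (rule bounded_linear_ev[OF us])
    have "\<bar>ev (0, 0) e\<bar> \<le> 1 / 2" using norm_ev_le[OF us, of e] ne by simp
    thus ?thesis by (simp add: c0_def y0 q00 E.add)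
  qed
  obtain r1 where r1: "r1 > 0" "real_analytic_on (ball 0 r1) c0" using real_analytic_at_imp_on_ball[OF c0an] by blast
  have "\<exists>r>0. real_analytic_on (ball 0 r) (d0 j)" for j
  proof -
    have "real_analytic_at (d0 j) 0"
      unfolding d0_def by (rule real_analytic_at_linear_compose[OF bounded_linear_coef yan])
    thus ?thesis using real_analytic_at_imp_near by metis
  qed
  then obtain r2 where r2: "\<And>j. r2 j > 0" "\<And>j. real_analytic_on (ball 0 (r2 j)) (d0 j)" by metis
  define S where "S = {1 / 2, \<rho>1, r1} \<union> r2 ` {..<p}"
  have S: "finite S" "S \<noteq> {}" "\<And>x. x \<in> S \<Longrightarrow> x > 0" using \<rho>1 r1 r2 by (auto simp: S_def)
  define r where "r = Min S"
  have r: "r > 0" "r \<le> 1 / 2" "r \<le> \<rho>1" "r \<le> r1" "\<And>j. j < p \<Longrightarrow> r \<le> r2 j"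
  proof -
    have le: "r \<le> x" if "x \<in> S" for x unfolding r_def by (rule Min_le[OF S(1) that])
    show "r > 0" unfolding r_def using S by simp
    show "r \<le> 1 / 2" "r \<le> \<rho>1" "r \<le> r1" by (rule le, simp add: S_def)+
    show "r \<le> r2 j" if "j < p" for j by (rule le) (use that in \<open>simp add: S_def\<close>)
  qed
  define \<rho>' where "\<rho>' = \<rho>0 * \<theta>"
  have \<rho>': "\<rho>' > 0" using \<rho>0 \<theta> by (simp add: \<rho>'_def)
  show thesis
  proof (rule that[of "\<rho>' * r" "\<lambda>w. N / \<rho>' ^ p * c0 ((1 / \<rho>') *\<^sub>R w)" "\<lambda>j z. \<rho>' ^ (p - j) * d0 j ((1 / \<rho>') *\<^sub>R z)"])
    show "\<rho>' * r > 0" using \<rho>' r by simp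
    have scale: "(1 / \<rho>') *\<^sub>R w \<in> ball 0 r" if "w \<in> ball 0 (\<rho>' * r)" for w :: "'x::real_normed_vector"
      using that \<rho>' by (simp add: field_simps)
    show "real_analytic_on (ball 0 (\<rho>' * r)) (\<lambda>w. N / \<rho>' ^ p * c0 ((1 / \<rho>') *\<^sub>R w))"
      unfolding real_analytic_on_def
    proof
      fix w :: "real \<times> real" assume "w \<in> ball 0 (\<rho>' * r)"
      from scale[OF this] have "(1 / \<rho>') *\<^sub>R w \<in> ball 0 r1" using r(4) by auto
      hence "real_analytic_at c0 ((1 / \<rho>') *\<^sub>R w)" using r1 by (simp add: real_analytic_on_def)
      thus "real_analytic_at (\<lambda>w. N / \<rho>' ^ p * c0 ((1 / \<rho>') *\<^sub>R w)) w"
        by (intro real_analytic_at_mult real_analytic_at_const real_analytic_at_compose_linear[OF bounded_linear_scaleR_right])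
    qed
    show "N / \<rho>' ^ p * c0 ((1 / \<rho>') *\<^sub>R 0) \<noteq> 0" using N \<rho>' c00 by simp
    show "real_analytic_on (ball 0 (\<rho>' * r)) (\<lambda>z. \<rho>' ^ (p - j) * d0 j ((1 / \<rho>') *\<^sub>R z))" if j: "j < p" for j
      unfolding real_analytic_on_def
    proof
      fix z :: real assume "z \<in> ball 0 (\<rho>' * r)"
      from scale[OF this] have "(1 / \<rho>') *\<^sub>R z \<in> ball 0 (r2 j)" using r(5)[OF j] by auto
      hence "real_analytic_at (d0 j) ((1 / \<rho>') *\<^sub>R z)" using r2 unfolding real_analytic_on_def by blast
      thus "real_analytic_at (\<lambda>z. \<rho>' ^ (p - j) * d0 j ((1 / \<rho>') *\<^sub>R z)) z"
        by (intro real_analytic_at_mult real_analytic_at_const real_analytic_at_compose_linear[OF bounded_linear_scaleR_right])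
    qed
    show "\<rho>' ^ (p - j) * d0 j ((1 / \<rho>') *\<^sub>R 0) = 0" for j by (simp add: d0_def y0)
    fix l z :: real assume lz: "(l, z) \<in> ball 0 (\<rho>' * r)"
    define s t where "s = l / \<rho>'" and "t = z / \<rho>'"
    have lzst: "l = \<rho>' * s" "z = \<rho>' * t" using \<rho>' by (auto simp: s_def t_def)
    have "(s, t) \<in> ball 0 r" using scale[OF lz] by (simp add: s_def t_def)
    hence "\<bar>s\<bar> < r" "\<bar>t\<bar> < r" using norm_fst_le[of s t] norm_snd_le[of t s] by simp_all
    hence st: "\<bar>s\<bar> \<le> 1" "\<bar>t\<bar> < 1 / 2" "\<bar>t\<bar> < \<rho>1" using r by linarith+
    have us: "(s, t) \<in> unit_square" using st by (simp add: unit_square_def)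
    have "g (l, z) = N * ev (s, t) A" using evA[OF us] by (simp add: lzst \<rho>'_def mult.assoc)
    also have "\<dots> = N * c0 (s, t) * (s ^ p + (\<Sum>j<p. d0 j t * s ^ j))" using fac[OF st] by simp
    also have "s ^ p + (\<Sum>j<p. d0 j t * s ^ j) = (1 / \<rho>' ^ p) * (l ^ p + (\<Sum>j<p. \<rho>' ^ (p - j) * d0 j t * l ^ j))"
    proof -
      have "\<rho>' ^ p * (s ^ p + (\<Sum>j<p. d0 j t * s ^ j)) = l ^ p + (\<Sum>j<p. \<rho>' ^ p * (d0 j t * s ^ j))"
        by (simp add: distrib_left sum_distrib_left lzst power_mult_distrib)
      also have "(\<Sum>j<p. \<rho>' ^ p * (d0 j t * s ^ j)) = (\<Sum>j<p. \<rho>' ^ (p - j) * d0 j t * l ^ j)"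
      proof (rule sum.cong[OF refl])
        fix j assume "j \<in> {..<p}"
        hence "\<rho>' ^ p = \<rho>' ^ (p - j) * \<rho>' ^ j" by (simp add: power_add[symmetric])
        thus "\<rho>' ^ p * (d0 j t * s ^ j) = \<rho>' ^ (p - j) * d0 j t * l ^ j" by (simp add: lzst power_mult_distrib)
      qed
      finally show ?thesis using \<rho>' by (simp add: field_simps)
    qed
    finally show "g (l, z) = N / \<rho>' ^ p * c0 ((1 / \<rho>') *\<^sub>R (l, z)) *
        (l ^ p + (\<Sum>j<p. \<rho>' ^ (p - j) * d0 j ((1 / \<rho>') *\<^sub>R z) * l ^ j))"
      by (simp add: s_def t_def)
  qed
qed

section \<open>Roots of Weierstrass polynomials\<close>

definition wpoly :: "nat \<Rightarrow> (nat \<Rightarrow> real \<Rightarrow> real) \<Rightarrow> real \<Rightarrow> real poly" where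
  "wpoly n c z = monom 1 n + (\<Sum>j<n. monom (c j z) j)"

lemma p_poly_eq_wpoly: "p_poly D = wpoly (chi D) (c_coeff D)"
  by (rule ext) (simp add: p_poly_def wpoly_def)

lemma coeff_wpoly: "coeff (wpoly n c z) i = (if i = n then 1 else if i < n then c i z else 0)"
  by (auto simp: wpoly_def coeff_sum)

lemma degree_wpoly [simp]: "degree (wpoly n c z) = n"
proof (rule antisym)
  show "degree (wpoly n c z) \<le> n" by (rule degree_le) (simp add: coeff_wpoly)
  show "n \<le> degree (wpoly n c z)" by (rule le_degree) (simp add: coeff_wpoly)
qed

lemma wpoly_nonzero [simp]: "wpoly n c z \<noteq> 0"
  using coeff_wpoly[of n c z n] by auto

lemma poly_wpoly: "poly (wpoly n c z) l = l ^ n + (\<Sum>j<n. c j z * l ^ j)"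
  by (simp add: wpoly_def poly_monom poly_sum)

lemma gpoly_wpoly:
  assumes "\<And>j. j < n \<Longrightarrow> real_analytic_at (c j) 0"
  shows "gpoly (wpoly n c)"
  unfolding wpoly_def[abs_def]
  by (intro gpoly_add gpoly_const gpoly_sum gpoly_monom germ_analytic assms) simp

lemma eventually_coeffs_small:
  fixes c :: "nat \<Rightarrow> real \<Rightarrow> real"
  assumes "\<And>j. j < n \<Longrightarrow> isCont (c j) 0" "\<And>j. j < n \<Longrightarrow> c j 0 = 0" and d: "d > 0"
  shows "\<forall>\<^sub>F z in nhds 0. (\<Sum>j<n. \<bar>c j z\<bar> * d ^ j) < d ^ n"
proof -
  have "((\<lambda>z. \<Sum>j<n. \<bar>c j z\<bar> * d ^ j) \<longlongrightarrow> (\<Sum>j<n. \<bar>0\<bar> * d ^ j)) (nhds 0)"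
  proof (intro tendsto_sum tendsto_mult tendsto_rabs tendsto_const)
    fix j assume "j \<in> {..<n}"
    thus "(c j \<longlongrightarrow> 0) (nhds 0)"
      using tendsto_at_iff_tendsto_nhds[THEN iffD1, OF isContD[OF assms(1)[of j]]] assms(2)[of j] by simp
  qed
  from order_tendstoD(2)[OF this, of "d ^ n"] show ?thesis using d by simp
qed

lemma wpoly_root_bound:
  assumes small: "(\<Sum>j<n. \<bar>c j z\<bar> * d ^ j) < d ^ n" and d: "d > 0" and root: "poly (wpoly n c z) l = 0"
  shows "\<bar>l\<bar> < d"
proof (rule ccontr)
  assume "\<not> \<bar>l\<bar> < d"
  hence l: "d \<le> \<bar>l\<bar>" "\<bar>l\<bar> > 0" using d by auto
  have "l ^ n = - (\<Sum>j<n. c j z * l ^ j)" using root by (simp add: poly_wpoly)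
  hence "\<bar>l\<bar> ^ n \<le> (\<Sum>j<n. \<bar>c j z\<bar> * \<bar>l\<bar> ^ j)"
    using sum_abs[of "\<lambda>j. c j z * l ^ j" "{..<n}"] by (simp add: abs_mult power_abs flip: power_abs)
  hence "\<bar>l\<bar> ^ n * d ^ n \<le> (\<Sum>j<n. \<bar>c j z\<bar> * \<bar>l\<bar> ^ j) * d ^ n"
    using d by (intro mult_right_mono) auto
  also have "\<dots> = (\<Sum>j<n. \<bar>c j z\<bar> * (\<bar>l\<bar> ^ j * d ^ n))" by (simp add: sum_distrib_right mult.assoc)
  also have "\<dots> \<le> (\<Sum>j<n. \<bar>c j z\<bar> * (\<bar>l\<bar> ^ n * d ^ j))"
  proof (intro sum_mono mult_left_mono)
    fix j assume "j \<in> {..<n}"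
    hence e: "n = j + (n - j)" by simp
    have "\<bar>l\<bar> ^ j * d ^ n = \<bar>l\<bar> ^ j * d ^ j * d ^ (n - j)" by (subst e) (simp only: power_add mult.assoc)
    also have "\<dots> \<le> \<bar>l\<bar> ^ j * d ^ j * \<bar>l\<bar> ^ (n - j)" using l d by (intro mult_left_mono power_mono) auto
    also have "\<dots> = (\<bar>l\<bar> ^ j * \<bar>l\<bar> ^ (n - j)) * d ^ j" by (simp only: mult_ac)
    also have "\<bar>l\<bar> ^ j * \<bar>l\<bar> ^ (n - j) = \<bar>l\<bar> ^ n" by (subst power_add[symmetric]) (simp only: e[symmetric])
    finally show "\<bar>l\<bar> ^ j * d ^ n \<le> \<bar>l\<bar> ^ n * d ^ j" .
  qed simp
  also have "\<dots> = \<bar>l\<bar> ^ n * (\<Sum>j<n. \<bar>c j z\<bar> * d ^ j)" by (simp add: sum_distrib_left mult_ac)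
  also have "\<dots> < \<bar>l\<bar> ^ n * d ^ n" using small l by (intro mult_strict_left_mono) auto
  finally show False by simp
qed

lemma wpoly_odd_root:
  assumes small: "(\<Sum>j<n. \<bar>c j z\<bar> * d ^ j) < d ^ n" and d: "d > 0" and odd: "odd n"
  shows "\<exists>l. poly (wpoly n c z) l = 0"
proof -
  have b: "\<bar>\<Sum>j<n. c j z * x ^ j\<bar> < d ^ n" if "\<bar>x\<bar> = d" for x
    using sum_abs[of "\<lambda>j. c j z * x ^ j" "{..<n}"] small that by (simp add: abs_mult power_abs)
  have "poly (wpoly n c z) d > 0" using b[of d] d by (simp add: poly_wpoly)
  moreover have "poly (wpoly n c z) (- d) < 0" using b[of "- d"] d odd by (simp add: poly_wpoly)
  ultimately show ?thesis using poly_IVT_pos[of "- d" d "wpoly n c z"] d by auto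
qed

lemma wpoly_branches:
  assumes n: "n \<ge> 1" and c: "\<And>j. j < n \<Longrightarrow> real_analytic_at (c j) 0" "\<And>j. j < n \<Longrightarrow> c j 0 = 0"
  obtains N e l where "e > 0"
    "\<And>z. 0 < z \<Longrightarrow> z < e \<Longrightarrow> {x. poly (wpoly n c z) x = 0} = (\<lambda>i. l i z) ` {..<N}"
    "\<And>z i j. 0 < z \<Longrightarrow> z < e \<Longrightarrow> i < j \<Longrightarrow> j < N \<Longrightarrow> l i z < l j z"
    "\<And>i. i < N \<Longrightarrow> real_analytic_on {0<..<e} (l i)"
    "\<And>i. i < N \<Longrightarrow> (l i \<longlongrightarrow> 0) (at_right 0)"
    "\<And>z. 0 < z \<Longrightarrow> z < e \<Longrightarrow> card {x. poly (wpoly n c z) x = 0} = N"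
    "odd n \<Longrightarrow> N \<ge> 1"
proof -
  have cont: "isCont (c j) 0" if "j < n" for j by (rule real_analytic_at_imp_isCont[OF c(1)[OF that]])
  have small: "\<forall>\<^sub>F z in at_right 0. (\<Sum>j<n. \<bar>c j z\<bar> * d ^ j) < d ^ n" if "d > 0" for d
    using eventually_coeffs_small[of n c, OF cont c(2) that] by (auto simp: eventually_at_filter elim: eventually_mono)
  have gp: "gpoly (wpoly n c)" by (rule gpoly_wpoly[OF c(1)])
  have nz: "\<forall>\<^sub>F z in at_right 0. poly (wpoly n c z) (- 1) \<noteq> 0 \<and> poly (wpoly n c z) 1 \<noteq> 0"
    using small[of 1, simplified]
  proof eventually_elim
    case (elim z)
    have "\<bar>x\<bar> < 1" if "poly (wpoly n c z) x = 0" for x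
      by (rule wpoly_root_bound[where n = n and c = c and z = z and d = 1]) (use elim that in auto)
    from this[of 1] this[of "- 1"] show ?case by auto
  qed
  obtain N where N: "\<forall>\<^sub>F z in at_right 0. card {x \<in> {-1<..<1}. poly (wpoly n c z) x = 0} = N"
    by (rule eventually_root_count_constant[OF gp _ _ nz, of n]) auto
  have "\<forall>\<^sub>F z in at_right 0. card {x. poly (wpoly n c z) x = 0} = N"
    using N small[of 1, simplified]
  proof eventually_elim
    case (elim z)
    have "{x. poly (wpoly n c z) x = 0} = {x \<in> {-1<..<1}. poly (wpoly n c z) x = 0}"
      using wpoly_root_bound[where n = n and c = c and z = z and d = 1] elim(2) by force
    thus ?case using elim(1) by simp
  qed
  moreover have "\<forall>\<^sub>F z in at_right (0::real). degree (wpoly n c z) \<noteq> 0" using n by simp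
  ultimately obtain e l where e: "e > 0"
    and l1: "\<And>z. 0 < z \<Longrightarrow> z < e \<Longrightarrow> {x. poly (wpoly n c z) x = 0} = (\<lambda>i. l i z) ` {..<N}"
    and l2: "\<And>z i j. 0 < z \<Longrightarrow> z < e \<Longrightarrow> i < j \<Longrightarrow> j < N \<Longrightarrow> l i z < l j z"
    and l3: "\<And>i. i < N \<Longrightarrow> real_analytic_on {0<..<e} (l i)"
    using analytic_root_branches[OF gp, of N] by blast
  have near: "\<forall>\<^sub>F z in at_right 0. 0 < z \<and> z < e" using e by (auto simp: eventually_at_right_field)
  show thesis
  proof (rule that[OF e l1 l2 l3])
    show "card {x. poly (wpoly n c z) x = 0} = N" if z: "0 < z" "z < e" for z
    proof -
      have "inj_on (\<lambda>i. l i z) {..<N}"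
      proof (rule linorder_inj_onI)
        show "l i z \<noteq> l j z" if "i < j" "j \<in> {..<N}" for i j using l2[OF z that(1)] that(2) by simp
      qed auto
      thus ?thesis unfolding l1[OF z] by (simp add: card_image)
    qed
    show "(l i \<longlongrightarrow> 0) (at_right 0)" if i: "i < N" for i
    proof (rule tendstoI)
      fix d :: real assume d: "d > 0"
      show "\<forall>\<^sub>F z in at_right 0. dist (l i z) 0 < d"
        using small[OF d] near
      proof eventually_elim
        case (elim z)
        have "l i z \<in> {x. poly (wpoly n c z) x = 0}" using l1[of z] elim i by blast
        thus ?case using wpoly_root_bound[where n = n and c = c and z = z and d = d and l = "l i z", OF elim(1) d] by simp
      qed
    qed
    show "N \<ge> 1" if "odd n"
    proof -
      from small[of 1, simplified] near
      have "\<forall>\<^sub>F z in at_right 0. (\<Sum>j<n. \<bar>c j z\<bar>) < 1 \<and> 0 < z \<and> z < e" by eventually_elim simp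
      then obtain z where z: "(\<Sum>j<n. \<bar>c j z\<bar>) < 1" "0 < z" "z < e"
        using eventually_happens[of _ "at_right (0::real)"] by auto
      have "\<exists>x. poly (wpoly n c z) x = 0" by (rule wpoly_odd_root[where n = n and c = c and z = z and d = 1]) (use z that in auto)
      hence "(\<lambda>i. l i z) ` {..<N} \<noteq> {}" using l1[OF z(2,3)] by auto
      thus ?thesis by (cases N) auto
    qed
  qed
qed

lemma sturm_count_p_poly:
  assumes "lam_minus D < lam_plus D" "poly (p_poly D z) (lam_minus D) \<noteq> 0" "poly (p_poly D z) (lam_plus D) \<noteq> 0"
  shows "int (V_count D (lam_minus D) z) - int (V_count D (lam_plus D) z) = int (real_root_count D z)"
proof -
  have "p_poly D z \<noteq> 0" "degree (p_poly D z) \<le> chi D" by (simp_all add: p_poly_eq_wpoly)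
  from sturm[OF this assms] show ?thesis
    unfolding V_count_def real_root_count_def by simp
qed

lemma tagged_family:
  assumes tag: "\<And>k x. k \<in> K \<Longrightarrow> x \<in> H k \<Longrightarrow> tag x = k" and ne: "\<And>k. k \<in> K \<Longrightarrow> H k \<noteq> {}"
  shows "disjoint (H ` K)" "inj_on H K"
proof -
  show "disjoint (H ` K)"
    unfolding disjoint_def
  proof (intro ballI impI)
    fix A B assume AB: "A \<in> H ` K" "B \<in> H ` K" "A \<noteq> B"
    then obtain j k where jk: "A = H j" "B = H k" "j \<in> K" "k \<in> K" by blast
    have "j \<noteq> k" using AB jk by blast
    thus "A \<inter> B = {}" using tag jk by blast
  qed
  show "inj_on H K"
  proof (rule inj_onI)
    fix j k assume jk: "j \<in> K" "k \<in> K" "H j = H k"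
    obtain x where "x \<in> H j" using ne[OF jk(1)] by blast
    thus "j = k" using tag[OF jk(1)] tag[OF jk(2)] jk(3) by metis
  qed
qed

section \<open>Existence of the reduction data\<close>

lemma exists_order:
  fixes f :: "real \<Rightarrow> real"
  assumes an: "real_analytic_at f 0" and f0: "f 0 = 0" and d: "d > 0" "\<And>x. x \<noteq> 0 \<Longrightarrow> \<bar>x\<bar> < d \<Longrightarrow> f x \<noteq> 0"
  obtains n where "n \<ge> 1" "has_order_at f 0 n"
proof -
  obtain a r where r: "r > 0" and s': "\<And>x. \<bar>x\<bar> < r \<Longrightarrow> (\<lambda>n. x ^ n *\<^sub>R a n) sums f (0 + x)"
    by (rule real_analytic_at_powser[OF an]) (rule that)
  have s: "(\<lambda>n. a n * x ^ n) sums f x" if "\<bar>x\<bar> < r" for x using s'[OF that] by (simp add: mult.commute)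
  have hd: "(deriv ^^ k) f 0 = fact k * a k" for k by (rule higher_deriv_powser[OF r s])
  have "\<exists>n. a n \<noteq> 0"
  proof (rule ccontr)
    assume "\<not> (\<exists>n. a n \<noteq> 0)"
    moreover define x where "x = min (r / 2) (d / 2)"
    ultimately have "f x = 0" using s[of x] r d(1) by (auto simp: sums_iff)
    moreover have "x \<noteq> 0" "\<bar>x\<bar> < d" using r d(1) by (auto simp: x_def)
    ultimately show False using d(2) by blast
  qed
  define n where "n = (LEAST n. a n \<noteq> 0)"
  have an: "a n \<noteq> 0" unfolding n_def by (rule LeastI_ex) fact
  have a0: "a k = 0" if "k < n" for k using not_less_Least[of k "\<lambda>n. a n \<noteq> 0"] that by (auto simp: n_def)
  have "a 0 = 0" using hd[of 0] f0 by simp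
  hence "n \<ge> 1" using an by (cases n) auto
  moreover have "has_order_at f 0 n" unfolding has_order_at_def using hd an a0 by simp
  ultimately show ?thesis by (rule that)
qed

lemma reduced_derivative:
  fixes F :: "real \<times> 'u::banach \<Rightarrow> 'v::banach" and y :: "real \<times> real \<Rightarrow> 'u"
  assumes F: "real_analytic_at F (l, 0)" and y: "real_analytic_at y (l, 0)" "y (l, 0) = 0"
    and f: "bounded_linear f" and fy: "\<forall>\<^sub>F z in nhds 0. f (y (l, z)) = z"
    and g: "isCont g (l, 0)" and eq: "\<forall>\<^sub>F z in nhds 0. F (l, y (l, z)) = (z * g (l, z)) *\<^sub>R \<psi>"
  obtains v where "f v = 1" "linearization F l v = g (l, 0) *\<^sub>R \<psi>"
proof -
  interpret f: bounded_linear f by fact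
  have bl: "bounded_linear (\<lambda>z::real. (0::real, z))" by (intro bounded_linear_Pair bounded_linear_zero bounded_linear_ident)
  have "real_analytic_at (\<lambda>z. y (l, z)) 0"
    using real_analytic_at_affine[OF bl, of y 0 "(l, 0)"] y(1) by simp
  then obtain Y where Y: "((\<lambda>z. y (l, z)) has_derivative Y) (at 0)" by (rule real_analytic_at_strict)
  interpret Y: bounded_linear Y by (rule has_derivative_bounded_linear[OF Y])
  define v where "v = Y 1"
  have "((\<lambda>z. f (y (l, z))) has_derivative (\<lambda>z. f (Y z))) (at 0)" by (rule f.has_derivative[OF Y])
  moreover have "((\<lambda>z. f (y (l, z))) has_derivative (\<lambda>z. z)) (at 0)"
    by (rule has_derivative_transform_eventually[OF has_derivative_ident])
       (use fy eventually_nhds_x_imp_x[OF fy] in \<open>auto simp: eventually_at_filter elim: eventually_mono\<close>)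
  ultimately have "f v = 1" unfolding v_def by (metis has_derivative_unique)
  have 1: "((\<lambda>z. F (l, y (l, z))) has_derivative (\<lambda>z. linearization F l (Y z))) (at 0)"
    using has_derivative_compose[OF Y, of "\<lambda>u. F (l, u)" "linearization F l"]
      has_derivative_linearization[OF F] y(2) by simp
  have gc: "isCont (\<lambda>z. g (l, z)) 0"
    using isCont_o2[of 0 "\<lambda>z. (l, z)" g] g by (simp add: continuous_intros)
  have 2: "((\<lambda>z. F (l, y (l, z))) has_derivative (\<lambda>z. (z * g (l, 0)) *\<^sub>R \<psi>)) (at 0)"
  proof -
    have "((\<lambda>z. z * g (l, z)) has_field_derivative g (l, 0)) (at 0)"
    proof (rule CARAT_DERIV[THEN iffD2])
      show "\<exists>h. (\<forall>z. z * g (l, z) - 0 * g (l, 0) = h z * (z - 0)) \<and> isCont h 0 \<and> h 0 = g (l, 0)"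
        using gc by (intro exI[of _ "\<lambda>z. g (l, z)"]) (simp add: mult.commute)
    qed
    hence "((\<lambda>z. z * g (l, z)) has_derivative (\<lambda>z. z * g (l, 0))) (at 0)"
      unfolding has_field_derivative_def by (rule has_derivative_eq_rhs) (simp add: fun_eq_iff mult.commute)
    hence "((\<lambda>z. (z * g (l, z)) *\<^sub>R \<psi>) has_derivative (\<lambda>z. (z * g (l, 0)) *\<^sub>R \<psi>)) (at 0)"
      by (rule has_derivative_scaleR_left)
    moreover have "\<forall>\<^sub>F z in at 0. (z * g (l, z)) *\<^sub>R \<psi> = F (l, y (l, z))"
      using eq by (auto simp: eventually_at_filter elim: eventually_mono)
    ultimately show ?thesis
      by (rule has_derivative_transform_eventually) (use eventually_nhds_x_imp_x[OF eq] in simp_all)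
  qed
  from has_derivative_unique[OF 1 2] have "linearization F l v = (1 * g (l, 0)) *\<^sub>R \<psi>"
    unfolding v_def by metis
  thus ?thesis using that[of v] \<open>f v = 1\<close> by simp
qed

lemma eventually_at_right_reflect:
  fixes P :: "real \<Rightarrow> bool"
  assumes "\<forall>\<^sub>F z in at_right 0. P (- z)"
  shows "\<exists>e>0. \<forall>z. - e < z \<longrightarrow> z < 0 \<longrightarrow> P z"
proof -
  obtain e where "e > 0" "\<And>z. 0 < z \<Longrightarrow> z < e \<Longrightarrow> P (- z)" using assms by (auto simp: eventually_at_right_field)
  hence "P z" if "- e < z" "z < 0" for z using that by (metis minus_less_iff neg_0_less_iff_less minus_minus)
  thus ?thesis using \<open>e > 0\<close> by blast
qed

lemma exists_reduction_data:
  fixes F :: "real \<times> 'u::banach \<Rightarrow> 'v::banach" and \<phi> :: 'u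
  assumes analytic: "real_analytic_on UNIV F"
    and F1: "\<forall>l. F (l, 0) = 0"
    and F2: "\<forall>l. linearization F l \<in> fredholm_index_zero"
    and F3: "0 isolated_in eigenvalues (linearization F)"
            "zero_set (linearization F 0) = span {\<phi>}" "\<phi> \<noteq> 0"
  shows "\<exists>D :: ('u, 'v) reduction. reduction_data F \<phi> D"
proof -
  let ?L = "linearization F 0"
  have an: "real_analytic_at F x" for x using analytic unfolding real_analytic_on_def by blast
  have blL: "bounded_linear ?L" using F2 by (auto simp: fredholm_index_zero_def)
  obtain f :: "'u \<Rightarrow> real" where f: "bounded_linear f" "f \<phi> = 1"
    by (rule exists_functional[OF F3(3)]) (rule that)
  interpret L: bounded_linear ?L by fact
  interpret f: bounded_linear f by fact
  obtain \<psi> where \<psi>: "\<psi> \<notin> range ?L" "\<And>v. \<exists>c u. v = c *\<^sub>R \<psi> + ?L u"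
    by (rule fredholm_simple_kernel[OF F2[rule_format] F3(2,3)]) (rule that)
  obtain R where R: "bounded_linear R" "\<And>u. R (?L u + f u *\<^sub>R \<psi>) = u" "\<And>v. ?L (R v) + f (R v) *\<^sub>R \<psi> = v"
    by (rule bordered_isomorphism[OF blL F3(2) f \<psi>]) (rule that)
  interpret R: bounded_linear R by fact
  define Q where "Q v = ?L (R v)" for v
  define q where "q v = f (R v)" for v
  have blQ: "bounded_linear Q" unfolding Q_def by (rule bounded_linear_compose[OF blL R(1)])
  have blq: "bounded_linear q" unfolding q_def by (rule bounded_linear_compose[OF f(1) R(1)])
  interpret q: bounded_linear q by fact
  have Qq: "v = Q v + q v *\<^sub>R \<psi>" for v using R(3)[of v] by (simp add: Q_def q_def)
  have qL: "q (?L u) = 0" for u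
  proof (rule ccontr)
    define c where "c = q (?L u)"
    assume "q (?L u) \<noteq> 0"
    hence c: "c \<noteq> 0" by (simp add: c_def)
    have "c *\<^sub>R \<psi> = ?L (u - R (?L u))" using Qq[of "?L u"] by (simp add: c_def Q_def L.diff algebra_simps)
    hence "(1 / c) *\<^sub>R (c *\<^sub>R \<psi>) = ?L ((1 / c) *\<^sub>R (u - R (?L u)))" by (simp only: L.scaleR)
    hence "\<psi> = ?L ((1 / c) *\<^sub>R (u - R (?L u)))" using c by simp
    thus False using \<psi>(1) by blast
  qed
  have QL: "Q (?L u) = ?L u" for u using Qq[of "?L u"] qL[of u] by simp
  have L\<phi>: "?L \<phi> = 0" using F3(2) span_base[of \<phi> "{\<phi>}"] by blast
  have "R \<psi> = \<phi>" using R(2)[of \<phi>] L\<phi> f(2) by simp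
  hence q\<psi>: "q \<psi> = 1" by (simp add: q_def f(2))
  hence Q\<psi>: "Q \<psi> = 0" using Qq[of \<psi>] by simp
  interpret Q: bounded_linear Q by fact
  obtain \<rho>1 y where \<rho>1: "\<rho>1 > 0" and y: "real_analytic_on (ball 0 \<rho>1) y"
    "\<And>w. w \<in> ball 0 \<rho>1 \<Longrightarrow> f (y w) = snd w" "\<And>w. w \<in> ball 0 \<rho>1 \<Longrightarrow> Q (F (fst w, y w)) = 0"
    "\<And>l. (l, 0::real) \<in> ball 0 \<rho>1 \<Longrightarrow> y (l, 0) = 0"
    by (rule lyapunov_schmidt_solution[OF an F1[rule_format] f(1) \<psi>(1) R blQ QL])
       (auto simp: Q_def intro: that)
  have y_at: "real_analytic_at y w" if "w \<in> ball 0 \<rho>1" for w using y(1) that by (simp add: real_analytic_on_def)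
  define G where "G w = q (F (fst w, y w))" for w
  have FG: "F (fst w, y w) = G w *\<^sub>R \<psi>" if "w \<in> ball 0 \<rho>1" for w
    using Qq[of "F (fst w, y w)"] y(3)[OF that] by (simp add: G_def)
  have "real_analytic_at G 0"
  proof -
    have "real_analytic_at (\<lambda>w. (fst w, y w)) 0"
      by (rule real_analytic_at_Pair[OF real_analytic_at_linear[OF bounded_linear_fst] y_at]) (use \<rho>1 in simp)
    from real_analytic_at_linear_compose[OF blq real_analytic_at_compose[OF an this]]
    show ?thesis by (simp add: G_def[abs_def])
  qed
  moreover have "G (l, 0) = 0" if "\<bar>l\<bar> < \<rho>1" for l
  proof -
    have "(l, 0::real) \<in> ball 0 \<rho>1" using that by (simp add: norm_Pair)
    thus ?thesis using y(4)[of l] F1 by (simp add: G_def q.zero)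
  qed
  ultimately obtain g \<rho>2 where \<rho>2: "\<rho>2 > 0" and g: "real_analytic_on (ball 0 \<rho>2) g"
    "\<And>w. w \<in> ball 0 \<rho>2 \<Longrightarrow> G w = snd w * g w"
    using real_analytic_divide_snd[OF _ \<rho>1, of G] by metis
  define \<rho>3 where "\<rho>3 = min \<rho>1 \<rho>2"
  have \<rho>3: "\<rho>3 > 0" using \<rho>1 \<rho>2 by (simp add: \<rho>3_def)
  have key: "\<exists>v. f v = 1 \<and> linearization F l v = g (l, 0) *\<^sub>R \<psi>" if l: "\<bar>l\<bar> < \<rho>3" for l
  proof -
    have l0: "(l, 0::real) \<in> ball 0 \<rho>3" using l by (simp add: norm_Pair)
    hence b: "(l, 0::real) \<in> ball 0 \<rho>1" "(l, 0::real) \<in> ball 0 \<rho>2" by (auto simp: \<rho>3_def)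
    have "\<forall>\<^sub>F w in nhds (l, 0::real). w \<in> ball 0 \<rho>3" by (rule eventually_nhds_in_open[OF _ l0]) simp
    moreover have "filterlim (\<lambda>z. (l, z)) (nhds (l, 0::real)) (nhds 0)" by (intro tendsto_intros filterlim_ident)
    ultimately have ev: "\<forall>\<^sub>F z in nhds (0::real). (l, z) \<in> ball 0 \<rho>3" by (rule eventually_compose_filterlim)
    have fy: "\<forall>\<^sub>F z in nhds 0. f (y (l, z)) = z" using ev by eventually_elim (use y(2) in \<open>auto simp: \<rho>3_def\<close>)
    have Fy: "\<forall>\<^sub>F z in nhds 0. F (l, y (l, z)) = (z * g (l, z)) *\<^sub>R \<psi>"
      using ev
    proof eventually_elim
      case (elim z)
      hence "(l, z) \<in> ball 0 \<rho>1" "(l, z) \<in> ball 0 \<rho>2" by (auto simp: \<rho>3_def)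
      thus ?case using FG[of "(l, z)"] g(2)[of "(l, z)"] by simp
    qed
    have gc: "isCont g (l, 0)"
      by (rule real_analytic_at_imp_isCont) (use g(1) b in \<open>simp add: real_analytic_on_def\<close>)
    obtain v where "f v = 1" "linearization F l v = g (l, 0) *\<^sub>R \<psi>"
      by (rule reduced_derivative[OF an y_at[OF b(1)] y(4)[OF b(1)] f(1) fy gc Fy]) (rule that)
    thus ?thesis by blast
  qed
  have g00: "g (0, 0) = 0"
  proof (rule ccontr)
    assume ne: "g (0, 0) \<noteq> 0"
    obtain v where "?L v = g (0, 0) *\<^sub>R \<psi>" using key[of 0] \<rho>3 by auto
    from arg_cong[OF this, of q] show False using ne qL[of v] q\<psi> by (simp add: q.scaleR)
  qed
  obtain T where T: "open T" "T \<inter> eigenvalues (linearization F) = {0}"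
    using F3(1) by (auto simp: isolated_in_def)
  have "0 \<in> T" using T(2) by blast
  then obtain \<rho>4 where \<rho>4: "\<rho>4 > 0" "ball 0 \<rho>4 \<subseteq> T" using T(1) openE by blast
  define \<rho>5 where "\<rho>5 = min \<rho>3 \<rho>4"
  have \<rho>5: "\<rho>5 > 0" using \<rho>3 \<rho>4 by (simp add: \<rho>5_def)
  have gnz: "g (l, 0) \<noteq> 0" if l: "l \<noteq> 0" "\<bar>l\<bar> < \<rho>5" for l
  proof
    assume g0: "g (l, 0) = 0"
    have "l \<in> T" using \<rho>4(2) l by (auto simp: \<rho>5_def)
    hence "l \<notin> eigenvalues (linearization F)" using T(2) l(1) by blast
    then obtain S where S: "\<And>u. S (linearization F l u) = u" "bounded_linear S" by (auto simp: eigenvalues_def GL_def)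
    obtain v where v: "f v = 1" "linearization F l v = 0" using key[of l] l g0 by (auto simp: \<rho>5_def)
    have "v = 0" using S(1)[of v] v(2) linear_0[OF bounded_linear.linear[OF S(2)]] by simp
    thus False using v(1) by (simp add: f.zero)
  qed
  have g_at0: "real_analytic_at g 0" using g(1) \<rho>2 by (simp add: real_analytic_on_def)
  have ga: "real_analytic_at (\<lambda>l. g (l, 0)) 0"
  proof -
    have bl: "bounded_linear (\<lambda>l::real. (l, 0::real))" by (intro bounded_linear_Pair bounded_linear_ident bounded_linear_zero)
    have "real_analytic_at g (0, 0)" using g_at0 by (simp add: zero_prod_def)
    thus ?thesis by (rule real_analytic_at_compose_linear[OF bl])
  qed
  obtain n where n: "n \<ge> 1" "has_order_at (\<lambda>l. g (l, 0)) 0 n"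
    by (rule exists_order[where f = "\<lambda>l. g (l, 0)", OF ga g00 \<rho>5]) (use gnz that in blast)+
  obtain \<rho>6 c d where \<rho>6: "\<rho>6 > 0" and cd: "real_analytic_on (ball 0 \<rho>6) c" "c 0 \<noteq> 0"
    "\<And>j. j < n \<Longrightarrow> real_analytic_on (ball 0 \<rho>6) (d j)" "\<And>j. j < n \<Longrightarrow> d j 0 = 0"
    "\<And>l z. (l, z) \<in> ball 0 \<rho>6 \<Longrightarrow> g (l, z) = c (l, z) * (l ^ n + (\<Sum>j<n. d j z * l ^ j))"
    by (rule weierstrass_preparation[OF g_at0 n(2)]) (rule that)
  have "isCont c 0" by (rule real_analytic_at_imp_isCont) (use cd(1) \<rho>6 in \<open>simp add: real_analytic_on_def\<close>)
  from continuous_at_avoid[OF this, of 0] cd(2) obtain \<rho>7 where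
    \<rho>7: "\<rho>7 > 0" "\<And>w. dist 0 w < \<rho>7 \<Longrightarrow> c w \<noteq> 0" by auto
  define r where "r = Min {\<rho>3, \<rho>6, \<rho>7} / 2"
  have r: "r > 0" "2 * r \<le> \<rho>3" "2 * r \<le> \<rho>6" "2 * r \<le> \<rho>7" using \<rho>3 \<rho>6 \<rho>7 by (auto simp: r_def)
  define \<delta> where "\<delta> = r / 2"
  have \<delta>: "\<delta> > 0" "\<delta> < r" using r by (auto simp: \<delta>_def)
  have d_at: "real_analytic_at (d j) 0" if "j < n" for j using cd(3)[OF that] \<rho>6 by (simp add: real_analytic_on_def)
  have "\<forall>\<^sub>F z in nhds 0. (\<Sum>j<n. \<bar>d j z\<bar> * \<delta> ^ j) < \<delta> ^ n"
    by (rule eventually_coeffs_small[where n = n and c = d, OF real_analytic_at_imp_isCont[OF d_at] cd(4) \<delta>(1)])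
  then obtain e0 where e0: "e0 > 0" "\<And>z. \<bar>z\<bar> < e0 \<Longrightarrow> (\<Sum>j<n. \<bar>d j z\<bar> * \<delta> ^ j) < \<delta> ^ n"
    by (auto simp: eventually_nhds_metric dist_real_def)
  have nz: "poly (wpoly n d z) \<delta> \<noteq> 0" "poly (wpoly n d z) (- \<delta>) \<noteq> 0" if "\<bar>z\<bar> < e0" for z
    using wpoly_root_bound[where n = n and c = d and z = z and d = \<delta> and l = \<delta>, OF e0(2)[OF that] \<delta>(1)] wpoly_root_bound[where n = n and c = d and z = z and d = \<delta> and l = "- \<delta>", OF e0(2)[OF that] \<delta>(1)] by auto
  have near: "\<forall>\<^sub>F z in at_right 0. \<bar>z\<bar> < e0 \<and> \<bar>- z\<bar> < e0"
    using e0(1) by (auto simp: eventually_at_right_field intro!: exI[of _ e0])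
  obtain C1 where C1: "\<forall>\<^sub>F z in at_right 0. card {x \<in> {- \<delta><..<\<delta>}. poly (wpoly n d z) x = 0} = C1"
  proof (rule eventually_root_count_constant)
    show "gpoly (wpoly n d)" by (rule gpoly_wpoly[OF d_at])
    show "\<forall>\<^sub>F z in at_right 0. poly (wpoly n d z) (- \<delta>) \<noteq> 0 \<and> poly (wpoly n d z) \<delta> \<noteq> 0"
      using near by eventually_elim (use nz in blast)
  qed (use \<delta>(1) that in auto)
  have dm_at: "real_analytic_at (\<lambda>z. d j (- z)) 0" if "j < n" for j
    by (rule real_analytic_at_compose_linear[OF bounded_linear_minus[OF bounded_linear_ident]]) (simp add: d_at that)
  have refl: "wpoly n (\<lambda>j z. d j (- z)) z = wpoly n d (- z)" for z by (simp add: wpoly_def)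
  have "gpoly (wpoly n (\<lambda>j z. d j (- z)))" by (rule gpoly_wpoly[OF dm_at])
  moreover have "wpoly n (\<lambda>j z. d j (- z)) = (\<lambda>z. wpoly n d (- z))" by (rule ext) (rule refl)
  ultimately have gpm: "gpoly (\<lambda>z. wpoly n d (- z))" by (rule subst[rotated])
  obtain C2 where C2: "\<forall>\<^sub>F z in at_right 0. card {x \<in> {- \<delta><..<\<delta>}. poly (wpoly n d (- z)) x = 0} = C2"
  proof (rule eventually_root_count_constant[OF gpm])
    show "\<forall>\<^sub>F z in at_right 0. poly (wpoly n d (- z)) (- \<delta>) \<noteq> 0 \<and> poly (wpoly n d (- z)) \<delta> \<noteq> 0"
      using near by eventually_elim (use nz in blast)
  qed (use \<delta>(1) that in auto)
  obtain e1 where e1: "e1 > 0" "\<And>z. 0 < z \<Longrightarrow> z < e1 \<Longrightarrow> card {x \<in> {- \<delta><..<\<delta>}. poly (wpoly n d z) x = 0} = C1"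
    using C1 by (auto simp: eventually_at_right_field)
  obtain e2 where e2: "e2 > 0" "\<And>z. - e2 < z \<Longrightarrow> z < 0 \<Longrightarrow> card {x \<in> {- \<delta><..<\<delta>}. poly (wpoly n d z) x = 0} = C2"
    using eventually_at_right_reflect[OF C2] by blast
  define e where "e = Min {r, e0, e1, e2}"
  have e: "e > 0" "e \<le> r" "e \<le> e0" "e \<le> e1" "e \<le> e2" using r e0 e1 e2 by (auto simp: e_def)
  define D :: "('u, 'v) reduction" where "D = \<lparr>phi_star = f, Q_proj = Q, S_iso = q,
    Y_map = (\<lambda>(l, x). y (l, f x) - f x *\<^sub>R \<phi>), lam_nbhd = {- r<..<r}, alpha = - e, omega = e,
    g_fun = g, chi = n, c_unit = c, c_coeff = d, lam_minus = - \<delta>, lam_plus = \<delta>\<rparr>"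
  have D: "phi_star D = f" "Q_proj D = Q" "S_iso D = q" "Y_map D = (\<lambda>(l, x). y (l, f x) - f x *\<^sub>R \<phi>)"
    "lam_nbhd D = {- r<..<r}" "alpha D = - e" "omega D = e" "g_fun D = g" "chi D = n" "c_unit D = c"
    "c_coeff D = d" "lam_minus D = - \<delta>" "lam_plus D = \<delta>" by (simp_all add: D_def)
  have nb: "nbhd D = {- r<..<r} \<times> {- e<..<e}" by (simp add: nbhd_def D)
  have nbb: "norm w < 2 * r" if "w \<in> nbhd D" for w
  proof -
    have "\<bar>fst w\<bar> < r" "\<bar>snd w\<bar> < e" using that by (auto simp: nb)
    thus ?thesis using norm_Pair_le[of "fst w" "snd w"] e(2) by simp
  qed
  have b1: "w \<in> ball 0 \<rho>1" "w \<in> ball 0 \<rho>2" "w \<in> ball 0 \<rho>6" "dist 0 w < \<rho>7" if "w \<in> nbhd D" for w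
    using nbb[OF that] r by (auto simp: \<rho>3_def)
  have Ymap: "Y_map D (l, z *\<^sub>R \<phi>) = y (l, z) - z *\<^sub>R \<phi>" for l z by (simp add: D f.scaleR f(2))
  have lift: "lift \<phi> D w = (fst w, y w)" for w by (cases w) (simp add: lift_def Ymap)
  have pD: "p_poly D = wpoly n d" by (simp add: p_poly_eq_wpoly D)
  have GD: "G_fun F \<phi> D w = snd w * g w" if w: "w \<in> nbhd D" for w
    unfolding G_fun_def lift using y(3)[OF b1(1)[OF w]] g(2)[OF b1(2)[OF w]] by (simp add: D G_def)
  have gD: "g (l, z) = c (l, z) * poly (wpoly n d z) l" if "(l, z) \<in> nbhd D" for l z
    using cd(5)[OF b1(3)[OF that]] by (simp add: poly_wpoly)
  have ls: "lyapunov_schmidt F \<phi> D"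
    unfolding lyapunov_schmidt_def
  proof (intro conjI)
    show "bounded_linear (phi_star D)" "phi_star D \<phi> = 1" "bounded_linear (Q_proj D)" using f blQ by (simp_all add: D)
    show "\<forall>v. Q_proj D (Q_proj D v) = Q_proj D v" by (simp add: D) (simp add: Q_def[of "Q _"] QL[unfolded Q_def] Q_def)
    show "range (Q_proj D) = range ?L"
    proof
      show "range (Q_proj D) \<subseteq> range ?L" by (auto simp: D Q_def)
      show "range ?L \<subseteq> range (Q_proj D)" unfolding D using QL by (metis image_subsetI rangeI)
    qed
    show "\<forall>x\<in>zero_set (Q_proj D). \<forall>y\<in>zero_set (Q_proj D). S_iso D (x + y) = S_iso D x + S_iso D y"
      by (simp add: D q.add)
    show "\<forall>r. \<forall>x\<in>zero_set (Q_proj D). S_iso D (r *\<^sub>R x) = r * S_iso D x" by (simp add: D q.scaleR)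
    show "bij_betw (S_iso D) (zero_set (Q_proj D)) UNIV"
    proof (rule bij_betwI[where g = "\<lambda>c. c *\<^sub>R \<psi>"])
      show "(\<lambda>c. c *\<^sub>R \<psi>) \<in> UNIV \<rightarrow> zero_set (Q_proj D)" by (simp add: D Q.scaleR Q\<psi>)
      show "S_iso D x *\<^sub>R \<psi> = x" if "x \<in> zero_set (Q_proj D)" for x using Qq[of x] that by (simp add: D)
      show "S_iso D (c *\<^sub>R \<psi>) = c" for c by (simp add: D q.scaleR q\<psi>)
    qed simp
    show "open (lam_nbhd D)" "0 \<in> lam_nbhd D" "alpha D < 0" "0 < omega D" using r e by (simp_all add: D)
    show "real_analytic_on (nbhd D) (\<lambda>(l, z). Y_map D (l, z *\<^sub>R \<phi>))"
    proof -
      have "(\<lambda>(l, z). Y_map D (l, z *\<^sub>R \<phi>)) = (\<lambda>w. y w - snd w *\<^sub>R \<phi>)" by (auto simp: Ymap)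
      moreover have "real_analytic_at (\<lambda>w. y w - snd w *\<^sub>R \<phi>) w" if "w \<in> nbhd D" for w
        by (rule real_analytic_at_diff[OF y_at[OF b1(1)[OF that]] real_analytic_at_linear[OF
              bounded_linear_compose[OF bounded_linear_scaleR_left bounded_linear_snd]]])
      ultimately show ?thesis by (simp add: real_analytic_on_def)
    qed
    show "Y_map D (0, 0) = 0" using y(4)[of 0] \<rho>1 by (simp add: D f.zero norm_Pair)
    show "\<forall>(l, z)\<in>nbhd D. Y_map D (l, z *\<^sub>R \<phi>) \<in> zero_set (P_proj \<phi> D)"
      using y(2)[OF b1(1)] by (auto simp: P_proj_def Ymap D(1) f.diff f.scaleR f(2))
    show "\<forall>w\<in>nbhd D. Q_proj D (F (lift \<phi> D w)) = 0" unfolding lift D(2) using y(3)[OF b1(1)] by blast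
  qed
  have ws: "weierstrass F \<phi> D"
    unfolding weierstrass_def D pD
  proof (intro conjI)
    show "real_analytic_on (nbhd D) g" using g(1) b1(2) by (auto simp: real_analytic_on_def)
    show "\<forall>(l, z)\<in>nbhd D. G_fun F \<phi> D (l, z) = z * g (l, z)" using GD by auto
    show "real_analytic_on (nbhd D) c" using cd(1) b1(3) by (auto simp: real_analytic_on_def)
    show "c (0, 0) \<noteq> 0" using cd(2) by (simp add: zero_prod_def)
    show "\<forall>j<n. real_analytic_on {- e<..<e} (d j) \<and> d j 0 = 0"
    proof (intro allI impI conjI)
      fix j assume j: "j < n"
      have "z \<in> ball 0 \<rho>6" if "z \<in> {- e<..<e}" for z using that e r by auto
      thus "real_analytic_on {- e<..<e} (d j)" using cd(3)[OF j] by (auto simp: real_analytic_on_def)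
      show "d j 0 = 0" by (rule cd(4)[OF j])
    qed
    show "\<forall>(l, z)\<in>nbhd D. g (l, z) = c (l, z) * poly (wpoly n d z) l" using gD by auto
  qed (use n in simp_all)
  have sd: "sturm_data F \<phi> D"
    unfolding sturm_data_def D pD
  proof (intro conjI ballI)
    show "- \<delta> < 0" "0 < \<delta>" using \<delta> by simp_all
    fix l assume l: "l \<in> {- \<delta>, \<delta>}"
    show lr: "l \<in> {- r<..<r}" using l \<delta> by auto
    show pn: "poly (wpoly n d z) l \<noteq> 0" if "z \<in> {- e<..<e}" for z
    proof -
      have "\<bar>z\<bar> < e0" using that e by auto
      thus ?thesis using nz[of z] l by auto
    qed
    show "({l} \<times> {- e<..<e}) \<inter> zero_set (G_fun F \<phi> D) = {(l, 0)}"
    proof -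
      have "G_fun F \<phi> D (l, z) = 0 \<longleftrightarrow> z = 0" if z: "z \<in> {- e<..<e}" for z
      proof -
        have w: "(l, z) \<in> nbhd D" using lr z by (simp add: nb)
        show ?thesis using GD[OF w] gD[OF w] \<rho>7(2)[OF b1(4)[OF w]] pn[OF z] by simp
      qed
      thus ?thesis using e(1) by auto
    qed
  next
    show "real_root_count D constant_on {0<..<e}"
      unfolding constant_on_def real_root_count_def D pD using e1(2) e(4) by (intro exI[of _ C1]) auto
    show "real_root_count D constant_on {- e<..<0}"
      unfolding constant_on_def real_root_count_def D pD using e2(2) e(5) by (intro exI[of _ C2]) auto
  qed
  show ?thesis using ls ws sd unfolding reduction_data_def by blast
qed

section \<open>Half branches of the zero set\<close>

lemma half_branch_of_root:
  fixes y :: "real \<times> real \<Rightarrow> 'u::banach" and f :: "'u \<Rightarrow> real"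
  assumes e: "e > 0" and s: "s \<noteq> 0" and l: "real_analytic_on {0<..<e} l" "(l \<longlongrightarrow> 0) (at_right 0)"
    and y: "\<And>z. 0 < z \<Longrightarrow> z < e \<Longrightarrow> real_analytic_at y (l z, s * z)" "isCont y (0, 0)" "y (0, 0) = 0"
    and f: "\<And>z. 0 < z \<Longrightarrow> z < e \<Longrightarrow> f (y (l z, s * z)) = s * z"
  shows "half_branch (0, 0) ((\<lambda>z. (l z, y (l z, s * z))) ` {0<..<e})"
    and "((\<lambda>z. (l z, y (l z, s * z))) \<longlongrightarrow> (0, 0)) (at_right 0)"
proof -
  define \<gamma> where "\<gamma> z = (l z, y (l z, s * z))" for z
  have "((\<lambda>z. (l z, s * z)) \<longlongrightarrow> (0, s * 0)) (at_right 0)" by (intro tendsto_intros l(2))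
  hence lim0: "((\<lambda>z. (l z, s * z)) \<longlongrightarrow> (0, 0)) (at_right 0)" by simp
  have "((\<lambda>z. y (l z, s * z)) \<longlongrightarrow> y (0, 0)) (at_right 0)" by (rule isCont_tendsto_compose[OF y(2) lim0])
  hence lim: "(\<gamma> \<longlongrightarrow> (0, 0)) (at_right 0)" unfolding \<gamma>_def y(3) by (intro tendsto_Pair l(2))
  thus "((\<lambda>z. (l z, y (l z, s * z))) \<longlongrightarrow> (0, 0)) (at_right 0)" by (simp add: \<gamma>_def[abs_def])
  have an: "real_analytic_at \<gamma> z" if z: "0 < z" "z < e" for z
  proof -
    have "real_analytic_at (\<lambda>z. (l z, s * z)) z"
      by (rule real_analytic_at_Pair[OF _ real_analytic_at_linear[OF bounded_linear_mult_right]])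
         (use l(1) z in \<open>simp add: real_analytic_on_def\<close>)
    moreover have "real_analytic_at (\<lambda>w. (fst w, y w)) (l z, s * z)"
      by (rule real_analytic_at_Pair[OF real_analytic_at_linear[OF bounded_linear_fst] y(1)[OF z]])
    ultimately have "real_analytic_at (\<lambda>z. (fst (l z, s * z), y (l z, s * z))) z"
      by (intro real_analytic_at_compose_real[where f = "\<lambda>w. (fst w, y w)" and u = "\<lambda>z. (l z, s * z)"])
    thus ?thesis by (simp add: \<gamma>_def[abs_def])
  qed
  have "half_branch (0, 0) (\<gamma> ` {0<..<e})"
    unfolding half_branch_def
  proof (intro exI[of _ "\<lambda>t. \<gamma> (e * t)"] conjI)
    show "real_analytic_on {0<..<1} (\<lambda>t. \<gamma> (e * t))"
      unfolding real_analytic_on_def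
    proof
      fix t :: real assume "t \<in> {0<..<1}"
      hence "real_analytic_at \<gamma> (e * t)" using e by (intro an) auto
      thus "real_analytic_at (\<lambda>t. \<gamma> (e * t)) t" by (rule real_analytic_at_compose_linear[OF bounded_linear_mult_right])
    qed
    show "inj_on (\<lambda>t. \<gamma> (e * t)) {0<..<1}"
    proof (rule inj_onI)
      fix t t' :: real assume t: "t \<in> {0<..<1}" "t' \<in> {0<..<1}" "\<gamma> (e * t) = \<gamma> (e * t')"
      from arg_cong[OF t(3), of "\<lambda>x. f (snd x)"]
      have "f (y (l (e * t), s * (e * t))) = f (y (l (e * t'), s * (e * t')))" by (simp only: \<gamma>_def snd_conv)
      moreover have "f (y (l (e * t), s * (e * t))) = s * (e * t)" by (rule f) (use t e in auto)
      moreover have "f (y (l (e * t'), s * (e * t'))) = s * (e * t')" by (rule f) (use t e in auto)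
      ultimately have "s * (e * t) = s * (e * t')" by linarith
      thus "t = t'" using s e by simp
    qed
    have "filterlim (\<lambda>t. e * t) (at_right 0) (at_right 0)"
      using filterlim_times_pos[of "\<lambda>t. t" 0 "at_right 0" e] e by (simp add: filterlim_ident mult.commute)
    thus "((\<lambda>t. \<gamma> (e * t)) \<longlongrightarrow> (0, 0)) (at_right 0)" by (rule filterlim_compose[OF lim])
    show "\<gamma> ` {0<..<e} = (\<lambda>t. \<gamma> (e * t)) ` {0<..<1}"
    proof -
      have "{0<..<e} = (\<lambda>t. e * t) ` {0<..<1}"
      proof
        show "{0<..<e} \<subseteq> (\<lambda>t. e * t) ` {0<..<1}"
        proof
          fix z assume "z \<in> {0<..<e}"
          thus "z \<in> (\<lambda>t. e * t) ` {0<..<1}" using e by (intro image_eqI[of _ _ "z / e"]) auto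
        qed
      qed (use e in auto)
      thus ?thesis by (simp add: image_image)
    qed
  qed
  thus "half_branch (0, 0) ((\<lambda>z. (l z, y (l z, s * z))) ` {0<..<e})" by (simp add: \<gamma>_def[abs_def])
qed

lemma half_branch_trivial:
  assumes "e > 0" "s \<noteq> (0::real)"
  shows "half_branch (0, 0::'u::real_normed_vector) ((\<lambda>t. (s * t, 0)) ` {0<..<e})"
  unfolding half_branch_def
proof (intro exI[of _ "\<lambda>t. (s * (e * t), 0)"] conjI)
  have "bounded_linear (\<lambda>t. (s * (e * t), 0::'u))"
    by (intro bounded_linear_Pair bounded_linear_zero bounded_linear_compose[OF bounded_linear_mult_right] bounded_linear_mult_right)
  thus "real_analytic_on {0<..<1} (\<lambda>t. (s * (e * t), 0::'u))"
    unfolding real_analytic_on_def using real_analytic_at_linear by blast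
  show "inj_on (\<lambda>t. (s * (e * t), 0::'u)) {0<..<1}" using assms by (auto simp: inj_on_def)
  have "((\<lambda>t. (s * (e * t), 0::'u)) \<longlongrightarrow> (s * (e * 0), 0)) (at_right 0)" by (intro tendsto_intros)
  thus "((\<lambda>t. (s * (e * t), 0::'u)) \<longlongrightarrow> (0, 0)) (at_right 0)" by simp
  show "(\<lambda>t. (s * t, 0::'u)) ` {0<..<e} = (\<lambda>t. (s * (e * t), 0)) ` {0<..<1}"
  proof
    show "(\<lambda>t. (s * t, 0::'u)) ` {0<..<e} \<subseteq> (\<lambda>t. (s * (e * t), 0)) ` {0<..<1}"
    proof
      fix x assume "x \<in> (\<lambda>t. (s * t, 0::'u)) ` {0<..<e}"
      then obtain t where "x = (s * t, 0)" "t \<in> {0<..<e}" by (rule imageE)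
      thus "x \<in> (\<lambda>t. (s * (e * t), 0::'u)) ` {0<..<1}" using assms(1) by (intro image_eqI[of _ _ "t / e"]) auto
    qed
  qed (use assms in auto)
qed

lemma reduction_half_branches:
  fixes F :: "real \<times> 'u::banach \<Rightarrow> 'v::banach" and \<phi> :: 'u and D :: "('u, 'v) reduction"
  assumes analytic: "real_analytic_on UNIV F"
    and F1: "\<forall>l. F (l, 0) = 0"
    and F2: "linearization F 0 \<in> fredholm_index_zero"
    and F3: "zero_set (linearization F 0) = span {\<phi>}" "\<phi> \<noteq> 0"
    and rd: "reduction_data F \<phi> D"
  shows "\<exists>N :: nat.
        (\<forall>z\<^sub>p\<in>{0<..<omega D}. \<forall>z\<^sub>m\<in>{alpha D<..<0}.
           int N = (int (V_count D (lam_minus D) z\<^sub>p) - int (V_count D (lam_plus D) z\<^sub>p))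
                 + (int (V_count D (lam_minus D) z\<^sub>m) - int (V_count D (lam_plus D) z\<^sub>m)) + 2) \<and>
        (\<forall>A. open A \<and> (0, 0) \<in> A \<longrightarrow>
           (\<exists>W \<H>. open W \<and> (0, 0) \<in> W \<and> W \<subseteq> A \<and>
              half_branch_decomposition (0, 0) (zero_set F \<inter> W) \<H> \<and> card \<H> = N \<and>
              {(l, u) \<in> W. l > 0 \<and> u = 0} \<in> \<H> \<and> {(l, u) \<in> W. l < 0 \<and> u = 0} \<in> \<H>)) \<and>
        (odd (chi D) \<longrightarrow> N \<ge> 3 \<and> bifurcation_point F)"
proof -
  let ?L = "linearization F 0"
  have an: "real_analytic_at F x" for x using analytic unfolding real_analytic_on_def by blast
  have blL: "bounded_linear ?L" using F2 by (auto simp: fredholm_index_zero_def)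
  have ls: "lyapunov_schmidt F \<phi> D" and ws: "weierstrass F \<phi> D" and sd: "sturm_data F \<phi> D"
    using rd unfolding reduction_data_def by blast+
  define f where "f = phi_star D"
  define Q where "Q = Q_proj D"
  define S where "S = S_iso D"
  define n where "n = chi D"
  define c where "c = c_coeff D"
  have f: "bounded_linear f" "f \<phi> = 1" and blQ: "bounded_linear Q" and QQ: "\<And>v. Q (Q v) = Q v"
    and rQ: "range Q = range ?L"
    and S_add: "\<And>x y. Q x = 0 \<Longrightarrow> Q y = 0 \<Longrightarrow> S (x + y) = S x + S y"
    and S_bij: "bij_betw S (zero_set Q) UNIV"
    and op: "open (lam_nbhd D)" "0 \<in> lam_nbhd D" and ao: "alpha D < 0" "0 < omega D"
    and Y_an: "real_analytic_on (nbhd D) (\<lambda>(l, z). Y_map D (l, z *\<^sub>R \<phi>))" and Y0: "Y_map D (0, 0) = 0"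
    and YP: "\<And>l z. (l, z) \<in> nbhd D \<Longrightarrow> P_proj \<phi> D (Y_map D (l, z *\<^sub>R \<phi>)) = 0"
    and QF: "\<And>w. w \<in> nbhd D \<Longrightarrow> Q (F (lift \<phi> D w)) = 0"
    using ls unfolding lyapunov_schmidt_def f_def Q_def S_def by auto
  have GD: "\<And>l z. (l, z) \<in> nbhd D \<Longrightarrow> G_fun F \<phi> D (l, z) = z * g_fun D (l, z)"
    and n1: "n \<ge> 1" and cu_an: "real_analytic_on (nbhd D) (c_unit D)" and cu0: "c_unit D (0, 0) \<noteq> 0"
    and c_an: "\<And>j. j < n \<Longrightarrow> real_analytic_on {alpha D<..<omega D} (c j)" and c0: "\<And>j. j < n \<Longrightarrow> c j 0 = 0"
    and gD: "\<And>l z. (l, z) \<in> nbhd D \<Longrightarrow> g_fun D (l, z) = c_unit D (l, z) * poly (p_poly D z) l"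
    using ws unfolding weierstrass_def n_def c_def by auto
  have lam: "lam_minus D < 0" "0 < lam_plus D"
    and p_nz: "\<And>z. z \<in> {alpha D<..<omega D} \<Longrightarrow> poly (p_poly D z) (lam_minus D) \<noteq> 0"
      "\<And>z. z \<in> {alpha D<..<omega D} \<Longrightarrow> poly (p_poly D z) (lam_plus D) \<noteq> 0"
    and rc: "real_root_count D constant_on {0<..<omega D}" "real_root_count D constant_on {alpha D<..<0}"
    using sd unfolding sturm_data_def by auto
  interpret f: bounded_linear f by fact
  interpret Q: bounded_linear Q by fact
  have pD: "p_poly D = wpoly n c" by (simp add: p_poly_eq_wpoly n_def c_def)
  obtain \<psi> where \<psi>: "\<psi> \<notin> range ?L" "\<And>v. \<exists>c u. v = c *\<^sub>R \<psi> + ?L u"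
    by (rule fredholm_simple_kernel[OF F2 F3]) (rule that)
  obtain R where R: "bounded_linear R" "\<And>u. R (?L u + f u *\<^sub>R \<psi>) = u" "\<And>v. ?L (R v) + f (R v) *\<^sub>R \<psi> = v"
    by (rule bordered_isomorphism[OF blL F3(1) f \<psi>]) (rule that)
  have QL: "Q (?L u) = ?L u" for u
  proof -
    have "?L u \<in> range Q" using rQ by blast
    thus ?thesis using QQ by auto
  qed
  obtain d where d: "d > 0" "\<And>l u u'. \<lbrakk>norm (l, u) < d; norm (l, u') < d; f u = f u'; Q (F (l, u)) = Q (F (l, u'))\<rbrakk> \<Longrightarrow> u = u'"
    by (rule lyapunov_schmidt_unique[OF an f(1) R(1,2) blQ QL]) (rule that)

  have w0: "(0, 0) \<in> nbhd D" using op ao by (simp add: nbhd_def)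
  have opn: "open (nbhd D)" unfolding nbhd_def by (intro open_Times op) simp
  define y where "y w = snd (lift \<phi> D w)" for w
  have lift: "lift \<phi> D w = (fst w, y w)" for w by (cases w) (simp add: y_def lift_def)
  have y_eq: "y = (\<lambda>w. snd w *\<^sub>R \<phi> + (\<lambda>(l, z). Y_map D (l, z *\<^sub>R \<phi>)) w)" by (auto simp: y_def lift_def)
  have y_at: "real_analytic_at y w" if "w \<in> nbhd D" for w
    unfolding y_eq
    by (rule real_analytic_at_add[OF real_analytic_at_linear[OF bounded_linear_compose[OF bounded_linear_scaleR_left bounded_linear_snd]]])
       (use Y_an that in \<open>simp add: real_analytic_on_def\<close>)
  have y00: "y (0, 0) = 0" using Y0 by (simp add: y_eq)
  have fy: "f (y w) = snd w" if "w \<in> nbhd D" for w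
  proof -
    have "f (Y_map D (fst w, snd w *\<^sub>R \<phi>)) = 0" using YP[of "fst w" "snd w"] that F3(2) by (simp add: P_proj_def f_def)
    thus ?thesis by (simp add: y_eq case_prod_beta f.add f.scaleR f(2))
  qed
  have Qy: "Q (F (fst w, y w)) = 0" if "w \<in> nbhd D" for w using QF[OF that] by (simp add: lift)
  have S0: "S 0 = 0" using S_add[of 0 0] by (simp add: Q.zero)
  have zero_iff: "F (l, y (l, z)) = 0 \<longleftrightarrow> z = 0 \<or> c_unit D (l, z) = 0 \<or> poly (wpoly n c z) l = 0"
    if w: "(l, z) \<in> nbhd D" for l z
  proof -
    have "G_fun F \<phi> D (l, z) = S (F (l, y (l, z)))" using Qy[OF w] by (simp add: G_fun_def lift S_def Q_def)
    hence "S (F (l, y (l, z))) = z * (c_unit D (l, z) * poly (wpoly n c z) l)" using GD[OF w] gD[OF w] by (simp add: pD)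
    moreover have "F (l, y (l, z)) = 0 \<longleftrightarrow> S (F (l, y (l, z))) = 0"
    proof
      assume "S (F (l, y (l, z))) = 0"
      hence "S (F (l, y (l, z))) = S 0" by (simp add: S0)
      thus "F (l, y (l, z)) = 0"
        using bij_betw_imp_inj_on[OF S_bij] Qy[OF w] by (auto simp: inj_on_def Q.zero)
    qed (simp add: S0)
    ultimately show ?thesis by simp
  qed

  have c_at: "real_analytic_at (c j) 0" if "j < n" for j
    using c_an[OF that] ao by (simp add: real_analytic_on_def)
  define c' where "c' j z = c j (- z)" for j z
  have c'_at: "real_analytic_at (c' j) 0" "c' j 0 = 0" if "j < n" for j
  proof -
    show "real_analytic_at (c' j) 0" unfolding c'_def
      by (rule real_analytic_at_compose_linear[OF bounded_linear_minus[OF bounded_linear_ident]]) (simp add: c_at that)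
    show "c' j 0 = 0" using c0[OF that] by (simp add: c'_def)
  qed
  have refl: "wpoly n c' z = wpoly n c (- z)" for z by (simp add: wpoly_def c'_def)
  obtain Np ep lp where ep: "ep > 0"
    and lp1: "\<And>z. 0 < z \<Longrightarrow> z < ep \<Longrightarrow> {x. poly (wpoly n c z) x = 0} = (\<lambda>i. lp i z) ` {..<Np}"
    and lp2: "\<And>z i j. 0 < z \<Longrightarrow> z < ep \<Longrightarrow> i < j \<Longrightarrow> j < Np \<Longrightarrow> lp i z < lp j z"
    and lp3: "\<And>i. i < Np \<Longrightarrow> real_analytic_on {0<..<ep} (lp i)"
    and lp4: "\<And>i. i < Np \<Longrightarrow> (lp i \<longlongrightarrow> 0) (at_right 0)"
    and lp5: "\<And>z. 0 < z \<Longrightarrow> z < ep \<Longrightarrow> card {x. poly (wpoly n c z) x = 0} = Np"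
    and lp6: "odd n \<Longrightarrow> Np \<ge> 1"
    by (rule wpoly_branches[where c = c, OF n1 c_at c0]) (assumption+, rule that)
  obtain Nm em lm where em: "em > 0"
    and lm1': "\<And>z. 0 < z \<Longrightarrow> z < em \<Longrightarrow> {x. poly (wpoly n c' z) x = 0} = (\<lambda>i. lm i z) ` {..<Nm}"
    and lm2: "\<And>z i j. 0 < z \<Longrightarrow> z < em \<Longrightarrow> i < j \<Longrightarrow> j < Nm \<Longrightarrow> lm i z < lm j z"
    and lm3: "\<And>i. i < Nm \<Longrightarrow> real_analytic_on {0<..<em} (lm i)"
    and lm4: "\<And>i. i < Nm \<Longrightarrow> (lm i \<longlongrightarrow> 0) (at_right 0)"
    and lm5': "\<And>z. 0 < z \<Longrightarrow> z < em \<Longrightarrow> card {x. poly (wpoly n c' z) x = 0} = Nm"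
    and "odd n \<Longrightarrow> Nm \<ge> 1"
    by (rule wpoly_branches[where c = c', OF n1 c'_at]) (assumption+, rule that)
  note lm1 = lm1'[unfolded refl] and lm5 = lm5'[unfolded refl]
  have small: "\<exists>e>0. \<forall>z. \<bar>z\<bar> < e \<longrightarrow> (\<forall>l. poly (wpoly n c z) l = 0 \<longrightarrow> \<bar>l\<bar> < \<delta>)" if \<delta>: "\<delta> > 0" for \<delta>
  proof -
    have "\<forall>\<^sub>F z in nhds 0. (\<Sum>j<n. \<bar>c j z\<bar> * \<delta> ^ j) < \<delta> ^ n"
      by (rule eventually_coeffs_small[where n = n and c = c, OF real_analytic_at_imp_isCont[OF c_at] c0 \<delta>])
    then obtain e where e: "e > 0" "\<And>z. \<bar>z\<bar> < e \<Longrightarrow> (\<Sum>j<n. \<bar>c j z\<bar> * \<delta> ^ j) < \<delta> ^ n"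
      by (auto simp: eventually_nhds_metric dist_real_def)
    have "\<bar>l\<bar> < \<delta>" if "\<bar>z\<bar> < e" "poly (wpoly n c z) l = 0" for z l
      by (rule wpoly_root_bound[where n = n and c = c and z = z, OF e(2)[OF that(1)] \<delta> that(2)])
    thus ?thesis using e(1) by blast
  qed

  have count_small: "\<exists>e>0. \<forall>z. \<bar>z\<bar> < e \<longrightarrow> real_root_count D z = card {x. poly (wpoly n c z) x = 0}"
  proof -
    define \<delta> where "\<delta> = min (- lam_minus D) (lam_plus D)"
    have "\<delta> > 0" using lam by (simp add: \<delta>_def)
    from small[OF this] obtain e where e: "e > 0" "\<And>z l. \<bar>z\<bar> < e \<Longrightarrow> poly (wpoly n c z) l = 0 \<Longrightarrow> \<bar>l\<bar> < \<delta>" by blast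
    have "real_root_count D z = card {x. poly (wpoly n c z) x = 0}" if z: "\<bar>z\<bar> < e" for z
    proof -
      have "x \<in> {lam_minus D<..<lam_plus D}" if "poly (wpoly n c z) x = 0" for x
        using e(2)[OF z that] by (auto simp: \<delta>_def)
      hence "{l \<in> {lam_minus D<..<lam_plus D}. poly (p_poly D z) l = 0} = {x. poly (wpoly n c z) x = 0}"
        by (auto simp: pD)
      thus ?thesis by (simp add: real_root_count_def)
    qed
    thus ?thesis using e(1) by blast
  qed
  then obtain es where es: "es > 0" "\<And>z. \<bar>z\<bar> < es \<Longrightarrow> real_root_count D z = card {x. poly (wpoly n c z) x = 0}" by blast
  have cp: "real_root_count D z = Np" if z: "z \<in> {0<..<omega D}" for z
  proof -
    define z0 where "z0 = Min {es, ep, omega D} / 2"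
    have "0 < z0" "z0 < es" "z0 < ep" "z0 < omega D" using es ep ao by (auto simp: z0_def min_def)
    hence "real_root_count D z0 = Np" "z0 \<in> {0<..<omega D}" using es(2)[of z0] lp5[of z0] by auto
    moreover obtain k where "\<And>z. z \<in> {0<..<omega D} \<Longrightarrow> real_root_count D z = k" using rc(1) unfolding constant_on_def by blast
    ultimately show ?thesis using z by simp
  qed
  have cm: "real_root_count D z = Nm" if z: "z \<in> {alpha D<..<0}" for z
  proof -
    define z0 where "z0 = Min {es, em, - alpha D} / 2"
    have "0 < z0" "z0 < es" "z0 < em" "z0 < - alpha D" using es em ao by (auto simp: z0_def min_def)
    hence "real_root_count D (- z0) = Nm" "- z0 \<in> {alpha D<..<0}" using es(2)[of "- z0"] lm5[of z0] by auto
    moreover obtain k where "\<And>z. z \<in> {alpha D<..<0} \<Longrightarrow> real_root_count D z = k" using rc(2) unfolding constant_on_def by blast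
    ultimately show ?thesis using z by simp
  qed
  have V: "int (V_count D (lam_minus D) z) - int (V_count D (lam_plus D) z) = int (real_root_count D z)"
    if "z \<in> {alpha D<..<omega D}" for z
    by (rule sturm_count_p_poly) (use lam p_nz that in auto)
  define N where "N = Np + Nm + 2"

  have part1: "int N = (int (V_count D (lam_minus D) zp) - int (V_count D (lam_plus D) zp))
      + (int (V_count D (lam_minus D) zm) - int (V_count D (lam_plus D) zm)) + 2"
    if "zp \<in> {0<..<omega D}" "zm \<in> {alpha D<..<0}" for zp zm
    using V[of zp] V[of zm] cp[OF that(1)] cm[OF that(2)] that ao by (simp add: N_def)

  have y_cont: "isCont y (0, 0)" by (rule real_analytic_at_imp_isCont[OF y_at[OF w0]])
  have ev_lim: "\<forall>\<^sub>F w in nhds (0, 0). norm (y w) < r" if "r > 0" for r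
  proof -
    have "((\<lambda>w. norm (y w)) \<longlongrightarrow> 0) (nhds (0, 0))"
      using tendsto_at_iff_tendsto_nhds[THEN iffD1, OF isContD[OF y_cont]] y00 by (simp add: tendsto_norm_zero)
    from order_tendstoD(2)[OF this that] show ?thesis .
  qed
  have cu_ev: "\<forall>\<^sub>F w in nhds (0, 0). c_unit D w \<noteq> 0"
  proof -
    have "isCont (c_unit D) (0, 0)" by (rule real_analytic_at_imp_isCont) (use cu_an w0 in \<open>simp add: real_analytic_on_def\<close>)
    from tendsto_imp_eventually_ne[OF tendsto_at_iff_tendsto_nhds[THEN iffD1, OF isContD[OF this]] cu0] show ?thesis .
  qed
  have nb_ev: "\<forall>\<^sub>F w in nhds (0, 0). w \<in> nbhd D" by (rule eventually_nhds_in_open[OF opn w0])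

  have part2: "\<exists>W \<H>. open W \<and> (0, 0) \<in> W \<and> W \<subseteq> A \<and>
              half_branch_decomposition (0, 0) (zero_set F \<inter> W) \<H> \<and> card \<H> = N \<and>
              {(l, u) \<in> W. l > 0 \<and> u = 0} \<in> \<H> \<and> {(l, u) \<in> W. l < 0 \<and> u = 0} \<in> \<H>"
    if A: "open A" "(0, 0) \<in> A" for A
  proof -
    obtain r0 where r0: "r0 > 0" "ball (0, 0) r0 \<subseteq> A" using openE[OF A] by blast
    define r where "r = min r0 d"
    have r: "r > 0" "r \<le> r0" "r \<le> d" using r0 d by (auto simp: r_def)
    have "\<forall>\<^sub>F w in nhds (0, 0). w \<in> nbhd D \<and> norm (y w) < r / 2 \<and> c_unit D w \<noteq> 0"
      using nb_ev ev_lim[of "r / 2"] cu_ev r(1) by (auto intro: eventually_conj)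
    then obtain \<delta>1 where \<delta>1: "\<delta>1 > 0"
      and nice: "\<And>w. dist w (0, 0) < \<delta>1 \<Longrightarrow> w \<in> nbhd D \<and> norm (y w) < r / 2 \<and> c_unit D w \<noteq> 0"
      unfolding eventually_nhds_metric by blast
    define \<delta> where "\<delta> = min (\<delta>1 / 2) (r / 2)"
    have \<delta>: "\<delta> > 0" "\<delta> \<le> \<delta>1 / 2" "\<delta> \<le> r / 2" using \<delta>1 r by (auto simp: \<delta>_def)
    obtain e' where e': "e' > 0" "\<And>z l. \<bar>z\<bar> < e' \<Longrightarrow> poly (wpoly n c z) l = 0 \<Longrightarrow> \<bar>l\<bar> < \<delta>" using small[OF \<delta>(1)] by blast
    define e where "e = Min {e', \<delta>, ep, em}"
    have e: "e > 0" "e \<le> e'" "e \<le> \<delta>" "e \<le> ep" "e \<le> em" using e' \<delta> ep em by (auto simp: e_def)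
    have box: "(l, z) \<in> nbhd D" "norm (y (l, z)) < r / 2" "c_unit D (l, z) \<noteq> 0" if "\<bar>l\<bar> < \<delta>" "\<bar>z\<bar> < e" for l z
    proof -
      have "dist (l, z) (0, 0) < \<delta>1" using that norm_Pair_le[of l z] \<delta> e by (simp add: dist_norm)
      from nice[OF this] show "(l, z) \<in> nbhd D" "norm (y (l, z)) < r / 2" "c_unit D (l, z) \<noteq> 0" by auto
    qed
    have small': "\<bar>l\<bar> < \<delta>" if "\<bar>z\<bar> < e" "poly (wpoly n c z) l = 0" for z l using e'(2)[OF _ that(2)] that(1) e by simp
    define W where "W = {x :: real \<times> 'u. \<bar>fst x\<bar> < \<delta> \<and> \<bar>f (snd x)\<bar> < e \<and> norm (snd x) < r / 2}"
    have "continuous_on UNIV (\<lambda>x::real \<times> 'u. f (snd x))"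
      by (intro bounded_linear.continuous_on[OF f(1)] continuous_intros)
    hence oW: "open W" unfolding W_def by (intro open_Collect_conj open_Collect_less continuous_intros)
    have W0: "(0, 0) \<in> W" using \<delta> e r by (simp add: W_def f.zero)
    have Wr: "norm x < r" if "x \<in> W" for x
      using that norm_Pair_le[of "fst x" "snd x"] \<delta> by (auto simp: W_def)
    have WA: "W \<subseteq> A"
    proof
      fix x assume "x \<in> W"
      from Wr[OF this] have "norm x < r0" using r by linarith
      hence "x \<in> ball (0, 0) r0" by (simp add: zero_prod_def[symmetric])
      thus "x \<in> A" using r0 by blast
    qed
    have uniq: "u = y (l, f u)" if x: "(l, u) \<in> W" "F (l, u) = 0" for l u
    proof -
      have lu: "\<bar>l\<bar> < \<delta>" "\<bar>f u\<bar> < e" using x by (auto simp: W_def)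
      note b = box[OF lu]
      have "norm (l, y (l, f u)) < r" using norm_Pair_le[of l "y (l, f u)"] b(2) lu \<delta> by simp
      thus ?thesis
        using Wr[OF x(1)] r(3) fy[OF b(1)] Qy[OF b(1)] x(2) by (intro d(2)[of l]) (auto simp: Q.zero)
    qed
    have inW: "(l, y (l, z)) \<in> W" if "\<bar>l\<bar> < \<delta>" "\<bar>z\<bar> < e" for l z
      using that box[OF that] fy[OF box(1)[OF that]] by (simp add: W_def)
    have yl0: "y (l, 0) = 0" if "\<bar>l\<bar> < \<delta>" for l
    proof -
      have "(l, 0) \<in> W" using that e r by (simp add: W_def f.zero)
      from uniq[OF this] show ?thesis using F1 by (simp add: f.zero)
    qed

    define H where "H k = (if fst k = (0::nat) then {(l, u) \<in> W. l > 0 \<and> u = 0}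
      else if fst k = 1 then {(l, u) \<in> W. l < 0 \<and> u = 0}
      else if fst k = 2 then (\<lambda>z. (lp (snd k) z, y (lp (snd k) z, 1 * z))) ` {0<..<e}
      else (\<lambda>z. (lm (snd k) z, y (lm (snd k) z, - 1 * z))) ` {0<..<e})" for k :: "nat \<times> nat"
    define K :: "(nat \<times> nat) set" where "K = {(0, 0), (1, 0)} \<union> {2} \<times> {..<Np} \<union> {3} \<times> {..<Nm}"
    have K_cases: thesis if "k \<in> K" "k = (0, 0) \<Longrightarrow> thesis" "k = (1, 0) \<Longrightarrow> thesis"
        "\<And>i. k = (2, i) \<Longrightarrow> i < Np \<Longrightarrow> thesis" "\<And>i. k = (3, i) \<Longrightarrow> i < Nm \<Longrightarrow> thesis" for k thesis
      using that unfolding K_def by auto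
    have H0: "H (0, 0) = (\<lambda>t. (1 * t, 0)) ` {0<..<\<delta>}" and H0': "H (0, 0) = {(l, u) \<in> W. l > 0 \<and> u = 0}"
      using e r by (auto simp: H_def W_def f.zero image_iff)
    have H1: "H (1, 0) = (\<lambda>t. (- 1 * t, 0)) ` {0<..<\<delta>}" and H1': "H (1, 0) = {(l, u) \<in> W. l < 0 \<and> u = 0}"
    proof -
      show "H (1, 0) = {(l, u) \<in> W. l < 0 \<and> u = 0}" by (simp add: H_def)
      have "x \<in> {(l, u) \<in> W. l < 0 \<and> u = 0} \<longleftrightarrow> x \<in> (\<lambda>t. (- 1 * t, 0)) ` {0<..<\<delta>}" for x
      proof -
        have "(\<exists>t. x = (- 1 * t, 0) \<and> 0 < t \<and> t < \<delta>) \<longleftrightarrow> snd x = 0 \<and> fst x < 0 \<and> - fst x < \<delta>"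
          by (cases x) (auto intro: exI[of _ "- fst x"])
        thus ?thesis using e r by (cases x) (auto simp: W_def f.zero)
      qed
      thus "H (1, 0) = (\<lambda>t. (- 1 * t, 0)) ` {0<..<\<delta>}" by (auto simp: H_def)
    qed
    have H2: "H (2, i) = (\<lambda>z. (lp i z, y (lp i z, 1 * z))) ` {0<..<e}" for i by (simp add: H_def)
    have H3: "H (3, i) = (\<lambda>z. (lm i z, y (lm i z, - 1 * z))) ` {0<..<e}" for i by (simp add: H_def)
    have rootp: "poly (wpoly n c z) (lp i z) = 0" "\<bar>lp i z\<bar> < \<delta>" if "i < Np" "0 < z" "z < e" for i z
    proof -
      show 1: "poly (wpoly n c z) (lp i z) = 0" using lp1[of z] that e by auto
      show "\<bar>lp i z\<bar> < \<delta>" by (rule small'[OF _ 1]) (use that in simp)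
    qed
    have rootm: "poly (wpoly n c (- z)) (lm i z) = 0" "\<bar>lm i z\<bar> < \<delta>" if "i < Nm" "0 < z" "z < e" for i z
    proof -
      show 1: "poly (wpoly n c (- z)) (lm i z) = 0" using lm1[of z] that e by auto
      show "\<bar>lm i z\<bar> < \<delta>" by (rule small'[OF _ 1]) (use that in simp)
    qed
    have boxp: "(lp i z, 1 * z) \<in> nbhd D" if "i < Np" "0 < z" "z < e" for i z
      using box(1)[OF rootp(2)[OF that]] that by simp
    have boxm: "(lm i z, - 1 * z) \<in> nbhd D" if "i < Nm" "0 < z" "z < e" for i z
      using box(1)[OF rootm(2)[OF that], of "- z"] that by simp
    have sub: "real_analytic_on {0<..<e} l" if "real_analytic_on {0<..<e'} l" "e \<le> e'" for l :: "real \<Rightarrow> real" and e'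
      using that by (auto simp: real_analytic_on_def)
    have hb: "half_branch (0, 0) (H k)" if "k \<in> K" for k
      using that
    proof (rule K_cases)
      assume "k = (0, 0)" thus ?thesis unfolding \<open>k = _\<close> H0 by (intro half_branch_trivial \<delta>(1)) simp
    next
      assume "k = (1, 0)" thus ?thesis unfolding \<open>k = _\<close> H1 by (intro half_branch_trivial \<delta>(1)) simp
    next
      fix i assume i: "k = (2, i)" "i < Np"
      show ?thesis unfolding i(1) H2
        by (rule half_branch_of_root(1)[where f = f, OF e(1) _ sub[OF lp3[OF i(2)] e(4)] lp4[OF i(2)] y_at[OF boxp] y_cont y00])
           (use i(2) fy[OF boxp] in simp_all)
    next
      fix i assume i: "k = (3, i)" "i < Nm"
      show ?thesis unfolding i(1) H3
        by (rule half_branch_of_root(1)[where f = f, OF e(1) _ sub[OF lm3[OF i(2)] e(5)] lm4[OF i(2)] y_at[OF boxm] y_cont y00])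
           (use i(2) fy[OF boxm] in simp_all)
    qed
    define tag :: "real \<times> 'u \<Rightarrow> nat \<times> nat" where "tag x = (if f (snd x) = 0 then (if fst x > 0 then (0, 0) else (1, 0))
      else if f (snd x) > 0 then (2, THE i. i < Np \<and> lp i (f (snd x)) = fst x)
      else (3, THE i. i < Nm \<and> lm i (- f (snd x)) = fst x))" for x :: "real \<times> 'u"
    have injp: "i = j" if "i < Np" "j < Np" "0 < z" "z < e" "lp i z = lp j z" for i j z
      using lp2[of z i j] lp2[of z j i] that e by (cases i j rule: linorder_cases) auto
    have injm: "i = j" if "i < Nm" "j < Nm" "0 < z" "z < e" "lm i z = lm j z" for i j z
      using lm2[of z i j] lm2[of z j i] that e by (cases i j rule: linorder_cases) auto
    have tag: "tag x = k" if kK: "k \<in> K" and xH: "x \<in> H k" for k x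
      using kK
    proof (rule K_cases)
      assume "k = (0, 0)" thus ?thesis using xH by (auto simp: H0' tag_def f.zero)
    next
      assume k: "k = (1, 0)"
      from xH have "x \<in> {(l, u) \<in> W. l < 0 \<and> u = 0}" unfolding k H1' .
      thus ?thesis unfolding k by (auto simp: tag_def f.zero)
    next
      fix i assume i: "k = (2, i)" "i < Np"
      obtain z where z: "0 < z" "z < e" "x = (lp i z, y (lp i z, 1 * z))" using xH unfolding i(1) H2 by auto
      have fz: "f (snd x) = z" using fy[OF boxp[OF i(2) z(1,2)]] z(3) by simp
      have "(THE i'. i' < Np \<and> lp i' z = lp i z) = i" using injp[OF _ i(2) z(1,2)] i(2) by blast
      thus ?thesis using z fz i by (simp add: tag_def)
    next
      fix i assume i: "k = (3, i)" "i < Nm"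
      obtain z where z: "0 < z" "z < e" "x = (lm i z, y (lm i z, - 1 * z))" using xH unfolding i(1) H3 by auto
      have fz: "f (snd x) = - z" using fy[OF boxm[OF i(2) z(1,2)]] z(3) by simp
      have "(THE i'. i' < Nm \<and> lm i' z = lm i z) = i" using injm[OF _ i(2) z(1,2)] i(2) by blast
      thus ?thesis using z fz i by (simp add: tag_def)
    qed
    have ne: "H k \<noteq> {}" if "k \<in> K" for k
      using that by (rule K_cases) (use H0 H1 H2 H3 \<delta>(1) e(1) in auto)
    note fam = tagged_family[OF tag ne]
    have "card K = N"
    proof -
      have "card K = card ({(0, 0), (1::nat, 0::nat)} \<union> {2} \<times> {..<Np}) + card ({3::nat} \<times> {..<Nm})"
        unfolding K_def by (rule card_Un_disjoint) auto
      also have "card ({(0, 0), (1::nat, 0::nat)} \<union> {2} \<times> {..<Np}) = 2 + card ({2::nat} \<times> {..<Np})"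
        by (subst card_Un_disjoint) auto
      finally show ?thesis by (simp add: N_def card_cartesian_product)
    qed
    hence card: "card (H ` K) = N" using card_image[OF fam(2)] by simp
    have un: "\<Union>(H ` K) = zero_set F \<inter> W - {(0, 0)}"
    proof
      show "\<Union>(H ` K) \<subseteq> zero_set F \<inter> W - {(0, 0)}"
      proof
        fix x assume "x \<in> \<Union>(H ` K)"
        then obtain k where k: "k \<in> K" "x \<in> H k" by blast
        from k(1) show "x \<in> zero_set F \<inter> W - {(0, 0)}"
        proof (rule K_cases)
          assume "k = (0, 0)" thus ?thesis using k(2) F1 by (auto simp: H0')
        next
          assume k1: "k = (1, 0)"
          from k(2) have "x \<in> {(l, u) \<in> W. l < 0 \<and> u = 0}" unfolding k1 H1' .
          thus ?thesis using F1 by auto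
        next
          fix i assume i: "k = (2, i)" "i < Np"
          obtain z where z: "0 < z" "z < e" "x = (lp i z, y (lp i z, 1 * z))" using k(2) unfolding i(1) H2 by auto
          note b = boxp[OF i(2) z(1,2)] and rt = rootp[OF i(2) z(1,2)]
          have "F x = 0" using zero_iff[OF b] rt(1) z(3) by simp
          moreover have "x \<in> W" using inW[OF rt(2), of z] z by simp
          moreover have "x \<noteq> (0, 0)" using fy[OF b] z by (auto simp: f.zero)
          ultimately show ?thesis by blast
        next
          fix i assume i: "k = (3, i)" "i < Nm"
          obtain z where z: "0 < z" "z < e" "x = (lm i z, y (lm i z, - 1 * z))" using k(2) unfolding i(1) H3 by auto
          note b = boxm[OF i(2) z(1,2)] and rt = rootm[OF i(2) z(1,2)]
          have "F x = 0" using zero_iff[OF b] rt(1) z(3) by simp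
          moreover have "x \<in> W" using inW[OF rt(2), of "- z"] z by simp
          moreover have "x \<noteq> (0, 0)" using fy[OF b] z by (auto simp: f.zero)
          ultimately show ?thesis by blast
        qed
      qed
      show "zero_set F \<inter> W - {(0, 0)} \<subseteq> \<Union>(H ` K)"
      proof
        fix x assume x: "x \<in> zero_set F \<inter> W - {(0, 0)}"
        obtain l u where lu: "x = (l, u)" by (cases x)
        define z where "z = f u"
        have xW: "(l, u) \<in> W" "F (l, u) = 0" "(l, u) \<noteq> (0, 0)" using x lu by auto
        have uy: "u = y (l, z)" unfolding z_def by (rule uniq[OF xW(1,2)])
        have lz: "\<bar>l\<bar> < \<delta>" "\<bar>z\<bar> < e" using xW(1) by (auto simp: W_def z_def)
        have cases: "z = 0 \<or> poly (wpoly n c z) l = 0"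
          using zero_iff[OF box(1)[OF lz]] box(3)[OF lz] xW(2) uy by auto
        consider "z = 0" | "z > 0" | "z < 0" by linarith
        thus "x \<in> \<Union>(H ` K)"
        proof cases
          case 1
          hence u0: "u = 0" using uy yl0[OF lz(1)] by simp
          hence "l \<noteq> 0" using xW(3) by auto
          hence "x \<in> H (0, 0) \<or> x \<in> H (1, 0)" unfolding H0' H1' using xW(1) u0 lu by auto
          moreover have "(0, 0) \<in> K" "(1, 0) \<in> K" by (simp_all add: K_def)
          ultimately show ?thesis by blast
        next
          case 2
          hence "l \<in> {x. poly (wpoly n c z) x = 0}" using cases by simp
          also have "\<dots> = (\<lambda>i. lp i z) ` {..<Np}" using 2 lz e by (intro lp1) auto
          finally obtain i where i: "i < Np" "l = lp i z" by auto
          have "x \<in> H (2, i)" unfolding H2 using 2 lz i uy lu by (intro image_eqI[of _ _ z]) auto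
          moreover have "(2, i) \<in> K" using i by (simp add: K_def)
          ultimately show ?thesis by blast
        next
          case 3
          hence "l \<in> {x. poly (wpoly n c (- (- z))) x = 0}" using cases by simp
          also have "\<dots> = (\<lambda>i. lm i (- z)) ` {..<Nm}" using 3 lz e by (intro lm1) auto
          finally obtain i where i: "i < Nm" "l = lm i (- z)" by auto
          have "x \<in> H (3, i)" unfolding H3 using 3 lz i uy lu by (intro image_eqI[of _ _ "- z"]) auto
          moreover have "(3, i) \<in> K" using i by (simp add: K_def)
          ultimately show ?thesis by blast
        qed
      qed
    qed
    have "finite K" by (simp add: K_def)
    have dec: "half_branch_decomposition (0, 0) (zero_set F \<inter> W) (H ` K)"
      unfolding half_branch_decomposition_def
    proof (intro conjI un fam(1) ballI)
      show "finite (H ` K)" by (rule finite_imageI) fact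
      fix B assume "B \<in> H ` K"
      then obtain k where "B = H k" "k \<in> K" by (rule imageE)
      thus "half_branch (0, 0) B" using hb[of k] by simp
    qed
    have mem: "{(l, u) \<in> W. l > 0 \<and> u = 0} \<in> H ` K" "{(l, u) \<in> W. l < 0 \<and> u = 0} \<in> H ` K"
      unfolding H0'[symmetric] H1'[symmetric] by (rule imageI, simp add: K_def)+
    show ?thesis
      by (intro exI[of _ W] exI[of _ "H ` K"] conjI oW W0 WA dec card mem)
  qed

  have part3: "N \<ge> 3 \<and> bifurcation_point F" if odd: "odd n"
  proof
    have Np: "Np \<ge> 1" by (rule lp6[OF odd])
    thus "N \<ge> 3" by (simp add: N_def)
    define l where "l = lp 0"
    have l0: "(l \<longlongrightarrow> 0) (at_right 0)" unfolding l_def by (rule lp4) (use Np in simp)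
    have "((\<lambda>z. (l z, z)) \<longlongrightarrow> (0, 0)) (at_right 0)" by (intro tendsto_intros l0)
    hence lim: "filterlim (\<lambda>z. (l z, z)) (nhds (0, 0)) (at_right 0)" .
    have "\<forall>\<^sub>F z in at_right 0. (l z, z) \<in> nbhd D" by (rule eventually_compose_filterlim[OF nb_ev lim])
    then obtain e where e: "e > 0" "\<And>z. 0 < z \<Longrightarrow> z < e \<Longrightarrow> (l z, z) \<in> nbhd D" by (auto simp: eventually_at_right_field)
    define t where "t k = min e ep / (real k + 2)" for k
    have t: "0 < t k" "t k < e" "t k < ep" for k
    proof -
      have "min e ep / (real k + 2) < min e ep / 1" by (rule divide_strict_left_mono) (use e ep in auto)
      hence "t k < min e ep" by (simp only: t_def div_by_1)
      thus "t k < e" "t k < ep" by (auto simp: t_def)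
      show "0 < t k" using e ep by (simp add: t_def)
    qed
    have "(\<lambda>k. min e ep / real (k + 2)) \<longlonglongrightarrow> 0"
      by (rule LIMSEQ_ignore_initial_segment[OF lim_const_over_n])
    hence "t \<longlonglongrightarrow> 0" by (simp add: t_def[abs_def] add.commute)
    moreover have "t k \<in> {0<..} \<and> t k \<noteq> 0" for k using t(1)[of k] by simp
    ultimately have "filterlim t (at_right 0) sequentially"
      unfolding filterlim_at by (simp add: always_eventually)
    hence tl: "filterlim (\<lambda>k. (l (t k), t k)) (nhds (0, 0)) sequentially" by (rule filterlim_compose[OF lim])
    have "(\<lambda>k. (l (t k), y (l (t k), t k))) \<longlonglongrightarrow> (0, y (0, 0))"
    proof (rule tendsto_Pair)
      show "(\<lambda>k. l (t k)) \<longlonglongrightarrow> 0" using tendsto_fst[OF tl] by simp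
      show "(\<lambda>k. y (l (t k), t k)) \<longlonglongrightarrow> y (0, 0)" by (rule isCont_tendsto_compose[OF y_cont tl])
    qed
    moreover have "F (l (t k), y (l (t k), t k)) = 0 \<and> y (l (t k), t k) \<noteq> 0" for k
    proof
      have w: "(l (t k), t k) \<in> nbhd D" using e(2) t by blast
      have "poly (wpoly n c (t k)) (l (t k)) = 0" using lp1[OF t(1,3), of k] Np by (auto simp: l_def)
      thus "F (l (t k), y (l (t k), t k)) = 0" using zero_iff[OF w] by simp
      show "y (l (t k), t k) \<noteq> 0" using fy[OF w] t(1)[of k] by (auto simp: f.zero)
    qed
    ultimately show "bifurcation_point F"
      unfolding bifurcation_point_def y00
      by (intro exI[of _ "\<lambda>k. l (t k)"] exI[of _ "\<lambda>k. y (l (t k), t k)"]) blast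
  qed
  show ?thesis
    using part1 part2 part3 by (intro exI[of _ N]) (simp add: n_def)
qed

theorem theorem6p7:
  fixes F :: "real \<times> 'u::banach \<Rightarrow> 'v::banach" and \<phi>\<^sub>0 :: 'u
  assumes analytic: "real_analytic_on UNIV F"
    and F1: "\<forall>l. F (l, 0) = 0"
    and F2: "\<forall>l. linearization F l \<in> fredholm_index_zero"
    and F3: "0 isolated_in eigenvalues (linearization F)"
            "zero_set (linearization F 0) = span {\<phi>\<^sub>0}" "\<phi>\<^sub>0 \<noteq> 0"
  shows "(\<exists>D :: ('u, 'v) reduction. reduction_data F \<phi>\<^sub>0 D) \<and>
    (\<forall>D :: ('u, 'v) reduction. reduction_data F \<phi>\<^sub>0 D \<longrightarrow>
      (\<exists>N :: nat.
        (\<forall>z\<^sub>p\<in>{0<..<omega D}. \<forall>z\<^sub>m\<in>{alpha D<..<0}.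
           int N = (int (V_count D (lam_minus D) z\<^sub>p) - int (V_count D (lam_plus D) z\<^sub>p))
                 + (int (V_count D (lam_minus D) z\<^sub>m) - int (V_count D (lam_plus D) z\<^sub>m)) + 2) \<and>
        (\<forall>A. open A \<and> (0, 0) \<in> A \<longrightarrow>
           (\<exists>W \<H>. open W \<and> (0, 0) \<in> W \<and> W \<subseteq> A \<and>
              half_branch_decomposition (0, 0) (zero_set F \<inter> W) \<H> \<and> card \<H> = N \<and>
              {(l, u) \<in> W. l > 0 \<and> u = 0} \<in> \<H> \<and> {(l, u) \<in> W. l < 0 \<and> u = 0} \<in> \<H>)) \<and>
        (odd (chi D) \<longrightarrow> N \<ge> 3 \<and> bifurcation_point F)))"
proof (rule conjI; (rule allI, rule impI)?)
  show "\<exists>D :: ('u, 'v) reduction. reduction_data F \<phi>\<^sub>0 D"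
    by (rule exists_reduction_data[OF analytic F1 F2 F3])
qed (rule reduction_half_branches[OF analytic F1 F2[rule_format] F3(2,3)])

end
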